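(* Assume that $m\in\mathcal{M}(W)$ is either purely even or purely odd, i.e. for some $k\in\mathcal{M}(W)$, either $m_\alpha=2k_\alpha$ for all $\alpha\in\mathcal{A}$, or $m_\alpha=2k_\alpha+1$ for all $\alpha\in\mathcal{A}$. Then $\mathbf{Q}_m(W)$ is a free module over $\mathbf{k}[V]$ of rank $|W|$. In particular, $\mathbf{V}_m(W)=\mathrm{Spec}\,\mathbf{Q}_m(W)$ is a Cohen–Macaulay variety.
   Context: Let $\mathbf{k}$ be a field of characteristic zero, $W$ a finite Coxeter group and $V$ a finite-dimensional $\mathbf{k}$-vector space carrying a reflection representation of $W$. Let $\mathcal{A}$ be the set of reflection hyperplanes; for each fix a linear form $\alpha\in V^*$ with $H_\alpha=\mathrm{Ker}(\alpha)$ (we write $\alpha\in\mathcal{A}$), and let $s_\alpha\in W$ be the corresponding reflection. $\mathbf{k}[V]=\mathrm{Sym}_{\mathbf{k}}(V^* )$. $\mathcal{M}(W)$ is the set of $W$-invariant functions $m:\mathcal{A}\to\mathbb{Z}_{\ge0}$, $\alpha\mapsto m_\alpha$. The algebra of $m$-quasi-covariants is $\mathbf{Q}_m(W)=\{(p_w)_{w\in W}\in\prod_{w\in W}\mathbf{k}[V]: p_w\equiv p_{s_\alpha w}\bmod\langle\alpha\rangle^{m_\alpha}\ \forall\,\alpha\in\mathcal{A},\ w\in W\}$ with componentwise multiplication. It is a $\mathbf{k}[V]$-module via the diagonal inclusion $\mathbf{k}[V]\hookrightarrow\mathbf{Q}_m(W)$, $f\mapsto(f)_{w\in W}$. *)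

theory Defs
  imports
    "HOL-Algebra.Multiplicative_Group"
    "HOL-Algebra.Generated_Rings"
    "HOL-Algebra.Ring_Divisibility"
    "HOL-Algebra.Module"
    "HOL-Library.Poly_Mapping"
    "HOL-Library.Extended_Nat"
begin

section \<open>Coxeter groups and reflection representations\<close>

text \<open>
  The congruence on words over \<open>S\<close> generated by the relations \<open>(st)^{ord(st)} = 1\<close>.
  A pair with \<open>st\<close> of infinite order has \<open>ord = 0\<close> and contributes only a trivial relation;
  the pairs with \<open>s = t\<close> contribute \<open>ss = 1\<close> when \<open>s\<close> is an involution.
\<close>

inductive coxeter_cong :: "('w, 'x) monoid_scheme \<Rightarrow> 'w set \<Rightarrow> 'w list \<Rightarrow> 'w list \<Rightarrow> bool"
  for W :: "('w, 'x) monoid_scheme" and S :: "'w set" where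
  refl: "coxeter_cong W S u u"
| sym: "coxeter_cong W S u v \<Longrightarrow> coxeter_cong W S v u"
| trans: "coxeter_cong W S u v \<Longrightarrow> coxeter_cong W S v w \<Longrightarrow> coxeter_cong W S u w"
| braid: "s \<in> S \<Longrightarrow> t \<in> S \<Longrightarrow>
    coxeter_cong W S (u @ concat (replicate (group.ord W (s \<otimes>\<^bsub>W\<^esub> t)) [s, t]) @ v) (u @ v)"

text \<open>
  Bourbaki's definition: \<open>S\<close> is a generating set of involutions, and together with the relations
  \<open>(st)^{ord(st)} = 1\<close> it is a presentation of \<open>W\<close>.  As the generators are involutions, group words
  reduce to lists over \<open>S\<close>.
\<close>

definition coxeter_system :: "('w, 'x) monoid_scheme \<Rightarrow> 'w set \<Rightarrow> bool" where
  "coxeter_system W S \<longleftrightarrow>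
     group W \<and> S \<subseteq> carrier W \<and>
     (\<forall>s\<in>S. s \<noteq> \<one>\<^bsub>W\<^esub> \<and> s \<otimes>\<^bsub>W\<^esub> s = \<one>\<^bsub>W\<^esub>) \<and>
     generate W S = carrier W \<and>
     (\<forall>u\<in>lists S. \<forall>v\<in>lists S.
        foldr (\<otimes>\<^bsub>W\<^esub>) u \<one>\<^bsub>W\<^esub> = foldr (\<otimes>\<^bsub>W\<^esub>) v \<one>\<^bsub>W\<^esub> \<longrightarrow> coxeter_cong W S u v)"

definition fixed_space :: "('v \<Rightarrow> 'v) \<Rightarrow> 'v set" where
  "fixed_space f = {v. f v = v}"

definition is_reflection :: "('k::field \<Rightarrow> 'v::ab_group_add \<Rightarrow> 'v) \<Rightarrow> ('v \<Rightarrow> 'v) \<Rightarrow> bool" where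
  "is_reflection scale f \<longleftrightarrow>
     Vector_Spaces.linear scale scale f \<and> f \<circ> f = id \<and>
     Suc (vector_space.dim scale (fixed_space f)) = vector_space.dim scale UNIV"

text \<open>
  Faithfulness is what makes the reflection \<open>s\<^sub>\<alpha> \<in> W\<close> attached to a hyperplane well defined.
\<close>

definition reflection_representation ::
  "('k::field \<Rightarrow> 'v::ab_group_add \<Rightarrow> 'v) \<Rightarrow> ('w, 'x) monoid_scheme \<Rightarrow> 'w set \<Rightarrow> ('w \<Rightarrow> 'v \<Rightarrow> 'v) \<Rightarrow> bool" where
  "reflection_representation scale W S \<rho> \<longleftrightarrow>
     (\<forall>g\<in>carrier W. Vector_Spaces.linear scale scale (\<rho> g)) \<and>
     \<rho> \<one>\<^bsub>W\<^esub> = id \<and>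
     (\<forall>g\<in>carrier W. \<forall>h\<in>carrier W. \<rho> (g \<otimes>\<^bsub>W\<^esub> h) = \<rho> g \<circ> \<rho> h) \<and>
     inj_on \<rho> (carrier W) \<and>
     (\<forall>s\<in>S. is_reflection scale (\<rho> s))"

definition reflection_hyperplanes ::
  "('k::field \<Rightarrow> 'v::ab_group_add \<Rightarrow> 'v) \<Rightarrow> ('w, 'x) monoid_scheme \<Rightarrow> ('w \<Rightarrow> 'v \<Rightarrow> 'v) \<Rightarrow> 'v set set" where
  "reflection_hyperplanes scale W \<rho> =
     {fixed_space (\<rho> s) | s. s \<in> carrier W \<and> is_reflection scale (\<rho> s)}"

definition hyperplane_reflection ::
  "('k::field \<Rightarrow> 'v::ab_group_add \<Rightarrow> 'v) \<Rightarrow> ('w, 'x) monoid_scheme \<Rightarrow> ('w \<Rightarrow> 'v \<Rightarrow> 'v) \<Rightarrow> 'v set \<Rightarrow> 'w" where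
  "hyperplane_reflection scale W \<rho> H =
     (THE s. s \<in> carrier W \<and> is_reflection scale (\<rho> s) \<and> fixed_space (\<rho> s) = H)"

definition defining_forms ::
  "('k::field \<Rightarrow> 'v::ab_group_add \<Rightarrow> 'v) \<Rightarrow> ('w, 'x) monoid_scheme \<Rightarrow> ('w \<Rightarrow> 'v \<Rightarrow> 'v) \<Rightarrow>
    ('v set \<Rightarrow> 'v \<Rightarrow> 'k) \<Rightarrow> bool" where
  "defining_forms scale W \<rho> \<alpha> \<longleftrightarrow>
     (\<forall>H\<in>reflection_hyperplanes scale W \<rho>.
        Vector_Spaces.linear scale (*) (\<alpha> H) \<and> {v. \<alpha> H v = 0} = H)"

text \<open>
  The set \<open>\<M>(W)\<close>; multiplicities are indexed by the hyperplanes, and their values off the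
  arrangement are irrelevant.
\<close>

definition invariant_multiplicity ::
  "('k::field \<Rightarrow> 'v::ab_group_add \<Rightarrow> 'v) \<Rightarrow> ('w, 'x) monoid_scheme \<Rightarrow> ('w \<Rightarrow> 'v \<Rightarrow> 'v) \<Rightarrow>
    ('v set \<Rightarrow> nat) \<Rightarrow> bool" where
  "invariant_multiplicity scale W \<rho> m \<longleftrightarrow>
     (\<forall>g\<in>carrier W. \<forall>H\<in>reflection_hyperplanes scale W \<rho>. m (\<rho> g ` H) = m H)"

section \<open>The ring \<open>\<k>[V]\<close> and quasi-covariants\<close>

text \<open>
  \<open>Sym(V\<^sup>*)\<close> as the polynomial ring over \<open>'k\<close> in the variables \<open>x\<^sub>b\<close>, \<open>b \<in> B\<close>, where \<open>B\<close> is
  a basis of \<open>V\<close> and \<open>x\<^sub>b\<close> stands for the corresponding element of the dual basis.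
\<close>

definition sym_dual :: "'v set \<Rightarrow> (('v \<Rightarrow>\<^sub>0 nat) \<Rightarrow>\<^sub>0 'k::comm_ring_1) ring" where
  "sym_dual B =
     \<lparr> carrier = {p. \<forall>e\<in>Poly_Mapping.keys p. Poly_Mapping.keys e \<subseteq> B},
       monoid.mult = (*), one = 1, ring.zero = 0, add = (+) \<rparr>"

definition poly_const :: "'k \<Rightarrow> ('v \<Rightarrow>\<^sub>0 nat) \<Rightarrow>\<^sub>0 'k::comm_ring_1" where
  "poly_const c = Poly_Mapping.single 0 c"

text \<open>The inclusion \<open>V\<^sup>* \<hookrightarrow> Sym(V\<^sup>*)\<close>: a linear form \<open>f\<close> is \<open>\<Sum>\<^sub>b f(b) x\<^sub>b\<close>.\<close>

definition form_poly :: "'v set \<Rightarrow> ('v \<Rightarrow> 'k) \<Rightarrow> ('v \<Rightarrow>\<^sub>0 nat) \<Rightarrow>\<^sub>0 'k::comm_ring_1" where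
  "form_poly B f = (\<Sum>b\<in>B. Poly_Mapping.single (Poly_Mapping.single b 1) (f b))"

definition diagonal :: "('w, 'x) monoid_scheme \<Rightarrow> 'p \<Rightarrow> 'w \<Rightarrow> 'p" where
  "diagonal W f = (\<lambda>w\<in>carrier W. f)"

text \<open>
  \<open>\<langle>\<alpha>\<rangle>^{m\<^sub>\<alpha>}\<close> is the principal ideal generated by \<open>\<alpha>^{m\<^sub>\<alpha>}\<close>.  The record carries both the ring
  structure and the \<open>\<k>[V]\<close>-module structure of the quasi-covariants.
\<close>

definition quasi_covariants ::
  "('k::field \<Rightarrow> 'v::ab_group_add \<Rightarrow> 'v) \<Rightarrow> 'v set \<Rightarrow> ('w, 'x) monoid_scheme \<Rightarrow> ('w \<Rightarrow> 'v \<Rightarrow> 'v) \<Rightarrow>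
    ('v set \<Rightarrow> 'v \<Rightarrow> 'k) \<Rightarrow> ('v set \<Rightarrow> nat) \<Rightarrow>
    (('v \<Rightarrow>\<^sub>0 nat) \<Rightarrow>\<^sub>0 'k, 'w \<Rightarrow> ('v \<Rightarrow>\<^sub>0 nat) \<Rightarrow>\<^sub>0 'k) module" where
  "quasi_covariants scale B W \<rho> \<alpha> m =
     (let A = sym_dual B;
          mul = (\<lambda>p q. \<lambda>w\<in>carrier W. p w \<otimes>\<^bsub>A\<^esub> q w)
      in \<lparr> carrier =
             {p \<in> carrier W \<rightarrow>\<^sub>E carrier A.
                \<forall>H\<in>reflection_hyperplanes scale W \<rho>. \<forall>w\<in>carrier W.
                  p w \<ominus>\<^bsub>A\<^esub> p (hyperplane_reflection scale W \<rho> H \<otimes>\<^bsub>W\<^esub> w)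
                    \<in> PIdl\<^bsub>A\<^esub> (form_poly B (\<alpha> H) [^]\<^bsub>A\<^esub> m H)},
           monoid.mult = mul,
           one = diagonal W \<one>\<^bsub>A\<^esub>,
           ring.zero = diagonal W \<zero>\<^bsub>A\<^esub>,
           add = (\<lambda>p q. \<lambda>w\<in>carrier W. p w \<oplus>\<^bsub>A\<^esub> q w),
           smult = (\<lambda>f p. mul (diagonal W f) p) \<rparr>)"

section \<open>Free modules\<close>

definition finite_module_basis ::
  "('a, 'c) ring_scheme \<Rightarrow> ('a, 'b, 'd) module_scheme \<Rightarrow> 'b set \<Rightarrow> bool" where
  "finite_module_basis R M B \<longleftrightarrow>
     finite B \<and> B \<subseteq> carrier M \<and>
     (\<forall>x\<in>carrier M. \<exists>!c. c \<in> B \<rightarrow>\<^sub>E carrier R \<and> x = (\<Oplus>\<^bsub>M\<^esub>b\<in>B. c b \<odot>\<^bsub>M\<^esub> b))"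

definition free_module_of_rank ::
  "('a, 'c) ring_scheme \<Rightarrow> ('a, 'b, 'd) module_scheme \<Rightarrow> nat \<Rightarrow> bool" where
  "free_module_of_rank R M n \<longleftrightarrow>
     module R M \<and> (\<exists>B. finite_module_basis R M B \<and> card B = n)"

section \<open>Cohen--Macaulay varieties\<close>

definition fraction_rel :: "('a, 'c) ring_scheme \<Rightarrow> 'a set \<Rightarrow> (('a \<times> 'a) \<times> ('a \<times> 'a)) set" where
  "fraction_rel R D =
     {((a, s), (b, t)). a \<in> carrier R \<and> b \<in> carrier R \<and> s \<in> D \<and> t \<in> D \<and>
        (\<exists>u\<in>D. u \<otimes>\<^bsub>R\<^esub> (a \<otimes>\<^bsub>R\<^esub> t) = u \<otimes>\<^bsub>R\<^esub> (b \<otimes>\<^bsub>R\<^esub> s))}"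

definition frac :: "('a, 'c) ring_scheme \<Rightarrow> 'a set \<Rightarrow> 'a \<Rightarrow> 'a \<Rightarrow> ('a \<times> 'a) set" where
  "frac R D a s = fraction_rel R D `` {(a, s)}"

text \<open>
  The ring of fractions \<open>D\<^sup>-\<^sup>1R\<close> for a multiplicative set \<open>D\<close>.  The unions in the operations run
  over representatives and collapse to a single class.
\<close>

definition ring_of_fractions :: "('a, 'c) ring_scheme \<Rightarrow> 'a set \<Rightarrow> ('a \<times> 'a) set ring" where
  "ring_of_fractions R D =
     \<lparr> carrier = (carrier R \<times> D) // fraction_rel R D,
       monoid.mult = (\<lambda>X Y. \<Union>(a, s)\<in>X. \<Union>(b, t)\<in>Y. frac R D (a \<otimes>\<^bsub>R\<^esub> b) (s \<otimes>\<^bsub>R\<^esub> t)),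
       one = frac R D \<one>\<^bsub>R\<^esub> \<one>\<^bsub>R\<^esub>,
       ring.zero = frac R D \<zero>\<^bsub>R\<^esub> \<one>\<^bsub>R\<^esub>,
       add = (\<lambda>X Y. \<Union>(a, s)\<in>X. \<Union>(b, t)\<in>Y.
                frac R D (a \<otimes>\<^bsub>R\<^esub> t \<oplus>\<^bsub>R\<^esub> b \<otimes>\<^bsub>R\<^esub> s) (s \<otimes>\<^bsub>R\<^esub> t)) \<rparr>"

definition localization_at :: "('a, 'c) ring_scheme \<Rightarrow> 'a set \<Rightarrow> ('a \<times> 'a) set ring" where
  "localization_at R P = ring_of_fractions R (carrier R - P)"

definition krull_dim :: "('a, 'c) ring_scheme \<Rightarrow> enat" where
  "krull_dim R =
     Sup {enat n | n. \<exists>P :: nat \<Rightarrow> 'a set.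
            (\<forall>i\<le>n. primeideal (P i) R) \<and> (\<forall>i<n. P i \<subset> P (Suc i))}"

definition regular_sequence :: "('a, 'c) ring_scheme \<Rightarrow> 'a list \<Rightarrow> bool" where
  "regular_sequence R xs \<longleftrightarrow>
     set xs \<subseteq> carrier R \<and>
     (\<forall>i<length xs. \<forall>r\<in>carrier R.
        xs ! i \<otimes>\<^bsub>R\<^esub> r \<in> Idl\<^bsub>R\<^esub> (set (take i xs)) \<longrightarrow> r \<in> Idl\<^bsub>R\<^esub> (set (take i xs))) \<and>
     Idl\<^bsub>R\<^esub> (set xs) \<noteq> carrier R"

definition ideal_depth :: "('a, 'c) ring_scheme \<Rightarrow> 'a set \<Rightarrow> enat" where
  "ideal_depth R I = Sup {enat (length xs) | xs. set xs \<subseteq> I \<and> regular_sequence R xs}"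

definition cohen_macaulay_local_ring :: "('a, 'c) ring_scheme \<Rightarrow> bool" where
  "cohen_macaulay_local_ring R \<longleftrightarrow>
     cring R \<and> noetherian_ring R \<and>
     (\<exists>!M. maximalideal M R) \<and>
     (\<forall>M. maximalideal M R \<longrightarrow> ideal_depth R M = krull_dim R)"

text \<open>
  \<open>Spec R\<close> is an affine variety over the field \<open>K\<close> (which need not be algebraically closed, and
  the variety need not be irreducible): \<open>R\<close> is a reduced finitely generated commutative
  \<open>K\<close>-algebra.
\<close>

definition spec_is_variety :: "'a set \<Rightarrow> ('a, 'c) ring_scheme \<Rightarrow> bool" where
  "spec_is_variety K R \<longleftrightarrow>
     cring R \<and> subfield K R \<and>
     (\<exists>F. finite F \<and> F \<subseteq> carrier R \<and> generate_ring R (K \<union> F) = carrier R) \<and>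
     (\<forall>x\<in>carrier R. \<forall>n::nat. x [^]\<^bsub>R\<^esub> n = \<zero>\<^bsub>R\<^esub> \<longrightarrow> x = \<zero>\<^bsub>R\<^esub>)"

text \<open>All the stalks of the structure sheaf of \<open>Spec R\<close>, which are the rings \<open>R\<^sub>P\<close>, are Cohen--Macaulay.\<close>

definition spec_is_cohen_macaulay_variety :: "'a set \<Rightarrow> ('a, 'c) ring_scheme \<Rightarrow> bool" where
  "spec_is_cohen_macaulay_variety K R \<longleftrightarrow>
     spec_is_variety K R \<and>
     (\<forall>P. primeideal P R \<longrightarrow> cohen_macaulay_local_ring (localization_at R P))"

end

theory Submission
  imports Defs "Jordan_Normal_Form.Determinant" "HOL-Library.Function_Algebras"
begin

text \<open>
  Even multiplicities \<open>2k\<close>: Dunkl operators act on the module of quasi-covariants and lower the degree.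
  Choose a maximal independent set of homogeneous singular vectors (common kernel of the Dunkl operators).
  The constant vectors in its saturated span form a subrepresentation of the regular representation; a Maschke
  projection killing them kills everything, since a nonzero image of minimal degree would be singular.
  So there are \<open>|W|\<close> independent singular vectors. They solve a linear differential system, whose trace
  gives their total degree, and Saito's determinant criterion shows that they form a basis. Normalising by the
  value at a generic point gives a basis permuted by \<open>W\<close>.

  Odd multiplicities \<open>2k + 1\<close>: in coordinates with respect to this basis the condition becomes the one
  for multiplicity \<open>1\<close>. That module is spanned by the vectors \<open>(w \<cdot> p)\<^sub>w\<close>, and Chevalley's theorem (polynomials
  are free over the invariants) provides a basis.

  Cohen--Macaulayness: in a polynomial ring every chain of \<open>n + 1\<close> primes admits a regular sequence of length \<open>n\<close>
  in its top member, by induction on the number of variables via Noether normalisation of hypersurfaces.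
  Since the quasi-covariants are finite and free over the polynomials, chains contract by incomparability and
  regular sequences extend, so the property lifts; at a localization it says that the depth is at least the
  dimension, and the converse inequality holds in every Noetherian ring.
\<close>

section \<open>Polynomials as finitely supported maps\<close>

text \<open>Parity enters through one computation. Let \<open>a\<close> be the form of a reflection
  \<open>s\<close> and let a quasi-covariant jump by \<open>a ^ m * u\<close> across
  \<open>s\<close>. The divided difference \<open>(1 - s) / a\<close> feels the sign with which
  \<open>s\<close> acts on \<open>a ^ m\<close>. For \<open>m = 2 * k\<close> the result starts with
  \<open>2 * a ^ (2 * k - 1) * u\<close>, and this cancels the power lost in differentiating
  \<open>a ^ (2 * k)\<close> exactly when the Dunkl coefficient is \<open>k\<close>. For
  \<open>m = 2 * k + 1\<close> the sign is opposite, the quotient lands in the even module, and it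
  can be expanded in the basis found there. The field is an arbitrary one of characteristic zero, so
  Knizhnik-Zamolodchikov solutions cannot be continued analytically. Two algebraic facts take over:
  a solution vanishing at one point off the hyperplanes is zero, by recursion on Taylor
  coefficients, and the number of solutions comes from representation theory instead of local
  existence. For the Cohen-Macaulay property no dimension or height is ever computed. Chains of
  primes are matched with regular sequences of the same length, a comparison that survives finite
  free extensions and localization.\<close>

type_synonym ('v, 'k) mpoly = "('v \<Rightarrow>\<^sub>0 nat) \<Rightarrow>\<^sub>0 'k"

definition pvar :: "'v \<Rightarrow> ('v, 'k::comm_ring_1) mpoly" where
  "pvar v = Poly_Mapping.single (Poly_Mapping.single v 1) 1"

lemma poly_mapping_add_induct [case_names zero add]:
  fixes f :: "'a \<Rightarrow>\<^sub>0 'b::comm_monoid_add"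
  assumes "P 0" "\<And>f a b. a \<notin> Poly_Mapping.keys f \<Longrightarrow> b \<noteq> 0 \<Longrightarrow> P f \<Longrightarrow> P (f + Poly_Mapping.single a b)"
  shows "P f"
proof (induction f rule: update_induct)
  case const
  then show ?case by (rule assms(1))
next
  case (update f a b)
  have "Poly_Mapping.update a b f = f + Poly_Mapping.single a b"
    using update(1)
    by (intro poly_mapping_eqI) (auto simp: lookup_update lookup_add lookup_single when_def in_keys_iff)
  then show ?case using assms(2) update by metis
qed

lemma poly_mapping_nat_induct [case_names zero add]:
  fixes e :: "'a \<Rightarrow>\<^sub>0 nat"
  assumes "P 0" "\<And>e v. P e \<Longrightarrow> P (e + Poly_Mapping.single v 1)"
  shows "P e"
proof (induction e rule: poly_mapping_add_induct)
  case zero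
  then show ?case by (rule assms(1))
next
  case (add f a b)
  have "P (f + Poly_Mapping.single a n)" for n
  proof (induction n)
    case 0
    then show ?case using add by simp
  next
    case (Suc n)
    then have "P (f + Poly_Mapping.single a n + Poly_Mapping.single a 1)" by (rule assms(2))
    then show ?case by (simp add: add.assoc single_add [symmetric])
  qed
  then show ?case .
qed

lemma poly_const_simps [simp]:
  "poly_const 0 = 0" "poly_const 1 = 1" "poly_const (- a) = - poly_const a"
  by (simp_all add: poly_const_def single_uminus)

lemma poly_const_hom: "comm_ring_hom (poly_const :: 'k::comm_ring_1 \<Rightarrow> ('v, 'k) mpoly)"
  by unfold_locales (simp_all add: poly_const_def single_add mult_single)

lemma poly_const_add: "poly_const (a + b) = poly_const a + poly_const b"
  by (simp add: poly_const_def single_add)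

lemma poly_const_mult: "poly_const (a * b) = poly_const a * poly_const b"
  by (simp add: poly_const_def mult_single)

lemma poly_const_inj: "poly_const a = poly_const b \<longleftrightarrow> a = b"
  by (metis poly_const_def lookup_single_eq)

lemma poly_const_eq_0 [simp]: "poly_const a = 0 \<longleftrightarrow> a = 0"
  by (metis poly_const_inj poly_const_simps(1))

lemma poly_const_of_nat: "poly_const (of_nat n) = of_nat n"
proof -
  interpret comm_ring_hom poly_const by (rule poly_const_hom)
  show ?thesis by (rule hom_of_nat)
qed

lemma single_eq_const_mult: "Poly_Mapping.single e a = poly_const a * Poly_Mapping.single e 1"
  by (simp add: poly_const_def mult_single)

lemma single_add_var:
  "Poly_Mapping.single (e + Poly_Mapping.single v 1) 1 = Poly_Mapping.single e 1 * pvar v"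
  by (simp add: pvar_def mult_single)

text \<open>Inside the one polynomial type; for \<open>X = B\<close> this is the carrier of
  \<open>sym_dual B\<close>. Most of the argument runs over the whole type, and
  \<open>retract\<close> returns to \<open>PV B\<close> at the end.\<close>

definition PV :: "'v set \<Rightarrow> ('v, 'k::comm_ring_1) mpoly set" where
  "PV X = {p. \<forall>e\<in>Poly_Mapping.keys p. Poly_Mapping.keys e \<subseteq> X}"

lemma PV_UNIV [simp]: "p \<in> PV UNIV" by (simp add: PV_def)

lemma PV_mono: "X \<subseteq> Y \<Longrightarrow> PV X \<subseteq> PV Y" by (fastforce simp: PV_def)

lemma PV_zero [simp]: "0 \<in> PV X" by (simp add: PV_def)

lemma PV_const [simp]: "poly_const c \<in> PV X"
  by (auto simp: PV_def poly_const_def split: if_splits)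

lemma PV_one [simp]: "1 \<in> PV X" using PV_const [of 1] by simp

lemma PV_var [simp]: "v \<in> X \<Longrightarrow> pvar v \<in> PV X"
  by (auto simp: PV_def pvar_def split: if_splits)

lemma PV_add: "p \<in> PV X \<Longrightarrow> q \<in> PV X \<Longrightarrow> p + q \<in> PV X"
  using keys_add [of p q] by (auto simp: PV_def)

lemma PV_mult:
  assumes "p \<in> PV X" "q \<in> PV X" shows "p * q \<in> PV X"
  unfolding PV_def
proof (clarify)
  fix e v assume e: "e \<in> Poly_Mapping.keys (p * q)" and v: "v \<in> Poly_Mapping.keys e"
  then obtain a b where "e = a + b" "a \<in> Poly_Mapping.keys p" "b \<in> Poly_Mapping.keys q"
    using keys_mult [of p q] by blast
  then show "v \<in> X" using v assms keys_add [of a b] unfolding PV_def by blast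
qed

lemma PV_uminus: "p \<in> PV X \<Longrightarrow> - p \<in> PV X"
  by (auto simp: PV_def in_keys_iff)

lemma PV_diff: "p \<in> PV X \<Longrightarrow> q \<in> PV X \<Longrightarrow> p - q \<in> PV X"
  using PV_add [OF _ PV_uminus, of p X q] by simp

lemma PV_sum: "(\<And>i. i \<in> I \<Longrightarrow> f i \<in> PV X) \<Longrightarrow> sum f I \<in> PV X"
  by (induction I rule: infinite_finite_induct) (auto intro: PV_add)

lemma PV_prod: "(\<And>i. i \<in> I \<Longrightarrow> f i \<in> PV X) \<Longrightarrow> prod f I \<in> PV X"
  by (induction I rule: infinite_finite_induct) (auto intro: PV_mult)

lemma PV_power: "p \<in> PV X \<Longrightarrow> p ^ n \<in> PV X"
  by (induction n) (auto intro: PV_mult)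

lemma ex_finite_PV: "\<exists>X. finite X \<and> p \<in> PV X"
  by (intro exI [of _ "\<Union>(Poly_Mapping.keys ` Poly_Mapping.keys p)"]) (auto simp: PV_def)

lemma ex_finite_PV_image:
  assumes "finite I" shows "\<exists>X. finite X \<and> f ` I \<subseteq> PV X"
proof -
  define X where "X i = (SOME X. finite X \<and> f i \<in> PV X)" for i
  have X: "finite (X i) \<and> f i \<in> PV (X i)" for i
    unfolding X_def by (rule someI_ex [OF ex_finite_PV])
  have "f ` I \<subseteq> PV (\<Union>(X ` I))"
    using X PV_mono [of "X _" "\<Union>(X ` I)"] by blast
  then show ?thesis using X assms by blast
qed

lemma sum_singles: "p = (\<Sum>e\<in>Poly_Mapping.keys p. Poly_Mapping.single e (Poly_Mapping.lookup p e))"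
  by (intro poly_mapping_eqI) (auto simp: lookup_sum lookup_single when_def sum.delta in_keys_iff)

lemma PV_induct [consumes 1, case_names const var add mult]:
  assumes p: "p \<in> PV X"
    and "\<And>c. P (poly_const c)" and "\<And>v. v \<in> X \<Longrightarrow> P (pvar v)"
    and "\<And>p q. P p \<Longrightarrow> P q \<Longrightarrow> P (p + q)" and "\<And>p q. P p \<Longrightarrow> P q \<Longrightarrow> P (p * q)"
  shows "P p"
proof -
  have mon: "Poly_Mapping.keys e \<subseteq> X \<Longrightarrow> P (Poly_Mapping.single e 1)" for e
  proof (induction e rule: poly_mapping_nat_induct)
    case zero
    then show ?case using assms(2) [of 1] by (simp add: poly_const_def)
  next
    case (add e v)
    have "Poly_Mapping.keys e \<subseteq> Poly_Mapping.keys (e + Poly_Mapping.single v 1)"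
      "v \<in> Poly_Mapping.keys (e + Poly_Mapping.single v 1)"
      by (auto simp: in_keys_iff lookup_add)
    then show ?case unfolding single_add_var using add assms(3,5) by blast
  qed
  have "P (\<Sum>e\<in>E. Poly_Mapping.single e (Poly_Mapping.lookup p e))"
    if "finite E" "E \<subseteq> Poly_Mapping.keys p" for E
    using that
  proof (induction E)
    case empty
    then show ?case using assms(2) [of 0] by simp
  next
    case (insert e E)
    have "P (Poly_Mapping.single e (Poly_Mapping.lookup p e))"
      using mon [of e] insert.prems p assms(2,5) unfolding PV_def
      by (subst single_eq_const_mult) auto
    then show ?case using insert assms(4) by simp
  qed
  then show ?thesis by (subst sum_singles) auto
qed

lemma mpoly_induct [case_names const var add mult]:
  assumes "\<And>c. P (poly_const c)" and "\<And>v. P (pvar v)"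
    and "\<And>p q. P p \<Longrightarrow> P q \<Longrightarrow> P (p + q)" and "\<And>p q. P p \<Longrightarrow> P q \<Longrightarrow> P (p * q)"
  shows "P p"
  by (rule PV_induct [of p UNIV]) (use assms in auto)

subsection \<open>Substitution\<close>

text \<open>The evaluation homomorphism with \<open>c\<close> on coefficients and \<open>h\<close>
  on variables. Point evaluation, linear substitution, the view as a polynomial in one variable and
  partial derivatives all arise from it by a choice of the target ring.\<close>

definition insn :: "('k::comm_ring_1 \<Rightarrow> 'r::comm_ring_1) \<Rightarrow> ('v \<Rightarrow> 'r) \<Rightarrow> ('v, 'k) mpoly \<Rightarrow> 'r" where
  "insn c h p = (\<Sum>e\<in>Poly_Mapping.keys p. c (Poly_Mapping.lookup p e) *
     (\<Prod>v\<in>Poly_Mapping.keys e. h v ^ Poly_Mapping.lookup e v))"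

lemma monomial_value_superset:
  assumes "finite F" "Poly_Mapping.keys e \<subseteq> F"
  shows "(\<Prod>v\<in>Poly_Mapping.keys e. (h v :: 'r::comm_ring_1) ^ Poly_Mapping.lookup e v)
    = (\<Prod>v\<in>F. h v ^ Poly_Mapping.lookup e v)"
  using assms by (intro prod.mono_neutral_left) (auto simp: in_keys_iff)

lemma monomial_value_add:
  "(\<Prod>v\<in>Poly_Mapping.keys (e + e'). (h v :: 'r::comm_ring_1) ^ Poly_Mapping.lookup (e + e') v) =
   (\<Prod>v\<in>Poly_Mapping.keys e. h v ^ Poly_Mapping.lookup e v) *
   (\<Prod>v\<in>Poly_Mapping.keys e'. h v ^ Poly_Mapping.lookup e' v)"
proof -
  let ?F = "Poly_Mapping.keys e \<union> Poly_Mapping.keys e'"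
  have *: "finite ?F" "Poly_Mapping.keys (e + e') \<subseteq> ?F" using keys_add [of e e'] by auto
  show ?thesis
    unfolding monomial_value_superset [OF *]
    by (simp add: monomial_value_superset [of ?F e] monomial_value_superset [of ?F e']
        prod.distrib [symmetric] lookup_add power_add)
qed

lemma insn_superset:
  assumes "comm_ring_hom c" "finite E" "Poly_Mapping.keys p \<subseteq> E"
  shows "insn c h p = (\<Sum>e\<in>E. c (Poly_Mapping.lookup p e) *
     (\<Prod>v\<in>Poly_Mapping.keys e. h v ^ Poly_Mapping.lookup e v))"
proof -
  interpret comm_ring_hom c by fact
  show ?thesis unfolding insn_def
    using assms by (intro sum.mono_neutral_left) (auto simp: in_keys_iff)
qed

lemma insn_single:
  assumes "comm_ring_hom c"
  shows "insn c h (Poly_Mapping.single e a) = c a * (\<Prod>v\<in>Poly_Mapping.keys e. h v ^ Poly_Mapping.lookup e v)"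
  using insn_superset [OF assms, of "{e}" "Poly_Mapping.single e a"] by auto

lemma insn_add:
  assumes "comm_ring_hom c"
  shows "insn c h (p + q) = insn c h p + insn c h q"
proof -
  interpret comm_ring_hom c by fact
  let ?E = "Poly_Mapping.keys p \<union> Poly_Mapping.keys q"
  have "Poly_Mapping.keys (p + q) \<subseteq> ?E" by (rule keys_add)
  then show ?thesis
    by (simp add: insn_superset [OF assms, of ?E] lookup_add hom_add sum.distrib distrib_right)
qed

lemma insn_sum:
  assumes "comm_ring_hom c"
  shows "insn c h (sum f I) = (\<Sum>i\<in>I. insn c h (f i))"
  by (induction I rule: infinite_finite_induct)
    (simp_all add: insn_add [OF assms] insn_def [of _ _ 0])

lemma insn_hom:
  assumes "comm_ring_hom c"
  shows "comm_ring_hom (insn c h)"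
proof -
  interpret comm_ring_hom c by fact
  have mult: "insn c h (p * q) = insn c h p * insn c h q" for p q
  proof -
    let ?L = Poly_Mapping.lookup and ?K = Poly_Mapping.keys and ?s = Poly_Mapping.single
    have "p * q = (\<Sum>e\<in>?K p. \<Sum>e'\<in>?K q. ?s (e + e') (?L p e * ?L q e'))"
      by (subst (1) sum_singles [of p], subst (1) sum_singles [of q])
        (simp add: sum_product mult_single)
    then have "insn c h (p * q) = (\<Sum>e\<in>?K p. \<Sum>e'\<in>?K q. insn c h (?s e (?L p e)) * insn c h (?s e' (?L q e')))"
      by (simp add: insn_sum [OF assms] insn_single [OF assms] monomial_value_add hom_mult ac_simps)
    also have "\<dots> = insn c h p * insn c h q"
      by (simp add: sum_product insn_def [of _ _ p] insn_def [of _ _ q] insn_single [OF assms])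
    finally show ?thesis .
  qed
  show ?thesis
    by unfold_locales (simp_all add: insn_add [OF assms] mult insn_single [OF assms, of h 0 1, simplified] , simp add: insn_def)
qed

lemma insn_const: "comm_ring_hom c \<Longrightarrow> insn c h (poly_const a) = c a"
  by (simp add: poly_const_def insn_single)

lemma insn_var: "comm_ring_hom c \<Longrightarrow> insn c h (pvar v) = h v"
  by (simp add: pvar_def insn_single comm_ring_hom_def ring_hom_def semiring_hom_def monoid_mult_hom_def one_hom.hom_one)

lemma hom_eq_on_PV:
  assumes "comm_ring_hom f" "comm_ring_hom g"
    and "\<And>a. f (poly_const a) = g (poly_const a)" "\<And>v. v \<in> X \<Longrightarrow> f (pvar v) = g (pvar v)"
    and "p \<in> PV X"
  shows "f p = g p"
proof -
  interpret f: comm_ring_hom f by fact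
  interpret g: comm_ring_hom g by fact
  show ?thesis using assms(5)
    by (induction rule: PV_induct) (simp_all add: assms f.hom_add g.hom_add f.hom_mult g.hom_mult)
qed

lemma hom_eqI:
  fixes f :: "('v, 'k::comm_ring_1) mpoly \<Rightarrow> 'r::comm_ring_1"
  assumes "comm_ring_hom f" "comm_ring_hom g"
    and "\<And>a. f (poly_const a) = g (poly_const a)" "\<And>v. f (pvar v) = g (pvar v)"
  shows "f = g"
  by (rule ext, rule hom_eq_on_PV [OF assms(1,2), of UNIV]) (use assms in auto)

abbreviation psubst :: "('v \<Rightarrow> ('w, 'k::comm_ring_1) mpoly) \<Rightarrow> ('v, 'k) mpoly \<Rightarrow> ('w, 'k) mpoly" where
  "psubst \<equiv> insn poly_const"

abbreviation peval :: "('v \<Rightarrow> 'k::comm_ring_1) \<Rightarrow> ('v, 'k) mpoly \<Rightarrow> 'k" where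
  "peval \<equiv> insn (\<lambda>c. c)"

lemma ident_hom: "comm_ring_hom (\<lambda>c::'k::comm_ring_1. c)" by unfold_locales auto

lemma comp_hom: "comm_ring_hom f \<Longrightarrow> comm_ring_hom g \<Longrightarrow> comm_ring_hom (\<lambda>x. f (g x))"
proof -
  assume "comm_ring_hom f" "comm_ring_hom g"
  then interpret f: comm_ring_hom f + g: comm_ring_hom g .
  show ?thesis by unfold_locales (simp_all add: f.hom_add g.hom_add f.hom_mult g.hom_mult)
qed

lemmas psubst_hom = insn_hom [OF poly_const_hom]
lemmas peval_hom = insn_hom [OF ident_hom]

lemma psubst_simps [simp]:
  "psubst h (poly_const a) = poly_const a" "psubst h (pvar v) = h v"
  "psubst h 0 = 0" "psubst h 1 = 1"
  "psubst h (p + q) = psubst h p + psubst h q" "psubst h (p * q) = psubst h p * psubst h q"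
  "psubst h (p - q) = psubst h p - psubst h q" "psubst h (- p) = - psubst h p"
  "psubst h (p ^ n) = psubst h p ^ n"
proof -
  interpret comm_ring_hom "psubst h" by (rule psubst_hom)
  show "psubst h (poly_const a) = poly_const a" "psubst h (pvar v) = h v"
  "psubst h 0 = 0" "psubst h 1 = 1"
  "psubst h (p + q) = psubst h p + psubst h q" "psubst h (p * q) = psubst h p * psubst h q"
  "psubst h (p - q) = psubst h p - psubst h q" "psubst h (- p) = - psubst h p"
  "psubst h (p ^ n) = psubst h p ^ n"
    by (simp_all add: insn_const [OF poly_const_hom] insn_var [OF poly_const_hom] hom_distribs)
qed

lemma peval_simps [simp]:
  "peval x (poly_const a) = a" "peval x (pvar v) = x v"
  "peval x 0 = 0" "peval x 1 = 1"
  "peval x (p + q) = peval x p + peval x q" "peval x (p * q) = peval x p * peval x q"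
  "peval x (p - q) = peval x p - peval x q" "peval x (- p) = - peval x p"
  "peval x (p ^ n) = peval x p ^ n"
proof -
  interpret comm_ring_hom "peval x" by (rule peval_hom)
  show "peval x (poly_const a) = a" "peval x (pvar v) = x v"
  "peval x 0 = 0" "peval x 1 = 1"
  "peval x (p + q) = peval x p + peval x q" "peval x (p * q) = peval x p * peval x q"
  "peval x (p - q) = peval x p - peval x q" "peval x (- p) = - peval x p"
  "peval x (p ^ n) = peval x p ^ n"
    by (simp_all add: insn_const [OF ident_hom] insn_var [OF ident_hom] hom_distribs)
qed

lemma psubst_sum: "psubst h (sum f I) = (\<Sum>i\<in>I. psubst h (f i))"
  by (rule insn_sum [OF poly_const_hom])

lemma psubst_PV:
  assumes "p \<in> PV X" "\<And>v. v \<in> X \<Longrightarrow> h v \<in> PV Y"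
  shows "psubst h p \<in> PV Y"
  using assms(1) by (induction rule: PV_induct) (use assms(2) in \<open>auto intro: PV_add PV_mult\<close>)

lemma psubst_id_PV:
  assumes "p \<in> PV X" "\<And>v. v \<in> X \<Longrightarrow> h v = pvar v"
  shows "psubst h p = p"
  using assms(1) by (induction rule: PV_induct) (use assms(2) in auto)

lemma psubst_pvar [simp]: "psubst pvar p = p"
  by (rule psubst_id_PV [of _ UNIV]) auto

lemma psubst_psubst: "psubst h (psubst g p) = psubst (\<lambda>v. psubst h (g v)) p"
  by (induction p rule: mpoly_induct) auto

subsection \<open>One distinguished variable; absence of zero divisors\<close>

text \<open>Collects the powers of \<open>b\<close>. The coefficients keep the same type, but by
  \<open>coeff_uni_PV\<close> they are free of \<open>b\<close>; inductions on the number of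
  variables rest on this.\<close>

definition uni :: "'v \<Rightarrow> ('v, 'k::comm_ring_1) mpoly \<Rightarrow> ('v, 'k) mpoly poly" where
  "uni b = insn (\<lambda>c. [:poly_const c:]) (\<lambda>v. if v = b then [:0, 1:] else [:pvar v:])"

lemma const_poly_hom: "comm_ring_hom (\<lambda>c::'k::comm_ring_1. [:poly_const c :: ('v, 'k) mpoly:])"
  by unfold_locales (simp_all add: poly_const_add poly_const_mult)

lemma uni_hom: "comm_ring_hom (uni b)"
  unfolding uni_def by (rule insn_hom [OF const_poly_hom])

lemma uni_simps [simp]:
  "uni b (poly_const c) = [:poly_const c:]" "uni b (pvar b) = [:0, 1:]"
  "v \<noteq> b \<Longrightarrow> uni b (pvar v) = [:pvar v:]"
  "uni b 0 = 0" "uni b 1 = 1"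
  "uni b (p + q) = uni b p + uni b q" "uni b (p * q) = uni b p * uni b q"
  "uni b (p - q) = uni b p - uni b q" "uni b (- p) = - uni b p"
  "uni b (p ^ n) = uni b p ^ n"
proof -
  interpret comm_ring_hom "uni b" by (rule uni_hom)
  show "uni b (poly_const c) = [:poly_const c:]" "uni b (pvar b) = [:0, 1:]"
    "v \<noteq> b \<Longrightarrow> uni b (pvar v) = [:pvar v:]" for v
    by (simp_all add: uni_def insn_const [OF const_poly_hom] insn_var [OF const_poly_hom])
  show "uni b 0 = 0" "uni b 1 = 1"
  "uni b (p + q) = uni b p + uni b q" "uni b (p * q) = uni b p * uni b q"
  "uni b (p - q) = uni b p - uni b q" "uni b (- p) = - uni b p" "uni b (p ^ n) = uni b p ^ n"
    by (simp_all add: hom_distribs)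
qed

lemma uni_sum: "uni b (sum f I) = (\<Sum>i\<in>I. uni b (f i))"
  unfolding uni_def by (rule insn_sum [OF const_poly_hom])

lemma poly_uni [simp]: "poly (uni b p) (pvar b) = p"
proof (induction p rule: mpoly_induct)
  case (var v)
  then show ?case by (cases "v = b") auto
qed auto

lemma uni_eq_0_iff [simp]: "uni b p = 0 \<longleftrightarrow> p = 0"
  by (metis poly_uni poly_0 uni_simps(4))

lemma uni_PV: "p \<in> PV X \<Longrightarrow> b \<notin> X \<Longrightarrow> uni b p = [:p:]"
proof (induction rule: PV_induct)
  case (var v)
  then show ?case by (cases "v = b") auto
qed auto

lemma coeff_uni_PV:
  assumes "p \<in> PV (insert b X)" shows "coeff (uni b p) i \<in> PV X"
  using assms
proof (induction arbitrary: i rule: PV_induct)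
  case (const c)
  then show ?case by (cases i) auto
next
  case (var v)
  show ?case
  proof (cases "v = b")
    case True
    then show ?thesis by (cases i) (auto simp: coeff_pCons split: nat.split)
  next
    case False
    then show ?thesis using var by (cases i) auto
  qed
next
  case (mult p q)
  then show ?case by (auto simp: coeff_mult intro!: PV_sum PV_mult)
qed (auto intro: PV_add)

text \<open>The top coefficient of a product with respect to \<open>b\<close> is the product of the
  leading coefficients, and these involve one variable fewer.\<close>

lemma PV_no_zero_divisors:
  fixes p q :: "('v, 'k::idom) mpoly"
  assumes "finite X" "p \<in> PV X" "q \<in> PV X" "p * q = 0"
  shows "p = 0 \<or> q = 0"
  using assms
proof (induction X arbitrary: p q)
  case empty
  have c: "\<exists>a. p = poly_const a" if "p \<in> PV {}" for p :: "('v, 'k) mpoly"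
    using that by (induction rule: PV_induct)
      (auto, metis poly_const_add, metis poly_const_mult)
  obtain a b where "p = poly_const a" "q = poly_const b" using c empty by metis
  then show ?case using empty by (simp add: poly_const_mult [symmetric])
next
  case (insert b X)
  let ?p = "uni b p" and ?q = "uni b q"
  have "lead_coeff ?p * lead_coeff ?q = coeff (?p * ?q) (degree ?p + degree ?q)"
    by (simp add: coeff_mult_degree_sum)
  also have "\<dots> = 0" using insert.prems uni_simps(7) [of b p q] by simp
  finally have "lead_coeff ?p = 0 \<or> lead_coeff ?q = 0"
    by (rule insert.IH [OF coeff_uni_PV [OF insert.prems(1)] coeff_uni_PV [OF insert.prems(2)]])
  then show ?case by auto
qed

lemma mpoly_mult_eq_0 [simp]:
  fixes p q :: "('v, 'k::idom) mpoly"
  shows "p * q = 0 \<longleftrightarrow> p = 0 \<or> q = 0"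
proof
  assume pq: "p * q = 0"
  obtain X where X: "finite X" "id ` {p, q} \<subseteq> PV X"
    using ex_finite_PV_image [of "{p, q}" id] by blast
  then have "p \<in> PV X" "q \<in> PV X" by auto
  then show "p = 0 \<or> q = 0" using PV_no_zero_divisors [OF X(1)] pq by blast
next
  assume "p = 0 \<or> q = 0"
  then show "p * q = 0" by (metis mult_zero_left mult_zero_right)
qed

lemma mpoly_mult_cancel [simp]:
  fixes p q r :: "('v, 'k::idom) mpoly"
  shows "r * p = r * q \<longleftrightarrow> r = 0 \<or> p = q" "p * r = q * r \<longleftrightarrow> r = 0 \<or> p = q"
proof -
  have "r * p = r * q \<longleftrightarrow> r * (p - q) = 0" by (simp only: right_diff_distrib right_minus_eq)
  then show *: "r * p = r * q \<longleftrightarrow> r = 0 \<or> p = q"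
    by (simp only: mpoly_mult_eq_0 right_minus_eq)
  show "p * r = q * r \<longleftrightarrow> r = 0 \<or> p = q"
    using * by (simp only: mult.commute [of _ r])
qed

lemma mpoly_prod_eq_0:
  fixes f :: "'i \<Rightarrow> ('v, 'k::idom) mpoly"
  shows "finite I \<Longrightarrow> prod f I = 0 \<longleftrightarrow> (\<exists>i\<in>I. f i = 0)"
  by (induction I rule: finite_induct) auto

lemma mpoly_power_eq_0 [simp]:
  fixes p :: "('v, 'k::idom) mpoly"
  shows "p ^ n = 0 \<longleftrightarrow> p = 0 \<and> n > 0"
  by (induction n) auto

lemma mpoly_dvd_cancel:
  fixes p q r :: "('v, 'k::idom) mpoly"
  shows "r * p dvd r * q \<longleftrightarrow> r = 0 \<or> p dvd q"
  by (auto simp: dvd_def mult.assoc)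

text \<open>Variable by variable: choose the other coordinates so that the leading coefficient in
  \<open>b\<close> survives, then avoid finitely many roots in an infinite field.\<close>

lemma ex_nonzero_point:
  fixes p :: "('v, 'k::field_char_0) mpoly"
  assumes "p \<noteq> 0" shows "\<exists>x. peval x p \<noteq> 0"
proof -
  have "p \<noteq> 0 \<Longrightarrow> \<exists>x. peval x p \<noteq> 0" if "finite X" "p \<in> PV X" for X and p :: "('v, 'k) mpoly"
    using that
  proof (induction X arbitrary: p)
    case empty
    have "\<exists>a. p = poly_const a" using \<open>p \<in> PV {}\<close>
      by (induction rule: PV_induct) (auto, metis poly_const_add, metis poly_const_mult)
    then show ?case using empty by auto
  next
    case (insert b X)
    have "lead_coeff (uni b p) \<noteq> 0" using insert by simp
    then obtain x where x: "peval x (lead_coeff (uni b p)) \<noteq> 0"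
      using insert.IH [OF _ coeff_uni_PV [OF insert.prems(2)]] by blast
    define c where "c a = [:a:]" for a :: 'k
    define h where "h v = (if v = b then [:0, 1:] else [:x v:])" for v
    have c: "comm_ring_hom c" unfolding c_def by unfold_locales simp_all
    interpret comm_ring_hom "peval x" by (rule peval_hom)
    interpret u: comm_ring_hom "insn c h" by (rule insn_hom [OF c])
    have ev: "peval (x(b := t)) q = poly (insn c h q) t" for q t
      by (induction q rule: mpoly_induct)
        (simp_all add: insn_const [OF c] insn_var [OF c] u.hom_add u.hom_mult, simp_all add: c_def h_def)
    have co: "coeff (insn c h q) i = peval x (coeff (uni b q) i)" for q i
    proof (induction q arbitrary: i rule: mpoly_induct)
      case (var v)
      then show ?case
        by (cases "v = b"; cases i)
          (auto simp: insn_var [OF c] h_def coeff_pCons split: nat.split)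
    next
      case (const a)
      then show ?case by (cases i) (simp_all add: insn_const [OF c], simp_all add: c_def)
    qed (auto simp: u.hom_add u.hom_mult coeff_mult hom_sum)
    let ?m = "insn c h p"
    have "coeff ?m (degree (uni b p)) \<noteq> 0" using x by (simp add: co)
    then have "?m \<noteq> 0" by auto
    then have "finite {t. poly ?m t = 0}" by (rule poly_roots_finite)
    then have "\<exists>t. poly ?m t \<noteq> 0"
      using infinite_UNIV_char_0 [where 'a='k] by (metis (mono_tags, lifting) Collect_cong UNIV_def)
    then show ?case using ev by metis
  qed
  then show ?thesis using ex_finite_PV assms by metis
qed

subsection \<open>Partial derivatives\<close>

text \<open>The first-order coefficient after an infinitesimal shift of \<open>b\<close>, with the
  polynomial variable as the infinitesimal. The Leibniz rule becomes the formula for the first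
  coefficient of a product.\<close>

definition pd :: "'v \<Rightarrow> ('v, 'k::comm_ring_1) mpoly \<Rightarrow> ('v, 'k) mpoly" where
  "pd b p = coeff (insn (\<lambda>c. [:poly_const c:]) (\<lambda>v. if v = b then [:pvar v, 1:] else [:pvar v:]) p) 1"

lemmas single_add_Suc_0 = single_add_var [unfolded One_nat_def]

lemma pd_simps [simp]:
  fixes p q :: "('v, 'k::comm_ring_1) mpoly"
  shows "pd b (poly_const c :: ('v, 'k) mpoly) = 0"
  "pd b (pvar v :: ('v, 'k) mpoly) = (if v = b then 1 else 0)"
  "pd b (0 :: ('v, 'k) mpoly) = 0" "pd b (1 :: ('v, 'k) mpoly) = 0"
  "pd b (p + q) = pd b p + pd b q" "pd b (p - q) = pd b p - pd b q" "pd b (- p) = - pd b p"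
  "pd b (p * q) = pd b p * q + p * pd b q"
proof -
  define h where "h = (\<lambda>v. if v = b then [:pvar v, 1:] else [:pvar v :: ('v, 'k) mpoly:])"
  define D where "D = insn (\<lambda>c::'k. [:poly_const c:]) h"
  interpret D: comm_ring_hom D unfolding D_def by (rule insn_hom [OF const_poly_hom])
  have pd: "pd b p = coeff (D p) 1" for p :: "('v, 'k) mpoly" by (simp add: pd_def D_def h_def)
  have c: "D (poly_const c) = [:poly_const c:]" for c by (simp add: D_def insn_const [OF const_poly_hom])
  have v: "D (pvar v) = h v" for v by (simp add: D_def insn_var [OF const_poly_hom])
  have 0: "coeff (D p) 0 = p" for p
    by (induction p rule: mpoly_induct) (auto simp: c v h_def D.hom_add D.hom_mult coeff_mult)
  show "pd b (poly_const c :: ('v, 'k) mpoly) = 0" by (simp add: pd c)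
  show "pd b (pvar v :: ('v, 'k) mpoly) = (if v = b then 1 else 0)" by (simp add: pd v h_def)
  show "pd b (0 :: ('v, 'k) mpoly) = 0" "pd b (1 :: ('v, 'k) mpoly) = 0" by (simp_all add: pd)
  show "pd b (p + q) = pd b p + pd b q" by (simp add: pd D.hom_add)
  show "pd b (p - q) = pd b p - pd b q" by (simp add: pd D.hom_minus)
  show "pd b (- p) = - pd b p" by (simp add: pd D.hom_uminus)
  show "pd b (p * q) = pd b p * q + p * pd b q"
    by (simp add: pd D.hom_mult coeff_mult 0 atMost_Suc)
qed

lemma pd_sum: "pd b (sum f I) = (\<Sum>i\<in>I. pd b (f i))"
  by (induction I rule: infinite_finite_induct) auto

lemma pd_power_Suc: "pd b (p ^ Suc n) = of_nat (Suc n) * p ^ n * pd b p"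
  by (induction n) (simp_all add: algebra_simps)

text \<open>Derivations along a ring homomorphism are determined on generators. This serves for the
  chain rule of the group action and for commutation with translations.\<close>

lemma derivation_eqI:
  fixes h :: "('v, 'k::comm_ring_1) mpoly \<Rightarrow> ('w, 'k) mpoly"
  assumes "\<And>p q. D (p + q) = D p + D q" "\<And>p q. D' (p + q) = D' p + D' q"
    and "\<And>p q. D (p * q) = D p * h q + h p * D q" "\<And>p q. D' (p * q) = D' p * h q + h p * D' q"
    and "\<And>c. D (poly_const c) = D' (poly_const c)" "\<And>v. D (pvar v) = D' (pvar v)"
  shows "D p = D' p"
  by (induction p rule: mpoly_induct) (simp_all add: assms)

subsection \<open>Homogeneous polynomials\<close>

definition mdeg :: "('v \<Rightarrow>\<^sub>0 nat) \<Rightarrow> nat" where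
  "mdeg e = sum (Poly_Mapping.lookup e) (Poly_Mapping.keys e)"

lemma mdeg_superset: "finite F \<Longrightarrow> Poly_Mapping.keys e \<subseteq> F \<Longrightarrow> mdeg e = sum (Poly_Mapping.lookup e) F"
  unfolding mdeg_def by (intro sum.mono_neutral_left) (auto simp: in_keys_iff)

lemma mdeg_add: "mdeg (e + e') = mdeg e + mdeg e'"
proof -
  let ?F = "Poly_Mapping.keys e \<union> Poly_Mapping.keys e'"
  have "finite ?F" "Poly_Mapping.keys (e + e') \<subseteq> ?F" using keys_add [of e e'] by auto
  then show ?thesis
    by (simp add: mdeg_superset [of ?F] lookup_add sum.distrib)
qed

lemma mdeg_0 [simp]: "mdeg 0 = 0" by (simp add: mdeg_def)

lemma mdeg_single [simp]: "mdeg (Poly_Mapping.single v n) = n" by (simp add: mdeg_def)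

lemma mdeg_eq_0: "mdeg e = 0 \<longleftrightarrow> e = 0"
  by (metis finite_keys in_keys_iff keys_eq_empty mdeg_0 mdeg_def sum_eq_0_iff equals0I)

definition homog :: "nat \<Rightarrow> ('v, 'k::comm_ring_1) mpoly \<Rightarrow> bool" where
  "homog d p \<longleftrightarrow> (\<forall>e\<in>Poly_Mapping.keys p. mdeg e = d)"

lemma homog_0 [simp]: "homog d 0" by (simp add: homog_def)

lemma homog_const [simp]: "homog 0 (poly_const c)"
  by (simp add: homog_def poly_const_def)

lemma homog_1 [simp]: "homog 0 1" using homog_const [of 1] by simp

lemma homog_var [simp]: "homog (Suc 0) (pvar v)"
  by (simp add: homog_def pvar_def)

lemma homog_add: "homog d p \<Longrightarrow> homog d q \<Longrightarrow> homog d (p + q)"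
  using keys_add [of p q] by (auto simp: homog_def)

lemma homog_uminus: "homog d p \<Longrightarrow> homog d (- p)"
  by (auto simp: homog_def in_keys_iff)

lemma homog_diff: "homog d p \<Longrightarrow> homog d q \<Longrightarrow> homog d (p - q)"
  using homog_add [OF _ homog_uminus, of d p q] by simp

lemma homog_sum: "(\<And>i. i \<in> I \<Longrightarrow> homog d (f i)) \<Longrightarrow> homog d (sum f I)"
  by (induction I rule: infinite_finite_induct) (auto intro: homog_add)

lemma homog_mult:
  assumes "homog d p" "homog d' q" shows "homog (d + d') (p * q)"
  unfolding homog_def
proof
  fix e assume "e \<in> Poly_Mapping.keys (p * q)"
  then obtain a b where "e = a + b" "a \<in> Poly_Mapping.keys p" "b \<in> Poly_Mapping.keys q"
    using keys_mult [of p q] by blast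
  then show "mdeg e = d + d'" using assms by (simp add: homog_def mdeg_add)
qed

lemma homog_const_mult: "homog d p \<Longrightarrow> homog d (poly_const c * p)"
  using homog_mult [OF homog_const] by fastforce

lemma homog_prod: "(\<And>i. i \<in> I \<Longrightarrow> homog (d i) (f i)) \<Longrightarrow> homog (sum d I) (prod f I)"
  by (induction I rule: infinite_finite_induct) (auto intro: homog_mult)

lemma homog_power: "homog d p \<Longrightarrow> homog (n * d) (p ^ n)"
  by (induction n) (auto intro: homog_mult)

lemma homog_zero_const:
  assumes "homog 0 p" shows "\<exists>c. p = poly_const c"
proof -
  have "p = poly_const (Poly_Mapping.lookup p 0)"
    by (rule poly_mapping_eqI)
      (use assms in \<open>auto simp: poly_const_def lookup_single when_def homog_def mdeg_eq_0 in_keys_iff\<close>)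
  then show ?thesis by blast
qed

definition hc :: "nat \<Rightarrow> ('v, 'k::comm_ring_1) mpoly \<Rightarrow> ('v, 'k) mpoly" where
  "hc d p = (\<Sum>e\<in>{e\<in>Poly_Mapping.keys p. mdeg e = d}. Poly_Mapping.single e (Poly_Mapping.lookup p e))"

lemma lookup_hc: "Poly_Mapping.lookup (hc d p) e = (if mdeg e = d then Poly_Mapping.lookup p e else 0)"
  by (auto simp: hc_def lookup_sum lookup_single when_def sum.delta in_keys_iff)

lemma homog_hc [simp]: "homog d (hc d p)"
  by (auto simp: homog_def in_keys_iff lookup_hc split: if_splits)

lemma hc_add: "hc d (p + q) = hc d p + hc d q"
  by (rule poly_mapping_eqI) (simp add: lookup_hc lookup_add)

lemma hc_0 [simp]: "hc d 0 = 0" by (rule poly_mapping_eqI) (simp add: lookup_hc)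

lemma hc_sum: "hc d (sum f I) = (\<Sum>i\<in>I. hc d (f i))"
  by (induction I rule: infinite_finite_induct) (auto simp: hc_add)

lemma hc_homog: "homog n p \<Longrightarrow> hc d p = (if d = n then p else 0)"
  by (rule poly_mapping_eqI) (auto simp: lookup_hc homog_def in_keys_iff)

lemma hc_bound: "\<exists>n. \<forall>d>n. hc d p = 0"
proof -
  have "hc d p = 0" if "d > Max (insert 0 (mdeg ` Poly_Mapping.keys p))" for d
  proof (rule poly_mapping_eqI)
    fix e
    show "Poly_Mapping.lookup (hc d p) e = Poly_Mapping.lookup 0 e"
      using that by (auto simp: lookup_hc in_keys_iff)
  qed
  then show ?thesis by blast
qed

lemma sum_hc:
  assumes "\<forall>d>n. hc d p = 0" shows "p = (\<Sum>d\<le>n. hc d p)"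
proof (rule poly_mapping_eqI)
  fix e
  have "mdeg e > n \<Longrightarrow> Poly_Mapping.lookup p e = 0"
    using assms lookup_hc [of "mdeg e" p e] by simp
  then show "Poly_Mapping.lookup p e = Poly_Mapping.lookup (\<Sum>d\<le>n. hc d p) e"
    by (auto simp: lookup_sum lookup_hc)
qed

lemma hc_eqI: "(\<And>d. hc d p = hc d q) \<Longrightarrow> p = q"
  by (rule poly_mapping_eqI) (metis lookup_hc)

lemma hc_homog_mult:
  assumes x: "homog n x" shows "hc d (x * y) = (if n \<le> d then x * hc (d - n) y else 0)"
proof -
  obtain m where m: "\<forall>d>m. hc d y = 0" using hc_bound by blast
  have h: "homog (n + i) (x * hc i y)" for i by (rule homog_mult [OF x homog_hc])
  have "hc d (x * y) = (\<Sum>i\<le>m. hc d (x * hc i y))"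
    by (subst sum_hc [OF m]) (simp add: sum_distrib_left hc_sum)
  also have "\<dots> = (\<Sum>i\<le>m. if i = d - n \<and> n \<le> d then x * hc i y else 0)"
    by (intro sum.cong HOL.refl) (auto simp: hc_homog [OF h])
  also have "\<dots> = (if n \<le> d then x * hc (d - n) y else 0)"
    using m by (auto simp: not_le)
  finally show ?thesis .
qed

text \<open>Multiplication by the homogeneous \<open>x\<close> shifts components, so a component of
  \<open>y\<close> in a degree other than \<open>n\<close> would show up in the product in a
  forbidden degree.\<close>

lemma homog_cancel:
  fixes x y :: "('v, 'k::idom) mpoly"
  assumes "homog d x" "homog (d + n) (x * y)" "x \<noteq> 0"
  shows "homog n y"
proof -
  have 0: "hc i y = 0" if "i \<noteq> n" for i
  proof -
    have "hc (d + i) (x * y) = 0" using hc_homog [OF assms(2)] that by simp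
    then show ?thesis using hc_homog_mult [OF assms(1), of "d + i" y] assms(3) by simp
  qed
  have "y = hc n y"
  proof (rule hc_eqI)
    show "hc i y = hc i (hc n y)" for i
      by (cases "i = n") (simp_all add: hc_homog [OF homog_hc] 0)
  qed
  then show ?thesis by (metis homog_hc)
qed

lemma homog_induct [consumes 1, case_names zero add mon]:
  assumes p: "homog d p" and "P 0" "\<And>p q. P p \<Longrightarrow> P q \<Longrightarrow> P (p + q)"
    and "\<And>e a. mdeg e = d \<Longrightarrow> P (Poly_Mapping.single e a)"
  shows "P p"
proof -
  have "P (\<Sum>e\<in>E. Poly_Mapping.single e (Poly_Mapping.lookup p e))" if "finite E" "E \<subseteq> Poly_Mapping.keys p" for E
    using that by (induction E) (use assms p in \<open>auto simp: homog_def\<close>)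
  then show ?thesis by (subst sum_singles) auto
qed

text \<open>The subtraction in the degree is truncated, so vanishing in degree 0 is carried along;
  without it the product with the next variable would get the wrong degree.\<close>

lemma homog_pd_mon: "(mdeg e = 0 \<longrightarrow> pd b (Poly_Mapping.single e (1::'k::comm_ring_1)) = 0) \<and>
  homog (mdeg e - 1) (pd b (Poly_Mapping.single e (1::'k)))"
proof (induction e rule: poly_mapping_nat_induct)
  case zero
  then show ?case by simp
next
  case (add e v)
  have "homog (mdeg e) (pd b (Poly_Mapping.single e (1::'k)) * pvar v)"
    using add homog_mult [of "mdeg e - 1" "pd b (Poly_Mapping.single e (1::'k))" 1 "pvar v"]
    by (cases "mdeg e = 0") auto
  moreover have "homog (mdeg e) (Poly_Mapping.single e (1::'k) * (if v = b then 1 else 0))"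
    by (simp add: homog_def)
  ultimately show ?case by (simp add: single_add_Suc_0 mdeg_add homog_add)
qed

lemma homog_pd: "homog d p \<Longrightarrow> homog (d - 1) (pd b p)"
proof (induction rule: homog_induct)
  case (mon e a)
  then show ?case using homog_pd_mon [of e b] homog_const_mult
    by (subst single_eq_const_mult) auto
qed (auto intro: homog_add)

lemma pd_homog_0: "homog 0 p \<Longrightarrow> pd b p = 0"
  using homog_zero_const by fastforce

lemma euler_identity:
  fixes p :: "('v, 'k::comm_ring_1) mpoly"
  assumes "homog d p" "finite F" "p \<in> PV F"
  shows "(\<Sum>b\<in>F. pvar b * pd b p) = of_nat d * p"
proof -
  have mon: "Poly_Mapping.keys e \<subseteq> F \<Longrightarrow>
    (\<Sum>b\<in>F. pvar b * pd b (Poly_Mapping.single e (1::'k))) = of_nat (mdeg e) * Poly_Mapping.single e (1::'k)" for e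
  proof (induction e rule: poly_mapping_nat_induct)
    case zero
    then show ?case by simp
  next
    case (add e v)
    have sub: "Poly_Mapping.keys e \<subseteq> F" "v \<in> F"
      using add.prems by (auto simp: subset_iff in_keys_iff lookup_add)
    have "(\<Sum>b\<in>F. pvar b * pd b (Poly_Mapping.single e (1::'k) * pvar v)) =
      (\<Sum>b\<in>F. pvar b * pd b (Poly_Mapping.single e (1::'k))) * pvar v
       + (\<Sum>b\<in>F. if b = v then Poly_Mapping.single e 1 * pvar v else 0)"
      by (simp add: algebra_simps sum_distrib_right sum_distrib_left sum.distrib [symmetric])
        (intro sum.cong HOL.refl, auto simp: algebra_simps)
    also have "\<dots> = of_nat (mdeg e + 1) * (Poly_Mapping.single e (1::'k) * pvar v)"
      using add.IH [OF sub(1)] sub(2) assms(2) by (simp add: algebra_simps)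
    finally show ?case by (simp add: single_add_Suc_0 mdeg_add)
  qed
  have "p = (\<Sum>e\<in>Poly_Mapping.keys p. poly_const (Poly_Mapping.lookup p e) * Poly_Mapping.single e (1::'k))"
    using sum_singles [of p] by (simp only: single_eq_const_mult [symmetric])
  moreover have "(\<Sum>b\<in>F. pvar b * pd b (\<Sum>e\<in>Poly_Mapping.keys p. poly_const (Poly_Mapping.lookup p e) * Poly_Mapping.single e 1))
     = (\<Sum>e\<in>Poly_Mapping.keys p. poly_const (Poly_Mapping.lookup p e) * (\<Sum>b\<in>F. pvar b * pd b (Poly_Mapping.single e (1::'k))))"
    by (simp add: pd_sum sum_distrib_left algebra_simps) (rule sum.swap)
  moreover have "\<dots> = of_nat d * (\<Sum>e\<in>Poly_Mapping.keys p. poly_const (Poly_Mapping.lookup p e) * Poly_Mapping.single e (1::'k))"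
    unfolding sum_distrib_left [where r = "of_nat d"]
  proof (rule sum.cong [OF HOL.refl])
    fix e assume "e \<in> Poly_Mapping.keys p"
    then have "Poly_Mapping.keys e \<subseteq> F" "mdeg e = d" using assms by (auto simp: PV_def homog_def)
    then show "poly_const (Poly_Mapping.lookup p e) * (\<Sum>b\<in>F. pvar b * pd b (Poly_Mapping.single e (1::'k))) =
      of_nat d * (poly_const (Poly_Mapping.lookup p e) * Poly_Mapping.single e (1::'k))"
      by (simp only: mon mult.left_commute)
  qed
  ultimately show ?thesis by metis
qed

lemma psubst_homog:
  assumes "homog d p" "\<And>v. homog 1 (h v)" shows "homog d (psubst h p)"
proof -
  have hmon: "homog (mdeg e) (psubst h (Poly_Mapping.single e 1))" for e
  proof (induction e rule: poly_mapping_nat_induct)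
    case zero
    then show ?case by simp
  next
    case (add e v)
    then show ?case using homog_mult [OF add assms(2) [of v]] by (simp add: single_add_Suc_0 mdeg_add)
  qed
  show ?thesis using assms(1)
  proof (induction rule: homog_induct)
    case (mon e a)
    have "psubst h (Poly_Mapping.single e a) = poly_const a * psubst h (Poly_Mapping.single e 1)"
      by (subst single_eq_const_mult) simp
    then show ?case using mon hmon [of e] homog_const_mult by metis
  qed (auto intro: homog_add)
qed

subsection \<open>Linear forms\<close>

lemma homog_1_induct [consumes 1, case_names zero add var]:
  assumes "homog (Suc 0) p" "P 0" "\<And>p q. P p \<Longrightarrow> P q \<Longrightarrow> P (p + q)" "\<And>a v. P (poly_const a * pvar v)"
  shows "P p"
  using assms(1)
proof (induction rule: homog_induct)
  case (mon e a)
  have "\<exists>v. e = Poly_Mapping.single v 1"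
    using mon
  proof (induction e rule: poly_mapping_nat_induct)
    case (add e v)
    then have "e = 0" by (simp add: mdeg_add mdeg_eq_0)
    then show ?case by auto
  qed auto
  then obtain v where "e = Poly_Mapping.single v 1" ..
  then have "Poly_Mapping.single e a = poly_const a * pvar v"
    by (simp add: poly_const_def pvar_def mult_single)
  then show ?case using assms(4) by metis
qed (use assms in auto)

text \<open>Substitution is a ring homomorphism, hence the identity modulo \<open>l\<close> as soon
  as it is so on the variables. For the action of a reflection this gives divisibility of
  \<open>p - act s p\<close> by its form.\<close>

lemma dvd_diff_psubst:
  assumes "\<And>v. l dvd pvar v - h v"
  shows "l dvd p - psubst h p"
proof (induction p rule: mpoly_induct)
  case (add p q)
  have "p + q - psubst h (p + q) = (p - psubst h p) + (q - psubst h q)" by simp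
  then show ?case using add by (metis dvd_add)
next
  case (mult p q)
  have "p * q - psubst h (p * q) = (p - psubst h p) * q + psubst h p * (q - psubst h q)"
    by (simp add: algebra_simps)
  then show ?case using mult by (metis dvd_add dvd_mult dvd_mult2)
qed (use assms in auto)

lemma linear_form_pd_const: "homog (Suc 0) l \<Longrightarrow> \<exists>c. pd v l = poly_const c"
  using homog_pd homog_zero_const by fastforce

lemma linear_form_ex_pd:
  fixes l :: "('v, 'k::field_char_0) mpoly"
  assumes "homog (Suc 0) l" "l \<noteq> 0" shows "\<exists>v. pd v l \<noteq> 0"
proof (rule ccontr)
  assume "\<not> ?thesis"
  moreover obtain F where "finite F" "l \<in> PV F" using ex_finite_PV by blast
  ultimately show False using euler_identity [OF assms(1), of F] assms(2) by simp
qed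

text \<open>Some derivative of \<open>l\<close> is a nonzero constant, so \<open>l = 0\<close> can
  be solved for that variable. Divisibility by \<open>l\<close> is then the kernel of a substitution
  into a ring without zero divisors, which makes \<open>l\<close> prime.\<close>

lemma linear_form_elim:
  fixes l :: "('v, 'k::field_char_0) mpoly"
  assumes "homog (Suc 0) l" "l \<noteq> 0"
  shows "\<exists>h :: 'v \<Rightarrow> ('v, 'k) mpoly. \<forall>p. l dvd p \<longleftrightarrow> psubst h p = 0"
proof -
  obtain v where v: "pd v l \<noteq> 0" using linear_form_ex_pd [OF assms] by blast
  obtain c where c: "pd v l = poly_const c" using linear_form_pd_const [OF assms(1)] by blast
  \<comment> \<open>Subtracting \<open>l / c\<close> from \<open>v\<close> changes \<open>l\<close>
    by \<open>- l\<close>, since \<open>l\<close> has slope \<open>c\<close> in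
    \<open>v\<close>.\<close>
  define h where "h = pvar(v := pvar v - poly_const (1 / c) * l)"
  have c0: "c \<noteq> 0" using v c by auto
  have "psubst (pvar(v := pvar v + t)) m = m + pd v m * t" if "homog (Suc 0) m"
    for t m :: "('v, 'k) mpoly"
    using that by (induction rule: homog_1_induct) (auto simp: algebra_simps)
  from this [OF assms(1), of "- (poly_const (1 / c) * l)"]
  have "psubst h l = l - poly_const c * (poly_const (1 / c) * l)"
    by (simp add: h_def c)
  also have "\<dots> = 0"
    using c0 by (simp add: mult.assoc [symmetric] poly_const_mult [symmetric])
  finally have 0: "psubst h l = 0" .
  have d: "l dvd p - psubst h p" for p
    by (rule dvd_diff_psubst) (auto simp: h_def)
  have "l dvd p \<longleftrightarrow> psubst h p = 0" for p
  proof
    assume "l dvd p"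
    then show "psubst h p = 0" using 0 by (auto simp: dvd_def)
  next
    assume "psubst h p = 0"
    then show "l dvd p" using d [of p] by simp
  qed
  then show ?thesis by blast
qed

lemma linear_form_prime:
  fixes l :: "('v, 'k::field_char_0) mpoly"
  assumes "homog (Suc 0) l" "l \<noteq> 0" "l dvd p * q"
  shows "l dvd p \<or> l dvd q"
proof -
  obtain h :: "'v \<Rightarrow> ('v, 'k) mpoly" where "\<forall>p. l dvd p \<longleftrightarrow> psubst h p = 0"
    using linear_form_elim [OF assms(1,2)] by blast
  then show ?thesis using assms(3) by simp
qed

lemma linear_form_not_dvd_const:
  fixes l :: "('v, 'k::field_char_0) mpoly"
  assumes "homog (Suc 0) l" "l \<noteq> 0" shows "l dvd poly_const c \<longleftrightarrow> c = 0"
proof -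
  obtain h :: "'v \<Rightarrow> ('v, 'k) mpoly" where "\<forall>p. l dvd p \<longleftrightarrow> psubst h p = 0"
    using linear_form_elim [OF assms(1,2)] by blast
  then show ?thesis by simp
qed

lemma linear_form_prime_prod:
  fixes l :: "('v, 'k::field_char_0) mpoly"
  assumes "homog (Suc 0) l" "l \<noteq> 0" "finite I" "l dvd prod f I"
  shows "\<exists>i\<in>I. l dvd f i"
  using assms(3,4)
proof (induction I)
  case empty
  then show ?case using linear_form_not_dvd_const [OF assms(1,2), of 1] by simp
next
  case (insert i I)
  then show ?case using linear_form_prime [OF assms(1,2)] by fastforce
qed

lemma linear_form_prime_power:
  fixes l :: "('v, 'k::field_char_0) mpoly"
  assumes l: "homog (Suc 0) l" "l \<noteq> 0" and "l ^ n dvd q * p" "\<not> l dvd q"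
  shows "l ^ n dvd p"
  using assms(3)
proof (induction n arbitrary: p)
  case (Suc n)
  have "l dvd q * p" using Suc.prems dvd_mult_left by (metis power_Suc)
  then have "l dvd p" using linear_form_prime [OF l] assms(4) by blast
  then obtain r where r: "p = l * r" by (auto simp: dvd_def)
  have "l * l ^ n dvd l * (q * r)" using Suc.prems r by (simp add: algebra_simps)
  then have "l ^ n dvd q * r" using l(2) by (simp add: mpoly_dvd_cancel)
  then have "l ^ n dvd r" by (rule Suc.IH)
  then show ?case unfolding r power_Suc by (rule mult_dvd_mono [OF dvd_refl])
qed simp

lemma linear_forms_prod_dvd:
  fixes l :: "'i \<Rightarrow> ('v, 'k::field_char_0) mpoly"
  assumes "finite I" "\<And>i. i \<in> I \<Longrightarrow> homog (Suc 0) (l i) \<and> l i \<noteq> 0"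
    and "\<And>i j. i \<in> I \<Longrightarrow> j \<in> I \<Longrightarrow> i \<noteq> j \<Longrightarrow> \<not> l i dvd l j"
    and "\<And>i. i \<in> I \<Longrightarrow> l i ^ n i dvd y"
  shows "(\<Prod>i\<in>I. l i ^ n i) dvd y"
  using assms
proof (induction I)
  case (insert i I)
  then obtain z where z: "y = (\<Prod>i\<in>I. l i ^ n i) * z" by (auto simp: dvd_def)
  have l: "homog (Suc 0) (l i)" "l i \<noteq> 0" using insert.prems by auto
  have "\<not> l i dvd (\<Prod>i\<in>I. l i ^ n i)"
  proof
    assume "l i dvd (\<Prod>i\<in>I. l i ^ n i)"
    then obtain j where j: "j \<in> I" "l i dvd l j ^ n j"
      using linear_form_prime_prod [OF l insert.hyps(1)] by blast
    then have "l i dvd (\<Prod>_\<in>{..<n j}. l j)" by simp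
    then have "l i dvd l j" using linear_form_prime_prod [OF l, of "{..<n j}" "\<lambda>_. l j"] by blast
    then show False using insert.prems(2) [of i j] insert.hyps j by auto
  qed
  moreover have "l i ^ n i dvd (\<Prod>i\<in>I. l i ^ n i) * z" using insert.prems(3) z by auto
  ultimately have "l i ^ n i dvd z" using linear_form_prime_power [OF l] by blast
  then have "l i ^ n i * (\<Prod>i\<in>I. l i ^ n i) dvd z * (\<Prod>i\<in>I. l i ^ n i)"
    by (rule mult_dvd_mono [OF _ dvd_refl])
  then show ?case using insert.hyps z by (simp add: mult.commute)
qed simp

text \<open>Exact quotient; an arbitrary value when \<open>a\<close> does not divide
  \<open>y\<close>.\<close>

definition quo :: "('v, 'k::comm_ring_1) mpoly \<Rightarrow> ('v, 'k) mpoly \<Rightarrow> ('v, 'k) mpoly" where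
  "quo a y = (SOME z. y = a * z)"

lemma quo: "a dvd y \<Longrightarrow> a * quo a y = y"
  unfolding quo_def dvd_def by (metis (mono_tags, lifting) someI_ex)

section \<open>A finite reflection group acting on polynomials\<close>

text \<open>Variables outside \<open>B\<close> are allowed and the group acts trivially on them, so that the coefficient ring
  is a whole type.\<close>

locale reflection_action = group G
  for G :: "('w, 'x) monoid_scheme" (structure) +
  fixes B :: "'v set"
    and hh :: "'w \<Rightarrow> 'v \<Rightarrow> ('v, 'k::field_char_0) mpoly"
    and Rf :: "'w set"
    and al :: "'w \<Rightarrow> ('v, 'k) mpoly"
  assumes fin_G: "finite (carrier G)"
    and fin_B: "finite B"
    and hh_homog: "homog (Suc 0) (hh g v)"
    and hh_PV: "b \<in> B \<Longrightarrow> hh g b \<in> PV B"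
    and hh_out: "v \<notin> B \<Longrightarrow> hh g v = pvar v"
    and hh_one: "hh \<one> v = pvar v"
    and hh_mult: "g \<in> carrier G \<Longrightarrow> h \<in> carrier G \<Longrightarrow> hh (g \<otimes> h) v = psubst (hh g) (hh h v)"
    and Rf_sub: "Rf \<subseteq> carrier G"
    and Rf_square: "s \<in> Rf \<Longrightarrow> s \<otimes> s = \<one>"
    and al_homog: "s \<in> Rf \<Longrightarrow> homog (Suc 0) (al s)"
    and al_nz: "s \<in> Rf \<Longrightarrow> al s \<noteq> 0"
    and al_PV: "s \<in> Rf \<Longrightarrow> al s \<in> PV B"
    and al_dvd_var: "s \<in> Rf \<Longrightarrow> al s dvd pvar v - hh s v"
    and al_neg: "s \<in> Rf \<Longrightarrow> psubst (hh s) (al s) = - al s"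
    and al_distinct: "s \<in> Rf \<Longrightarrow> t \<in> Rf \<Longrightarrow> s \<noteq> t \<Longrightarrow> \<not> al s dvd al t"
    and Rf_conj: "g \<in> carrier G \<Longrightarrow> s \<in> Rf \<Longrightarrow> g \<otimes> s \<otimes> inv g \<in> Rf"
    and al_conj: "g \<in> carrier G \<Longrightarrow> s \<in> Rf \<Longrightarrow>
      \<exists>u. u \<noteq> 0 \<and> psubst (hh g) (al s) = poly_const u * al (g \<otimes> s \<otimes> inv g)"
    and Rf_generate: "generate G Rf = carrier G"
    and non_reflection: "g \<in> carrier G \<Longrightarrow> g \<noteq> \<one> \<Longrightarrow> g \<notin> Rf \<Longrightarrow>
      \<exists>v w. hh g v \<noteq> pvar v \<and> hh g w \<noteq> pvar w \<and> \<not> (pvar v - hh g v) dvd (pvar w - hh g w)"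
begin

abbreviation W where "W \<equiv> carrier G"

abbreviation act :: "'w \<Rightarrow> ('v, 'k) mpoly \<Rightarrow> ('v, 'k) mpoly" where
  "act g \<equiv> psubst (hh g)"

lemma act_one [simp]: "act \<one> p = p"
  by (rule psubst_id_PV [of _ UNIV]) (simp_all add: hh_one)

lemma act_act: "g \<in> W \<Longrightarrow> h \<in> W \<Longrightarrow> act g (act h p) = act (g \<otimes> h) p"
proof -
  assume "g \<in> W" "h \<in> W"
  then have "hh (g \<otimes> h) = (\<lambda>v. act g (hh h v))" by (simp add: hh_mult fun_eq_iff)
  then show ?thesis by (simp add: psubst_psubst)
qed

lemma act_inv [simp]: "g \<in> W \<Longrightarrow> act (inv g) (act g p) = p" "g \<in> W \<Longrightarrow> act g (act (inv g) p) = p"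
  by (simp_all add: act_act)

lemma act_eq_0 [simp]: "g \<in> W \<Longrightarrow> act g p = 0 \<longleftrightarrow> p = 0"
  by (metis act_inv(1) psubst_simps(3))

lemma act_dvd: "a dvd b \<Longrightarrow> act g a dvd act g b"
  by (auto simp: dvd_def)

lemma act_homog: "homog d p \<Longrightarrow> homog d (act g p)"
  by (rule psubst_homog) (simp_all add: hh_homog)

lemma fin_Rf: "finite Rf" using Rf_sub fin_G finite_subset by blast

lemma Rf_carrier [simp]: "s \<in> Rf \<Longrightarrow> s \<in> W" using Rf_sub by blast

lemma Rf_inv: "s \<in> Rf \<Longrightarrow> inv s = s"
  by (metis Rf_square Rf_carrier inv_equality)

lemma Rf_cancel [simp]: "s \<in> Rf \<Longrightarrow> w \<in> W \<Longrightarrow> s \<otimes> (s \<otimes> w) = w"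
  by (metis Rf_square Rf_carrier m_assoc l_one)

lemma Rf_act_act [simp]: "s \<in> Rf \<Longrightarrow> act s (act s p) = p"
  by (simp add: act_act Rf_square)

lemma Rf_not_one: "s \<in> Rf \<Longrightarrow> s \<noteq> \<one>"
proof
  assume s: "s \<in> Rf" "s = \<one>"
  then have "al s = - al s" using al_neg by fastforce
  then have "2 * al s = 0" by (metis mult_2 add.right_inverse)
  then have "(2 :: ('v, 'k) mpoly) = 0" using al_nz s by simp
  moreover have "(2 :: ('v, 'k) mpoly) = poly_const 2"
    by (simp only: one_add_one [symmetric] poly_const_add poly_const_simps)
  ultimately show False by (metis poly_const_eq_0 zero_neq_numeral)
qed

lemma Rf_mult_neq: "s \<in> Rf \<Longrightarrow> w \<in> W \<Longrightarrow> s \<otimes> w \<noteq> w"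
  using Rf_not_one Rf_carrier by (metis one_closed r_cancel l_one)

lemma al_dvd_act: "s \<in> Rf \<Longrightarrow> al s dvd p - act s p"
  by (rule dvd_diff_psubst) (simp add: al_dvd_var)

lemma conj_move:
  assumes "g \<in> W" "s \<in> Rf" "w \<in> W"
  shows "inv g \<otimes> (s \<otimes> w) = (inv g \<otimes> s \<otimes> g) \<otimes> (inv g \<otimes> w)"
  using assms by (simp add: m_assoc) (simp add: m_assoc [symmetric])

lemma Rf_conj': "g \<in> W \<Longrightarrow> s \<in> Rf \<Longrightarrow> inv g \<otimes> s \<otimes> g \<in> Rf"
  using Rf_conj [of "inv g" s] by simp

lemma al_conj':
  assumes "g \<in> W" "s \<in> Rf"
  shows "\<exists>u. u \<noteq> 0 \<and> act g (al (inv g \<otimes> s \<otimes> g)) = poly_const u * al s"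
proof -
  have "g \<otimes> (inv g \<otimes> s \<otimes> g) \<otimes> inv g = s"
    using assms by (simp add: m_assoc) (simp add: m_assoc [symmetric])
  then show ?thesis using al_conj [OF assms(1) Rf_conj' [OF assms]] by simp
qed

lemma unit_dvd_iff: "u \<noteq> 0 \<Longrightarrow> poly_const (u::'k) * a dvd (b :: ('v, 'k) mpoly) \<longleftrightarrow> a dvd b"
proof -
  assume u: "u \<noteq> 0"
  have "a = poly_const (1/u) * (poly_const u * a)"
    using u by (simp add: mult.assoc [symmetric] poly_const_mult [symmetric])
  then show ?thesis by (metis dvd_mult2 dvd_mult_right dvd_trans dvd_triv_right)
qed

section \<open>Quasi-covariants, the group acting on them, and divided differences\<close>

definition conj_inv :: "('w \<Rightarrow> nat) \<Rightarrow> bool" where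
  "conj_inv m \<longleftrightarrow> (\<forall>g\<in>W. \<forall>s\<in>Rf. m (g \<otimes> s \<otimes> inv g) = m s)"

text \<open>Quasi-covariants over the full polynomial type, with exponents indexed by reflections
  instead of hyperplanes. Values off \<open>W\<close> are free, and elements are compared on
  \<open>W\<close>.\<close>

definition QC :: "('w \<Rightarrow> nat) \<Rightarrow> ('w \<Rightarrow> ('v, 'k) mpoly) set" where
  "QC m = {p. \<forall>s\<in>Rf. \<forall>w\<in>W. al s ^ m s dvd p w - p (s \<otimes> w)}"

text \<open>The twisted action of \<open>W\<close> on families: translate the index and transform
  the entry. It respects the congruences because conjugation carries \<open>al s\<close> to a
  multiple of the conjugate form.\<close>

definition sig :: "'w \<Rightarrow> ('w \<Rightarrow> ('v, 'k) mpoly) \<Rightarrow> 'w \<Rightarrow> ('v, 'k) mpoly" where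
  "sig g p w = act g (p (inv g \<otimes> w))"

lemma QC_D: "p \<in> QC m \<Longrightarrow> s \<in> Rf \<Longrightarrow> w \<in> W \<Longrightarrow> al s ^ m s dvd p w - p (s \<otimes> w)"
  by (simp add: QC_def)

lemma QC_add: "p \<in> QC m \<Longrightarrow> q \<in> QC m \<Longrightarrow> (\<lambda>w. p w + q w) \<in> QC m"
  unfolding QC_def by clarify (metis add_diff_add dvd_add)

lemma QC_cmult: "p \<in> QC m \<Longrightarrow> (\<lambda>w. a * p w) \<in> QC m"
  unfolding QC_def by (auto simp: right_diff_distrib [symmetric])

lemma QC_zero: "(\<lambda>w. 0) \<in> QC m" by (simp add: QC_def)

lemma QC_sum: "(\<And>i. i \<in> I \<Longrightarrow> p i \<in> QC m) \<Longrightarrow> (\<lambda>w. \<Sum>i\<in>I. p i w) \<in> QC m"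
  by (induction I rule: infinite_finite_induct) (auto intro: QC_add QC_zero)

lemma QC_diff: "p \<in> QC m \<Longrightarrow> q \<in> QC m \<Longrightarrow> (\<lambda>w. p w - q w) \<in> QC m"
  using QC_add [OF _ QC_cmult [of q m "-1"]] by auto

lemma QC_sig:
  assumes "conj_inv m" "p \<in> QC m" "g \<in> W"
  shows "sig g p \<in> QC m"
  unfolding QC_def
proof clarify
  fix s w assume s: "s \<in> Rf" and w: "w \<in> W"
  let ?s = "inv g \<otimes> s \<otimes> g"
  obtain u where u: "u \<noteq> 0" "act g (al ?s) = poly_const u * al s"
    using al_conj' assms(3) s by blast
  have m: "m ?s = m s" using assms(1) inv_closed [OF assms(3)] s assms(3) unfolding conj_inv_def by (metis inv_inv)
  have "al ?s ^ m ?s dvd p (inv g \<otimes> w) - p (?s \<otimes> (inv g \<otimes> w))"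
    by (rule QC_D [OF assms(2) Rf_conj' [OF assms(3) s]]) (use w assms(3) in auto)
  from act_dvd [OF this, of g]
  have "act g (al ?s ^ m s) dvd sig g p w - sig g p (s \<otimes> w)"
    by (simp only: sig_def conj_move [OF assms(3) s w] m psubst_simps)
  also have "act g (al ?s ^ m s) = poly_const (u ^ m s) * al s ^ m s"
  proof -
    interpret comm_ring_hom "poly_const :: 'k \<Rightarrow> ('v, 'k) mpoly" by (rule poly_const_hom)
    show ?thesis by (simp add: u power_mult_distrib hom_power)
  qed
  finally show "al s ^ m s dvd sig g p w - sig g p (s \<otimes> w)"
    using u(1) by (simp add: unit_dvd_iff)
qed

lemma sig_sig:
  assumes "g \<in> W" "h \<in> W" "w \<in> W"
  shows "sig g (sig h p) w = sig (g \<otimes> h) p w"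
  using assms by (simp add: sig_def act_act inv_mult_group m_assoc)

text \<open>The divided difference \<open>(1 - s) / al s\<close> for the action
  \<open>sig\<close>.\<close>

definition rr :: "'w \<Rightarrow> ('w \<Rightarrow> ('v, 'k) mpoly) \<Rightarrow> 'w \<Rightarrow> ('v, 'k) mpoly" where
  "rr s p w = quo (al s) (p w - sig s p w)"

lemma sig_refl: "s \<in> Rf \<Longrightarrow> sig s p w = act s (p (s \<otimes> w))"
  by (simp add: sig_def Rf_inv)

text \<open>Pass through the value \<open>p (s \<otimes> w)\<close>: the first difference is
  divisible by quasi-covariance, the second because \<open>act s\<close> is the identity modulo
  \<open>al s\<close>.\<close>

lemma rr_dvd:
  assumes "p \<in> QC m" "s \<in> Rf" "m s > 0" "w \<in> W"
  shows "al s dvd p w - sig s p w"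
proof -
  have "al s dvd p w - p (s \<otimes> w)"
    using QC_D [OF assms(1,2,4)] assms(3) by (metis dvd_power dvd_trans)
  moreover have "al s dvd p (s \<otimes> w) - act s (p (s \<otimes> w))" by (rule al_dvd_act [OF assms(2)])
  ultimately have "al s dvd (p w - p (s \<otimes> w)) + (p (s \<otimes> w) - act s (p (s \<otimes> w)))" by (rule dvd_add)
  then show ?thesis using assms(2) by (simp add: sig_refl)
qed

lemma rr:
  assumes "p \<in> QC m" "s \<in> Rf" "m s > 0" "w \<in> W"
  shows "al s * rr s p w = p w - sig s p w"
  unfolding rr_def by (rule quo [OF rr_dvd [OF assms]])

text \<open>The form \<open>al t\<close> is a prime not dividing \<open>al s\<close>, so its full
  power in the jump survives division by \<open>al s\<close>.\<close>

lemma rr_other: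
  assumes m: "conj_inv m" and p: "p \<in> QC m" and s: "s \<in> Rf" and ms: "m s > 0"
    and t: "t \<in> Rf" "s \<noteq> t" and w: "w \<in> W"
  shows "al t ^ m t dvd rr s p w - rr s p (t \<otimes> w)"
proof -
  have "(\<lambda>w. p w - sig s p w) \<in> QC m" using QC_diff [OF p QC_sig [OF m p]] s by simp
  then have "al t ^ m t dvd (p w - sig s p w) - (p (t \<otimes> w) - sig s p (t \<otimes> w))"
    by (rule QC_D) (use t w in auto)
  also have "\<dots> = al s * (rr s p w - rr s p (t \<otimes> w))"
    using t w by (simp add: rr [OF p s ms] right_diff_distrib)
  finally show ?thesis
    by (rule linear_form_prime_power [OF al_homog [OF t(1)] al_nz [OF t(1)]])
      (use al_distinct [OF t(1) s] t(2) in simp)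
qed

text \<open>The right side is \<open>1 + act s\<close> applied to the jump of \<open>p\<close>
  across \<open>s\<close>. With the jump written as \<open>al s ^ m s * u\<close>, this is the power
  times \<open>u + act s u\<close> for even \<open>m s\<close> and times \<open>u - act s u\<close>
  for odd \<open>m s\<close>; here the two cases part.\<close>

lemma rr_same:
  assumes p: "p \<in> QC m" and s: "s \<in> Rf" and ms: "m s > 0" and w: "w \<in> W"
  shows "al s * (rr s p w - rr s p (s \<otimes> w)) = (p w - p (s \<otimes> w)) + act s (p w - p (s \<otimes> w))"
  using s w by (simp add: right_diff_distrib rr [OF p s ms] sig_refl)

subsection \<open>Dunkl operators\<close>

text \<open>The coefficient is half of the exponent \<open>2 * k\<close> in the congruences: with
  this value the reflection term restores the power of the form lost by differentiation.\<close>

definition dunkl :: "('w \<Rightarrow> nat) \<Rightarrow> 'v \<Rightarrow> ('w \<Rightarrow> ('v, 'k) mpoly) \<Rightarrow> 'w \<Rightarrow> ('v, 'k) mpoly" where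
  "dunkl k b p w = pd b (p w) - (\<Sum>s\<in>Rf. of_nat (k s) * (pd b (al s) * rr s p w))"

text \<open>Only the summand of \<open>t\<close> itself endangers the congruence for
  \<open>t\<close>; the others fall under \<open>rr_other\<close>. Differentiating a jump
  \<open>a ^ (2 * k t) * u\<close> leaves a term with \<open>2 * k t * a ^ (2 * k t - 1)\<close>,
  and the summand of \<open>t\<close> cancels it modulo \<open>a ^ (2 * k t)\<close>.\<close>

lemma dunkl_QC:
  assumes k: "conj_inv k" and p: "p \<in> QC (\<lambda>s. 2 * k s)"
  shows "dunkl k b p \<in> QC (\<lambda>s. 2 * k s)"
  unfolding QC_def
proof clarify
  fix t w assume t: "t \<in> Rf" and w: "w \<in> W"
  let ?m = "\<lambda>s. 2 * k s"
  have m: "conj_inv ?m" using k by (simp add: conj_inv_def)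
  let ?d = "\<lambda>s. of_nat (k s) * (pd b (al s) * (rr s p w - rr s p (t \<otimes> w)))"
  have "dunkl k b p w - dunkl k b p (t \<otimes> w) = pd b (p w - p (t \<otimes> w)) - (\<Sum>s\<in>Rf. ?d s)"
    by (simp add: dunkl_def right_diff_distrib sum_subtractf)
  also have "\<dots> = (pd b (p w - p (t \<otimes> w)) - ?d t) - (\<Sum>s\<in>Rf - {t}. ?d s)"
    using t by (simp add: sum.remove [OF fin_Rf t])
  finally have eq: "dunkl k b p w - dunkl k b p (t \<otimes> w) =
      (pd b (p w - p (t \<otimes> w)) - ?d t) - (\<Sum>s\<in>Rf - {t}. ?d s)" .
  have "al t ^ ?m t dvd ?d s" if "s \<in> Rf - {t}" for s
  proof (cases "k s = 0")
    case False
    then have "al t ^ ?m t dvd rr s p w - rr s p (t \<otimes> w)"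
      using that t w by (intro rr_other [OF m p]) auto
    then show ?thesis by (intro dvd_mult) auto
  qed auto
  then have 1: "al t ^ ?m t dvd (\<Sum>s\<in>Rf - {t}. ?d s)" by (rule dvd_sum)
  have 2: "al t ^ ?m t dvd pd b (p w - p (t \<otimes> w)) - ?d t"
  proof (cases "k t")
    case (Suc j)
    define a where "a = al t"
    obtain u where u: "p w - p (t \<otimes> w) = a ^ (2 * Suc j) * u"
      using QC_D [OF p t w] Suc by (auto simp: a_def dvd_def)
    have neg: "act t a = - a" using al_neg t by (simp add: a_def)
    obtain z where z: "u - act t u = a * z" using al_dvd_act [OF t, of u] by (auto simp: a_def dvd_def)
    have "a * (rr t p w - rr t p (t \<otimes> w)) = a ^ (2 * Suc j) * u + act t (a ^ (2 * Suc j) * u)"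
      using rr_same [OF p t _ w] Suc u by (simp add: a_def)
    also have "\<dots> = a ^ (2 * Suc j) * (u + act t u)" by (simp add: neg algebra_simps)
    also have "u + act t u = 2 * u - a * z" using z by (simp add: algebra_simps)
    also have "a ^ (2 * Suc j) * (2 * u - a * z) = a * (a ^ (2 * j + 1) * (2 * u - a * z))" by simp
    finally have r: "rr t p w - rr t p (t \<otimes> w) = a ^ (2 * j + 1) * (2 * u - a * z)"
      using al_nz [OF t] unfolding a_def mpoly_mult_cancel by blast
    define x where "x = a ^ (2 * j + 1)"
    define c :: "('v, 'k) mpoly" where "c = of_nat (Suc j)"
    have x: "a ^ (2 * Suc j) = a * x" by (simp add: x_def)
    have "pd b (a * x) = of_nat (2 * Suc j) * x * pd b a"
      using pd_power_Suc [of b a "2 * j + 1"] by (simp add: x_def)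
    then have "pd b (a * x * u) = 2 * c * x * pd b a * u + a * x * pd b u"
      by (simp only: pd_simps(8) [of b "a * x" u] of_nat_mult of_nat_numeral c_def)
    then have "pd b (p w - p (t \<otimes> w)) - ?d t = a ^ (2 * Suc j) * (pd b u + c * (pd b a * z))"
      unfolding u r Suc x x_def [symmetric] a_def [symmetric] c_def [symmetric]
      by (simp only:) (simp add: algebra_simps)
    then show ?thesis by (simp add: Suc a_def)
  qed simp
  show "al t ^ ?m t dvd dunkl k b p w - dunkl k b p (t \<otimes> w)"
    unfolding eq by (rule dvd_diff [OF 2 1])
qed

lemma rr_homog:
  assumes p: "p \<in> QC m" and s: "s \<in> Rf" and ms: "m s > 0" and w: "w \<in> W"
    and h: "\<And>w. w \<in> W \<Longrightarrow> homog d (p w)"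
  shows "homog (d - 1) (rr s p w)" "d = 0 \<Longrightarrow> rr s p w = 0"
proof -
  have "homog d (p w - sig s p w)"
    using h s w by (auto simp: sig_refl intro!: homog_diff act_homog)
  then have 1: "homog d (al s * rr s p w)" using rr [OF p s ms w] by simp
  show 0: "rr s p w = 0" if "d = 0"
  proof -
    have "hc 0 (al s * rr s p w) = al s * rr s p w" using 1 that hc_homog by fastforce
    moreover have "hc 0 (al s * rr s p w) = 0"
      using hc_homog_mult [OF al_homog [OF s]] by simp
    ultimately show ?thesis using al_nz [OF s] by simp
  qed
  show "homog (d - 1) (rr s p w)"
  proof (cases "d = 0")
    case False
    then show ?thesis
      using homog_cancel [OF al_homog [OF s], of "d - 1" "rr s p w"] 1 al_nz [OF s] by simp
  qed (simp add: 0)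
qed

text \<open>Degree 0 is stated separately because \<open>d - 1\<close> is truncated. That the
  operator vanishes there settles the bottom of the minimal-degree argument in
  \<open>indicator_constU\<close>.\<close>

lemma dunkl_homog:
  assumes p: "p \<in> QC (\<lambda>s. 2 * k s)" and w: "w \<in> W"
    and h: "\<And>w. w \<in> W \<Longrightarrow> homog d (p w)"
  shows "homog (d - 1) (dunkl k b p w)" "d = 0 \<Longrightarrow> dunkl k b p w = 0"
proof -
  have c: "homog 0 (pd b (al s))" if "s \<in> Rf" for s
    using homog_pd [OF al_homog [OF that]] by simp
  have "homog (d - 1) (of_nat (k s) * (pd b (al s) * rr s p w))" if s: "s \<in> Rf" for s
  proof (cases "k s = 0")
    case False
    then have "homog (d - 1) (pd b (al s) * rr s p w)"
      using homog_mult [OF c [OF s] rr_homog(1) [OF p s _ w h]] by simp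
    then show ?thesis
      using homog_const_mult [of "d - 1" _ "of_nat (k s) :: 'k"] by (simp add: poly_const_of_nat)
  qed simp
  then show "homog (d - 1) (dunkl k b p w)"
    unfolding dunkl_def using h w by (intro homog_diff homog_sum homog_pd) auto
  assume "d = 0"
  then have "rr s p w = 0" if "s \<in> Rf" "k s > 0" for s
    using rr_homog(2) [OF p _ _ w h] that by simp
  then have "of_nat (k s) * (pd b (al s) * rr s p w) = 0" if "s \<in> Rf" for s
    using that by (cases "k s") auto
  then have "(\<Sum>s\<in>Rf. of_nat (k s) * (pd b (al s) * rr s p w)) = 0" by (rule sum.neutral [OF ballI])
  then show "dunkl k b p w = 0"
    unfolding dunkl_def using h [OF w] \<open>d = 0\<close> by (simp only: pd_homog_0 diff_self)
qed

end

section \<open>Determinants and linear dependence\<close>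

definition dt :: "nat \<Rightarrow> (nat \<Rightarrow> nat \<Rightarrow> 'a::comm_ring_1) \<Rightarrow> 'a" where
  "dt n f = det (mat n n (\<lambda>(i, j). f i j))"

lemma dt_cong: "(\<And>i j. i < n \<Longrightarrow> j < n \<Longrightarrow> f i j = g i j) \<Longrightarrow> dt n f = dt n g"
  unfolding dt_def by (rule arg_cong [where f = det]) (rule cong_mat, auto)

text \<open>The third clause is Cramer's rule: replacing column \<open>j\<close> leaves the
  cofactors along that column unchanged.\<close>

lemma dt_adjugate:
  fixes f :: "nat \<Rightarrow> nat \<Rightarrow> 'a::comm_ring_1"
  shows "\<exists>a. (\<forall>i<n. \<forall>i'<n. (\<Sum>j<n. f i j * a j i') = (if i = i' then dt n f else 0)) \<and>
    (\<forall>j<n. \<forall>j'<n. (\<Sum>i<n. a j i * f i j') = (if j = j' then dt n f else 0)) \<and>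
    (\<forall>j<n. \<forall>b. (\<Sum>i<n. a j i * b i) = dt n (\<lambda>i j'. if j' = j then b i else f i j'))"
proof -
  define A where "A = mat n n (\<lambda>(i, j). f i j)"
  have A: "A \<in> carrier_mat n n" by (simp add: A_def)
  note adj = adj_mat [OF A]
  define a where "a = (\<lambda>j i. adj_mat A $$ (j, i))"
  have "(\<Sum>j<n. f i j * a j i') = (if i = i' then dt n f else 0)" if "i < n" "i' < n" for i i'
  proof -
    have "(A * adj_mat A) $$ (i, i') = (\<Sum>j<n. f i j * a j i')"
      using that adj(1) by (simp add: A_def a_def scalar_prod_def atLeast0LessThan)
    then show ?thesis unfolding adj(2) using that by (auto simp: dt_def A_def split: if_splits)
  qed
  moreover have "(\<Sum>i<n. a j i * f i j') = (if j = j' then dt n f else 0)" if "j < n" "j' < n" for j j'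
  proof -
    have "(adj_mat A * A) $$ (j, j') = (\<Sum>i<n. a j i * f i j')"
      using that adj(1) by (simp add: A_def a_def scalar_prod_def atLeast0LessThan)
    then show ?thesis unfolding adj(3) using that by (auto simp: dt_def A_def split: if_splits)
  qed
  moreover have "(\<Sum>i<n. a j i * b i) = dt n (\<lambda>i j'. if j' = j then b i else f i j')" if "j < n" for j b
  proof -
    define A' where "A' = mat n n (\<lambda>(i, j'). if j' = j then b i else f i j')"
    have A': "A' \<in> carrier_mat n n" by (simp add: A'_def)
    have "cofactor A' i j = cofactor A i j" if "i < n" for i
    proof -
      have "mat_delete A' i j = mat_delete A i j"
        by (rule eq_matI) (auto simp: mat_delete_def A_def A'_def)
      then show ?thesis by (simp add: cofactor_def)
    qed
    then have "det A' = (\<Sum>i<n. b i * cofactor A i j)"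
      using \<open>j < n\<close> laplace_expansion_column [OF A' \<open>j < n\<close>] by (simp add: A'_def)
    also have "\<dots> = (\<Sum>i<n. a j i * b i)"
      using \<open>j < n\<close> by (intro sum.cong HOL.refl) (simp add: a_def adj_mat_def A_def mult.commute)
    finally show ?thesis by (simp add: dt_def A'_def)
  qed
  ultimately show ?thesis by (intro exI [of _ a]) simp
qed

text \<open>A means of seeing that \<open>dt n f\<close> is nonzero: exhibit a \<open>g\<close> for
  which the product of the \<open>d i\<close> does not vanish.\<close>

lemma dt_product_diagonal:
  fixes f g :: "nat \<Rightarrow> nat \<Rightarrow> 'a::comm_ring_1"
  assumes "\<And>i j. i < n \<Longrightarrow> j < n \<Longrightarrow> (\<Sum>l<n. f i l * g l j) = (if i = j then d i else 0)"
  shows "dt n f * dt n g = (\<Prod>i<n. d i)"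
proof -
  define A where "A = mat n n (\<lambda>(i, j). f i j)"
  define B where "B = mat n n (\<lambda>(i, j). g i j)"
  define D where "D = mat n n (\<lambda>(i, j). if i = j then d i else 0)"
  have "A * B = D"
    by (rule eq_matI) (auto simp: A_def B_def D_def scalar_prod_def assms atLeast0LessThan)
  then have "det A * det B = det D"
    using det_mult [of A n B] by (simp add: A_def B_def)
  also have "det D = prod_list (diag_mat D)"
    by (rule det_upper_triangular) (auto simp: D_def)
  also have "\<dots> = (\<Prod>i<n. d i)"
    by (simp add: diag_mat_def D_def prod.list_conv_set_nth atLeast0LessThan)
  finally show ?thesis by (simp add: dt_def A_def B_def)
qed

lemma dt_hom:
  assumes "comm_ring_hom h" shows "dt n (\<lambda>i j. h (f i j)) = h (dt n f)"
proof -
  interpret comm_ring_hom h by fact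
  have "mat n n (\<lambda>(i, j). h (f i j)) = map_mat h (mat n n (\<lambda>(i, j). f i j))"
    by (rule eq_matI) auto
  then show ?thesis by (simp add: dt_def)
qed

lemma dt_eq_0_kernel:
  fixes f :: "nat \<Rightarrow> nat \<Rightarrow> 'a::field"
  assumes "dt n f = 0"
  shows "\<exists>v. (\<exists>j<n. v j \<noteq> 0) \<and> (\<forall>i<n. (\<Sum>j<n. f i j * v j) = 0)"
proof -
  define A where "A = mat n n (\<lambda>(i, j). f i j)"
  have A: "A \<in> carrier_mat n n" by (simp add: A_def)
  obtain x where x: "x \<in> carrier_vec n" "x \<noteq> 0\<^sub>v n" "A *\<^sub>v x = 0\<^sub>v n"
    using assms det_0_iff_vec_prod_zero_field [OF A] by (auto simp: dt_def A_def)
  have "\<exists>j<n. x $ j \<noteq> 0" using x(1,2) by (metis carrier_vecD eq_vecI index_zero_vec)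
  moreover have "(\<Sum>j<n. f i j * x $ j) = 0" if "i < n" for i
  proof -
    have "(A *\<^sub>v x) $ i = (\<Sum>j<n. f i j * x $ j)"
      using that x(1) by (simp add: A_def scalar_prod_def atLeast0LessThan)
    then show ?thesis using x(3) that by simp
  qed
  ultimately show ?thesis by blast
qed

text \<open>Subtracting its partner from a row of \<open>T\<close> makes the row divisible by
  \<open>a\<close>. The partners lie outside \<open>T\<close>, so the operations do not interfere
  and each yields a factor.\<close>

lemma dt_paired_rows_dvd:
  fixes f :: "nat \<Rightarrow> nat \<Rightarrow> 'a::comm_ring_1"
  assumes "finite T" "T \<subseteq> {..<n}" "\<And>i. i \<in> T \<Longrightarrow> r i < n \<and> r i \<notin> T"
    and "\<And>i j. i \<in> T \<Longrightarrow> j < n \<Longrightarrow> a dvd f i j - f (r i) j"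
  shows "a ^ card T dvd dt n f"
  using assms
proof (induction T arbitrary: f)
  case (insert i T)
  have i: "i < n" "r i < n" "r i \<noteq> i" using insert.prems by auto
  have "\<exists>q. \<forall>j<n. f i j - f (r i) j = a * q j"
    using insert.prems(3) [of i] by (simp add: dvd_def) metis
  then obtain q where q: "\<And>j. j < n \<Longrightarrow> f i j - f (r i) j = a * q j" by blast
  define g where "g i' j = (if i' = i then q j else f i' j)" for i' j
  have "addrow (-1) i (r i) (mat n n (\<lambda>(i, j). f i j)) = multrow i a (mat n n (\<lambda>(i, j). g i j))"
    using q i by (intro eq_matI) (auto simp: g_def mat_addrow_def algebra_simps)
  then have "dt n f = a * dt n g"
    using det_addrow [OF i(2) i(3) [symmetric], of "mat n n (\<lambda>(i, j). f i j)" "-1"]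
      det_multrow [OF i(1), of "mat n n (\<lambda>(i, j). g i j)" a] by (simp add: dt_def)
  moreover have "a ^ card T dvd dt n g"
  proof (rule insert.IH)
    show "a dvd g i' j - g (r i') j" if "i' \<in> T" "j < n" for i' j
      using insert.prems(2,3) [of i'] that insert.hyps(2) by (auto simp: g_def)
  qed (use insert.prems in auto)
  ultimately show ?case using insert.hyps by (simp add: mult_dvd_mono)
qed simp

lemma dt_homog:
  fixes f :: "nat \<Rightarrow> nat \<Rightarrow> ('v, 'k::comm_ring_1) mpoly"
  assumes "\<And>i j. i < n \<Longrightarrow> j < n \<Longrightarrow> homog (d j) (f i j)"
  shows "homog (\<Sum>j<n. d j) (dt n f)"
proof -
  have "homog (\<Sum>j<n. d j) (signof p * (\<Prod>i = 0..<n. f i (p i)))" if p: "p permutes {0..<n}" for p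
  proof -
    have pi: "p i < n" if "i < n" for i using permutes_in_image [OF p, of i] that by simp
    have "homog (\<Sum>i = 0..<n. d (p i)) (\<Prod>i = 0..<n. f i (p i))"
      by (rule homog_prod) (simp add: assms pi)
    also have "(\<Sum>i = 0..<n. d (p i)) = (\<Sum>j<n. d j)"
      using sum.permute [OF p, of d] by (simp add: o_def atLeast0LessThan)
    finally show ?thesis by (auto simp: sign_def homog_uminus)
  qed
  moreover have "dt n f = (\<Sum>p | p permutes {0..<n}. signof p * (\<Prod>i = 0..<n. f i (p i)))"
  proof -
    have "(\<Prod>i = 0..<n. mat n n (\<lambda>(i, j). f i j) $$ (i, p i)) = (\<Prod>i = 0..<n. f i (p i))"
      if "p permutes {0..<n}" for p
      using permutes_in_image [OF that] by (intro prod.cong HOL.refl) auto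
    then show ?thesis
      unfolding dt_def det_def' [OF mat_carrier] by (intro sum.cong HOL.refl) simp
  qed
  ultimately show ?thesis by (auto intro: homog_sum)
qed

text \<open>Rings are taken as subsets of a ring type, so that a ring and its subrings share their
  operations and primes can simply be intersected with a subring. Ring records are compared with
  such subsets through \<open>ring_model\<close>.\<close>

definition sub_ring :: "'a::comm_ring_1 set \<Rightarrow> bool" where
  "sub_ring R \<longleftrightarrow> 0 \<in> R \<and> 1 \<in> R \<and> (\<forall>x\<in>R. \<forall>y\<in>R. x + y \<in> R \<and> x * y \<in> R) \<and> (\<forall>x\<in>R. - x \<in> R)"

definition ideal_in :: "'a::comm_ring_1 set \<Rightarrow> 'a set \<Rightarrow> bool" where
  "ideal_in R I \<longleftrightarrow> I \<subseteq> R \<and> 0 \<in> I \<and> (\<forall>x\<in>I. \<forall>y\<in>I. x + y \<in> I) \<and> (\<forall>r\<in>R. \<forall>x\<in>I. r * x \<in> I)"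

definition prime_in :: "'a::comm_ring_1 set \<Rightarrow> 'a set \<Rightarrow> bool" where
  "prime_in R I \<longleftrightarrow> ideal_in R I \<and> 1 \<notin> I \<and> (\<forall>x\<in>R. \<forall>y\<in>R. x * y \<in> I \<longrightarrow> x \<in> I \<or> y \<in> I)"

lemma sub_ring_add: "sub_ring R \<Longrightarrow> x \<in> R \<Longrightarrow> y \<in> R \<Longrightarrow> x + y \<in> R"
  and sub_ring_mult: "sub_ring R \<Longrightarrow> x \<in> R \<Longrightarrow> y \<in> R \<Longrightarrow> x * y \<in> R"
  and sub_ring_uminus: "sub_ring R \<Longrightarrow> x \<in> R \<Longrightarrow> - x \<in> R"
  and sub_ring_0: "sub_ring R \<Longrightarrow> 0 \<in> R"
  and sub_ring_1: "sub_ring R \<Longrightarrow> 1 \<in> R"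
  by (simp_all add: sub_ring_def)

lemma sub_ring_diff: "sub_ring R \<Longrightarrow> x \<in> R \<Longrightarrow> y \<in> R \<Longrightarrow> x - y \<in> R"
  using sub_ring_add [OF _ _ sub_ring_uminus, of R x y] by simp

lemma sub_ring_sum: "sub_ring R \<Longrightarrow> (\<And>i. i \<in> I \<Longrightarrow> f i \<in> R) \<Longrightarrow> sum f I \<in> R"
  by (induction I rule: infinite_finite_induct) (auto intro: sub_ring_add sub_ring_0)

lemma sub_ring_power: "sub_ring R \<Longrightarrow> x \<in> R \<Longrightarrow> x ^ n \<in> R"
  by (induction n) (auto intro: sub_ring_mult sub_ring_1)

lemma ideal_in_add: "ideal_in R I \<Longrightarrow> x \<in> I \<Longrightarrow> y \<in> I \<Longrightarrow> x + y \<in> I"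
  and ideal_in_mult: "ideal_in R I \<Longrightarrow> r \<in> R \<Longrightarrow> x \<in> I \<Longrightarrow> r * x \<in> I"
  and ideal_in_0: "ideal_in R I \<Longrightarrow> 0 \<in> I"
  and ideal_in_sub: "ideal_in R I \<Longrightarrow> x \<in> I \<Longrightarrow> x \<in> R"
  by (auto simp: ideal_in_def)

lemma ideal_in_sum: "ideal_in R I \<Longrightarrow> (\<And>i. i \<in> J \<Longrightarrow> f i \<in> I) \<Longrightarrow> sum f J \<in> I"
  by (induction J rule: infinite_finite_induct) (auto intro: ideal_in_add ideal_in_0)

lemma ideal_in_uminus: "sub_ring R \<Longrightarrow> ideal_in R I \<Longrightarrow> x \<in> I \<Longrightarrow> - x \<in> I"
  using ideal_in_mult [of R I "-1" x] by (simp add: sub_ring_def)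

lemma ideal_in_diff: "sub_ring R \<Longrightarrow> ideal_in R I \<Longrightarrow> x \<in> I \<Longrightarrow> y \<in> I \<Longrightarrow> x - y \<in> I"
  using ideal_in_add [OF _ _ ideal_in_uminus, of R I x R y] by simp

text \<open>Linear dependence over the domain \<open>R/q\<close>.\<close>

lemma dependent_mod_prime:
  fixes v :: "'i \<Rightarrow> 'j \<Rightarrow> 'a::comm_ring_1"
  assumes R: "sub_ring R" and q: "prime_in R q"
    and "finite J" "finite I" "card J < card I" "\<And>i j. i \<in> I \<Longrightarrow> j \<in> J \<Longrightarrow> v i j \<in> R"
  shows "\<exists>r. (\<forall>i\<in>I. r i \<in> R) \<and> (\<exists>i\<in>I. r i \<notin> q) \<and> (\<forall>j\<in>J. (\<Sum>i\<in>I. r i * v i j) \<in> q)"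
  using assms(3-)
proof (induction J arbitrary: I v)
  case empty
  then obtain i where "i \<in> I" by fastforce
  then show ?case using q R by (intro exI [of _ "\<lambda>_. 1"]) (auto simp: prime_in_def sub_ring_def)
next
  case (insert l J)
  have qi: "ideal_in R q" using q by (simp add: prime_in_def)
  show ?case
  proof (cases "\<forall>i\<in>I. v i l \<in> q")
    case True
    have "card J < card I" using insert by simp
    then obtain r where r: "\<forall>i\<in>I. r i \<in> R" "\<exists>i\<in>I. r i \<notin> q" "\<forall>j\<in>J. (\<Sum>i\<in>I. r i * v i j) \<in> q"
      using insert.IH [OF insert.prems(1), of v] insert.prems(3) by auto
    moreover have "(\<Sum>i\<in>I. r i * v i l) \<in> q"
      using True r(1) by (intro ideal_in_sum [OF qi] ideal_in_mult [OF qi]) auto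
    ultimately show ?thesis by auto
  next
    case False
    then obtain i0 where i0: "i0 \<in> I" "v i0 l \<notin> q" by blast
    let ?u = "v i0 l" and ?I = "I - {i0}"
    have vR: "v i j \<in> R" if "i \<in> I" "j \<in> insert l J" for i j using insert.prems(3) that by blast
    \<comment> \<open>Fraction-free elimination of column \<open>l\<close> with pivot
      \<open>?u\<close>, which is nonzero modulo the prime \<open>q\<close>.\<close>
    define w where "w i j = ?u * v i j - v i l * v i0 j" for i j
    have wR: "w i j \<in> R" if "i \<in> ?I" "j \<in> J" for i j
      unfolding w_def using that i0(1) by (intro sub_ring_diff [OF R] sub_ring_mult [OF R] vR) auto
    have "card J < card ?I" using insert.prems(1,2) insert.hyps i0(1) by simp
    then obtain r where r: "\<forall>i\<in>?I. r i \<in> R" "\<exists>i\<in>?I. r i \<notin> q" "\<forall>j\<in>J. (\<Sum>i\<in>?I. r i * w i j) \<in> q"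
      using insert.IH [of ?I w] insert.prems(1) wR by auto
    \<comment> \<open>The pivot row gets the coefficient that clears column \<open>l\<close>; the
      other coefficients are scaled by \<open>?u\<close>, and one outside \<open>q\<close> stays
      outside because \<open>q\<close> is prime.\<close>
    define r' where "r' i = (if i = i0 then - (\<Sum>i\<in>?I. r i * v i l) else r i * ?u)" for i
    have sum: "(\<Sum>i\<in>I. r' i * v i j) = (\<Sum>i\<in>?I. r i * w i j)" for j
    proof -
      have "(\<Sum>i\<in>I. r' i * v i j) = r' i0 * v i0 j + (\<Sum>i\<in>?I. r' i * v i j)"
        by (rule sum.remove [OF insert.prems(1) i0(1)])
      also have "(\<Sum>i\<in>?I. r' i * v i j) = (\<Sum>i\<in>?I. r i * ?u * v i j)"
        by (intro sum.cong) (auto simp: r'_def)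
      also have "r' i0 * v i0 j + \<dots> = (\<Sum>i\<in>?I. r i * w i j)"
        by (simp add: r'_def w_def right_diff_distrib sum_subtractf sum_distrib_right mult.assoc)
      finally show ?thesis .
    qed
    have "r' i \<in> R" if "i \<in> I" for i
      unfolding r'_def using r(1) vR that i0(1)
      by (auto intro!: sub_ring_uminus [OF R] sub_ring_sum [OF R] sub_ring_mult [OF R])
    moreover have "\<exists>i\<in>I. r' i \<notin> q"
    proof -
      obtain i where i: "i \<in> ?I" "r i \<notin> q" using r(2) by blast
      then have "r i * ?u \<notin> q" using q r(1) vR [of i0 l] i0 unfolding prime_in_def by blast
      then show ?thesis using i by (intro bexI [of _ i]) (auto simp: r'_def)
    qed
    moreover have "(\<Sum>i\<in>I. r' i * v i l) \<in> q"
      unfolding sum w_def by (simp add: mult.commute ideal_in_0 [OF qi])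
    ultimately show ?thesis using r(3) by (intro exI [of _ r']) (simp add: sum)
  qed
qed

lemma mpoly_dependent:
  fixes v :: "'i \<Rightarrow> 'j \<Rightarrow> ('v, 'k::field) mpoly"
  assumes "finite J" "finite I" "card J < card I"
  shows "\<exists>r. (\<exists>i\<in>I. r i \<noteq> 0) \<and> (\<forall>j\<in>J. (\<Sum>i\<in>I. r i * v i j) = 0)"
  using dependent_mod_prime [of UNIV "{0}" J I v] assms
  by (auto simp: sub_ring_def prime_in_def ideal_in_def)

section \<open>Linear differential systems\<close>

lemma hc_mult: "hc d (x * y) = (\<Sum>i\<le>d. hc i x * hc (d - i) y)"
proof -
  obtain m where m: "\<forall>d>m. hc d x = 0" using hc_bound by blast
  have "hc d (x * y) = (\<Sum>i\<le>m. hc d (hc i x * y))"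
    by (subst sum_hc [OF m]) (simp add: sum_distrib_right hc_sum)
  also have "\<dots> = (\<Sum>i\<le>m. if i \<le> d then hc i x * hc (d - i) y else 0)"
    by (simp add: hc_homog_mult [OF homog_hc])
  also have "\<dots> = (\<Sum>i\<in>{..m} \<inter> {..d}. hc i x * hc (d - i) y)"
    unfolding sum.inter_restrict [OF finite_atMost] by simp
  also have "\<dots> = (\<Sum>i\<le>d. hc i x * hc (d - i) y)"
  proof (rule sum.mono_neutral_left)
    show "\<forall>i\<in>{..d} - ({..m} \<inter> {..d}). hc i x * hc (d - i) y = 0"
    proof
      fix i assume "i \<in> {..d} - ({..m} \<inter> {..d})"
      then have "i > m" by auto
      then show "hc i x * hc (d - i) y = 0" using m by simp
    qed
  qed auto
  finally show ?thesis .
qed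

lemma hc_pd: "hc d (pd b p) = pd b (hc (Suc d) p)"
proof -
  obtain m where m: "\<forall>d>m. hc d p = 0" using hc_bound by blast
  have "hc d (pd b p) = (\<Sum>i\<le>m. hc d (pd b (hc i p)))"
    by (subst sum_hc [OF m]) (simp add: pd_sum hc_sum)
  also have "\<dots> = (\<Sum>i\<le>m. if i = Suc d then pd b (hc i p) else 0)"
  proof (intro sum.cong HOL.refl)
    fix i
    have "homog (i - 1) (pd b (hc i p))" by (rule homog_pd) simp
    then show "hc d (pd b (hc i p)) = (if i = Suc d then pd b (hc i p) else 0)"
      using pd_homog_0 [of "hc 0 p" b] by (cases i) (auto simp: hc_homog)
  qed
  also have "\<dots> = pd b (hc (Suc d) p)" using m by (auto simp: not_le)
  finally show ?thesis .
qed

lemma homog_pd_all_0: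
  fixes p :: "('v, 'k::field_char_0) mpoly"
  assumes "homog d p" "d > 0" "\<And>b. pd b p = 0" shows "p = 0"
proof -
  obtain F where F: "finite F" "p \<in> PV F" using ex_finite_PV by blast
  have "of_nat d * p = 0" using euler_identity [OF assms(1) F] assms(3) by simp
  then show ?thesis using assms(2) by simp
qed

text \<open>Recursion on Taylor coefficients at \<open>x\<close>: in degree \<open>e\<close> of the
  equation only the constant term of \<open>D\<close>, nonzero at \<open>x\<close>, meets a
  component of the solution not yet known to vanish. So all derivatives of the next component
  vanish, and with them the component.\<close>

lemma linear_system_unique:
  fixes f :: "'i \<Rightarrow> ('v, 'k::field_char_0) mpoly"
  assumes "finite W" and ode: "\<And>w b. w \<in> W \<Longrightarrow> \<exists>c. D * pd b (f w) = (\<Sum>u\<in>W. c u * f u)"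
    and D: "peval x D \<noteq> 0" and f0: "\<And>w. w \<in> W \<Longrightarrow> peval x (f w) = 0" and w: "w \<in> W"
  shows "f w = 0"
proof -
  \<comment> \<open>Moves \<open>x\<close> to the origin, so that homogeneous components become
    Taylor terms at \<open>x\<close>.\<close>
  define t where "t = psubst (\<lambda>v. pvar v + poly_const (x v))"
  have th: "comm_ring_hom t" unfolding t_def by (rule psubst_hom)
  interpret t: comm_ring_hom t by (rule th)
  have tinv: "psubst (\<lambda>v. pvar v - poly_const (x v)) (t p) = p" for p
    unfolding t_def psubst_psubst by simp
  have pdt: "pd b (t p) = t (pd b p)" for b p
    by (rule derivation_eqI [where h = t]) (auto simp: t_def)
  have hom0: "comm_ring_hom (hc 0 :: ('v, 'k) mpoly \<Rightarrow> _)"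
    by unfold_locales (simp_all add: hc_add hc_mult hc_homog [OF homog_1])
  have ev: "hc 0 (t p) = poly_const (peval x p)" for p
  proof -
    have "(\<lambda>p. hc 0 (t p)) = (\<lambda>p. poly_const (peval x p))"
      by (rule hom_eqI [OF comp_hom [OF hom0 th] comp_hom [OF poly_const_hom peval_hom]])
        (simp_all add: t_def hc_homog [OF homog_const] hc_add hc_homog [OF homog_var])
    then show ?thesis by metis
  qed
  define g where "g u = t (f u)" for u
  have hg: "hc d (g u) = 0" if "u \<in> W" for d u
    using that
  proof (induction d arbitrary: u rule: less_induct)
    case (less d)
    show ?case
    proof (cases d)
      case 0
      then show ?thesis using ev [of "f u"] f0 [OF less.prems] by (simp add: g_def)
    next
      case (Suc e)
      show ?thesis
      proof (rule homog_pd_all_0 [OF homog_hc])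
        fix b
        obtain c where c: "D * pd b (f u) = (\<Sum>u\<in>W. c u * f u)" using ode [OF less.prems] by blast
        have "t D * pd b (g u) = (\<Sum>u\<in>W. t (c u) * g u)"
          using arg_cong [OF c, of t] by (simp add: g_def pdt t.hom_mult t.hom_sum)
        then have "hc e (t D * pd b (g u)) = (\<Sum>u\<in>W. hc e (t (c u) * g u))"
          by (simp add: hc_sum)
        also have "\<dots> = 0"
          using less.IH Suc by (intro sum.neutral) (auto simp: hc_mult)
        also have "hc e (t D * pd b (g u)) = (\<Sum>i\<le>e. hc i (t D) * hc (e - i) (pd b (g u)))"
          by (rule hc_mult)
        also have "\<dots> = hc 0 (t D) * hc e (pd b (g u))"
        proof (subst sum.remove [of _ 0])
          have "hc i (t D) * hc (e - i) (pd b (g u)) = 0" if "i \<in> {..e} - {0}" for i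
          proof -
            have "Suc (e - i) < d" using that Suc by auto
            then show ?thesis using less.IH [OF _ less.prems] by (simp add: hc_pd)
          qed
          then show "hc 0 (t D) * hc (e - 0) (pd b (g u)) + (\<Sum>i\<in>{..e} - {0}. hc i (t D) * hc (e - i) (pd b (g u)))
             = hc 0 (t D) * hc e (pd b (g u))"
            by (simp add: sum.neutral)
        qed auto
        finally show "pd b (hc d (g u)) = 0"
          using D by (simp add: ev hc_pd Suc)
      qed (simp add: Suc)
    qed
  qed
  have "g w = 0" by (rule hc_eqI) (simp add: hg [OF w])
  then have "t (f w) = 0" by (simp add: g_def)
  then show ?thesis using tinv [of "f w"] by simp
qed

section \<open>Even multiplicities\<close>

lemma sum_fun_apply: "sum f I x = (\<Sum>i\<in>I. f i x)"
  by (induction I rule: infinite_finite_induct) auto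

section \<open>Equivariance of the Dunkl operators\<close>

context reflection_action
begin

text \<open>Chain rule for a linear substitution. The variable \<open>b\<close> is adjoined to
  \<open>B\<close> because variables outside \<open>B\<close> are fixed and contribute their own
  derivative.\<close>

lemma pd_act: "pd b (act g y) = (\<Sum>c\<in>insert b B. pd b (hh g c) * act g (pd c y))"
proof (rule derivation_eqI [where h = "act g" and D = "\<lambda>y. pd b (act g y)"
      and D' = "\<lambda>y. \<Sum>c\<in>insert b B. pd b (hh g c) * act g (pd c y)"])
  fix v
  show "pd b (act g (pvar v)) = (\<Sum>c\<in>insert b B. pd b (hh g c) * act g (pd c (pvar v)))"
  proof (cases "v \<in> insert b B")
    case True
    have "(\<Sum>c\<in>insert b B. pd b (hh g c) * act g (pd c (pvar v))) =
      (\<Sum>c\<in>insert b B. if v = c then pd b (hh g c) else 0)"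
      by (intro sum.cong) auto
    then show ?thesis using True fin_B by (simp add: sum.delta' del: sum.insert)
  next
    case False
    then have "hh g v = pvar v" by (simp add: hh_out)
    moreover have "(\<Sum>c\<in>insert b B. pd b (hh g c) * act g (pd c (pvar v))) = 0"
      using False by (intro sum.neutral) auto
    ultimately show ?thesis using False by simp
  qed
qed (simp_all add: distrib_left sum.distrib sum_distrib_left sum_distrib_right algebra_simps)

lemma rr_cong:
  assumes "\<And>w. w \<in> W \<Longrightarrow> p w = q w" "s \<in> Rf" "w \<in> W"
  shows "rr s p w = rr s q w"
  using assms by (simp add: rr_def sig_refl)

lemma dunkl_cong:
  assumes "\<And>w. w \<in> W \<Longrightarrow> p w = q w" "w \<in> W"
  shows "dunkl k b p w = dunkl k b q w"
  using assms rr_cong [of p q] by (simp add: dunkl_def)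

lemma QC_cong:
  assumes "\<And>w. w \<in> W \<Longrightarrow> p w = q w" "p \<in> QC m" shows "q \<in> QC m"
  using assms by (simp add: QC_def)

lemma conj_conj:
  assumes "g \<in> W" "s \<in> W"
  shows "inv g \<otimes> (g \<otimes> s \<otimes> inv g) \<otimes> g = s" "g \<otimes> (inv g \<otimes> s \<otimes> g) \<otimes> inv g = s"
  using assms by (simp_all add: m_assoc) (simp_all add: m_assoc [symmetric])

lemma conj_bij: "g \<in> W \<Longrightarrow> bij_betw (\<lambda>s. g \<otimes> s \<otimes> inv g) Rf Rf"
  by (rule bij_betwI [where g = "\<lambda>s. inv g \<otimes> s \<otimes> g"])
    (auto simp: conj_conj Rf_conj Rf_conj')

lemma sig_minus_conj:
  assumes g: "g \<in> W" and s: "s \<in> Rf" and w: "w \<in> W"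
  shows "sig (g \<otimes> s \<otimes> inv g) (sig g p) w = act g (sig s p (inv g \<otimes> w))"
proof -
  have "sig (g \<otimes> s \<otimes> inv g) (sig g p) w = sig (g \<otimes> s) p w"
    using g s w by (subst sig_sig) (simp_all add: m_assoc)
  also have "\<dots> = sig g (sig s p) w" using g s w by (simp add: sig_sig)
  finally show ?thesis by (simp add: sig_def)
qed

text \<open>Conjugation permutes the reflections, and the scalar between \<open>act g (al s)\<close>
  and the form of the conjugate cancels between the derivative of the form and the divided
  difference. The operators therefore transform like directional derivatives.\<close>

lemma dunkl_sig:
  assumes k: "conj_inv k" and p: "p \<in> QC (\<lambda>s. 2 * k s)" and g: "g \<in> W" and w: "w \<in> W"
  shows "dunkl k b (sig g p) w = (\<Sum>c\<in>insert b B. pd b (hh g c) * act g (dunkl k c p (inv g \<otimes> w)))"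
proof -
  let ?u = "inv g \<otimes> w" and ?c = "\<lambda>s. g \<otimes> s \<otimes> inv g"
  have u: "?u \<in> W" using g w by simp
  have m: "conj_inv (\<lambda>s. 2 * k s)" using k by (simp add: conj_inv_def)
  have r: "of_nat (k s) * (pd b (al (?c s)) * rr (?c s) (sig g p) w) =
      of_nat (k s) * (pd b (act g (al s)) * act g (rr s p ?u))" if s: "s \<in> Rf" for s
  proof (cases "k s = 0")
    case False
    have k': "k (?c s) = k s" using k g s by (simp add: conj_inv_def)
    obtain c where c: "c \<noteq> 0" "act g (al s) = poly_const c * al (?c s)" using al_conj [OF g s] by blast
    have "al (?c s) * rr (?c s) (sig g p) w = sig g p w - sig (?c s) (sig g p) w"
      by (rule rr [OF QC_sig [OF m p g] Rf_conj [OF g s] _ w]) (use False k' in simp)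
    also have "\<dots> = act g (p ?u - sig s p ?u)"
      unfolding sig_minus_conj [OF g s w] by (simp add: sig_def)
    also have "p ?u - sig s p ?u = al s * rr s p ?u"
      using rr [OF p s _ u] False by simp
    also have "act g (al s * rr s p ?u) = al (?c s) * (poly_const c * act g (rr s p ?u))"
      by (simp add: c)
    finally have "rr (?c s) (sig g p) w = poly_const c * act g (rr s p ?u)"
      using al_nz [OF Rf_conj [OF g s]] by simp
    moreover have "pd b (act g (al s)) = poly_const c * pd b (al (?c s))" by (simp add: c)
    ultimately show ?thesis by (simp add: algebra_simps)
  qed simp
  have "(\<Sum>s\<in>Rf. of_nat (k s) * (pd b (al s) * rr s (sig g p) w)) =
    (\<Sum>s\<in>Rf. of_nat (k (?c s)) * (pd b (al (?c s)) * rr (?c s) (sig g p) w))"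
    by (rule sum.reindex_bij_betw [OF conj_bij [OF g], symmetric])
  also have "\<dots> = (\<Sum>s\<in>Rf. of_nat (k s) * (pd b (act g (al s)) * act g (rr s p ?u)))"
    using k g r by (intro sum.cong) (auto simp: conj_inv_def)
  also have "\<dots> = (\<Sum>s\<in>Rf. \<Sum>c\<in>insert b B. pd b (hh g c) * act g (of_nat (k s) * (pd c (al s) * rr s p ?u)))"
  proof (rule sum.cong [OF HOL.refl])
    fix s
    have n: "act g (of_nat n) = of_nat n" for n
      using psubst_simps(1) [of "hh g" "of_nat n"] by (simp add: poly_const_of_nat)
    show "of_nat (k s) * (pd b (act g (al s)) * act g (rr s p ?u)) =
      (\<Sum>c\<in>insert b B. pd b (hh g c) * act g (of_nat (k s) * (pd c (al s) * rr s p ?u)))"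
      unfolding pd_act [of b g "al s"] psubst_simps n sum_distrib_left sum_distrib_right
      by (intro sum.cong HOL.refl) (simp add: algebra_simps)
  qed
  also have "\<dots> = (\<Sum>c\<in>insert b B. pd b (hh g c) * act g (\<Sum>s\<in>Rf. of_nat (k s) * (pd c (al s) * rr s p ?u)))"
    by (subst sum.swap) (simp only: psubst_sum sum_distrib_left)
  finally have "dunkl k b (sig g p) w = pd b (act g (p ?u)) - \<dots>"
    by (simp add: dunkl_def sig_def)
  then show ?thesis
    unfolding pd_act [of b g "p ?u"] by (simp only: dunkl_def psubst_simps right_diff_distrib sum_subtractf)
qed

section \<open>Singular vectors and constant matrices commuting with the action\<close>

definition Sing :: "('w \<Rightarrow> nat) \<Rightarrow> ('w \<Rightarrow> ('v, 'k) mpoly) set" where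
  "Sing k = {p \<in> QC (\<lambda>s. 2 * k s). \<forall>b. \<forall>w\<in>W. dunkl k b p w = 0}"

definition homogF :: "nat \<Rightarrow> ('w \<Rightarrow> ('v, 'k) mpoly) \<Rightarrow> bool" where
  "homogF d p \<longleftrightarrow> (\<forall>w\<in>W. homog d (p w))"

lemma Sing_pd:
  assumes "p \<in> Sing k" "w \<in> W"
  shows "pd b (p w) = (\<Sum>s\<in>Rf. of_nat (k s) * (pd b (al s) * rr s p w))"
  using assms by (simp add: Sing_def dunkl_def)

lemma Sing_sig:
  assumes k: "conj_inv k" and p: "p \<in> Sing k" and g: "g \<in> W"
  shows "sig g p \<in> Sing k"
proof -
  have "conj_inv (\<lambda>s. 2 * k s)" using k by (simp add: conj_inv_def)
  then show ?thesis using assms QC_sig dunkl_sig [OF k _ g] unfolding Sing_def by simp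
qed

lemma homogF_sig: "homogF d p \<Longrightarrow> g \<in> W \<Longrightarrow> homogF d (sig g p)"
  by (auto simp: homogF_def sig_def intro!: act_homog)

text \<open>Constant matrices on the index set. The equivariant ones commute with left translation,
  so they represent the right regular action; they commute with the reflections, preserve the
  congruences and commute with the Dunkl operators.\<close>

definition mact :: "('w \<Rightarrow> 'w \<Rightarrow> 'k) \<Rightarrow> ('w \<Rightarrow> ('v, 'k) mpoly) \<Rightarrow> 'w \<Rightarrow> ('v, 'k) mpoly" where
  "mact M p w = (\<Sum>x\<in>W. poly_const (M w x) * p x)"

definition equivariant :: "('w \<Rightarrow> 'w \<Rightarrow> 'k) \<Rightarrow> bool" where
  "equivariant M \<longleftrightarrow> (\<forall>g\<in>W. \<forall>w\<in>W. \<forall>x\<in>W. M (g \<otimes> w) (g \<otimes> x) = M w x)"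

lemma left_mult_bij: "g \<in> W \<Longrightarrow> bij_betw (\<lambda>x. g \<otimes> x) W W"
  by (rule bij_betwI [where g = "\<lambda>x. inv g \<otimes> x"]) (auto simp: m_assoc [symmetric])

lemma mact_sig:
  assumes M: "equivariant M" and s: "s \<in> Rf" and w: "w \<in> W"
  shows "sig s (mact M p) w = mact M (sig s p) w"
proof -
  have "sig s (mact M p) w = (\<Sum>x\<in>W. poly_const (M (s \<otimes> w) x) * act s (p x))"
    using s w by (simp add: sig_refl mact_def psubst_sum)
  also have "\<dots> = (\<Sum>x\<in>W. poly_const (M (s \<otimes> w) (s \<otimes> x)) * act s (p (s \<otimes> x)))"
    using s by (intro sum.reindex_bij_betw [symmetric] left_mult_bij) simp
  also have "\<dots> = mact M (sig s p) w"
    unfolding mact_def using M s w by (intro sum.cong) (auto simp: equivariant_def sig_refl)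
  finally show ?thesis .
qed

lemma mact_QC:
  assumes M: "equivariant M" and p: "p \<in> QC m"
  shows "mact M p \<in> QC m"
  unfolding QC_def
proof clarify
  fix s w assume s: "s \<in> Rf" and w: "w \<in> W"
  have "mact M p (s \<otimes> w) = (\<Sum>x\<in>W. poly_const (M (s \<otimes> w) (s \<otimes> x)) * p (s \<otimes> x))"
    unfolding mact_def using s by (intro sum.reindex_bij_betw [symmetric] left_mult_bij) simp
  also have "\<dots> = (\<Sum>x\<in>W. poly_const (M w x) * p (s \<otimes> x))"
    using M s w by (intro sum.cong) (auto simp: equivariant_def)
  finally have "mact M p w - mact M p (s \<otimes> w) = (\<Sum>x\<in>W. poly_const (M w x) * (p x - p (s \<otimes> x)))"
    by (simp add: mact_def right_diff_distrib sum_subtractf)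
  then show "al s ^ m s dvd mact M p w - mact M p (s \<otimes> w)"
    using QC_D [OF p s] by (simp add: dvd_sum)
qed

lemma mact_dunkl:
  assumes M: "equivariant M" and p: "p \<in> QC (\<lambda>s. 2 * k s)" and w: "w \<in> W"
  shows "dunkl k b (mact M p) w = mact M (dunkl k b p) w"
proof -
  have r: "of_nat (k s) * (pd b (al s) * rr s (mact M p) w) =
      (\<Sum>x\<in>W. poly_const (M w x) * (of_nat (k s) * (pd b (al s) * rr s p x)))" if s: "s \<in> Rf" for s
  proof (cases "k s = 0")
    case False
    have "al s * rr s (mact M p) w = mact M p w - mact M (sig s p) w"
      using rr [OF mact_QC [OF M p] s _ w] False mact_sig [OF M s w] by simp
    also have "\<dots> = (\<Sum>x\<in>W. poly_const (M w x) * (al s * rr s p x))"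
      using False by (simp add: mact_def rr [OF p s] right_diff_distrib sum_subtractf)
    also have "\<dots> = al s * (\<Sum>x\<in>W. poly_const (M w x) * rr s p x)"
      by (simp add: sum_distrib_left algebra_simps)
    finally have "rr s (mact M p) w = (\<Sum>x\<in>W. poly_const (M w x) * rr s p x)"
      using al_nz [OF s] by simp
    then show ?thesis by (simp add: sum_distrib_left algebra_simps)
  qed simp
  have "dunkl k b (mact M p) w = pd b (mact M p w) -
      (\<Sum>s\<in>Rf. \<Sum>x\<in>W. poly_const (M w x) * (of_nat (k s) * (pd b (al s) * rr s p x)))"
    by (simp add: dunkl_def r)
  also have "(\<Sum>s\<in>Rf. \<Sum>x\<in>W. poly_const (M w x) * (of_nat (k s) * (pd b (al s) * rr s p x))) =
    (\<Sum>x\<in>W. poly_const (M w x) * (\<Sum>s\<in>Rf. of_nat (k s) * (pd b (al s) * rr s p x)))"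
    by (subst sum.swap) (simp only: sum_distrib_left)
  also have "pd b (mact M p w) = (\<Sum>x\<in>W. poly_const (M w x) * pd b (p x))"
    by (simp add: mact_def pd_sum)
  finally show ?thesis
    by (simp add: mact_def [of M "dunkl k b p"] dunkl_def right_diff_distrib sum_subtractf)
qed

text \<open>Maschke's theorem for the left regular representation.\<close>

lemma equivariant_projection:
  fixes U :: "('w \<Rightarrow> 'k) set"
  assumes add: "\<And>u v. u \<in> U \<Longrightarrow> v \<in> U \<Longrightarrow> (\<lambda>w. u w + v w) \<in> U"
    and scale: "\<And>c u. u \<in> U \<Longrightarrow> (\<lambda>w. c * u w) \<in> U" and zero: "(\<lambda>w. 0) \<in> U"
    and translate: "\<And>g u. g \<in> W \<Longrightarrow> u \<in> U \<Longrightarrow> (\<lambda>w. u (g \<otimes> w)) \<in> U"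
    and local: "\<And>u v. u \<in> U \<Longrightarrow> (\<And>w. w \<in> W \<Longrightarrow> u w = v w) \<Longrightarrow> v \<in> U"
  shows "\<exists>A. equivariant A \<and> (\<forall>u\<in>U. \<forall>w\<in>W. (\<Sum>x\<in>W. A w x * u x) = u w) \<and>
    (\<forall>x\<in>W. (\<lambda>w. A w x) \<in> U)"
proof -
  let ?s = "\<lambda>(c::'k) (f :: 'w \<Rightarrow> 'k) x. c * f x"
  interpret vs: vector_space ?s
    by unfold_locales (auto simp: fun_eq_iff algebra_simps)
  interpret vp: vector_space_pair ?s ?s ..
  have "vs.subspace U" unfolding vs.subspace_def
    using add scale zero by (auto simp: zero_fun_def plus_fun_def)
  \<comment> \<open>A linear projection of all functions onto \<open>U\<close>, still without
    equivariance.\<close>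
  then obtain P where P: "P ` UNIV \<subseteq> U" "Vector_Spaces.linear ?s ?s P" "\<forall>v\<in>U. P v = v"
    using vp.linear_exists_left_inverse_on [of id U] vs.linear_id by auto
  interpret P: Vector_Spaces.linear ?s ?s P by (rule P(2))
  define e where "e x w = (if w = x then 1 else 0 :: 'k)" for x w :: 'w
  define F where "F w x = P (e x) w" for w x
  have F: "(\<Sum>x\<in>W. F w x * u x) = u w" if u: "u \<in> U" and w: "w \<in> W" for u w
  proof -
    \<comment> \<open>A finite combination of indicators that differs from \<open>u\<close> only
      outside \<open>W\<close>, which \<open>local\<close> permits.\<close>
    let ?u = "\<lambda>w. \<Sum>x\<in>W. u x * e x w"
    have eq: "?u w = u w" if "w \<in> W" for w
      using that fin_G by (simp add: e_def if_distrib cong: if_cong)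
    then have "?u \<in> U" using local [OF u, of ?u] by simp
    then have "P ?u = ?u" using P(3) by blast
    moreover have "P ?u = (\<lambda>w. \<Sum>x\<in>W. u x * P (e x) w)"
    proof -
      have u: "?u = (\<Sum>x\<in>W. ?s (u x) (e x))" by (auto simp: fun_eq_iff sum_fun_apply)
      have "P ?u = (\<Sum>x\<in>W. ?s (u x) (P (e x)))" unfolding u by (simp only: P.sum P.scale)
      then show ?thesis by (auto simp: fun_eq_iff sum_fun_apply)
    qed
    ultimately show ?thesis using eq [OF w] by (simp add: F_def fun_eq_iff mult.commute)
  qed
  define n where "n = (of_nat (card W) :: 'k)"
  have n: "n \<noteq> 0" using fin_G one_closed by (auto simp: n_def card_eq_0_iff)
  \<comment> \<open>Averaging over the group; its order is invertible in characteristic 0.\<close>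
  define A where "A w x = (\<Sum>g\<in>W. F (g \<otimes> w) (g \<otimes> x)) / n" for w x
  have "equivariant A"
    unfolding equivariant_def
  proof (intro ballI)
    fix h w x assume h: "h \<in> W" "w \<in> W" "x \<in> W"
    have b: "bij_betw (\<lambda>g. g \<otimes> h) W W"
      using h by (intro bij_betwI [where g = "\<lambda>x. x \<otimes> inv h"]) (auto simp: m_assoc)
    have "(\<Sum>g\<in>W. F (g \<otimes> (h \<otimes> w)) (g \<otimes> (h \<otimes> x))) = (\<Sum>g\<in>W. F ((g \<otimes> h) \<otimes> w) ((g \<otimes> h) \<otimes> x))"
      using h by (intro sum.cong) (auto simp: m_assoc)
    also have "\<dots> = (\<Sum>g\<in>W. F (g \<otimes> w) (g \<otimes> x))"
      by (rule sum.reindex_bij_betw [OF b])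
    finally show "A (h \<otimes> w) (h \<otimes> x) = A w x" by (simp add: A_def)
  qed
  moreover have "(\<Sum>x\<in>W. A w x * u x) = u w" if u: "u \<in> U" and w: "w \<in> W" for u w
  proof -
    have "(\<Sum>x\<in>W. F (g \<otimes> w) (g \<otimes> x) * u x) = u w" if g: "g \<in> W" for g
    proof -
      have "(\<Sum>x\<in>W. F (g \<otimes> w) (g \<otimes> x) * u x) =
        (\<Sum>x\<in>W. F (g \<otimes> w) (g \<otimes> x) * u (inv g \<otimes> (g \<otimes> x)))"
        using g by (intro sum.cong) (auto simp: m_assoc [symmetric])
      also have "\<dots> = (\<Sum>y\<in>W. F (g \<otimes> w) y * u (inv g \<otimes> y))"
        by (rule sum.reindex_bij_betw [OF left_mult_bij [OF g]])
      also have "\<dots> = u (inv g \<otimes> (g \<otimes> w))"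
        using F [OF translate [OF inv_closed [OF g] u], of "g \<otimes> w"] g w by simp
      finally show ?thesis using g w by (simp add: m_assoc [symmetric])
    qed
    then have "(\<Sum>g\<in>W. \<Sum>x\<in>W. F (g \<otimes> w) (g \<otimes> x) * u x) = n * u w"
      by (simp add: n_def)
    moreover have "(\<Sum>x\<in>W. A w x * u x) = (\<Sum>x\<in>W. \<Sum>g\<in>W. F (g \<otimes> w) (g \<otimes> x) * u x) / n"
      by (simp add: A_def sum_divide_distrib sum_distrib_right)
    ultimately show ?thesis using n by (subst (asm) sum.swap) simp
  qed
  moreover have "(\<lambda>w. A w x) \<in> U" if x: "x \<in> W" for x
  proof -
    have sumU: "(\<lambda>w. \<Sum>g\<in>I. f g w) \<in> U" if "\<And>g. g \<in> I \<Longrightarrow> f g \<in> U" for I :: "'w set" and f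
      using that by (induction I rule: infinite_finite_induct) (auto intro: zero add)
    have "(\<lambda>w. F (g \<otimes> w) (g \<otimes> x)) \<in> U" if "g \<in> W" for g
      unfolding F_def by (rule translate [OF that]) (use P(1) in blast)
    then have "(\<lambda>w. (1 / n) * (\<Sum>g\<in>W. F (g \<otimes> w) (g \<otimes> x))) \<in> U"
      by (intro scale sumU)
    then show ?thesis by (simp add: A_def)
  qed
  ultimately show ?thesis by (intro exI [of _ A]) simp
qed

end

section \<open>Spans and square systems over polynomials\<close>

definition lin_span :: "'i set \<Rightarrow> ('i \<Rightarrow> 'a::comm_ring_1) \<Rightarrow> 'a set" where
  "lin_span W f = {y. \<exists>c. y = (\<Sum>u\<in>W. c u * f u)}"

lemma lin_spanI: "y = (\<Sum>u\<in>W. c u * f u) \<Longrightarrow> y \<in> lin_span W f"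
  by (auto simp: lin_span_def)

lemma lin_span_add:
  assumes "x \<in> lin_span W f" "y \<in> lin_span W f" shows "x + y \<in> lin_span W f"
proof -
  obtain c c' where "x = (\<Sum>u\<in>W. c u * f u)" "y = (\<Sum>u\<in>W. c' u * f u)"
    using assms by (auto simp: lin_span_def)
  then show ?thesis
    by (intro lin_spanI [of _ "\<lambda>u. c u + c' u"]) (simp add: distrib_right sum.distrib)
qed

lemma lin_span_mult:
  assumes "x \<in> lin_span W f" shows "a * x \<in> lin_span W f"
proof -
  obtain c where "x = (\<Sum>u\<in>W. c u * f u)" using assms by (auto simp: lin_span_def)
  then show ?thesis
    by (intro lin_spanI [of _ "\<lambda>u. a * c u"]) (simp add: sum_distrib_left mult.assoc)
qed

lemma lin_span_zero: "0 \<in> lin_span W f"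
  by (rule lin_spanI [of _ "\<lambda>_. 0"]) simp

lemma lin_span_diff: "x \<in> lin_span W f \<Longrightarrow> y \<in> lin_span W f \<Longrightarrow> x - y \<in> lin_span W f"
  using lin_span_add [OF _ lin_span_mult, of x W f y "-1"] by simp

lemma lin_span_base: "finite W \<Longrightarrow> u \<in> W \<Longrightarrow> f u \<in> lin_span W f"
  by (rule lin_spanI [of _ "\<lambda>v. if v = u then 1 else 0"])
    (simp add: if_distrib [of "\<lambda>c. c * _"] cong: if_cong)

lemma lin_span_sum: "(\<And>i. i \<in> I \<Longrightarrow> g i \<in> lin_span W f) \<Longrightarrow> sum g I \<in> lin_span W f"
  by (induction I rule: infinite_finite_induct) (auto intro: lin_span_zero lin_span_add)

text \<open>The combinations giving multiples of unit vectors provide a second matrix whose product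
  with that of \<open>e\<close> is diagonal, so the determinant of \<open>e\<close> is nonzero. Its
  adjugate turns a relation into \<open>q g * dt ?n E = 0\<close>.\<close>

lemma spanning_independent:
  fixes e :: "'j \<Rightarrow> 'i \<Rightarrow> ('v, 'k::idom) mpoly"
  assumes fin: "finite W" "finite J" "card J = card W"
    and span: "\<And>x. x \<in> W \<Longrightarrow> d x \<noteq> 0 \<and> (\<exists>c. \<forall>w\<in>W. (\<Sum>g\<in>J. c g * e g w) = (if w = x then d x else 0))"
    and zero: "\<And>w. w \<in> W \<Longrightarrow> (\<Sum>g\<in>J. q g * e g w) = 0" and g: "g \<in> J"
  shows "q g = 0"
proof -
  let ?n = "card W"
  obtain ix where ix: "bij_betw ix {..<?n} W"
    using ex_bij_betw_nat_finite [OF fin(1)] by (auto simp: atLeast0LessThan)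
  obtain jx where jx: "bij_betw jx {..<?n} J"
    using ex_bij_betw_nat_finite [OF fin(2)] fin(3) by (auto simp: atLeast0LessThan)
  have ixW: "ix i \<in> W" if "i < ?n" for i using ix that by (auto simp: bij_betw_def)
  have "\<forall>x\<in>W. \<exists>c. \<forall>w\<in>W. (\<Sum>g\<in>J. c g * e g w) = (if w = x then d x else 0)" using span by blast
  then obtain c where c: "\<forall>x\<in>W. \<forall>w\<in>W. (\<Sum>g\<in>J. c x g * e g w) = (if w = x then d x else 0)"
    by (rule bchoice [THEN exE])
  have sJ: "(\<Sum>g\<in>J. f g) = (\<Sum>l<?n. f (jx l))" for f :: "'j \<Rightarrow> ('v, 'k) mpoly"
    by (rule sum.reindex_bij_betw [OF jx, symmetric])
  define E where "E i j = e (jx j) (ix i)" for i j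
  have "(\<Sum>l<?n. E i l * c (ix j) (jx l)) = (if i = j then d (ix i) else 0)" if "i < ?n" "j < ?n" for i j
  proof -
    have "(\<Sum>l<?n. E i l * c (ix j) (jx l)) = (if ix i = ix j then d (ix j) else 0)"
      using c ixW that sJ [of "\<lambda>g. c (ix j) g * e g (ix i)"] by (simp add: E_def mult.commute)
    moreover have "ix i = ix j \<longleftrightarrow> i = j"
      using ix that by (auto simp: bij_betw_def inj_on_def)
    ultimately show ?thesis by simp
  qed
  then have "dt ?n E * dt ?n (\<lambda>l j. c (ix j) (jx l)) = (\<Prod>i<?n. d (ix i))"
    by (rule dt_product_diagonal)
  moreover have "(\<Prod>i<?n. d (ix i)) \<noteq> 0" using span ixW by (simp add: mpoly_prod_eq_0)
  ultimately have E0: "dt ?n E \<noteq> 0" by auto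
  obtain a where a: "\<forall>j<?n. \<forall>j'<?n. (\<Sum>i<?n. a j i * E i j') = (if j = j' then dt ?n E else 0)"
    using dt_adjugate [of ?n E] by (elim exE conjE)
  obtain l where l: "l < ?n" "jx l = g" using jx g by (auto simp: bij_betw_def)
  have "(\<Sum>i<?n. a l i * (\<Sum>j<?n. q (jx j) * E i j)) = (\<Sum>i<?n. a l i * 0)"
    using zero ixW sJ by (intro sum.cong HOL.refl) (simp add: E_def)
  also have "(\<Sum>i<?n. a l i * (\<Sum>j<?n. q (jx j) * E i j)) = (\<Sum>j<?n. q (jx j) * (\<Sum>i<?n. a l i * E i j))"
    unfolding sum_distrib_left by (subst sum.swap) (simp add: mult.left_commute)
  also have "\<dots> = (\<Sum>j<?n. if l = j then q (jx j) * dt ?n E else 0)"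
    using l by (intro sum.cong HOL.refl) (simp add: a)
  also have "\<dots> = q g * dt ?n E" using l by simp
  finally show ?thesis using E0 by simp
qed

lemma poly_const_sum: "poly_const (sum f A) = (\<Sum>a\<in>A. poly_const (f a))"
proof -
  interpret comm_ring_hom poly_const by (rule poly_const_hom)
  show ?thesis by (rule hom_sum)
qed

section \<open>Counting independent singular vectors\<close>

context reflection_action
begin

definition indep :: "('w \<Rightarrow> ('v, 'k) mpoly) set \<Rightarrow> bool" where
  "indep I \<longleftrightarrow> finite I \<and> (\<forall>c. (\<forall>w\<in>W. (\<Sum>p\<in>I. c p * p w) = 0) \<longrightarrow> (\<forall>p\<in>I. c p = 0))"

lemma indep_card:
  assumes "indep I" shows "card I \<le> card W"
proof (rule ccontr)
  assume "\<not> ?thesis"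
  then show False
    using mpoly_dependent [OF fin_G, of I "\<lambda>p w. p w"] assms unfolding indep_def by fastforce
qed

text \<open>The span over the fraction field, cut down to polynomial vectors; \<open>d\<close> is a
  common denominator.\<close>

definition satspan :: "('w \<Rightarrow> ('v, 'k) mpoly) set \<Rightarrow> ('w \<Rightarrow> ('v, 'k) mpoly) set" where
  "satspan I = {v. \<exists>d c. d \<noteq> 0 \<and> (\<forall>w\<in>W. d * v w = (\<Sum>p\<in>I. c p * p w))}"

lemma satspanI:
  assumes "d \<noteq> 0" "\<And>w. w \<in> W \<Longrightarrow> d * v w = (\<Sum>p\<in>I. c p * p w)"
  shows "v \<in> satspan I"
  unfolding satspan_def mem_Collect_eq
  by (rule exI [of _ d], rule exI [of _ c]) (use assms in auto)

lemma satspan_cong: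
  "v \<in> satspan I \<Longrightarrow> (\<And>w. w \<in> W \<Longrightarrow> v w = u w) \<Longrightarrow> u \<in> satspan I"
  by (auto simp: satspan_def)

lemma satspan_add:
  assumes "u \<in> satspan I" "v \<in> satspan I" shows "(\<lambda>w. u w + v w) \<in> satspan I"
proof -
  obtain d c where 1: "d \<noteq> 0" "\<forall>w\<in>W. d * u w = (\<Sum>p\<in>I. c p * p w)"
    using assms(1) by (auto simp: satspan_def)
  obtain d' c' where 2: "d' \<noteq> 0" "\<forall>w\<in>W. d' * v w = (\<Sum>p\<in>I. c' p * p w)"
    using assms(2) by (auto simp: satspan_def)
  have "d * d' * (u w + v w) = (\<Sum>p\<in>I. (d' * c p + d * c' p) * p w)" if "w \<in> W" for w
  proof -
    have "d * d' * (u w + v w) = d' * (d * u w) + d * (d' * v w)" by (simp add: algebra_simps)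
    also have "\<dots> = d' * (\<Sum>p\<in>I. c p * p w) + d * (\<Sum>p\<in>I. c' p * p w)" using 1 2 that by simp
    finally show ?thesis by (simp add: sum_distrib_left sum.distrib algebra_simps)
  qed
  then show ?thesis
    by (intro satspanI [where d = "d * d'" and c = "\<lambda>p. d' * c p + d * c' p"]) (use 1(1) 2(1) in auto)
qed

lemma satspan_mult: "v \<in> satspan I \<Longrightarrow> (\<lambda>w. a * v w) \<in> satspan I"
proof -
  assume "v \<in> satspan I"
  then obtain d c where 1: "d \<noteq> 0" "\<forall>w\<in>W. d * v w = (\<Sum>p\<in>I. c p * p w)"
    by (auto simp: satspan_def)
  have "d * (a * v w) = (\<Sum>p\<in>I. (a * c p) * p w)" if "w \<in> W" for w
  proof -
    have "d * (a * v w) = a * (d * v w)" by (simp add: algebra_simps)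
    then show ?thesis using 1(2) that by (simp add: sum_distrib_left mult.assoc)
  qed
  then show ?thesis by (rule satspanI [where c = "\<lambda>p. a * c p", OF 1(1)])
qed

lemma satspan_div:
  assumes "(\<lambda>w. a * v w) \<in> satspan I" "a \<noteq> 0" shows "v \<in> satspan I"
proof -
  obtain d c where 1: "d \<noteq> 0" "\<forall>w\<in>W. d * (a * v w) = (\<Sum>p\<in>I. c p * p w)"
    using assms(1) by (auto simp: satspan_def)
  then show ?thesis
    by (intro satspanI [where d = "d * a" and c = c]) (use assms(2) in \<open>auto simp: mult.assoc\<close>)
qed

lemma satspan_zero: "(\<lambda>w. 0) \<in> satspan I"
  by (rule satspanI [where d = 1 and c = "\<lambda>_. 0"]) auto

lemma satspan_sum: "(\<And>i. i \<in> J \<Longrightarrow> f i \<in> satspan I) \<Longrightarrow> (\<lambda>w. \<Sum>i\<in>J. f i w) \<in> satspan I"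
  by (induction J rule: infinite_finite_induct) (auto intro: satspan_zero satspan_add)

lemma satspan_base:
  assumes "finite I" "p \<in> I" shows "p \<in> satspan I"
proof -
  have "p w = (\<Sum>q\<in>I. (if q = p then 1 else 0) * q w)" for w
    using assms by (simp add: if_distrib [of "\<lambda>c. c * _"] cong: if_cong)
  then show ?thesis by (intro satspanI [where d = 1 and c = "\<lambda>q. if q = p then 1 else 0"]) auto
qed

lemma satspan_diff: "u \<in> satspan I \<Longrightarrow> v \<in> satspan I \<Longrightarrow> (\<lambda>w. u w - v w) \<in> satspan I"
  using satspan_add [OF _ satspan_mult, of u I v "-1"] by simp

definition HSing :: "('w \<Rightarrow> nat) \<Rightarrow> ('w \<Rightarrow> ('v, 'k) mpoly) set" where
  "HSing k = {p \<in> Sing k. \<exists>d. homogF d p}"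

definition maximal_indep :: "('w \<Rightarrow> nat) \<Rightarrow> ('w \<Rightarrow> ('v, 'k) mpoly) set \<Rightarrow> bool" where
  "maximal_indep k I \<longleftrightarrow> indep I \<and> I \<subseteq> HSing k \<and> (\<forall>h\<in>HSing k. h \<in> satspan I)"

text \<open>Independent sets have at most \<open>card W\<close> elements, so one of greatest size
  exists. If adding \<open>h\<close> creates a relation, its coefficient at \<open>h\<close> is
  nonzero and serves as the denominator.\<close>

lemma ex_maximal_indep: "\<exists>I. maximal_indep k I"
proof -
  let ?P = "\<lambda>I. indep I \<and> I \<subseteq> HSing k"
  have "\<exists>I. ?P I \<and> (\<forall>I'. ?P I' \<longrightarrow> card I' \<le> card I)"
  proof (rule ex_has_greatest_nat [of ?P "{}" card "Suc (card W)"])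
    show "?P {}" by (simp add: indep_def)
    show "\<forall>I. ?P I \<longrightarrow> card I < Suc (card W)" using indep_card by (simp add: less_Suc_eq_le)
  qed
  then obtain I where I: "?P I" "\<forall>I'. ?P I' \<longrightarrow> card I' \<le> card I" by blast
  have "h \<in> satspan I" if h: "h \<in> HSing k" for h
  proof (cases "h \<in> I")
    case True
    then show ?thesis using I(1) satspan_base by (auto simp: indep_def)
  next
    case False
    have fin: "finite I" using I(1) by (simp add: indep_def)
    then have "\<not> indep (insert h I)" using I h False by fastforce
    then obtain c where c: "\<forall>w\<in>W. (\<Sum>p\<in>insert h I. c p * p w) = 0" "\<exists>p\<in>insert h I. c p \<noteq> 0"
      using fin by (auto simp: indep_def)
    have eq: "c h * h w + (\<Sum>p\<in>I. c p * p w) = 0" if "w \<in> W" for w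
      using c(1) that fin False by simp
    have "c h \<noteq> 0"
    proof
      assume "c h = 0"
      then have "\<forall>p\<in>I. c p = 0" using eq I(1) unfolding indep_def by simp
      then show False using c(2) \<open>c h = 0\<close> by blast
    qed
    then show ?thesis
      by (rule satspanI [where c = "\<lambda>p. - c p"]) (use eq in \<open>simp add: sum_negf eq_neg_iff_add_eq_0\<close>)
  qed
  then show ?thesis using I(1) unfolding maximal_indep_def by blast
qed

text \<open>A common multiple of the moduli. It carries every vector into the module, which
  therefore has full rank \<open>card W\<close>.\<close>

definition QCgen :: "('w \<Rightarrow> nat) \<Rightarrow> ('v, 'k) mpoly" where
  "QCgen m = (\<Prod>s\<in>Rf. al s ^ m s)"

lemma QCgen_nz: "QCgen m \<noteq> 0"
  using fin_Rf al_nz by (simp add: QCgen_def mpoly_prod_eq_0)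

lemma QCgen_QC: "(\<lambda>w. QCgen m * p w) \<in> QC m"
proof -
  have "al s ^ m s dvd QCgen m" if "s \<in> Rf" for s
    unfolding QCgen_def by (rule dvd_prodI [OF fin_Rf that])
  then show ?thesis by (simp add: QC_def right_diff_distrib [symmetric])
qed

context
  fixes k :: "'w \<Rightarrow> nat" and I :: "('w \<Rightarrow> ('v, 'k) mpoly) set"
  assumes k: "conj_inv k" and I: "maximal_indep k I"
begin

lemma satspan_HSing: "h \<in> HSing k \<Longrightarrow> h \<in> satspan I"
  using I by (simp add: maximal_indep_def)

lemma satspan_transform:
  assumes v: "v \<in> satspan I" and T: "\<And>p. p \<in> I \<Longrightarrow> sig g p \<in> satspan I" and g: "g \<in> W"
  shows "sig g v \<in> satspan I"
proof -
  obtain d c where 1: "d \<noteq> 0" "\<forall>w\<in>W. d * v w = (\<Sum>p\<in>I. c p * p w)"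
    using v by (auto simp: satspan_def)
  have "(\<lambda>w. \<Sum>p\<in>I. act g (c p) * sig g p w) \<in> satspan I"
    by (intro satspan_sum satspan_mult T)
  then have "(\<lambda>w. act g d * sig g v w) \<in> satspan I"
  proof (rule satspan_cong)
    fix w assume w: "w \<in> W"
    then have "act g (d * v (inv g \<otimes> w)) = act g (\<Sum>p\<in>I. c p * p (inv g \<otimes> w))"
      using 1(2) g by simp
    then show "(\<Sum>p\<in>I. act g (c p) * sig g p w) = act g d * sig g v w"
      by (simp add: sig_def psubst_sum)
  qed
  then show ?thesis by (rule satspan_div) (use 1(1) g in simp)
qed

lemma satspan_sig: "v \<in> satspan I \<Longrightarrow> g \<in> W \<Longrightarrow> sig g v \<in> satspan I"
proof (rule satspan_transform)
  fix p assume "p \<in> I" "g \<in> W"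
  then have "sig g p \<in> HSing k"
    using I Sing_sig [OF k] homogF_sig unfolding maximal_indep_def HSing_def by blast
  then show "sig g p \<in> satspan I" by (rule satspan_HSing)
qed

text \<open>On a singular vector the derivative equals the reflection part of the Dunkl operator.
  Its divided differences lie in the saturated span, because \<open>sig\<close> preserves the span
  and \<open>al s\<close> may be divided out.\<close>

lemma satspan_pd:
  assumes v: "v \<in> satspan I" shows "(\<lambda>w. pd b (v w)) \<in> satspan I"
proof -
  obtain d c where 1: "d \<noteq> 0" "\<forall>w\<in>W. d * v w = (\<Sum>p\<in>I. c p * p w)"
    using v by (auto simp: satspan_def)
  have pI: "p \<in> satspan I \<and> p \<in> Sing k" if "p \<in> I" for p
    using that I satspan_HSing unfolding maximal_indep_def HSing_def by blast
  have 2: "(\<lambda>w. pd b (p w)) \<in> satspan I" if p: "p \<in> I" for p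
  proof -
    have "(\<lambda>w. of_nat (k s) * (pd b (al s) * rr s p w)) \<in> satspan I" if s: "s \<in> Rf" for s
    proof (cases "k s = 0")
      case True
      then show ?thesis by (simp add: satspan_zero)
    next
      case False
      have "(\<lambda>w. p w - sig s p w) \<in> satspan I"
        using pI [OF p] s by (intro satspan_diff satspan_sig) auto
      then have "(\<lambda>w. al s * rr s p w) \<in> satspan I"
      proof (rule satspan_cong)
        show "p w - sig s p w = al s * rr s p w" if "w \<in> W" for w
          using rr [of p "\<lambda>s. 2 * k s" s w] pI [OF p] s False that by (simp add: Sing_def)
      qed
      then have "(\<lambda>w. rr s p w) \<in> satspan I" by (rule satspan_div) (rule al_nz [OF s])
      then show ?thesis by (intro satspan_mult)
    qed
    then have "(\<lambda>w. \<Sum>s\<in>Rf. of_nat (k s) * (pd b (al s) * rr s p w)) \<in> satspan I"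
      by (rule satspan_sum)
    then show ?thesis by (rule satspan_cong) (use Sing_pd pI [OF p] in auto)
  qed
  \<comment> \<open>The product rule applied to the expansion of \<open>d * v w\<close>, solved for
    \<open>d * pd b (v w)\<close>.\<close>
  have "(\<lambda>w. (\<Sum>p\<in>I. pd b (c p) * p w + c p * pd b (p w)) - pd b d * v w) \<in> satspan I"
    using pI by (intro satspan_diff satspan_sum satspan_add satspan_mult 2 v) auto
  then have "(\<lambda>w. d * pd b (v w)) \<in> satspan I"
  proof (rule satspan_cong)
    fix w assume "w \<in> W"
    then have "pd b (d * v w) = pd b (\<Sum>p\<in>I. c p * p w)" using 1(2) by simp
    then show "(\<Sum>p\<in>I. pd b (c p) * p w + c p * pd b (p w)) - pd b d * v w = d * pd b (v w)"
      by (simp add: pd_sum diff_eq_eq add.commute)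
  qed
  then show ?thesis by (rule satspan_div) (rule 1(1))
qed

definition constU :: "('w \<Rightarrow> 'k) set" where
  "constU = {u. (\<lambda>w. poly_const (u w)) \<in> satspan I}"

text \<open>Derivatives stay in the saturated span and commute with a constant matrix, so descending
  in the degree reduces the claim to constant vectors.\<close>

lemma constU_kill:
  assumes M: "\<And>u w. u \<in> constU \<Longrightarrow> w \<in> W \<Longrightarrow> (\<Sum>x\<in>W. M w x * u x) = 0"
    and "v \<in> satspan I" "homogF d v" "w \<in> W"
  shows "mact M v w = 0"
  using assms(2-)
proof (induction d arbitrary: v w)
  case 0
  have "\<forall>w\<in>W. \<exists>c. v w = poly_const c" using 0(2) homog_zero_const by (auto simp: homogF_def)
  then obtain u where u: "\<forall>w\<in>W. v w = poly_const (u w)" by (rule bchoice [THEN exE])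
  then have "u \<in> constU" unfolding constU_def by (auto intro: satspan_cong [OF 0(1)])
  have "mact M v w = poly_const (\<Sum>x\<in>W. M w x * u x)"
    by (simp add: mact_def u poly_const_sum poly_const_mult)
  then show ?case using M \<open>u \<in> constU\<close> 0(3) by simp
next
  case (Suc d)
  have hom: "homog (Suc d) (mact M v w)"
    using Suc.prems(2) by (auto simp: mact_def homogF_def intro!: homog_sum homog_const_mult)
  show ?case
  proof (rule homog_pd_all_0 [OF hom])
    fix b
    have "homog d (pd b (v w))" if "w \<in> W" for w
      using homog_pd [of "Suc d" "v w" b] Suc.prems(2) that by (simp add: homogF_def)
    then have "homogF d (\<lambda>w. pd b (v w))" by (simp add: homogF_def)
    then have "mact M (\<lambda>w. pd b (v w)) w = 0"
      using Suc.IH satspan_pd [OF Suc.prems(1)] Suc.prems(3) by blast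
    then show "pd b (mact M v w) = 0" by (simp add: mact_def pd_sum)
  qed simp
qed

lemma indicator_constU:
  assumes x0: "x0 \<in> W" shows "(\<lambda>w. if w = x0 then 1 else 0) \<in> constU"
proof (rule ccontr)
  assume not: "\<not> ?thesis"
  have U1: "(\<lambda>w. u w + v w) \<in> constU" if "u \<in> constU" "v \<in> constU" for u v
    using that satspan_add by (simp add: constU_def poly_const_add)
  have U2: "(\<lambda>w. c * u w) \<in> constU" if "u \<in> constU" for u c
    using that satspan_mult by (simp add: constU_def poly_const_mult)
  have U3: "(\<lambda>w. 0) \<in> constU" by (simp add: constU_def satspan_zero)
  have U4: "(\<lambda>w. u (g \<otimes> w)) \<in> constU" if "g \<in> W" "u \<in> constU" for g u
  proof -
    have "sig (inv g) (\<lambda>w. poly_const (u w)) = (\<lambda>w. poly_const (u (g \<otimes> w)))"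
      using that(1) by (auto simp: sig_def)
    then show ?thesis
      using satspan_sig [of "\<lambda>w. poly_const (u w)" "inv g"] that by (simp add: constU_def)
  qed
  have U5: "v \<in> constU" if "u \<in> constU" "\<And>w. w \<in> W \<Longrightarrow> u w = v w" for u v
    using that by (auto simp: constU_def intro: satspan_cong)
  let ?Q = "\<lambda>A. equivariant A \<and> (\<forall>u\<in>constU. \<forall>w\<in>W. (\<Sum>x\<in>W. A w x * u x) = u w) \<and>
    (\<forall>x\<in>W. (\<lambda>w. A w x) \<in> constU)"
  have "\<exists>A. ?Q A" by (rule equivariant_projection [of constU, OF U1 U2 U3 U4 U5])
  then obtain A where QA: "?Q A" ..
  then have A: "equivariant A"
    "\<And>u w. u \<in> constU \<Longrightarrow> w \<in> W \<Longrightarrow> (\<Sum>x\<in>W. A w x * u x) = u w"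
    "\<And>x. x \<in> W \<Longrightarrow> (\<lambda>w. A w x) \<in> constU" by simp_all
  \<comment> \<open>The complementary projection, which kills the constant vectors of the saturated
    span.\<close>
  define M where "M w x = (if w = x then 1 else 0) - A w x" for w x
  have Mid: "(\<Sum>x\<in>W. M w x * u x) = u w - (\<Sum>x\<in>W. A w x * u x)" if "w \<in> W" for w u
    using that fin_G by (simp add: M_def left_diff_distrib sum_subtractf if_distrib [of "\<lambda>c. c * _"] cong: if_cong)
  have Meq: "equivariant M"
    using A(1) by (auto simp: equivariant_def M_def)
  have Mkill: "(\<Sum>x\<in>W. M w x * u x) = 0" if "u \<in> constU" "w \<in> W" for u w
    using A(2) [OF that] Mid [OF that(2)] by simp
  \<comment> \<open>Idempotence on column \<open>x0\<close>: the columns of \<open>A\<close> lie in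
    \<open>constU\<close>, where \<open>A\<close> acts as the identity.\<close>
  have MM: "(\<Sum>x\<in>W. M w x * M x x0) = M w x0" if w: "w \<in> W" for w
  proof -
    have "(\<Sum>x\<in>W. A w x * M x x0) = A w x0 - (\<Sum>x\<in>W. A w x * A x x0)"
      using fin_G x0
      by (simp add: M_def right_diff_distrib sum_subtractf if_distrib [of "\<lambda>c. _ * c"] cong: if_cong)
    also have "\<dots> = 0" using A(2) [OF A(3) [OF x0] w] by simp
    finally show ?thesis using Mid [OF w, of "\<lambda>x. M x x0"] by simp
  qed
  let ?m = "\<lambda>s. 2 * k s"
  let ?P = "\<lambda>d q. q \<in> QC ?m \<and> homogF d q \<and> (\<exists>w\<in>W. q w \<noteq> 0) \<and> (\<forall>w\<in>W. mact M q w = q w)"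
  have "\<exists>d q. ?P d q"
  proof -
    \<comment> \<open>Column \<open>x0\<close> of \<open>M\<close> is nonzero, as otherwise the
      indicator would agree on \<open>W\<close> with a column of \<open>A\<close>. The factor
      \<open>QCgen\<close> turns it into a homogeneous quasi-covariant fixed by
      \<open>M\<close>.\<close>
    define q where "q w = QCgen ?m * poly_const (M w x0)" for w
    have "q \<in> QC ?m" unfolding q_def [abs_def] by (rule QCgen_QC)
    moreover have "homogF (\<Sum>s\<in>Rf. ?m s * 1) q"
    proof -
      have "homog (\<Sum>s\<in>Rf. ?m s * 1) (QCgen ?m)"
        unfolding QCgen_def by (intro homog_prod homog_power) (simp add: al_homog)
      then show ?thesis unfolding homogF_def q_def by (metis homog_const_mult mult.commute)
    qed
    moreover have "\<exists>w\<in>W. q w \<noteq> 0"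
    proof (rule ccontr)
      assume "\<not> ?thesis"
      then have "\<forall>w\<in>W. M w x0 = 0" by (simp add: q_def QCgen_nz)
      then have "(\<lambda>w. if w = x0 then 1 else 0) \<in> constU"
        by (intro U5 [OF A(3) [OF x0]]) (simp add: M_def)
      then show False using not by simp
    qed
    moreover have "mact M q w = q w" if "w \<in> W" for w
    proof -
      have "mact M q w = QCgen ?m * poly_const (\<Sum>x\<in>W. M w x * M x x0)"
        by (simp add: mact_def q_def poly_const_sum poly_const_mult sum_distrib_left mult.left_commute)
      then show ?thesis using MM [OF that] by (simp add: q_def)
    qed
    ultimately show ?thesis by blast
  qed
  then obtain d where d: "\<exists>q. ?P d q" "\<forall>e<d. \<not> (\<exists>q. ?P e q)"
    using exists_least_iff [of "\<lambda>d. \<exists>q. ?P d q"] by blast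
  then obtain q where q: "q \<in> QC ?m" "homogF d q" "\<exists>w\<in>W. q w \<noteq> 0" "\<forall>w\<in>W. mact M q w = q w"
    by blast
  have hq: "\<And>w. w \<in> W \<Longrightarrow> homog d (q w)" using q(2) by (simp add: homogF_def)
  have "dunkl k b q w = 0" if w: "w \<in> W" for b w
  proof (cases "d = 0")
    case True
    then show ?thesis using dunkl_homog(2) [OF q(1) w hq] by simp
  next
    case False
    \<comment> \<open>The Dunkl image is again fixed by \<open>M\<close> and has smaller degree, so
      minimality of \<open>d\<close> forces it to be zero.\<close>
    have "d - 1 < d" using False by simp
    then have "\<not> (\<exists>q. ?P (d - 1) q)" using d(2) by (elim allE) (erule mp)
    then have "\<not> ?P (d - 1) (dunkl k b q)" by (rule not_ex [THEN iffD1, THEN spec])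
    moreover have "dunkl k b q \<in> QC ?m" by (rule dunkl_QC [OF k q(1)])
    moreover have "homogF (d - 1) (dunkl k b q)"
      unfolding homogF_def using dunkl_homog(1) [OF q(1) _ hq] by blast
    moreover have "mact M (dunkl k b q) w = dunkl k b q w" if "w \<in> W" for w
      using mact_dunkl [OF Meq q(1) that, of b] dunkl_cong [OF _ that, of "mact M q" q k b] q(4) by simp
    ultimately show ?thesis using w by blast
  qed
  then have "q \<in> HSing k" using q(1,2) by (auto simp: HSing_def Sing_def)
  then have "mact M q w = 0" if "w \<in> W" for w
    using constU_kill [OF Mkill satspan_HSing q(2) that] by simp
  then show False using q(3,4) by simp
qed

text \<open>The indicators of all group elements lie in the saturated span, so \<open>I\<close>
  spans everything over the fraction field. In terms of polynomials: fewer than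
  \<open>card W\<close> vectors would make the coefficient rows of the indicators dependent, hence
  the indicators themselves.\<close>

lemma card_maximal_indep: "card I = card W"
proof (rule antisym)
  show "card I \<le> card W" using I indep_card by (simp add: maximal_indep_def)
  have finI: "finite I" using I by (simp add: maximal_indep_def indep_def)
  have "\<forall>x\<in>W. \<exists>dc. fst dc \<noteq> 0 \<and>
      (\<forall>w\<in>W. fst dc * poly_const (if w = x then 1 else 0) = (\<Sum>p\<in>I. snd dc p * p w))"
    using indicator_constU unfolding constU_def satspan_def by fastforce
  then obtain dc where dc: "\<forall>x\<in>W. fst (dc x) \<noteq> 0 \<and>
      (\<forall>w\<in>W. fst (dc x) * poly_const (if w = x then 1 else 0) = (\<Sum>p\<in>I. snd (dc x) p * p w))"
    by (rule bchoice [THEN exE])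
  show "card W \<le> card I"
  proof (rule ccontr)
    assume "\<not> ?thesis"
    then obtain r where r: "\<exists>x\<in>W. r x \<noteq> 0" "\<forall>p\<in>I. (\<Sum>x\<in>W. r x * snd (dc x) p) = 0"
      using mpoly_dependent [OF finI fin_G, of "\<lambda>x p. snd (dc x) p"] by auto
    have "r w = 0" if w: "w \<in> W" for w
    proof -
      have "(\<Sum>x\<in>W. r x * (fst (dc x) * poly_const (if w = x then 1 else 0))) = r w * fst (dc w)"
        using w fin_G by (simp add: if_distrib [of poly_const] if_distrib [of "\<lambda>c. _ * c"] cong: if_cong)
      moreover have "(\<Sum>x\<in>W. r x * (fst (dc x) * poly_const (if w = x then 1 else 0))) =
          (\<Sum>x\<in>W. r x * (\<Sum>p\<in>I. snd (dc x) p * p w))"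
        using dc w by (intro sum.cong) auto
      moreover have "\<dots> = (\<Sum>p\<in>I. (\<Sum>x\<in>W. r x * snd (dc x) p) * p w)"
        unfolding sum_distrib_left sum_distrib_right by (subst sum.swap) (simp add: mult.assoc)
      moreover have "\<dots> = 0" using r(2) by simp
      ultimately show ?thesis using dc w by simp
    qed
    then show False using r(1) by blast
  qed
qed

end

end

section \<open>The differential system of singular vectors, their degrees, and the even
  basis\<close>

context reflection_action
begin

text \<open>In these coordinates \<open>sig\<close> only translates the index, see
  \<open>ff_sig\<close>. The equations of a singular vector become a first-order system whose
  coefficients are logarithmic derivatives of linear forms times permutations of the index.\<close>

definition ff :: "('w \<Rightarrow> ('v, 'k) mpoly) \<Rightarrow> 'w \<Rightarrow> ('v, 'k) mpoly" where
  "ff p w = act (inv w) (p w)"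

lemma ff_sig: "g \<in> W \<Longrightarrow> w \<in> W \<Longrightarrow> ff (sig g p) w = ff p (inv g \<otimes> w)"
  by (simp add: ff_def sig_def act_act inv_mult_group)

lemma act_inv_refl:
  assumes "s \<in> Rf" "w \<in> W"
  shows "act (inv w) (act s (p (s \<otimes> w))) = ff p (s \<otimes> w)"
  using assms by (simp add: ff_def act_act inv_mult_group Rf_inv)

lemma Sing_comb:
  assumes "\<And>j. j \<in> J \<Longrightarrow> p j \<in> Sing k"
  shows "(\<lambda>w. \<Sum>j\<in>J. poly_const (c j) * p j w) \<in> Sing k"
proof -
  let ?q = "\<lambda>w. \<Sum>j\<in>J. poly_const (c j) * p j w"
  have p: "p j \<in> QC (\<lambda>s. 2 * k s)" if "j \<in> J" for j using assms that by (simp add: Sing_def)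
  have q: "?q \<in> QC (\<lambda>s. 2 * k s)" by (intro QC_sum QC_cmult p)
  moreover have "dunkl k b ?q w = 0" if w: "w \<in> W" for b w
  proof -
    have "of_nat (k s) * (pd b (al s) * rr s ?q w) =
      (\<Sum>j\<in>J. poly_const (c j) * (of_nat (k s) * (pd b (al s) * rr s (p j) w)))" if s: "s \<in> Rf" for s
    proof (cases "k s = 0")
      case False
      have "al s * rr s ?q w = ?q w - sig s ?q w" using rr [OF q s _ w] False by simp
      also have "\<dots> = (\<Sum>j\<in>J. poly_const (c j) * (p j w - sig s (p j) w))"
        using s by (simp add: sig_refl psubst_sum right_diff_distrib sum_subtractf)
      also have "\<dots> = (\<Sum>j\<in>J. poly_const (c j) * (al s * rr s (p j) w))"
        using rr [OF p s _ w] False by simp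
      also have "\<dots> = al s * (\<Sum>j\<in>J. poly_const (c j) * rr s (p j) w)"
        by (simp add: sum_distrib_left mult.left_commute)
      finally have "rr s ?q w = (\<Sum>j\<in>J. poly_const (c j) * rr s (p j) w)"
        using al_nz [OF s] by simp
      then show ?thesis by (simp add: sum_distrib_left mult.left_commute)
    qed simp
    then have "dunkl k b ?q w = (\<Sum>j\<in>J. poly_const (c j) * pd b (p j w)) -
      (\<Sum>s\<in>Rf. \<Sum>j\<in>J. poly_const (c j) * (of_nat (k s) * (pd b (al s) * rr s (p j) w)))"
      by (simp add: dunkl_def pd_sum)
    also have "\<dots> = (\<Sum>j\<in>J. poly_const (c j) * dunkl k b (p j) w)"
      by (subst sum.swap) (simp only: dunkl_def right_diff_distrib sum_subtractf sum_distrib_left)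
    also have "\<dots> = 0" using assms w by (simp add: Sing_def)
    finally show ?thesis .
  qed
  ultimately show ?thesis by (simp add: Sing_def)
qed

lemma Sing_diff:
  assumes "p \<in> Sing k" "q \<in> Sing k" shows "(\<lambda>w. p w - q w) \<in> Sing k"
proof -
  have "(\<lambda>w. \<Sum>j\<in>{True, False}. poly_const (if j then 1 else -1) * (if j then p else q) w) \<in> Sing k"
    by (rule Sing_comb) (use assms in auto)
  then show ?thesis by simp
qed

lemma ff_pd:
  assumes p: "p \<in> Sing k" and w: "w \<in> W"
  shows "pd b (ff p w) = (\<Sum>s\<in>Rf. of_nat (k s) * (pd b (act (inv w) (al s)) * act (inv w) (rr s p w)))"
proof -
  have n: "act g (of_nat n) = of_nat n" for g n
    using psubst_simps(1) [of "hh g" "of_nat n"] by (simp add: poly_const_of_nat)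
  have "pd b (ff p w) = (\<Sum>c\<in>insert b B. pd b (hh (inv w) c) * act (inv w) (pd c (p w)))"
    by (simp add: ff_def pd_act)
  also have "\<dots> = (\<Sum>c\<in>insert b B. \<Sum>s\<in>Rf. of_nat (k s) * (pd b (hh (inv w) c) * act (inv w) (pd c (al s)) * act (inv w) (rr s p w)))"
    unfolding Sing_pd [OF p w] psubst_sum psubst_simps n sum_distrib_left
    by (intro sum.cong HOL.refl) (simp only: ac_simps)
  also have "\<dots> = (\<Sum>s\<in>Rf. of_nat (k s) * (pd b (act (inv w) (al s)) * act (inv w) (rr s p w)))"
    unfolding pd_act [of b "inv w" "al _"]
    by (subst sum.swap) (simp only: sum_distrib_left sum_distrib_right)
  finally show ?thesis .
qed

definition generic_point :: "('v \<Rightarrow> 'k) \<Rightarrow> bool" where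
  "generic_point x \<longleftrightarrow> (\<forall>g\<in>W. \<forall>s\<in>Rf. peval x (act g (al s)) \<noteq> 0)"

lemma ex_generic_point: "\<exists>x. generic_point x"
proof -
  let ?D = "\<Prod>(g, s)\<in>W \<times> Rf. act g (al s)"
  have "?D \<noteq> 0" using fin_G fin_Rf al_nz by (subst mpoly_prod_eq_0) auto
  then obtain x where x: "peval x ?D \<noteq> 0" using ex_nonzero_point by blast
  interpret comm_ring_hom "peval x" by (rule peval_hom)
  have "peval x ?D = (\<Prod>(g, s)\<in>W \<times> Rf. peval x (act g (al s)))"
    by (simp add: hom_prod case_prod_beta)
  then have "(\<Prod>(g, s)\<in>W \<times> Rf. peval x (act g (al s))) \<noteq> 0" using x by simp
  then have "generic_point x"
    using fin_G fin_Rf by (auto simp: generic_point_def prod_zero_iff)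
  then show ?thesis by (rule exI [of generic_point x])
qed

text \<open>In the coordinates \<open>ff p\<close> a singular vector is a solution of a Knizhnik--Zamolodchikov system, hence
  determined by its value at a generic point.\<close>

lemma Sing_eq_0:
  assumes p: "p \<in> Sing k" and x: "generic_point x"
    and 0: "\<And>w. w \<in> W \<Longrightarrow> peval x (ff p w) = 0" and w: "w \<in> W"
  shows "p w = 0"
proof -
  let ?D = "\<Prod>(g, s)\<in>W \<times> Rf. act g (al s)"
  interpret comm_ring_hom "peval x" by (rule peval_hom)
  have "peval x ?D = (\<Prod>(g, s)\<in>W \<times> Rf. peval x (act g (al s)))"
    by (simp add: hom_prod case_prod_beta)
  then have D: "peval x ?D \<noteq> 0" using fin_G fin_Rf x by (auto simp: generic_point_def prod_zero_iff)
  have "?D * pd b (ff p w) \<in> lin_span W (ff p)" if w: "w \<in> W" for w b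
    unfolding ff_pd [OF p w] sum_distrib_left
  proof (rule lin_span_sum)
    fix s assume s: "s \<in> Rf"
    let ?t = "of_nat (k s) * (pd b (act (inv w) (al s)) * act (inv w) (rr s p w))"
    show "?D * ?t \<in> lin_span W (ff p)"
    proof (cases "k s = 0")
      case True
      then show ?thesis by (simp add: lin_span_zero)
    next
      case False
      \<comment> \<open>The denominator of the divided difference occurs among the factors of
        \<open>?D\<close>.\<close>
      have "?D = act (inv w) (al s) * (\<Prod>(g, s)\<in>W \<times> Rf - {(inv w, s)}. act g (al s))"
        using fin_G fin_Rf s w by (subst prod.remove [of _ "(inv w, s)"]) auto
      then obtain E where E: "?D = act (inv w) (al s) * E" by blast
      have "act (inv w) (al s) * act (inv w) (rr s p w) = act (inv w) (p w - sig s p w)"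
        using rr [of p "\<lambda>s. 2 * k s" s w] p s w False by (simp add: Sing_def flip: psubst_simps(6))
      also have "\<dots> = ff p w - ff p (s \<otimes> w)"
        using act_inv_refl [OF s w] s by (simp add: sig_refl ff_def [of p w])
      finally have AR: "act (inv w) (al s) * act (inv w) (rr s p w) = ff p w - ff p (s \<otimes> w)" .
      have "?D * ?t = (of_nat (k s) * pd b (act (inv w) (al s)) * E) *
          (act (inv w) (al s) * act (inv w) (rr s p w))"
        unfolding E by (simp only: ac_simps)
      then have eq: "?D * ?t = (of_nat (k s) * pd b (act (inv w) (al s)) * E) * (ff p w - ff p (s \<otimes> w))"
        unfolding AR .
      have "ff p w - ff p (s \<otimes> w) \<in> lin_span W (ff p)"
        using fin_G s w by (intro lin_span_diff lin_span_base) auto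
      then show ?thesis unfolding eq by (rule lin_span_mult)
    qed
  qed
  then have "ff p w = 0"
    using linear_system_unique [OF fin_G, of ?D "ff p" x w] D 0 w unfolding lin_span_def by blast
  then show ?thesis using w by (simp add: ff_def)
qed

lemma Sing_eqI:
  assumes "p \<in> Sing k" "q \<in> Sing k" "generic_point x"
    and "\<And>w. w \<in> W \<Longrightarrow> peval x (ff p w) = peval x (ff q w)" "w \<in> W"
  shows "p w = q w"
  using Sing_eq_0 [OF Sing_diff [OF assms(1,2)] assms(3) _ assms(5)] assms(4) by (simp add: ff_def)

text \<open>Contract the equations with the Euler vector field: \<open>al s\<close> has degree one,
  so its contraction is \<open>al s\<close> again and cancels the denominator of
  \<open>rr s\<close>. The degree becomes an eigenvalue of a constant matrix, the sum of
  \<open>k s\<close> times identity minus left translation by \<open>s\<close>.\<close>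

lemma Sing_euler:
  assumes p: "p \<in> Sing k" and h: "homogF d p" and w: "w \<in> W"
  shows "of_nat d * ff p w = (\<Sum>s\<in>Rf. of_nat (k s) * (ff p w - ff p (s \<otimes> w)))"
proof -
  obtain X where X: "finite X" "p w \<in> PV X" using ex_finite_PV by blast
  let ?F = "X \<union> B"
  have F: "finite ?F" using X fin_B by simp
  have alF: "al s \<in> PV ?F" if "s \<in> Rf" for s using al_PV [OF that] PV_mono [of B ?F] by blast
  have pF: "p w \<in> PV ?F" using X(2) PV_mono [of X ?F] by blast
  have "of_nat d * p w = (\<Sum>b\<in>?F. pvar b * pd b (p w))"
    by (rule euler_identity [OF _ F pF, symmetric]) (use h w in \<open>simp add: homogF_def\<close>)
  also have "\<dots> = (\<Sum>b\<in>?F. \<Sum>s\<in>Rf. of_nat (k s) * (pvar b * pd b (al s)) * rr s p w)"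
    unfolding Sing_pd [OF p w] sum_distrib_left by (intro sum.cong HOL.refl) (simp only: ac_simps)
  also have "\<dots> = (\<Sum>s\<in>Rf. of_nat (k s) * (\<Sum>b\<in>?F. pvar b * pd b (al s)) * rr s p w)"
    by (subst sum.swap) (simp only: sum_distrib_left sum_distrib_right)
  also have "\<dots> = (\<Sum>s\<in>Rf. of_nat (k s) * (al s * rr s p w))"
    using euler_identity [OF al_homog F alF] by (intro sum.cong HOL.refl) (simp add: mult.assoc)
  also have "\<dots> = (\<Sum>s\<in>Rf. of_nat (k s) * (p w - sig s p w))"
  proof (rule sum.cong [OF HOL.refl])
    fix s assume s: "s \<in> Rf"
    show "of_nat (k s) * (al s * rr s p w) = of_nat (k s) * (p w - sig s p w)"
      using rr [of p "\<lambda>s. 2 * k s" s w] p s w by (cases "k s = 0") (auto simp: Sing_def)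
  qed
  finally have "act (inv w) (of_nat d * p w) = act (inv w) (\<Sum>s\<in>Rf. of_nat (k s) * (p w - sig s p w))"
    by simp
  moreover have n: "act g (of_nat n) = of_nat n" for g n
    using psubst_simps(1) [of "hh g" "of_nat n"] by (simp add: poly_const_of_nat)
  ultimately have "of_nat d * ff p w = (\<Sum>s\<in>Rf. of_nat (k s) * (act (inv w) (p w) - act (inv w) (sig s p w)))"
    by (simp add: psubst_sum ff_def)
  also have "\<dots> = (\<Sum>s\<in>Rf. of_nat (k s) * (ff p w - ff p (s \<otimes> w)))"
    using act_inv_refl [OF _ w] by (intro sum.cong HOL.refl) (simp add: sig_refl ff_def [of p w])
  finally show ?thesis .
qed

text \<open>Saito's criterion: rows indexed by \<open>w\<close> and \<open>s \<otimes> w\<close> agree modulo \<open>al s ^ (2 * k s)\<close>.\<close>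

lemma QC_det_dvd:
  assumes ix: "bij_betw ix {..<card W} W"
    and p: "\<And>j. j < card W \<Longrightarrow> p j \<in> QC (\<lambda>s. 2 * k s)"
  shows "(\<Prod>s\<in>Rf. al s ^ (card W * k s)) dvd dt (card W) (\<lambda>i j. p j (ix i))"
proof (rule linear_forms_prod_dvd [OF fin_Rf])
  fix s assume s: "s \<in> Rf"
  let ?n = "card W"
  have ixG: "ix i \<in> W" if "i < ?n" for i using ix that by (auto simp: bij_betw_def)
  define r where "r i = the_inv_into {..<?n} ix (s \<otimes> ix i)" for i
  have r: "r i < ?n" "ix (r i) = s \<otimes> ix i" if "i < ?n" for i
  proof -
    have "s \<otimes> ix i \<in> ix ` {..<?n}" using ix ixG [OF that] s by (simp add: bij_betw_def)
    then show "r i < ?n" "ix (r i) = s \<otimes> ix i"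
      unfolding r_def using the_inv_into_into [of ix "{..<?n}" _ "{..<?n}"] f_the_inv_into_f [of ix "{..<?n}"] ix
      by (auto simp: bij_betw_def)
  qed
  have ix_inj: "ix i = ix j \<longleftrightarrow> i = j" if "i < ?n" "j < ?n" for i j
    using ix that by (auto simp: bij_betw_def inj_on_def)
  have rr: "r (r i) = i" if "i < ?n" for i
    using ix_inj [of "r (r i)" i] r that s ixG by simp
  have ne: "r i \<noteq> i" if "i < ?n" for i
    using r(2) [OF that] Rf_mult_neq [OF s ixG [OF that]] by metis
  \<comment> \<open>One index from each pair exchanged by \<open>s\<close>. No index is fixed, so
    \<open>T\<close> contains half of them, and an exponent \<open>2 * k s\<close> per pair adds up
    to \<open>card W * k s\<close>.\<close>
  define T where "T = {i. i < ?n \<and> i < r i}"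
  have T: "finite T" "T \<subseteq> {..<?n}" by (auto simp: T_def)
  have rT: "r i < ?n \<and> r i \<notin> T" if "i \<in> T" for i
    using that r rr by (auto simp: T_def)
  have un: "{..<?n} = T \<union> r ` T"
  proof
    show "{..<?n} \<subseteq> T \<union> r ` T"
    proof
      fix i assume "i \<in> {..<?n}"
      then have i: "i < ?n" by simp
      show "i \<in> T \<union> r ` T"
      proof (cases "i < r i")
        case False
        then have "r i \<in> T" using i ne [OF i] r(1) [OF i] rr [OF i] by (auto simp: T_def)
        then show ?thesis using rr [OF i] by (metis UnI2 image_eqI)
      qed (simp add: T_def i)
    qed
  qed (use T rT in auto)
  have "inj_on r T" by (rule inj_on_inverseI [where g = r]) (use rr T in auto)
  then have cT: "?n = 2 * card T"
    using arg_cong [OF un, of card] T rT by (subst (asm) card_Un_disjoint) (auto simp: card_image)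
  have "(al s ^ (2 * k s)) ^ card T dvd dt ?n (\<lambda>i j. p j (ix i))"
  proof (rule dt_paired_rows_dvd [OF T rT])
    show "al s ^ (2 * k s) dvd p j (ix i) - p j (ix (r i))" if "i \<in> T" "j < ?n" for i j
      using QC_D [OF p [OF that(2)] s ixG, of i] r(2) [of i] that T by auto
  qed
  also have "(al s ^ (2 * k s)) ^ card T = al s ^ (?n * k s)"
    by (simp add: cT power_mult [symmetric] ac_simps)
  finally show "al s ^ (?n * k s) dvd dt ?n (\<lambda>i j. p j (ix i))" .
qed (use al_homog al_nz al_distinct in auto)

text \<open>Coefficients range over the whole polynomial type and vectors are compared on
  \<open>W\<close>; \<open>quasi_basis_retract\<close> brings the coefficients into
  \<open>PV B\<close>.\<close>

definition is_basis :: "('w \<Rightarrow> ('v, 'k) mpoly) set \<Rightarrow> 'j set \<Rightarrow> ('j \<Rightarrow> 'w \<Rightarrow> ('v, 'k) mpoly) \<Rightarrow> bool" where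
  "is_basis M J e \<longleftrightarrow> finite J \<and> (\<forall>j\<in>J. e j \<in> M) \<and>
     (\<forall>p\<in>M. \<exists>q. \<forall>w\<in>W. p w = (\<Sum>j\<in>J. q j * e j w)) \<and>
     (\<forall>q. (\<forall>w\<in>W. (\<Sum>j\<in>J. q j * e j w) = 0) \<longrightarrow> (\<forall>j\<in>J. q j = 0))"

lemma spanning_is_basis:
  assumes J: "finite J" "card J = card W" and e: "\<And>j. j \<in> J \<Longrightarrow> e j \<in> QC m"
    and span: "\<And>p. p \<in> QC m \<Longrightarrow> \<exists>q. \<forall>w\<in>W. p w = (\<Sum>j\<in>J. q j * e j w)"
  shows "is_basis (QC m) J e"
proof -
  have "q g = 0" if q: "\<forall>w\<in>W. (\<Sum>j\<in>J. q j * e j w) = 0" and g: "g \<in> J" for q g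
  proof (rule spanning_independent [OF fin_G J(1,2), where d = "\<lambda>x. QCgen m" and e = e])
    fix x assume "x \<in> W"
    obtain c where c: "\<forall>w\<in>W. QCgen m * (if w = x then 1 else 0) = (\<Sum>j\<in>J. c j * e j w)"
      using span [OF QCgen_QC [of m "\<lambda>w. if w = x then 1 else 0"]] by blast
    have "(\<Sum>j\<in>J. c j * e j w) = (if w = x then QCgen m else 0)" if "w \<in> W" for w
      using c [rule_format, OF that] by (cases "w = x") auto
    then show "QCgen m \<noteq> 0 \<and> (\<exists>c. \<forall>w\<in>W. (\<Sum>j\<in>J. c j * e j w) = (if w = x then QCgen m else 0))"
      by (intro conjI QCgen_nz exI [of _ c] ballI)
  qed (use q g in auto)
  then show ?thesis using J e span unfolding is_basis_def by blast
qed

text \<open>The second clause is for the odd case: since \<open>sig\<close> merely permutes the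
  basis, the action of a reflection on coordinates is explicit.\<close>

theorem even_basis:
  assumes k: "conj_inv k"
  shows "\<exists>e. is_basis (QC (\<lambda>s. 2 * k s)) W e \<and>
    (\<forall>g\<in>W. \<forall>h\<in>W. \<forall>w\<in>W. sig h (e g) w = e (h \<otimes> g) w)"
proof -
  let ?n = "card W" and ?M = "QC (\<lambda>s. 2 * k s)"
  obtain I where I: "maximal_indep k I" using ex_maximal_indep by blast
  have cI: "card I = ?n" by (rule card_maximal_indep [OF k I])
  have finI: "finite I" using I by (simp add: maximal_indep_def indep_def)
  obtain ix where ix: "bij_betw ix {..<?n} W"
    using ex_bij_betw_nat_finite [OF fin_G] by (auto simp: atLeast0LessThan)
  obtain h where h: "bij_betw h {..<?n} I"
    using ex_bij_betw_nat_finite [OF finI] cI by (auto simp: atLeast0LessThan)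
  have ixG: "ix i \<in> W" if "i < ?n" for i using ix that by (auto simp: bij_betw_def)
  define jx where "jx = the_inv_into {..<?n} ix"
  have jx: "jx w < ?n" "ix (jx w) = w" if "w \<in> W" for w
  proof -
    have "w \<in> ix ` {..<?n}" using ix that by (simp add: bij_betw_def)
    then show "jx w < ?n" "ix (jx w) = w"
      unfolding jx_def using the_inv_into_into [of ix "{..<?n}" _ "{..<?n}"] f_the_inv_into_f [of ix "{..<?n}"] ix
      by (auto simp: bij_betw_def)
  qed
  have jx_ix: "jx (ix i) = i" if "i < ?n" for i
    unfolding jx_def using the_inv_into_f_f [of ix "{..<?n}" i] ix that by (auto simp: bij_betw_def)
  have ix_inj: "ix i = ix j \<longleftrightarrow> i = j" if "i < ?n" "j < ?n" for i j
    using ix that by (auto simp: bij_betw_def inj_on_def)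
  have hH: "h j \<in> HSing k" if "j < ?n" for j
    using h I that by (auto simp: bij_betw_def maximal_indep_def)
  then have hS: "h j \<in> Sing k" if "j < ?n" for j using that by (auto simp: HSing_def)
  have hM: "h j \<in> ?M" if "j < ?n" for j using hS [OF that] by (auto simp: Sing_def)
  have "\<forall>j\<in>{..<?n}. \<exists>d. homogF d (h j)" using hH by (auto simp: HSing_def)
  then obtain dg where dg: "\<forall>j\<in>{..<?n}. homogF (dg j) (h j)" by (rule bchoice [THEN exE])
  have sumI: "(\<Sum>p\<in>I. f p) = (\<Sum>j<?n. f (h j))" for f :: "_ \<Rightarrow> ('v, 'k) mpoly"
    by (rule sum.reindex_bij_betw [OF h, symmetric])
  obtain x where x: "generic_point x" using ex_generic_point by blast
  interpret ev: comm_ring_hom "peval x" by (rule peval_hom)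
  define F where "F i j = ff (h j) (ix i)" for i j
  define F0 where "F0 i j = peval x (F i j)" for i j
  \<comment> \<open>A kernel vector would give a constant combination of the \<open>h j\<close> that
    is singular and vanishes at \<open>x\<close> in the coordinates \<open>ff\<close>. It is then
    zero on \<open>W\<close>, against independence.\<close>
  have F0: "dt ?n F0 \<noteq> 0"
  proof
    assume "dt ?n F0 = 0"
    then obtain v where v: "\<exists>j<?n. v j \<noteq> 0" "\<forall>i<?n. (\<Sum>j<?n. F0 i j * v j) = 0"
      using dt_eq_0_kernel by blast
    define p where "p w = (\<Sum>j<?n. poly_const (v j) * h j w)" for w
    have pS: "p \<in> Sing k" unfolding p_def [abs_def] by (rule Sing_comb) (simp add: hS)
    have "peval x (ff p w) = 0" if w: "w \<in> W" for w
    proof -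
      have "peval x (ff p w) = (\<Sum>j<?n. F0 (jx w) j * v j)"
        using jx(2) [OF w] by (simp add: ff_def p_def psubst_sum ev.hom_sum F0_def F_def mult.commute)
      then show ?thesis using v(2) jx(1) [OF w] by simp
    qed
    then have "p w = 0" if "w \<in> W" for w using Sing_eq_0 [OF pS x _ that] by blast
    define u where "u q = (poly_const (v (the_inv_into {..<?n} h q)) :: ('v, 'k) mpoly)" for q
    have "(\<Sum>q\<in>I. u q * q w) = 0" if "w \<in> W" for w
      using \<open>\<And>w. w \<in> W \<Longrightarrow> p w = 0\<close> [OF that] h
      by (simp add: sumI p_def u_def bij_betw_def the_inv_into_f_f)
    then have "\<forall>q\<in>I. u q = 0" using I [unfolded maximal_indep_def indep_def] by simp
    then have "v j = 0" if "j < ?n" for j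
      using h that by (auto simp: bij_betw_def the_inv_into_f_f u_def)
    then show False using v(1) by blast
  qed
  have dtF: "dt ?n F0 = peval x (dt ?n F)"
    unfolding F0_def by (rule dt_hom) (rule peval_hom)
  then have F: "dt ?n F \<noteq> 0" using F0 by auto
  \<comment> \<open>The trace of the Euler relation, computed with the adjugate of \<open>F\<close>:
    one side is the sum of the degrees, and on the other each identity-minus-translation has trace
    \<open>?n\<close> because a reflection fixes no index.\<close>
  have degs: "(\<Sum>j<?n. dg j) = ?n * (\<Sum>s\<in>Rf. k s)"
  proof -
    obtain a where a: "\<forall>i<?n. \<forall>i'<?n. (\<Sum>j<?n. F i j * a j i') = (if i = i' then dt ?n F else 0)"
      "\<forall>j<?n. \<forall>j'<?n. (\<Sum>i<?n. a j i * F i j') = (if j = j' then dt ?n F else 0)"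
      using dt_adjugate [of ?n F] by (elim exE conjE)
    have e: "of_nat (dg j) * F i j = (\<Sum>s\<in>Rf. of_nat (k s) * (F i j - F (jx (s \<otimes> ix i)) j))"
      if "i < ?n" "j < ?n" for i j
      using Sing_euler [OF hS [OF that(2)] _ ixG [OF that(1)], of "dg j"] dg that ixG jx(2) by (simp add: F_def)
    have "of_nat (\<Sum>j<?n. dg j) * dt ?n F = (\<Sum>j<?n. of_nat (dg j) * (\<Sum>i<?n. a j i * F i j))"
      using a(2) by (simp add: sum_distrib_right)
    also have "\<dots> = (\<Sum>j<?n. \<Sum>i<?n. a j i * (of_nat (dg j) * F i j))"
      by (simp only: sum_distrib_left mult.left_commute)
    also have "\<dots> = (\<Sum>j<?n. \<Sum>i<?n. \<Sum>s\<in>Rf. of_nat (k s) * (F i j * a j i - F (jx (s \<otimes> ix i)) j * a j i))"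
    proof (intro sum.cong HOL.refl)
      fix j i assume "j \<in> {..<?n}" "i \<in> {..<?n}"
      then have "a j i * (of_nat (dg j) * F i j) =
          a j i * (\<Sum>s\<in>Rf. of_nat (k s) * (F i j - F (jx (s \<otimes> ix i)) j))" by (simp add: e)
      then show "a j i * (of_nat (dg j) * F i j) =
          (\<Sum>s\<in>Rf. of_nat (k s) * (F i j * a j i - F (jx (s \<otimes> ix i)) j * a j i))"
        by (simp add: sum_distrib_left algebra_simps)
    qed
    also have "\<dots> = (\<Sum>i<?n. \<Sum>j<?n. \<Sum>s\<in>Rf. of_nat (k s) * (F i j * a j i - F (jx (s \<otimes> ix i)) j * a j i))"
      by (rule sum.swap)
    also have "\<dots> = (\<Sum>i<?n. \<Sum>s\<in>Rf. \<Sum>j<?n. of_nat (k s) * (F i j * a j i - F (jx (s \<otimes> ix i)) j * a j i))"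
      by (rule sum.cong [OF HOL.refl]) (rule sum.swap)
    also have "\<dots> = (\<Sum>i<?n. \<Sum>s\<in>Rf. of_nat (k s) * dt ?n F)"
    proof (intro sum.cong HOL.refl)
      fix i s assume i: "i \<in> {..<?n}" and s: "s \<in> Rf"
      let ?i = "jx (s \<otimes> ix i)"
      have "?i < ?n" "?i \<noteq> i" using jx [of "s \<otimes> ix i"] s i ixG Rf_mult_neq [OF s, of "ix i"] by auto
      then have "(\<Sum>j<?n. F i j * a j i) - (\<Sum>j<?n. F ?i j * a j i) = dt ?n F" using a(1) i by simp
      then show "(\<Sum>j<?n. of_nat (k s) * (F i j * a j i - F ?i j * a j i)) = of_nat (k s) * dt ?n F"
        by (simp add: sum_distrib_left [symmetric] sum_subtractf)
    qed
    also have "\<dots> = of_nat (?n * (\<Sum>s\<in>Rf. k s)) * dt ?n F"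
      by (simp add: sum_distrib_right mult.assoc)
    finally have "dt ?n F = 0 \<or> of_nat (\<Sum>j<?n. dg j) = (of_nat (?n * (\<Sum>s\<in>Rf. k s)) :: ('v, 'k) mpoly)"
      by (simp only: mpoly_mult_cancel)
    then have "of_nat (\<Sum>j<?n. dg j) = (of_nat (?n * (\<Sum>s\<in>Rf. k s)) :: ('v, 'k) mpoly)"
      using F by blast
    then show ?thesis by (simp only: of_nat_eq_iff)
  qed
  define H where "H i j = h j (ix i)" for i j
  have "\<forall>y\<in>W. \<exists>dc. fst dc \<noteq> 0 \<and>
      (\<forall>w\<in>W. fst dc * poly_const (if w = y then 1 else 0) = (\<Sum>p\<in>I. snd dc p * p w))"
  proof
    fix y assume "y \<in> W"
    then have "(\<lambda>w. poly_const (if w = y then 1 else 0)) \<in> satspan I"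
      using indicator_constU [OF k I] by (simp add: constU_def [OF k I])
    then obtain d c where "d \<noteq> 0" "\<forall>w\<in>W. d * poly_const (if w = y then 1 else 0) = (\<Sum>p\<in>I. c p * p w)"
      unfolding satspan_def mem_Collect_eq by (elim exE conjE)
    then show "\<exists>dc. fst dc \<noteq> 0 \<and>
        (\<forall>w\<in>W. fst dc * poly_const (if w = y then 1 else 0) = (\<Sum>p\<in>I. snd dc p * p w))"
      by (intro exI [of _ "(d, c)"]) simp
  qed
  then obtain dc where dc: "\<forall>y\<in>W. fst (dc y) \<noteq> 0 \<and>
      (\<forall>w\<in>W. fst (dc y) * poly_const (if w = y then 1 else 0) = (\<Sum>p\<in>I. snd (dc y) p * p w))"
    by (rule bchoice [THEN exE])
  have "(\<Sum>l<?n. H i l * snd (dc (ix j)) (h l)) = (if i = j then fst (dc (ix i)) else 0)" if "i < ?n" "j < ?n" for i j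
  proof -
    have dcj: "\<forall>w\<in>W. fst (dc (ix j)) * poly_const (if w = ix j then 1 else 0) =
        (\<Sum>p\<in>I. snd (dc (ix j)) p * p w)"
      using dc ixG [OF that(2)] by blast
    have "(\<Sum>l<?n. H i l * snd (dc (ix j)) (h l)) = (\<Sum>p\<in>I. snd (dc (ix j)) p * p (ix i))"
      by (simp add: sumI H_def mult.commute)
    also have "\<dots> = fst (dc (ix j)) * poly_const (if ix i = ix j then 1 else 0)"
      by (rule dcj [THEN bspec, OF ixG [OF that(1)], THEN HOL.sym])
    finally show ?thesis using ix_inj [OF that] by simp
  qed
  then have "dt ?n H * dt ?n (\<lambda>l j. snd (dc (ix j)) (h l)) = (\<Prod>i<?n. fst (dc (ix i)))"
    by (rule dt_product_diagonal)
  moreover have "(\<Prod>i<?n. fst (dc (ix i))) \<noteq> 0" using dc ixG by (simp add: mpoly_prod_eq_0)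
  ultimately have H0: "dt ?n H \<noteq> 0" by auto
  define DD where "DD = (\<Prod>s\<in>Rf. al s ^ (?n * k s))"
  have D0: "DD \<noteq> 0" using al_nz fin_Rf by (simp add: DD_def mpoly_prod_eq_0)
  obtain z where z: "dt ?n H = DD * z"
    using QC_det_dvd [OF ix, of h k] hM unfolding H_def dvd_def DD_def by blast
  \<comment> \<open>By \<open>degs\<close> the determinant and its divisor \<open>DD\<close> have
    the same degree.\<close>
  have "homog 0 z"
  proof (rule homog_cancel [OF _ _ D0])
    have "homog (\<Sum>s\<in>Rf. (?n * k s) * 1) DD" unfolding DD_def by (intro homog_prod homog_power) (simp add: al_homog)
    moreover have "(\<Sum>s\<in>Rf. (?n * k s) * 1) = (\<Sum>j<?n. dg j)" by (simp add: degs sum_distrib_left)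
    ultimately show "homog (\<Sum>j<?n. dg j) DD" by simp
    have "homog (\<Sum>j<?n. dg j) (dt ?n H)"
      by (rule dt_homog) (use dg ixG in \<open>auto simp: H_def homogF_def\<close>)
    then show "homog ((\<Sum>j<?n. dg j) + 0) (DD * z)" by (simp add: z)
  qed
  then obtain c where c: "z = poly_const c" using homog_zero_const by blast
  have c0: "c \<noteq> 0" using H0 z c by auto
  \<comment> \<open>Cramer's rule: putting a quasi-covariant into a column keeps divisibility by
    \<open>DD\<close>, and \<open>DD\<close> is the determinant up to a nonzero constant, so the
    coordinates are polynomials.\<close>
  have hspan: "\<exists>q. \<forall>w\<in>W. p w = (\<Sum>j<?n. q j * h j w)" if p: "p \<in> ?M" for p
  proof -
    obtain a where a: "\<forall>i<?n. \<forall>i'<?n. (\<Sum>j<?n. H i j * a j i') = (if i = i' then dt ?n H else 0)"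
      "\<forall>j<?n. \<forall>b. (\<Sum>i<?n. a j i * b i) = dt ?n (\<lambda>i j'. if j' = j then b i else H i j')"
      using dt_adjugate [of ?n H] by (elim exE conjE)
    have "\<forall>j\<in>{..<?n}. \<exists>z. (\<Sum>i<?n. a j i * p (ix i)) = DD * z"
    proof
      fix j assume j: "j \<in> {..<?n}"
      have "DD dvd dt ?n (\<lambda>i j'. (if j' = j then p else h j') (ix i))"
        unfolding DD_def by (rule QC_det_dvd [OF ix]) (use p hM in auto)
      also have "(\<lambda>i j'. (if j' = j then p else h j') (ix i)) = (\<lambda>i j'. if j' = j then p (ix i) else H i j')"
        by (auto simp: fun_eq_iff H_def)
      also have "dt ?n \<dots> = (\<Sum>i<?n. a j i * p (ix i))" using a(2) j by simp
      finally show "\<exists>z. (\<Sum>i<?n. a j i * p (ix i)) = DD * z" by (simp add: dvd_def)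
    qed
    then obtain y where y: "\<forall>j\<in>{..<?n}. (\<Sum>i<?n. a j i * p (ix i)) = DD * y j" by (rule bchoice [THEN exE])
    have "p w = (\<Sum>j<?n. (poly_const (1 / c) * y j) * h j w)" if w: "w \<in> W" for w
    proof -
      let ?i = "jx w"
      have i: "?i < ?n" "ix ?i = w" using jx [OF w] by auto
      have "DD * (\<Sum>j<?n. y j * h j w) = (\<Sum>j<?n. H ?i j * (DD * y j))"
        by (simp add: sum_distrib_left H_def i algebra_simps)
      also have "\<dots> = (\<Sum>j<?n. H ?i j * (\<Sum>i'<?n. a j i' * p (ix i')))" using y by simp
      also have "\<dots> = (\<Sum>i'<?n. (\<Sum>j<?n. H ?i j * a j i') * p (ix i'))"
        unfolding sum_distrib_left sum_distrib_right by (subst sum.swap) (simp only: mult.assoc)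
      also have "\<dots> = (\<Sum>i'<?n. if ?i = i' then dt ?n H * p (ix i') else 0)"
        using a(1) i by (intro sum.cong HOL.refl) simp
      also have "\<dots> = DD * (poly_const c * p w)" using i by (simp add: z c)
      finally have "DD = 0 \<or> (\<Sum>j<?n. y j * h j w) = poly_const c * p w" by (simp only: mpoly_mult_cancel)
      then have "(\<Sum>j<?n. y j * h j w) = poly_const c * p w" using D0 by blast
      then have "poly_const (1 / c) * (\<Sum>j<?n. y j * h j w) = p w"
        using c0 by (simp add: mult.assoc [symmetric] poly_const_mult [symmetric])
      then show ?thesis by (simp add: sum_distrib_left mult.assoc)
    qed
    then show ?thesis by (intro exI [of _ "\<lambda>j. poly_const (1 / c) * y j"]) blast
  qed
  obtain b where b: "\<forall>i<?n. \<forall>i'<?n. (\<Sum>j<?n. F0 i j * b j i') = (if i = i' then dt ?n F0 else 0)"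
    using dt_adjugate [of ?n F0] by (elim exE conjE)
  \<comment> \<open>A constant change of basis by the inverse of \<open>F0\<close>: at the point
    \<open>x\<close>, the coordinates \<open>ff\<close> of \<open>e g\<close> form the indicator of
    \<open>g\<close>.\<close>
  define e where "e g w = (\<Sum>j<?n. poly_const (b j (jx g) / dt ?n F0) * h j w)" for g w
  have eS: "e g \<in> Sing k" for g
    unfolding e_def [abs_def] by (rule Sing_comb) (simp add: hS)
  have ee: "peval x (ff (e g) w) = (if w = g then 1 else 0)" if "g \<in> W" "w \<in> W" for g w
  proof -
    have "peval x (ff (e g) w) = (\<Sum>j<?n. F0 (jx w) j * b j (jx g)) / dt ?n F0"
      using jx(2) [OF that(2)]
      by (simp add: ff_def e_def psubst_sum ev.hom_sum F0_def F_def sum_divide_distrib mult.commute)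
    also have "\<dots> = (if jx w = jx g then 1 else 0)" using b jx that F0 by simp
    also have "jx w = jx g \<longleftrightarrow> w = g" using jx that by metis
    finally show ?thesis .
  qed
  have he: "h j w = (\<Sum>g\<in>W. poly_const (F0 (jx g) j) * e g w)" if "j < ?n" "w \<in> W" for j w
  proof (rule Sing_eqI [OF hS [OF that(1)] _ x _ that(2)])
    show "(\<lambda>w. \<Sum>g\<in>W. poly_const (F0 (jx g) j) * e g w) \<in> Sing k"
      by (rule Sing_comb) (simp add: eS)
    fix w assume w: "w \<in> W"
    have "peval x (ff (\<lambda>w. \<Sum>g\<in>W. poly_const (F0 (jx g) j) * e g w) w) =
      (\<Sum>g\<in>W. F0 (jx g) j * peval x (ff (e g) w))"
      by (simp add: ff_def psubst_sum ev.hom_sum)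
    also have "\<dots> = (\<Sum>g\<in>W. if w = g then F0 (jx g) j else 0)"
      using w by (intro sum.cong HOL.refl) (simp add: ee)
    also have "\<dots> = peval x (ff (h j) w)" using w fin_G jx(2) [OF w] by (simp add: F0_def F_def)
    finally show "peval x (ff (h j) w) = peval x (ff (\<lambda>w. \<Sum>g\<in>W. poly_const (F0 (jx g) j) * e g w) w)"
      by simp
  qed
  have "is_basis ?M W e"
  proof (rule spanning_is_basis [OF fin_G HOL.refl])
    show "e g \<in> ?M" for g using eS by (auto simp: Sing_def)
    fix p assume "p \<in> ?M"
    then obtain q where q: "\<forall>w\<in>W. p w = (\<Sum>j<?n. q j * h j w)" using hspan by blast
    have "p w = (\<Sum>g\<in>W. (\<Sum>j<?n. q j * poly_const (F0 (jx g) j)) * e g w)" if w: "w \<in> W" for w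
    proof -
      have "p w = (\<Sum>j<?n. q j * (\<Sum>g\<in>W. poly_const (F0 (jx g) j) * e g w))"
        using q w he by simp
      also have "\<dots> = (\<Sum>g\<in>W. (\<Sum>j<?n. q j * poly_const (F0 (jx g) j)) * e g w)"
        unfolding sum_distrib_left sum_distrib_right by (subst sum.swap) (simp only: mult.assoc)
      finally show ?thesis .
    qed
    then show "\<exists>q. \<forall>w\<in>W. p w = (\<Sum>g\<in>W. q g * e g w)"
      by (intro exI [of _ "\<lambda>g. \<Sum>j<?n. q j * poly_const (F0 (jx g) j)"]) blast
  qed
  \<comment> \<open>Both sides are singular, and they agree at \<open>x\<close> because
    \<open>sig\<close> translates the index of \<open>ff\<close>.\<close>
  moreover have "sig u (e g) w = e (u \<otimes> g) w"
    if g: "g \<in> W" and u: "u \<in> W" and w: "w \<in> W" for g u w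
  proof (rule Sing_eqI [OF Sing_sig [OF k eS u] eS x _ w])
    fix w assume w: "w \<in> W"
    have "inv u \<otimes> w = g \<longleftrightarrow> w = u \<otimes> g"
      using g u w by (metis inv_closed inv_solve_left m_closed)
    then show "peval x (ff (sig u (e g)) w) = peval x (ff (e (u \<otimes> g)) w)"
      using g u w by (simp add: ff_sig ee)
  qed
  ultimately show ?thesis by blast
qed

end

section \<open>Multiplicity one\<close>

context reflection_action
begin

text \<open>Two counts of dependence: more than \<open>card W\<close> vectors with
  \<open>card W\<close> entries satisfy a relation, and fewer cannot express \<open>QCgen\<close>
  times every indicator.\<close>

lemma basis_card:
  assumes "is_basis (QC m) J e" shows "card J = card W"
proof (rule antisym)
  have J: "finite J" and span: "\<And>p. p \<in> QC m \<Longrightarrow> \<exists>q. \<forall>w\<in>W. p w = (\<Sum>j\<in>J. q j * e j w)"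
    and ind: "\<And>q. \<forall>w\<in>W. (\<Sum>j\<in>J. q j * e j w) = 0 \<Longrightarrow> \<forall>j\<in>J. q j = 0"
    using assms by (auto simp: is_basis_def)
  show "card J \<le> card W"
  proof (rule ccontr)
    assume "\<not> ?thesis"
    then obtain r where "\<exists>j\<in>J. r j \<noteq> 0" "\<forall>w\<in>W. (\<Sum>j\<in>J. r j * e j w) = 0"
      using mpoly_dependent [OF fin_G J, of e] by (auto simp: not_le)
    then show False using ind by blast
  qed
  have "\<forall>x\<in>W. \<exists>c. \<forall>w\<in>W. QCgen m * (if w = x then 1 else 0) = (\<Sum>j\<in>J. c j * e j w)"
  proof
    fix x
    show "\<exists>c. \<forall>w\<in>W. QCgen m * (if w = x then 1 else 0) = (\<Sum>j\<in>J. c j * e j w)"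
      by (rule span [OF QCgen_QC])
  qed
  then obtain c where c: "\<forall>x\<in>W. \<forall>w\<in>W. QCgen m * (if w = x then 1 else 0) = (\<Sum>j\<in>J. c x j * e j w)"
    by (rule bchoice [THEN exE])
  show "card W \<le> card J"
  proof (rule ccontr)
    assume "\<not> ?thesis"
    then obtain r where r: "\<exists>x\<in>W. r x \<noteq> 0" "\<forall>j\<in>J. (\<Sum>x\<in>W. r x * c x j) = 0"
      using mpoly_dependent [OF J fin_G, of c] by (auto simp: not_le)
    have "r w = 0" if w: "w \<in> W" for w
    proof -
      have "r w * QCgen m = (\<Sum>x\<in>W. r x * (QCgen m * (if w = x then 1 else 0)))"
        using w fin_G by (simp add: if_distrib [of "\<lambda>c. _ * c"] cong: if_cong)
      also have "\<dots> = (\<Sum>x\<in>W. r x * (\<Sum>j\<in>J. c x j * e j w))"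
        using c w by (intro sum.cong) auto
      also have "\<dots> = (\<Sum>j\<in>J. (\<Sum>x\<in>W. r x * c x j) * e j w)"
        unfolding sum_distrib_left sum_distrib_right by (subst sum.swap) (simp only: mult.assoc)
      also have "\<dots> = 0" using r(2) by simp
      finally show ?thesis using QCgen_nz by simp
    qed
    then show False using r(1) by blast
  qed
qed

subsection \<open>Chevalley's theorem\<close>

definition invs :: "('v, 'k) mpoly set" where
  "invs = {p. \<forall>g\<in>W. act g p = p}"

lemma invsD: "p \<in> invs \<Longrightarrow> g \<in> W \<Longrightarrow> act g p = p"
  by (simp add: invs_def)

lemma invs_mult: "p \<in> invs \<Longrightarrow> q \<in> invs \<Longrightarrow> p * q \<in> invs" by (simp add: invs_def)
lemma invs_add: "p \<in> invs \<Longrightarrow> q \<in> invs \<Longrightarrow> p + q \<in> invs" by (simp add: invs_def)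
lemma invs_const: "poly_const c \<in> invs" by (simp add: invs_def)
lemma invs_0: "0 \<in> invs" by (simp add: invs_def)

lemma act_hc: "act g (hc d p) = hc d (act g p)"
proof -
  obtain n where n: "\<forall>d>n. hc d p = 0" using hc_bound by blast
  have h: "hc d (act g (hc i p)) = (if d = i then act g (hc i p) else 0)" for i
    by (rule hc_homog) (rule act_homog [OF homog_hc])
  have "hc d (act g p) = (\<Sum>i\<le>n. hc d (act g (hc i p)))"
    by (subst sum_hc [OF n]) (simp add: psubst_sum hc_sum)
  also have "\<dots> = act g (hc d p)" using n by (auto simp: h not_le)
  finally show ?thesis ..
qed

lemma invs_hc: "p \<in> invs \<Longrightarrow> hc d p \<in> invs" by (simp add: invs_def act_hc)

definition reyn :: "('v, 'k) mpoly \<Rightarrow> ('v, 'k) mpoly" where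
  "reyn p = poly_const (1 / of_nat (card W)) * (\<Sum>g\<in>W. act g p)"

lemma card_G_nz: "(of_nat (card W) :: 'k) \<noteq> 0"
  using fin_G one_closed by (auto simp: card_eq_0_iff)

lemma act_sum_invs: "(\<Sum>g\<in>W. act g p) \<in> invs"
  unfolding invs_def
proof clarify
  fix h assume h: "h \<in> W"
  have "act h (\<Sum>g\<in>W. act g p) = (\<Sum>g\<in>W. act (h \<otimes> g) p)"
    unfolding psubst_sum using h by (intro sum.cong HOL.refl) (simp add: act_act)
  also have "\<dots> = (\<Sum>g\<in>W. act g p)"
    by (rule sum.reindex_bij_betw [OF left_mult_bij [OF h]])
  finally show "act h (\<Sum>g\<in>W. act g p) = (\<Sum>g\<in>W. act g p)" .
qed

lemma reyn_invs: "reyn p \<in> invs"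
  unfolding reyn_def by (intro invs_mult invs_const act_sum_invs)

lemma reyn_mult: "f \<in> invs \<Longrightarrow> reyn (f * p) = f * reyn p"
  by (simp add: reyn_def invsD sum_distrib_left mult.left_commute)

lemma reyn_add: "reyn (p + q) = reyn p + reyn q"
  by (simp add: reyn_def sum.distrib distrib_left)

lemma reyn_const: "reyn (poly_const c) = poly_const c"
proof -
  have "(\<Sum>g\<in>W. act g (poly_const c)) = poly_const (of_nat (card W) * c)"
    by (simp add: poly_const_mult poly_const_of_nat)
  then show ?thesis using card_G_nz by (simp add: reyn_def poly_const_mult [symmetric])
qed

lemma reyn_sum: "reyn (sum f I) = (\<Sum>i\<in>I. reyn (f i))"
  using reyn_const [of 0] by (induction I rule: infinite_finite_induct) (simp_all add: reyn_add)

lemma reyn_homog: "homog d p \<Longrightarrow> homog d (reyn p)"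
  unfolding reyn_def by (intro homog_const_mult homog_sum act_homog)

lemma reyn_diff: "p - reyn p = poly_const (1 / of_nat (card W)) * (\<Sum>g\<in>W. p - act g p)"
proof -
  have "poly_const (1 / of_nat (card W)) * of_nat (card W) * p = p"
    using card_G_nz by (simp add: poly_const_of_nat [symmetric] poly_const_mult [symmetric])
  then show ?thesis by (simp add: reyn_def sum_subtractf right_diff_distrib mult.assoc)
qed

definition ddiff :: "'w \<Rightarrow> ('v, 'k) mpoly \<Rightarrow> ('v, 'k) mpoly" where
  "ddiff s p = quo (al s) (p - act s p)"

lemma ddiff: "s \<in> Rf \<Longrightarrow> al s * ddiff s p = p - act s p"
  unfolding ddiff_def by (rule quo [OF al_dvd_act])

lemma ddiff_homog:
  assumes s: "s \<in> Rf" and p: "homog (Suc d) p" shows "homog d (ddiff s p)"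
proof -
  have "homog (Suc 0 + d) (al s * ddiff s p)"
    using p by (auto simp: ddiff [OF s] intro!: homog_diff act_homog)
  then show ?thesis by (rule homog_cancel [OF al_homog [OF s] _ al_nz [OF s]])
qed

text \<open>The Hilbert ideal, generated by the homogeneous invariants of positive degree.\<close>

inductive inHI :: "('v, 'k) mpoly \<Rightarrow> bool" where
  gen: "f \<in> invs \<Longrightarrow> homog (Suc d) f \<Longrightarrow> inHI (a * f)"
| add: "inHI p \<Longrightarrow> inHI q \<Longrightarrow> inHI (p + q)"

lemma inHI_0: "inHI 0"
  using inHI.gen [of 0 0 0] by (simp add: invs_0)

lemma inHI_mult: "inHI p \<Longrightarrow> inHI (a * p)"
proof (induction rule: inHI.induct)
  case (gen f d b)
  then show ?case using inHI.gen [of f d "a * b"] by (simp add: mult.assoc)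
next
  case (add p q)
  then show ?case using inHI.add by (simp add: distrib_left)
qed

lemma inHI_act: "inHI p \<Longrightarrow> g \<in> W \<Longrightarrow> inHI (act g p)"
proof (induction rule: inHI.induct)
  case (gen f d b)
  then show ?case using inHI.gen [of f d "act g b"] by (simp add: invsD)
next
  case (add p q)
  then show ?case using inHI.add by simp
qed

lemma inHI_sum: "(\<And>i. i \<in> I \<Longrightarrow> inHI (f i)) \<Longrightarrow> inHI (sum f I)"
  by (induction I rule: infinite_finite_induct) (auto intro: inHI_0 inHI.add)

lemma inHI_diff: "inHI p \<Longrightarrow> inHI q \<Longrightarrow> inHI (p - q)"
  using inHI.add [OF _ inHI_mult, of p q "-1"] by simp

text \<open>Divided differences commute with multiplication by invariants, so they lower the degree
  of the relation. By induction \<open>f0\<close> agrees with its image under every reflection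
  modulo the Hilbert ideal, hence under all of \<open>W\<close>; averaging replaces it by an
  invariant of positive degree.\<close>

lemma chevalley:
  assumes "finite J" and P: "P0 \<in> invs" "\<And>j. j \<in> J \<Longrightarrow> P j \<in> invs"
    and nin: "\<not> (\<exists>Q. (\<forall>j\<in>J. Q j \<in> invs) \<and> P0 = (\<Sum>j\<in>J. Q j * P j))"
    and "homog e f0" "P0 * f0 + (\<Sum>j\<in>J. P j * f j) = 0"
  shows "inHI f0"
  using assms(5,6)
proof (induction e arbitrary: f0 f)
  case 0
  obtain c where c: "f0 = poly_const c" using homog_zero_const 0(1) by blast
  show ?case
  proof (cases "c = 0")
    case True
    then show ?thesis by (simp add: c inHI_0)
  next
    case False
    \<comment> \<open>In degree 0, averaging the relation would express \<open>P0\<close> through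
      the other \<open>P j\<close> with invariant coefficients, which \<open>nin\<close>
      excludes.\<close>
    have "reyn (P0 * f0 + (\<Sum>j\<in>J. P j * f j)) = 0" using 0(2) reyn_const [of 0] by simp
    then have "P0 * poly_const c + (\<Sum>j\<in>J. P j * reyn (f j)) = 0"
      using P by (simp add: reyn_add reyn_sum reyn_mult c reyn_const)
    then have S: "(\<Sum>j\<in>J. P j * reyn (f j)) = - (P0 * poly_const c)"
      by (simp add: eq_neg_iff_add_eq_0 add.commute)
    have "poly_const (- 1 / c) * (\<Sum>j\<in>J. P j * reyn (f j)) = poly_const (- 1 / c) * (- (P0 * poly_const c))"
      unfolding S ..
    also have "\<dots> = poly_const (- 1 / c) * poly_const (- c) * P0" by simp
    also have "\<dots> = P0" using False by (simp add: poly_const_mult [symmetric] del: poly_const_simps(3))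
    finally have "P0 = (\<Sum>j\<in>J. (poly_const (- 1 / c) * reyn (f j)) * P j)"
      by (simp add: sum_distrib_left ac_simps)
    moreover have "\<forall>j\<in>J. poly_const (- 1 / c) * reyn (f j) \<in> invs"
      by (intro ballI invs_mult invs_const reyn_invs)
    ultimately show ?thesis using nin by (elim notE) (intro exI conjI)
  qed
next
  case (Suc e)
  have refl: "inHI (f0 - act s f0)" if s: "s \<in> Rf" for s
  proof -
    have "act s (P0 * f0 + (\<Sum>j\<in>J. P j * f j)) = P0 * act s f0 + (\<Sum>j\<in>J. P j * act s (f j))"
      using P s by (simp add: psubst_sum invsD)
    then have act0: "P0 * act s f0 + (\<Sum>j\<in>J. P j * act s (f j)) = 0"
      unfolding Suc.prems(2) by simp
    have "al s * (P0 * ddiff s f0 + (\<Sum>j\<in>J. P j * ddiff s (f j))) =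
        (P0 * f0 + (\<Sum>j\<in>J. P j * f j)) - (P0 * act s f0 + (\<Sum>j\<in>J. P j * act s (f j)))"
      by (simp add: distrib_left sum_distrib_left mult.left_commute [of "al s"] ddiff [OF s]
          right_diff_distrib sum_subtractf)
    also have "\<dots> = 0" unfolding act0 Suc.prems(2) by simp
    finally have "al s * (P0 * ddiff s f0 + (\<Sum>j\<in>J. P j * ddiff s (f j))) = 0" .
    then have "P0 * ddiff s f0 + (\<Sum>j\<in>J. P j * ddiff s (f j)) = 0" using al_nz [OF s] by simp
    then have "inHI (ddiff s f0)" by (rule Suc.IH [OF ddiff_homog [OF s Suc.prems(1)]])
    then show ?thesis using inHI_mult [of "ddiff s f0" "al s"] by (simp add: ddiff [OF s])
  qed
  have "inHI (f0 - act g f0)" if "g \<in> generate G Rf" for g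
    using that
  proof (induction rule: generate.induct)
    case one
    then show ?case by (simp add: inHI_0)
  next
    case (incl s)
    then show ?case by (rule refl)
  next
    case (inv s)
    then show ?case using refl by (simp add: Rf_inv)
  next
    case (eng g h)
    then have G: "g \<in> W" "h \<in> W" using Rf_generate by auto
    have "f0 - act (g \<otimes> h) f0 = (f0 - act g f0) + act g (f0 - act h f0)"
      using G by (simp add: act_act)
    then show ?case using inHI.add [OF eng.IH(1) inHI_act [OF eng.IH(2) G(1)]] by simp
  qed
  then have "inHI (f0 - reyn f0)"
    unfolding reyn_diff Rf_generate by (intro inHI_mult inHI_sum)
  moreover have "inHI (reyn f0)"
    using inHI.gen [OF reyn_invs reyn_homog [OF Suc.prems(1)], of 1] by simp
  ultimately show ?case using inHI.add by fastforce
qed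

text \<open>Linear independence over the field modulo the Hilbert ideal.\<close>

definition kindep :: "'j set \<Rightarrow> ('j \<Rightarrow> ('v, 'k) mpoly) \<Rightarrow> bool" where
  "kindep J f \<longleftrightarrow> (\<forall>c. inHI (\<Sum>j\<in>J. poly_const (c j) * f j) \<longrightarrow> (\<forall>j\<in>J. c j = 0))"

lemma kindepD: "kindep J f \<Longrightarrow> inHI (\<Sum>j\<in>J. poly_const (c j) * f j) \<Longrightarrow> j \<in> J \<Longrightarrow> c j = 0"
  unfolding kindep_def by simp

lemma kindep_subset:
  assumes "kindep J f" "I \<subseteq> J" "finite J" shows "kindep I f"
  unfolding kindep_def
proof (intro allI impI ballI)
  fix c j assume c: "inHI (\<Sum>j\<in>I. poly_const (c j) * f j)" and j: "j \<in> I"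
  let ?c = "\<lambda>j. if j \<in> I then c j else 0"
  have "(\<Sum>j\<in>J. poly_const (?c j) * f j) = (\<Sum>j\<in>I. poly_const (c j) * f j)"
    using assms(2,3) by (intro sum.mono_neutral_cong_right) auto
  then have "?c j = 0" using kindepD [OF assms(1), of ?c j] c j assms(2) by auto
  then show "c j = 0" using j by simp
qed

text \<open>If \<open>P x\<close> is an invariant combination of the other \<open>P j\<close>, the
  vector \<open>f x\<close> can be absorbed into the remaining ones; otherwise
  \<open>chevalley\<close> puts \<open>f x\<close> into the Hilbert ideal, against
  \<open>kindep\<close>. The clause with \<open>n < e j\<close> makes up for truncated
  subtraction.\<close>

lemma kindep_imp_invs_indep_homog:
  assumes "finite J" "\<And>j. j \<in> J \<Longrightarrow> homog (e j) (f j)" "kindep J f"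
    and "\<And>j. j \<in> J \<Longrightarrow> P j \<in> invs \<and> homog (n - e j) (P j) \<and> (n < e j \<longrightarrow> P j = 0)"
    and "(\<Sum>j\<in>J. P j * f j) = 0"
  shows "\<forall>j\<in>J. P j = 0"
  using assms
proof (induction J arbitrary: f)
  case (insert x J)
  have J: "finite J" "x \<notin> J" using insert.hyps by auto
  have rel: "P x * f x + (\<Sum>j\<in>J. P j * f j) = 0" using insert.prems(4) J by simp
  show ?case
  proof (cases "P x = 0")
    case True
    have "\<forall>j\<in>J. P j = 0"
    proof (rule insert.IH)
      show "kindep J f" by (rule kindep_subset [OF insert.prems(2)]) (use J in auto)
      show "(\<Sum>j\<in>J. P j * f j) = 0" using rel True by simp
    qed (use insert.prems in auto)
    then show ?thesis using True by simp
  next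
    case False
    then have ex: "e x \<le> n" using insert.prems(3) [of x] by force
    show ?thesis
    proof (cases "\<exists>Q. (\<forall>j\<in>J. Q j \<in> invs) \<and> P x = (\<Sum>j\<in>J. Q j * P j)")
      case True
      then obtain Q where Q: "\<And>j. j \<in> J \<Longrightarrow> Q j \<in> invs" "P x = (\<Sum>j\<in>J. Q j * P j)" by blast
      \<comment> \<open>The component of the degree that keeps the modified vectors
        \<open>f'\<close> homogeneous.\<close>
      define Q' where "Q' j = (if e x \<le> e j then hc (e j - e x) (Q j) else 0)" for j
      have Q'i: "Q' j \<in> invs" if "j \<in> J" for j using Q(1) [OF that] by (simp add: Q'_def invs_hc invs_0)
      have Q'h: "homog (e j - e x) (Q' j)" for j by (simp add: Q'_def)
      have "P x = hc (n - e x) (P x)" using insert.prems(3) [of x] hc_homog [of "n - e x" "P x" "n - e x"] by simp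
      also have "P x = (\<Sum>j\<in>J. P j * Q j)" unfolding Q(2) by (simp only: mult.commute)
      finally have "P x = hc (n - e x) (\<Sum>j\<in>J. P j * Q j)" unfolding Q(2) by (simp only: mult.commute)
      also have "\<dots> = (\<Sum>j\<in>J. Q' j * P j)"
        unfolding hc_sum
      proof (rule sum.cong [OF HOL.refl])
        fix j assume j: "j \<in> J"
        show "hc (n - e x) (P j * Q j) = Q' j * P j"
        proof (cases "n < e j")
          case True
          then show ?thesis using insert.prems(3) [of j] j by simp
        next
          case False
          have "homog (n - e j) (P j)" using insert.prems(3) [of j] j by simp
          moreover have "n - e j \<le> n - e x \<longleftrightarrow> e x \<le> e j" "e x \<le> e j \<Longrightarrow> n - e x - (n - e j) = e j - e x"
            using False ex by auto
          ultimately show ?thesis by (simp add: hc_homog_mult Q'_def mult.commute)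
        qed
      qed
      finally have Px: "P x = (\<Sum>j\<in>J. Q' j * P j)" .
      define f' where "f' j = f j + Q' j * f x" for j
      have "\<forall>j\<in>J. P j = 0"
      proof (rule insert.IH [of f'])
        show "homog (e j) (f' j)" if j: "j \<in> J" for j
        proof (cases "e x \<le> e j")
          case True
          then show ?thesis
            using homog_mult [OF Q'h [of j] insert.prems(1) [of x]] insert.prems(1) [of j] j
            by (simp add: f'_def homog_add)
        next
          case False
          then show ?thesis using insert.prems(1) [of j] j by (simp add: f'_def Q'_def)
        qed
        have "(\<Sum>j\<in>J. P j * f' j) = (\<Sum>j\<in>J. Q' j * P j) * f x + (\<Sum>j\<in>J. P j * f j)"
          unfolding sum_distrib_right by (simp only: f'_def distrib_left sum.distrib ac_simps)
        then show "(\<Sum>j\<in>J. P j * f' j) = 0" using rel unfolding Px [symmetric] by simp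
        show "kindep J f'"
          unfolding kindep_def
        proof (intro allI impI ballI)
          fix c i assume c: "inHI (\<Sum>j\<in>J. poly_const (c j) * f' j)" and i: "i \<in> J"
          \<comment> \<open>Modulo the Hilbert ideal \<open>Q' j\<close> is a constant: either its
            degree is 0, or it is itself an invariant of positive degree.\<close>
          have "\<forall>j\<in>J. \<exists>q. inHI (Q' j * f x - poly_const q * f x)"
          proof
            fix j assume j: "j \<in> J"
            show "\<exists>q. inHI (Q' j * f x - poly_const q * f x)"
            proof (cases "e j - e x")
              case 0
              then obtain q where "Q' j = poly_const q" using Q'h [of j] homog_zero_const by fastforce
              then show ?thesis using inHI_0 by (intro exI [of _ q]) simp
            next
              case (Suc d)
              then have "inHI (f x * Q' j)" using inHI.gen [OF Q'i [OF j]] Q'h [of j] by simp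
              then show ?thesis by (intro exI [of _ 0]) (simp add: mult.commute)
            qed
          qed
          then obtain q where q: "\<forall>j\<in>J. inHI (Q' j * f x - poly_const (q j) * f x)" by (rule bchoice [THEN exE])
          define c' where "c' j = (if j = x then \<Sum>j\<in>J. c j * q j else c j)" for j
          have c'J: "(\<Sum>j\<in>J. poly_const (c' j) * f j) = (\<Sum>j\<in>J. poly_const (c j) * f j)"
            using J by (intro sum.cong) (auto simp: c'_def)
          have "inHI ((\<Sum>j\<in>J. poly_const (c j) * f' j) - (\<Sum>j\<in>J. poly_const (c j) * (Q' j * f x - poly_const (q j) * f x)))"
            using q by (intro inHI_diff [OF c] inHI_sum inHI_mult) auto
          also have "(\<Sum>j\<in>J. poly_const (c j) * f' j) - (\<Sum>j\<in>J. poly_const (c j) * (Q' j * f x - poly_const (q j) * f x))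
             = (\<Sum>j\<in>insert x J. poly_const (c' j) * f j)"
            using J c'J
            by (simp add: f'_def c'_def [of x] sum_subtractf [symmetric] sum.distrib [symmetric] poly_const_sum poly_const_mult sum_distrib_right algebra_simps)
              (simp add: sum.distrib sum_distrib_left)
          finally have "c' i = 0" using kindepD [OF insert.prems(2)] i by blast
          then show "c i = 0" using i J by (auto simp: c'_def split: if_splits)
        qed
      qed (use insert.prems in auto)
      then show ?thesis using Px by simp
    next
      case nin: False
      have "inHI (f x)"
        by (rule chevalley [OF J(1) _ _ nin insert.prems(1) rel]) (use insert.prems(3) in auto)
      moreover have "(\<Sum>j\<in>insert x J. poly_const (if j = x then 1 else 0) * f j) = f x"
        using J by (auto intro: sum.neutral)
      ultimately have "(1::'k) = 0"
        using kindepD [OF insert.prems(2), of "\<lambda>j. if j = x then 1 else 0" x] by simp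
      then show ?thesis by simp
    qed
  qed
qed simp

lemma kindep_imp_invs_indep:
  assumes J: "finite J" "\<And>j. j \<in> J \<Longrightarrow> homog (e j) (f j)" "kindep J f"
    and P: "\<And>j. j \<in> J \<Longrightarrow> P j \<in> invs" and rel: "(\<Sum>j\<in>J. P j * f j) = 0" and i: "i \<in> J"
  shows "P i = 0"
proof (rule hc_eqI)
  fix d
  \<comment> \<open>The total degree in which the degree \<open>d\<close> part of \<open>P i\<close>
    meets \<open>f i\<close>.\<close>
  define n where "n = d + e i"
  define Pn where "Pn j = (if e j \<le> n then hc (n - e j) (P j) else 0)" for j
  have "(\<Sum>j\<in>J. Pn j * f j) = hc n (\<Sum>j\<in>J. f j * P j)"
    unfolding hc_sum
  proof (rule sum.cong [OF HOL.refl])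
    fix j assume "j \<in> J"
    then show "Pn j * f j = hc n (f j * P j)"
      by (simp add: Pn_def hc_homog_mult [OF J(2)] mult.commute [of "hc _ _"])
  qed
  also have "\<dots> = 0" using rel by (simp add: mult.commute)
  finally have "\<forall>j\<in>J. Pn j = 0"
    by (intro kindep_imp_invs_indep_homog [OF J, where n = n]) (auto simp: Pn_def P invs_hc invs_0)
  then have "Pn i = 0" using i by blast
  then show "hc d (P i) = hc d 0" by (simp add: Pn_def n_def)
qed

end

section \<open>Orbit vectors and freeness over the invariants\<close>

context reflection_action
begin

text \<open>The image of the tensor square of the polynomial ring under the map sending
  \<open>a\<close> tensor \<open>b\<close> to the family \<open>a * act w b\<close>. Both rules look
  at values on \<open>W\<close> only, so membership depends on these alone.\<close>

inductive inL :: "('w \<Rightarrow> ('v, 'k) mpoly) \<Rightarrow> bool" where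
  gen: "(\<And>w. w \<in> W \<Longrightarrow> p w = a * act w b) \<Longrightarrow> inL p"
| add: "inL p \<Longrightarrow> inL q \<Longrightarrow> (\<And>w. w \<in> W \<Longrightarrow> r w = p w + q w) \<Longrightarrow> inL r"

lemma inL_cong:
  assumes "inL p" "\<And>w. w \<in> W \<Longrightarrow> q w = p w" shows "inL q"
proof -
  have "inL (\<lambda>w. 0)" by (rule inL.gen [where a = 0 and b = 0]) simp
  then show ?thesis by (rule inL.add [OF assms(1)]) (use assms(2) in simp)
qed

lemma inL_cmult: "inL p \<Longrightarrow> inL (\<lambda>w. c * p w)"
proof (induction rule: inL.induct)
  case (gen p a b)
  then show ?case by (intro inL.gen [where a = "c * a" and b = b]) (simp add: mult.assoc)
next
  case (add p q r)
  then show ?case by (intro inL.add [OF add.IH]) (simp add: distrib_left)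
qed

lemma inL_act_mult: "inL p \<Longrightarrow> inL (\<lambda>w. act w f * p w)"
proof (induction rule: inL.induct)
  case (gen p a b)
  then show ?case by (intro inL.gen [where a = a and b = "f * b"]) (simp add: mult.left_commute)
next
  case (add p q r)
  then show ?case by (intro inL.add [OF add.IH]) (simp add: distrib_left)
qed

lemma inL_mult: "inL p \<Longrightarrow> inL q \<Longrightarrow> inL (\<lambda>w. p w * q w)"
proof (induction rule: inL.induct)
  case (gen p a b)
  then show ?case
    by (intro inL_cong [OF inL_cmult [OF inL_act_mult [OF gen.prems], of a b]]) (simp add: mult.assoc)
next
  case (add p q r)
  then show ?case
    by (intro inL.add [OF add.IH(1) [OF add.prems] add.IH(2) [OF add.prems]]) (simp add: distrib_right)
qed

lemma inL_tau: "inL (\<lambda>w. act w b)"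
  by (rule inL.gen [where a = 1 and b = b]) simp

lemma inL_const: "inL (\<lambda>w. c)"
  by (rule inL.gen [where a = c and b = 1]) simp

lemma inL_diff: "inL p \<Longrightarrow> inL q \<Longrightarrow> inL (\<lambda>w. p w - q w)"
  by (rule inL.add [OF _ inL_cmult [where c = "-1"]]) auto

lemma inL_prod: "(\<And>i. i \<in> I \<Longrightarrow> inL (p i)) \<Longrightarrow> inL (\<lambda>w. \<Prod>i\<in>I. p i w)"
  by (induction I rule: infinite_finite_induct) (auto intro: inL_const inL_mult)

lemma inL_sum: "(\<And>i. i \<in> I \<Longrightarrow> inL (p i)) \<Longrightarrow> inL (\<lambda>w. \<Sum>i\<in>I. p i w)"
  by (induction I rule: infinite_finite_induct) (auto intro: inL_const inL.add)

lemma inL_QC: "inL p \<Longrightarrow> p \<in> QC (\<lambda>_. 1)"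
proof (induction rule: inL.induct)
  case (gen p a b)
  have "(\<lambda>w. a * act w b) \<in> QC (\<lambda>_. 1)"
  proof (rule QC_cmult)
    show "(\<lambda>w. act w b) \<in> QC (\<lambda>_. 1)"
      unfolding QC_def
    proof clarify
      fix s w assume s: "s \<in> Rf" and w: "w \<in> W"
      show "al s ^ 1 dvd act w b - act (s \<otimes> w) b"
        using al_dvd_act [OF s, of "act w b"] s w by (simp add: act_act)
    qed
  qed
  then show ?case by (rule QC_cong [rotated]) (use gen in simp)
next
  case (add p q r)
  then show ?case by (intro QC_cong [OF _ QC_add [OF add.IH]]) simp
qed

text \<open>Products of the elements \<open>x - act w (act (inv g) x)\<close>, which vanish at \<open>w = g\<close>, are supported at the
  identity.\<close>

definition lam :: "'w \<Rightarrow> 'v \<Rightarrow> ('v, 'k) mpoly" where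
  "lam g v = pvar v - hh (inv g) v"

lemma inL_support_one: "inL (\<lambda>w. if w = \<one> then \<Prod>g\<in>W - {\<one>}. lam g (i g) else 0)"
proof (rule inL_cong)
  let ?X = "W - {\<one>}"
  show "inL (\<lambda>w. \<Prod>g\<in>?X. pvar (i g) - act w (hh (inv g) (i g)))"
    by (intro inL_prod inL_diff inL_const inL_tau)
  fix w assume w: "w \<in> W"
  show "(if w = \<one> then \<Prod>g\<in>?X. lam g (i g) else 0) = (\<Prod>g\<in>?X. pvar (i g) - act w (hh (inv g) (i g)))"
  proof (cases "w = \<one>")
    case False
    have "act w (hh (inv w) (i w)) = pvar (i w)" using hh_mult [of w "inv w" "i w"] w by (simp add: hh_one)
    then have "(\<Prod>g\<in>?X. pvar (i g) - act w (hh (inv g) (i g))) = 0"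
      using w False fin_G by (subst mpoly_prod_eq_0) (auto intro!: bexI [of _ w])
    then show ?thesis using False by simp
  qed (simp add: lam_def)
qed

lemma reflection_moves: "s \<in> Rf \<Longrightarrow> \<exists>v. hh s v \<noteq> pvar v"
proof (rule ccontr)
  assume s: "s \<in> Rf" and "\<not> (\<exists>v. hh s v \<noteq> pvar v)"
  then have "act s p = act \<one> p" for p
    by (intro arg_cong [where f = "\<lambda>h. psubst h p"]) (auto simp: hh_one)
  then have "al s = - al s" using al_neg [OF s] by simp
  then have "al s + al s = 0" by (metis add.right_inverse)
  then have "poly_const 2 * al s = 0"
    by (simp only: one_add_one [symmetric] poly_const_add poly_const_simps distrib_right mult_1_left)
  then show False using al_nz [OF s] by simp
qed

lemma ex_lam_nz: "g \<in> W \<Longrightarrow> g \<noteq> \<one> \<Longrightarrow> \<exists>v. lam g v \<noteq> 0"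
proof -
  assume g: "g \<in> W" "g \<noteq> \<one>"
  then have "inv g \<in> W" "inv g \<noteq> \<one>" by (auto simp: inv_eq_1_iff)
  then have "\<exists>v. hh (inv g) v \<noteq> pvar v" using reflection_moves non_reflection by blast
  then show ?thesis by (metis lam_def right_minus_eq)
qed

text \<open>Summing over \<open>W\<close> against an arbitrary \<open>a\<close> gives a relation
  with invariant coefficients, which therefore vanish. Hence \<open>c j\<close> is orthogonal to all
  of \<open>inL\<close> under the pairing that sums \<open>p g * act g (c j)\<close>, and an element
  of \<open>inL\<close> supported at the identity detects it.\<close>

lemma tau_indep:
  assumes J: "finite J" "\<And>j. j \<in> J \<Longrightarrow> homog (e j) (f j)" "kindep J f"
    and rel: "\<And>w. w \<in> W \<Longrightarrow> (\<Sum>j\<in>J. c j * act w (f j)) = 0" and j: "j \<in> J"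
  shows "c j = 0"
proof -
  have tr: "(\<Sum>g\<in>W. act g a * act g (c j)) = 0" for a
  proof -
    define t where "t j = (\<Sum>g\<in>W. act g (a * c j))" for j
    have "(\<Sum>j\<in>J. t j * f j) = (\<Sum>g\<in>W. act g a * (\<Sum>j\<in>J. act g (c j) * f j))"
      unfolding t_def sum_distrib_right sum_distrib_left by (subst sum.swap) (simp add: mult.assoc)
    also have "\<dots> = 0"
    proof (rule sum.neutral, rule ballI)
      fix g assume g: "g \<in> W"
      have "(\<Sum>j\<in>J. act g (c j) * f j) = act g (\<Sum>j\<in>J. c j * act (inv g) (f j))"
        using g by (simp add: psubst_sum)
      also have "\<dots> = 0" using rel [of "inv g"] g by simp
      finally show "act g a * (\<Sum>j\<in>J. act g (c j) * f j) = 0" by simp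
    qed
    finally have 0: "(\<Sum>j\<in>J. t j * f j) = 0" .
    have "t j \<in> invs" for j unfolding t_def by (rule act_sum_invs)
    then have "t j = 0" using kindep_imp_invs_indep [OF J _ 0 j] by simp
    then show ?thesis by (simp add: t_def)
  qed
  have L: "(\<Sum>g\<in>W. p g * act g (c j)) = 0" if "inL p" for p
    using that
  proof (induction rule: inL.induct)
    case (gen p a b)
    have "(\<Sum>g\<in>W. p g * act g (c j)) = a * (\<Sum>g\<in>W. act g b * act g (c j))"
      unfolding sum_distrib_left using gen by (intro sum.cong) (auto simp: mult.assoc)
    then show ?case by (simp add: tr)
  next
    case (add p q r)
    have "(\<Sum>g\<in>W. r g * act g (c j)) =
        (\<Sum>g\<in>W. p g * act g (c j)) + (\<Sum>g\<in>W. q g * act g (c j))"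
      unfolding sum.distrib [symmetric] using add.hyps by (intro sum.cong) (auto simp: distrib_right)
    then show ?case using add.IH by simp
  qed
  have "\<forall>g\<in>W - {\<one>}. \<exists>v. lam g v \<noteq> 0" using ex_lam_nz by blast
  then obtain i where i: "\<forall>g\<in>W - {\<one>}. lam g (i g) \<noteq> 0" by (rule bchoice [THEN exE])
  let ?l = "\<Prod>g\<in>W - {\<one>}. lam g (i g)"
  have "?l \<noteq> 0" using i fin_G by (simp add: mpoly_prod_eq_0)
  moreover have "(\<Sum>g\<in>W. (if g = \<one> then ?l else 0) * act g (c j)) = (\<Sum>g\<in>W. if g = \<one> then ?l * act g (c j) else 0)"
    by (intro sum.cong) auto
  then have "?l * c j = 0" using L [OF inL_support_one [of i]] fin_G by simp
  ultimately show ?thesis by simp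
qed

text \<open>The span over the invariants; the set \<open>J\<close> is indexed by its own
  elements.\<close>

definition SW :: "('v, 'k) mpoly set \<Rightarrow> ('v, 'k) mpoly set" where
  "SW J = {f. \<exists>P. (\<forall>j\<in>J. P j \<in> invs) \<and> f = (\<Sum>j\<in>J. P j * j)}"

lemma SW_add:
  assumes "p \<in> SW J" "q \<in> SW J" shows "p + q \<in> SW J"
proof -
  obtain P Q where "\<forall>j\<in>J. P j \<in> invs" "p = (\<Sum>j\<in>J. P j * j)" "\<forall>j\<in>J. Q j \<in> invs" "q = (\<Sum>j\<in>J. Q j * j)"
    using assms by (auto simp: SW_def)
  then show ?thesis unfolding SW_def mem_Collect_eq
    by (intro exI [of _ "\<lambda>j. P j + Q j"]) (auto simp: invs_add distrib_right sum.distrib)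
qed

lemma SW_mult:
  assumes "p \<in> SW J" "a \<in> invs" shows "a * p \<in> SW J"
proof -
  obtain P where "\<forall>j\<in>J. P j \<in> invs" "p = (\<Sum>j\<in>J. P j * j)"
    using assms by (auto simp: SW_def)
  then show ?thesis unfolding SW_def mem_Collect_eq
    by (intro exI [of _ "\<lambda>j. a * P j"]) (auto simp: assms(2) invs_mult sum_distrib_left mult.assoc)
qed

lemma SW_0: "0 \<in> SW J"
  unfolding SW_def mem_Collect_eq by (rule exI [of _ "\<lambda>j. 0"]) (simp add: invs_0)

lemma SW_base: "finite J \<Longrightarrow> j \<in> J \<Longrightarrow> j \<in> SW J"
  unfolding SW_def mem_Collect_eq
  by (rule exI [of _ "\<lambda>i. if i = j then 1 else 0"])
    (auto simp: invs_0 invs_const [of 1, simplified] if_distrib [of "\<lambda>c. c * _"] cong: if_cong)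

lemma SW_sum: "(\<And>i. i \<in> I \<Longrightarrow> f i \<in> SW J) \<Longrightarrow> sum f I \<in> SW J"
  by (induction I rule: infinite_finite_induct) (auto intro: SW_add SW_0)

text \<open>By \<open>tau_indep\<close> a homogeneous set independent modulo the Hilbert ideal has
  at most \<open>card W\<close> elements, so a largest one exists. It spans by the graded Nakayama
  argument: in the Hilbert ideal the invariants have positive degree, so their cofactors have
  smaller degree and are known to lie in the span.\<close>

lemma ex_invs_basis: "\<exists>J e. finite J \<and> (\<forall>j\<in>J. homog (e j) j) \<and> kindep J (\<lambda>j. j) \<and> SW J = UNIV"
proof -
  let ?P = "\<lambda>J. finite J \<and> (\<forall>j\<in>J. \<exists>d. homog d j) \<and> kindep J (\<lambda>j. j)"
  have "\<exists>J. ?P J \<and> (\<forall>J'. ?P J' \<longrightarrow> card J' \<le> card J)"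
  proof (rule ex_has_greatest_nat [of ?P "{}" card "Suc (card W)"])
    show "?P {}" by (simp add: kindep_def)
    show "\<forall>J. ?P J \<longrightarrow> card J < Suc (card W)"
    proof (intro allI impI)
      fix J assume J: "?P J"
      have "\<forall>j\<in>J. \<exists>d. homog d j" using J by blast
      then obtain e where e: "\<forall>j\<in>J. homog (e j) j" by (rule bchoice [THEN exE])
      show "card J < Suc (card W)"
      proof (rule ccontr)
        assume "\<not> ?thesis"
        then obtain r where r: "\<exists>j\<in>J. r j \<noteq> 0" "\<forall>w\<in>W. (\<Sum>j\<in>J. r j * act w j) = 0"
          using mpoly_dependent [OF fin_G, of J "\<lambda>j w. act w j"] J by auto
        have "r j = 0" if "j \<in> J" for j
          by (rule tau_indep [of J e "\<lambda>j. j" r]) (use J e r(2) that in auto)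
        then show False using r(1) by blast
      qed
    qed
  qed
  then obtain J where J: "?P J" "\<forall>J'. ?P J' \<longrightarrow> card J' \<le> card J" by blast
  have "\<forall>j\<in>J. \<exists>d. homog d j" using J by blast
  then obtain e where e: "\<forall>j\<in>J. homog (e j) j" by (rule bchoice [THEN exE])
  have span: "\<exists>c. inHI (f - (\<Sum>j\<in>J. poly_const (c j) * j))" if f: "homog d f" for d f
  proof (cases "f \<in> J")
    case True
    have "(\<Sum>j\<in>J. poly_const (if j = f then 1 else 0) * j) = (\<Sum>j\<in>J. if j = f then j else 0)"
      by (intro sum.cong) auto
    also have "\<dots> = f" using True J by simp
    finally show ?thesis by (intro exI [of _ "\<lambda>j. if j = f then 1 else 0"]) (simp add: inHI_0)
  next
    case False
    have "\<not> ?P (insert f J)"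
      using J(2) [THEN spec, of "insert f J"] J(1) False by auto
    then have "\<not> kindep (insert f J) (\<lambda>j. j)" using J(1) f by auto
    then obtain c where c: "inHI (\<Sum>j\<in>insert f J. poly_const (c j) * j)" "\<not> (\<forall>j\<in>insert f J. c j = 0)"
      by (auto simp: kindep_def)
    have s: "(\<Sum>j\<in>insert f J. poly_const (c j) * j) = poly_const (c f) * f + (\<Sum>j\<in>J. poly_const (c j) * j)"
      using J(1) False by simp
    have cf: "c f \<noteq> 0"
    proof
      assume 0: "c f = 0"
      then have "inHI (\<Sum>j\<in>J. poly_const (c j) * j)" using c(1) s by simp
      then have "\<forall>j\<in>J. c j = 0" using J(1) unfolding kindep_def by blast
      then show False using c(2) 0 by blast
    qed
    have "poly_const (1 / c f) * (poly_const (c f) * f + (\<Sum>j\<in>J. poly_const (c j) * j)) =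
        f - (\<Sum>j\<in>J. poly_const (- c j / c f) * j)"
      using cf by (simp add: distrib_left mult.assoc [symmetric] poly_const_mult [symmetric] sum_distrib_left sum_negf)
    then have "inHI (f - (\<Sum>j\<in>J. poly_const (- c j / c f) * j))"
      using inHI_mult [OF c(1), of "poly_const (1 / c f)"] s by simp
    then show ?thesis by (intro exI [of _ "\<lambda>j. - c j / c f"])
  qed
  have SWh: "f \<in> SW J" if "homog d f" for d f
    using that
  proof (induction d arbitrary: f rule: less_induct)
    case (less d)
    have HI: "hc d h \<in> SW J" if "inHI h" for h
      using that
    proof (induction rule: inHI.induct)
      case (gen f n a)
      have "hc d (f * a) = (if Suc n \<le> d then f * hc (d - Suc n) a else 0)"
        by (rule hc_homog_mult [OF gen(2)])
      moreover have "hc (d - Suc n) a \<in> SW J" if "Suc n \<le> d"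
        by (rule less.IH [of "d - Suc n"]) (use that in auto)
      ultimately show ?case
        by (cases "Suc n \<le> d") (auto simp: mult.commute [of a f] intro: SW_mult [OF _ gen(1)] SW_0)
    next
      case (add p q)
      then show ?case by (simp add: hc_add SW_add)
    qed
    obtain c where c: "inHI (f - (\<Sum>j\<in>J. poly_const (c j) * j))" using span [OF less.prems] by blast
    have "f = hc d ((f - (\<Sum>j\<in>J. poly_const (c j) * j)) + (\<Sum>j\<in>J. poly_const (c j) * j))"
      using hc_homog [OF less.prems] by simp
    also have "\<dots> = hc d (f - (\<Sum>j\<in>J. poly_const (c j) * j)) + (\<Sum>j\<in>J. hc d (poly_const (c j) * j))"
      unfolding hc_add hc_sum ..
    also have "\<dots> \<in> SW J"
    proof (rule SW_add [OF HI [OF c] SW_sum])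
      fix j assume j: "j \<in> J"
      have "hc d (poly_const (c j) * j) = poly_const (c j) * (if d = e j then j else 0)"
        using hc_homog_mult [OF homog_const, of d "c j" j] hc_homog [of "e j" j d] e j by simp
      then show "hc d (poly_const (c j) * j) \<in> SW J"
        using SW_mult [OF _ invs_const] SW_base [of J j] SW_0 J(1) j by simp
    qed
    finally show ?case .
  qed
  have "f \<in> SW J" for f
  proof -
    obtain n where "\<forall>d>n. hc d f = 0" using hc_bound by blast
    then have f: "f = (\<Sum>d\<le>n. hc d f)" by (rule sum_hc)
    show ?thesis by (subst f) (rule SW_sum [OF SWh [OF homog_hc]])
  qed
  then show ?thesis using J(1) e by blast
qed

end

section \<open>Antisymmetrisation and generation at multiplicity one\<close>

context reflection_action
begin

definition delta :: "('v, 'k) mpoly" where "delta = (\<Prod>s\<in>Rf. al s)"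

lemma delta_nz: "delta \<noteq> 0"
  using fin_Rf al_nz by (simp add: delta_def mpoly_prod_eq_0)

lemma act_delta: "g \<in> W \<Longrightarrow> \<exists>c. c \<noteq> 0 \<and> act g delta = poly_const c * delta"
proof -
  assume g: "g \<in> W"
  interpret a: comm_ring_hom "act g" by (rule psubst_hom)
  interpret c: comm_ring_hom "poly_const :: 'k \<Rightarrow> ('v, 'k) mpoly" by (rule poly_const_hom)
  have "\<forall>s\<in>Rf. \<exists>u. u \<noteq> 0 \<and> act g (al s) = poly_const u * al (g \<otimes> s \<otimes> inv g)"
    using al_conj [OF g] by blast
  then obtain u where u: "\<forall>s\<in>Rf. u s \<noteq> 0 \<and> act g (al s) = poly_const (u s) * al (g \<otimes> s \<otimes> inv g)"
    by (rule bchoice [THEN exE])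
  have "act g delta = (\<Prod>s\<in>Rf. poly_const (u s) * al (g \<otimes> s \<otimes> inv g))"
    unfolding delta_def a.hom_prod using u by (intro prod.cong) auto
  also have "\<dots> = poly_const (\<Prod>s\<in>Rf. u s) * (\<Prod>s\<in>Rf. al (g \<otimes> s \<otimes> inv g))"
    by (simp add: prod.distrib c.hom_prod)
  also have "(\<Prod>s\<in>Rf. al (g \<otimes> s \<otimes> inv g)) = delta"
    unfolding delta_def by (rule prod.reindex_bij_betw [OF conj_bij [OF g]])
  finally show ?thesis using u fin_Rf by (intro exI [of _ "\<Prod>s\<in>Rf. u s"]) (simp add: prod_zero_iff)
qed

text \<open>The character by which \<open>W\<close> acts on \<open>delta\<close>, taking the value
  -1 on reflections by \<open>eps_refl\<close>.\<close>

definition eps :: "'w \<Rightarrow> 'k" where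
  "eps g = (SOME c. c \<noteq> 0 \<and> act g delta = poly_const c * delta)"

lemma eps: "g \<in> W \<Longrightarrow> eps g \<noteq> 0 \<and> act g delta = poly_const (eps g) * delta"
  unfolding eps_def by (rule someI_ex [OF act_delta])

lemma eps_mult: "g \<in> W \<Longrightarrow> h \<in> W \<Longrightarrow> eps (g \<otimes> h) = eps g * eps h"
proof -
  assume g: "g \<in> W" and h: "h \<in> W"
  have "poly_const (eps (g \<otimes> h)) * delta = act g (act h delta)"
    using eps [of "g \<otimes> h"] g h by (simp add: act_act)
  also have "\<dots> = poly_const (eps g * eps h) * delta"
    using eps [OF g] eps [OF h] by (simp add: poly_const_mult)
  finally show ?thesis using delta_nz by (simp add: poly_const_inj)
qed

lemma eps_one: "eps \<one> = 1"
proof -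
  have "1 * delta = poly_const (eps \<one>) * delta" using eps [of \<one>] by simp
  then have "poly_const (eps \<one>) = (1 :: ('v, 'k) mpoly)" using delta_nz unfolding mpoly_mult_cancel by simp
  then show ?thesis by (metis poly_const_simps(2) poly_const_inj)
qed

text \<open>After cancelling \<open>al s\<close> from \<open>delta\<close>, the cofactor agrees with
  its image under \<open>s\<close> modulo \<open>al s\<close> and is not divisible by
  \<open>al s\<close>. So \<open>al s\<close> divides the constant \<open>1 + eps s\<close>, which
  must be zero.\<close>

lemma eps_refl:
  assumes s: "s \<in> Rf" shows "eps s = -1"
proof -
  let ?d = "\<Prod>t\<in>Rf - {s}. al t"
  have d: "delta = al s * ?d" unfolding delta_def by (rule prod.remove [OF fin_Rf s])
  have "al s * (- act s ?d) = al s * (poly_const (eps s) * ?d)"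
    using eps [of s] s by (simp add: d al_neg algebra_simps)
  then have eq: "- act s ?d = poly_const (eps s) * ?d" using al_nz [OF s] unfolding mpoly_mult_cancel by blast
  have "al s dvd ?d - act s ?d" by (rule al_dvd_act [OF s])
  also have "?d - act s ?d = poly_const (1 + eps s) * ?d"
    using eq by (simp add: poly_const_add distrib_right)
  finally have "al s dvd poly_const (1 + eps s) * ?d" .
  moreover have "\<not> al s dvd ?d"
  proof
    assume "al s dvd ?d"
    then obtain t where "t \<in> Rf - {s}" "al s dvd al t"
      using linear_form_prime_prod [OF al_homog [OF s] al_nz [OF s]] fin_Rf by blast
    then show False using al_distinct [OF s, of t] by auto
  qed
  ultimately have "al s dvd poly_const (1 + eps s)"
    using linear_form_prime [OF al_homog [OF s] al_nz [OF s]] by blast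
  then have "1 + eps s = 0" using linear_form_not_dvd_const [OF al_homog [OF s] al_nz [OF s]] by blast
  then show ?thesis by (simp add: eq_neg_iff_add_eq_0 add.commute)
qed

lemma inL_basis:
  assumes J: "finite J" "SW J = UNIV" and p: "inL p"
  shows "\<exists>c. \<forall>w\<in>W. p w = (\<Sum>j\<in>J. c j * act w j)"
  using p
proof (induction rule: inL.induct)
  case (gen p a b)
  have "b \<in> SW J" using J(2) by simp
  then obtain P where P: "\<forall>j\<in>J. P j \<in> invs" "b = (\<Sum>j\<in>J. P j * j)" by (auto simp: SW_def)
  have "p w = (\<Sum>j\<in>J. (a * P j) * act w j)" if w: "w \<in> W" for w
  proof -
    have "act w b = (\<Sum>j\<in>J. P j * act w j)"
      unfolding P(2) psubst_sum psubst_simps using P(1) w by (intro sum.cong) (auto simp: invsD)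
    then show ?thesis using gen w by (simp add: sum_distrib_left mult.assoc)
  qed
  then show ?case by (intro exI [of _ "\<lambda>j. a * P j"]) blast
next
  case (add p q r)
  obtain c d where "\<forall>w\<in>W. p w = (\<Sum>j\<in>J. c j * act w j)" "\<forall>w\<in>W. q w = (\<Sum>j\<in>J. d j * act w j)"
    using add.IH by blast
  then have "\<forall>w\<in>W. r w = (\<Sum>j\<in>J. (c j + d j) * act w j)"
    using add.hyps by (simp add: distrib_right sum.distrib)
  then show ?case by (intro exI [of _ "\<lambda>j. c j + d j"])
qed

text \<open>In coordinates over a basis for the invariants the two memberships give
  \<open>m * a j = l * b j\<close>. The prime \<open>l\<close> does not divide \<open>m\<close>, so
  it divides every \<open>a j\<close> and can be cancelled.\<close>

lemma inL_saturated:
  assumes l: "homog (Suc 0) l" "l \<noteq> 0" "\<not> l dvd m" and "inL (\<lambda>w. l * z w)" "inL (\<lambda>w. m * z w)"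
  shows "inL z"
proof -
  obtain J e where J: "finite J" "\<forall>j\<in>J. homog (e j) j" "kindep J (\<lambda>j. j)" "SW J = UNIV"
    using ex_invs_basis by blast
  obtain a where a: "\<forall>w\<in>W. l * z w = (\<Sum>j\<in>J. a j * act w j)"
    using inL_basis [OF J(1,4) assms(4)] by blast
  obtain b where b: "\<forall>w\<in>W. m * z w = (\<Sum>j\<in>J. b j * act w j)"
    using inL_basis [OF J(1,4) assms(5)] by blast
  have eq: "m * a j - l * b j = 0" if "j \<in> J" for j
  proof (rule tau_indep [OF J(1) _ J(3), of e "\<lambda>j. m * a j - l * b j"])
    fix w assume w: "w \<in> W"
    have "(\<Sum>j\<in>J. (m * a j - l * b j) * act w j) = m * (\<Sum>j\<in>J. a j * act w j) - l * (\<Sum>j\<in>J. b j * act w j)"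
      by (simp add: left_diff_distrib sum_subtractf sum_distrib_left mult.assoc)
    also have "\<dots> = m * (l * z w) - l * (m * z w)" using a b w by simp
    also have "\<dots> = 0" by simp
    finally show "(\<Sum>j\<in>J. (m * a j - l * b j) * act w j) = 0" .
  qed (use J that in auto)
  have "\<forall>j\<in>J. \<exists>c. a j = l * c"
  proof
    fix j assume "j \<in> J"
    then have "m * a j = l * b j" using eq [of j] by simp
    then have "l dvd m * a j" by simp
    then show "\<exists>c. a j = l * c" using linear_form_prime [OF l(1,2)] l(3) unfolding dvd_def by blast
  qed
  then obtain c where c: "\<forall>j\<in>J. a j = l * c j" by (rule bchoice [THEN exE])
  show ?thesis
  proof (rule inL_cong)
    show "inL (\<lambda>w. \<Sum>j\<in>J. c j * act w j)" by (intro inL_sum inL_cmult inL_tau)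
    fix w assume w: "w \<in> W"
    have "l * z w = l * (\<Sum>j\<in>J. c j * act w j)"
      using a w c by (simp add: sum_distrib_left mult.assoc)
    then show "z w = (\<Sum>j\<in>J. c j * act w j)" using l(2) unfolding mpoly_mult_cancel by blast
  qed
qed

lemma lam_homog: "homog (Suc 0) (lam g v)"
  by (simp add: lam_def homog_diff hh_homog)

lemma refl_lam:
  assumes s: "s \<in> Rf" shows "\<exists>v c. c \<noteq> 0 \<and> lam s v = poly_const c * al s"
proof -
  obtain v where v: "hh s v \<noteq> pvar v" using reflection_moves [OF s] by blast
  obtain q where q: "lam s v = al s * q" using al_dvd_var [OF s, of v] s by (auto simp: lam_def Rf_inv dvd_def)
  have "homog (Suc 0 + 0) (al s * q)" using lam_homog [of s v] q by simp
  then have "homog 0 q" by (rule homog_cancel [OF al_homog [OF s] _ al_nz [OF s]])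
  then obtain c where c: "q = poly_const c" using homog_zero_const by blast
  have "lam s v \<noteq> 0" using v s by (simp add: lam_def Rf_inv)
  then show ?thesis using q c by (intro exI [of _ v] exI [of _ c]) (auto simp: mult.commute)
qed

text \<open>In the product of \<open>inL_support_one\<close> the reflections can be made to
  contribute \<open>delta\<close>, up to a constant. Any other group element offers two factors, the
  first not dividing the second; both choices lie in \<open>inL\<close>, and
  \<open>inL_saturated\<close> removes the factor.\<close>

lemma inL_delta_one: "inL (\<lambda>w. if w = \<one> then delta else 0)"
proof -
  let ?N = "W - {\<one>} - Rf"
  have finN: "finite ?N" using fin_G by simp
  have "\<forall>s\<in>Rf. \<exists>vc. snd vc \<noteq> 0 \<and> lam s (fst vc) = poly_const (snd vc) * al s"
  proof
    fix s assume "s \<in> Rf"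
    then obtain v c where "c \<noteq> 0 \<and> lam s v = poly_const c * al s" using refl_lam by blast
    then show "\<exists>vc. snd vc \<noteq> 0 \<and> lam s (fst vc) = poly_const (snd vc) * al s"
      by (intro exI [of _ "(v, c)"]) simp
  qed
  then obtain vc where vc: "\<forall>s\<in>Rf. snd (vc s) \<noteq> 0 \<and> lam s (fst (vc s)) = poly_const (snd (vc s)) * al s"
    by (rule bchoice [THEN exE])
  have "\<forall>g\<in>?N. \<exists>ab. lam g (fst ab) \<noteq> 0 \<and> \<not> lam g (fst ab) dvd lam g (snd ab)"
  proof
    fix g assume g: "g \<in> ?N"
    then have "inv g \<in> W" "inv g \<noteq> \<one>" by (auto simp: inv_eq_1_iff)
    moreover have "inv g \<notin> Rf" using g Rf_inv [of "inv g"] by auto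
    ultimately obtain v w where "hh (inv g) v \<noteq> pvar v" "\<not> (pvar v - hh (inv g) v) dvd (pvar w - hh (inv g) w)"
      using non_reflection by blast
    then have "lam g v \<noteq> 0" "\<not> lam g v dvd lam g w" by (simp_all add: lam_def)
    then show "\<exists>ab. lam g (fst ab) \<noteq> 0 \<and> \<not> lam g (fst ab) dvd lam g (snd ab)"
      by (intro exI [of _ "(v, w)"]) simp
  qed
  then obtain ab where ab: "\<forall>g\<in>?N. lam g (fst (ab g)) \<noteq> 0 \<and> \<not> lam g (fst (ab g)) dvd lam g (snd (ab g))"
    by (rule bchoice [THEN exE])
  \<comment> \<open>The boolean selects one of the two factors available at
    \<open>g\<close>.\<close>
  define ch where "ch b g = (if b then fst (ab g) else snd (ab g))" for b :: bool and g
  define Z where "Z X i w = (if w = \<one> then delta * (\<Prod>g\<in>X. lam g (ch (i g) g)) else 0)" for X i w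
  have base: "inL (Z ?N i)" for i
  proof -
    define j where "j g = (if g \<in> Rf then fst (vc g) else ch (i g) g)" for g
    let ?c = "\<Prod>s\<in>Rf. snd (vc s)"
    interpret c: comm_ring_hom "poly_const :: 'k \<Rightarrow> ('v, 'k) mpoly" by (rule poly_const_hom)
    have "W - {\<one>} = Rf \<union> ?N" using Rf_sub Rf_not_one by auto
    then have "(\<Prod>g\<in>W - {\<one>}. lam g (j g)) = (\<Prod>g\<in>Rf. lam g (j g)) * (\<Prod>g\<in>?N. lam g (j g))"
      using fin_Rf finN by (simp add: prod.union_disjoint [symmetric] Diff_Int_distrib2)
    also have "(\<Prod>g\<in>Rf. lam g (j g)) = (\<Prod>g\<in>Rf. poly_const (snd (vc g)) * al g)"
      using vc by (intro prod.cong) (auto simp: j_def)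
    also have "\<dots> = poly_const ?c * delta" by (simp add: prod.distrib c.hom_prod delta_def)
    also have "(\<Prod>g\<in>?N. lam g (j g)) = (\<Prod>g\<in>?N. lam g (ch (i g) g))"
      by (intro prod.cong) (auto simp: j_def)
    finally have P: "(\<Prod>g\<in>W - {\<one>}. lam g (j g)) = poly_const ?c * delta * (\<Prod>g\<in>?N. lam g (ch (i g) g))" .
    have c0: "?c \<noteq> 0" using vc fin_Rf by (simp add: prod_zero_iff)
    show ?thesis
    proof (rule inL_cong [OF inL_cmult [OF inL_support_one [of j], of "poly_const (1 / ?c)"]])
      fix w
      show "Z ?N i w = poly_const (1 / ?c) * (if w = \<one> then \<Prod>g\<in>W - {\<one>}. lam g (j g) else 0)"
        unfolding P Z_def using c0 by (simp add: mult.assoc [symmetric] poly_const_mult [symmetric])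
    qed
  qed
  \<comment> \<open>Induction on the set \<open>Y\<close> of elements whose factor is already
    removed, for all choice functions at once, since each removal needs both choices.\<close>
  have step: "Y \<subseteq> ?N \<Longrightarrow> inL (Z (?N - Y) i)" if "finite Y" for Y i
    using that
  proof (induction Y arbitrary: i)
    case empty
    then show ?case using base by simp
  next
    case (insert g Y)
    let ?X = "?N - insert g Y"
    have g: "g \<in> ?N" "g \<notin> Y" using insert by auto
    have X: "?N - Y = insert g ?X" "g \<notin> ?X" "finite ?X" using g finN by auto
    have Zg: "Z (?N - Y) (i(g := b)) = (\<lambda>w. lam g (ch b g) * Z ?X i w)" for b
    proof
      fix w
      have "(\<Prod>h\<in>?X. lam h (ch ((i(g := b)) h) h)) = (\<Prod>h\<in>?X. lam h (ch (i h) h))"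
        by (intro prod.cong) auto
      then show "Z (?N - Y) (i(g := b)) w = lam g (ch b g) * Z ?X i w"
        unfolding Z_def X(1) prod.insert [OF X(3,2)] by (simp add: ac_simps)
    qed
    have "inL (Z (?N - Y) (i(g := b)))" for b using insert by blast
    then have L: "inL (\<lambda>w. lam g (ch b g) * Z ?X i w)" for b unfolding Zg .
    have "lam g (ch True g) \<noteq> 0" "\<not> lam g (ch True g) dvd lam g (ch False g)"
      using ab g(1) by (auto simp: ch_def)
    then show ?case by (rule inL_saturated [OF lam_homog _ _ L L])
  qed
  have "inL (Z (?N - ?N) (\<lambda>_. True))" by (rule step [OF finN]) simp
  then show ?thesis by (rule inL_cong) (simp add: Z_def)
qed

text \<open>The antisymmetrised vector is multiplied by \<open>eps h\<close> under
  \<open>sig h\<close>. For reflections the sign makes its double a divisible difference, so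
  \<open>delta\<close> divides it; the quotient is fixed by \<open>sig\<close> and hence determined
  by its value at the identity.\<close>

lemma antisym_delta:
  assumes p: "p \<in> QC (\<lambda>_. 1)"
  shows "\<exists>z. \<forall>w\<in>W. (\<Sum>g\<in>W. poly_const (1 / eps g) * sig g p w) = delta * act w z"
proof -
  let ?y = "\<lambda>w. \<Sum>g\<in>W. poly_const (1 / eps g) * sig g p w"
  have one: "conj_inv (\<lambda>_. 1)" by (simp add: conj_inv_def)
  have y: "?y \<in> QC (\<lambda>_. 1)" by (intro QC_sum QC_cmult QC_sig [OF one p])
  have sy: "sig h ?y w = poly_const (eps h) * ?y w" if h: "h \<in> W" and w: "w \<in> W" for h w
  proof -
    have "sig h ?y w = (\<Sum>g\<in>W. poly_const (1 / eps g) * sig (h \<otimes> g) p w)"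
      unfolding sig_def [of h] psubst_sum psubst_simps
      using sig_sig [OF h _ w, of _ p] by (intro sum.cong) (auto simp: sig_def [of h])
    also have "\<dots> = (\<Sum>g\<in>W. poly_const (eps h) * (poly_const (1 / eps (h \<otimes> g)) * sig (h \<otimes> g) p w))"
    proof (intro sum.cong HOL.refl)
      fix g assume g: "g \<in> W"
      have "eps h * (1 / eps (h \<otimes> g)) = 1 / eps g" using eps [OF h] eps [OF g] by (simp add: eps_mult [OF h g])
      then show "poly_const (1 / eps g) * sig (h \<otimes> g) p w = poly_const (eps h) * (poly_const (1 / eps (h \<otimes> g)) * sig (h \<otimes> g) p w)"
        by (simp add: mult.assoc [symmetric] poly_const_mult [symmetric])
    qed
    also have "\<dots> = poly_const (eps h) * ?y w"
      unfolding sum_distrib_left by (rule sum.reindex_bij_betw [OF left_mult_bij [OF h]])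
    finally show ?thesis .
  qed
  have dvd: "delta dvd ?y w" if w: "w \<in> W" for w
  proof -
    have "al s ^ 1 dvd ?y w" if s: "s \<in> Rf" for s
    proof -
      have "sig s ?y w = - ?y w" using sy [of s w] s w by (simp add: eps_refl)
      then have "al s dvd ?y w + ?y w" using rr_dvd [OF y s _ w] by simp
      then have "al s dvd poly_const 2 * ?y w"
        by (simp only: one_add_one [symmetric] poly_const_add poly_const_simps distrib_right mult_1_left)
      then show ?thesis by (simp add: unit_dvd_iff) (use unit_dvd_iff dvd_trans linear_form_prime [OF al_homog [OF s] al_nz [OF s], of "poly_const 2" "?y w"]
            linear_form_not_dvd_const [OF al_homog [OF s] al_nz [OF s], of 2] in auto)
    qed
    then have "(\<Prod>s\<in>Rf. al s ^ 1) dvd ?y w"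
      by (intro linear_forms_prod_dvd [OF fin_Rf]) (use al_homog al_nz al_distinct in auto)
    then show ?thesis by (simp add: delta_def)
  qed
  then have "\<forall>w\<in>W. \<exists>z. ?y w = delta * z" by (auto simp: dvd_def)
  then obtain z where z: "\<forall>w\<in>W. ?y w = delta * z w" by (rule bchoice [THEN exE])
  have "?y w = delta * act w (z \<one>)" if w: "w \<in> W" for w
  proof -
    have "poly_const (eps w) * (delta * act w (z \<one>)) = act w delta * act w (z \<one>)"
      using eps [OF w] by (simp add: mult.assoc)
    also have "\<dots> = sig w ?y w" using z w by (simp add: sig_def [of w ?y])
    also have "\<dots> = poly_const (eps w) * ?y w" by (rule sy [OF w w])
    finally show ?thesis using eps [OF w] unfolding mpoly_mult_cancel by simp
  qed
  then show ?thesis by (intro exI [of _ "z \<one>"]) blast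
qed

text \<open>Antisymmetrise with a weight \<open>q\<close> from \<open>inL\<close>. For
  \<open>q g = a * act g b\<close> the factor \<open>b\<close> passes into \<open>sig g\<close>, and
  \<open>antisym_delta\<close> yields \<open>delta\<close> times an element of \<open>inL\<close>.
  The weight equal to \<open>delta\<close> at the identity and zero elsewhere returns
  \<open>delta * p\<close>, so \<open>p\<close> is in \<open>inL\<close>.\<close>

lemma QC_one_inL:
  assumes p: "p \<in> QC (\<lambda>_. 1)" shows "inL p"
proof -
  have "\<exists>z. inL z \<and> (\<forall>w\<in>W. (\<Sum>g\<in>W. poly_const (1 / eps g) * (q g * sig g p w)) = delta * z w)"
    if "inL q" for q
    using that
  proof (induction rule: inL.induct)
    case (gen q a b)
    obtain z where z: "\<forall>w\<in>W. (\<Sum>g\<in>W. poly_const (1 / eps g) * sig g (\<lambda>w. b * p w) w) = delta * act w z"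
      using antisym_delta [OF QC_cmult [OF p, of b]] by blast
    have "(\<Sum>g\<in>W. poly_const (1 / eps g) * (q g * sig g p w)) = delta * (a * act w z)" if w: "w \<in> W" for w
    proof -
      have "(\<Sum>g\<in>W. poly_const (1 / eps g) * (q g * sig g p w)) =
          a * (\<Sum>g\<in>W. poly_const (1 / eps g) * sig g (\<lambda>w. b * p w) w)"
        unfolding sum_distrib_left using gen by (intro sum.cong) (auto simp: sig_def)
      then show ?thesis using z w by (simp add: mult.left_commute)
    qed
    then show ?case by (intro exI [of _ "\<lambda>w. a * act w z"]) (simp add: inL_cmult inL_tau)
  next
    case (add q r s)
    obtain y z where y: "inL y" "\<forall>w\<in>W. (\<Sum>g\<in>W. poly_const (1 / eps g) * (q g * sig g p w)) = delta * y w"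
      and z: "inL z" "\<forall>w\<in>W. (\<Sum>g\<in>W. poly_const (1 / eps g) * (r g * sig g p w)) = delta * z w"
      using add.IH by blast
    have "(\<Sum>g\<in>W. poly_const (1 / eps g) * (s g * sig g p w)) = delta * (y w + z w)" if w: "w \<in> W" for w
    proof -
      have "(\<Sum>g\<in>W. poly_const (1 / eps g) * (s g * sig g p w)) =
        (\<Sum>g\<in>W. poly_const (1 / eps g) * (q g * sig g p w)) + (\<Sum>g\<in>W. poly_const (1 / eps g) * (r g * sig g p w))"
        unfolding sum.distrib [symmetric] using add.hyps by (intro sum.cong) (auto simp: distrib_left distrib_right)
      then show ?thesis using y(2) z(2) w by (simp add: distrib_left)
    qed
    then show ?case using y(1) z(1) by (intro exI [of _ "\<lambda>w. y w + z w"]) (auto intro: inL.add)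
  qed
  from this [OF inL_delta_one] obtain z where z: "inL z"
    "\<forall>w\<in>W. (\<Sum>g\<in>W. poly_const (1 / eps g) * ((if g = \<one> then delta else 0) * sig g p w)) = delta * z w"
    by blast
  show ?thesis
  proof (rule inL_cong [OF z(1)])
    fix w assume w: "w \<in> W"
    have "(\<Sum>g\<in>W. poly_const (1 / eps g) * ((if g = \<one> then delta else 0) * sig g p w)) =
      (\<Sum>g\<in>W. if g = \<one> then poly_const (1 / eps g) * (delta * sig g p w) else 0)"
      by (intro sum.cong) auto
    also have "\<dots> = delta * p w" using fin_G w by (simp add: eps_one sig_def)
    finally have eq: "(\<Sum>g\<in>W. poly_const (1 / eps g) * ((if g = \<one> then delta else 0) * sig g p w)) = delta * p w" .
    have "delta * p w = delta * z w" using z(2) [THEN bspec, OF w] unfolding eq .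
    then show "p w = z w" using delta_nz unfolding mpoly_mult_cancel by blast
  qed
qed

theorem one_basis: "\<exists>J. is_basis (QC (\<lambda>_. 1)) J (\<lambda>j w. act w j)"
proof -
  obtain J e where J: "finite J" "\<forall>j\<in>J. homog (e j) j" "kindep J (\<lambda>j. j)" "SW J = UNIV"
    using ex_invs_basis by blast
  have "is_basis (QC (\<lambda>_. 1)) J (\<lambda>j w. act w j)"
    unfolding is_basis_def
  proof (intro conjI ballI allI impI)
    show "(\<lambda>w. act w j) \<in> QC (\<lambda>_. 1)" for j by (rule inL_QC [OF inL_tau])
    show "\<exists>q. \<forall>w\<in>W. p w = (\<Sum>j\<in>J. q j * act w j)" if "p \<in> QC (\<lambda>_. 1)" for p
      by (rule inL_basis [OF J(1,4) QC_one_inL [OF that]])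
    show "q j = 0" if "\<forall>w\<in>W. (\<Sum>j\<in>J. q j * act w j) = 0" "j \<in> J" for q j
      by (rule tau_indep [of J e "\<lambda>j. j" q]) (use J that in auto)
  qed (rule J(1))
  then show ?thesis by blast
qed

section \<open>Odd multiplicities\<close>

text \<open>The odd module consists of the vectors whose divided differences exist and lie in the
  even module. By \<open>sigcmb\<close> these are computed on coordinates over the even basis, where
  their existence is the congruence of multiplicity one.\<close>

theorem odd_basis:
  assumes k: "conj_inv k"
  shows "\<exists>(J :: ('v, 'k) mpoly set) e. is_basis (QC (\<lambda>s. 2 * k s + 1)) J e"
proof -
  let ?E = "QC (\<lambda>s. 2 * k s)" and ?O = "QC (\<lambda>s. 2 * k s + 1)"
  obtain e where e: "is_basis ?E W e"
    and eq: "\<forall>g\<in>W. \<forall>h\<in>W. \<forall>w\<in>W. sig h (e g) w = e (h \<otimes> g) w"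
    using even_basis [OF k] by blast
  obtain J where J: "is_basis (QC (\<lambda>_. 1)) J (\<lambda>j w. act w j)" using one_basis by blast
  have conjE: "conj_inv (\<lambda>s. 2 * k s)" and conjO: "conj_inv (\<lambda>s. 2 * k s + 1)"
    using k by (auto simp: conj_inv_def)
  have eE: "e g \<in> ?E" if "g \<in> W" for g using e that by (simp add: is_basis_def)
  have espan: "\<exists>q. \<forall>w\<in>W. p w = (\<Sum>g\<in>W. q g * e g w)" if "p \<in> ?E" for p
    using e that unfolding is_basis_def by blast
  have eind: "\<forall>g\<in>W. q g = 0" if "\<forall>w\<in>W. (\<Sum>g\<in>W. q g * e g w) = 0" for q
    using e that unfolding is_basis_def by blast
  define cmb where "cmb q w = (\<Sum>g\<in>W. q g * e g w)" for q w
  have cmbE: "cmb q \<in> ?E" for q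
    unfolding cmb_def [abs_def] by (intro QC_sum QC_cmult eE)
  have sigcmb: "sig s (cmb q) w = cmb (\<lambda>g. act s (q (s \<otimes> g))) w" if s: "s \<in> Rf" and w: "w \<in> W" for s q w
  proof -
    have "sig s (cmb q) w = (\<Sum>g\<in>W. act s (q g) * e (s \<otimes> g) w)"
      unfolding cmb_def [abs_def] sig_def [of s] psubst_sum psubst_simps
      using eq s w by (intro sum.cong) (auto simp: sig_def)
    also have "\<dots> = (\<Sum>g\<in>W. act s (q (s \<otimes> (s \<otimes> g))) * e (s \<otimes> g) w)"
      using s by (intro sum.cong) auto
    also have "\<dots> = (\<Sum>g\<in>W. act s (q (s \<otimes> g)) * e g w)"
      using s by (intro sum.reindex_bij_betw [OF left_mult_bij]) simp
    finally show ?thesis by (simp add: cmb_def)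
  qed
  have OE: "p \<in> ?E" if "p \<in> ?O" for p
  proof -
    have "al s ^ (2 * k s) dvd p w - p (s \<otimes> w)" if "s \<in> Rf" "w \<in> W" for s w
      by (rule dvd_trans [OF le_imp_power_dvd QC_D [OF \<open>p \<in> ?O\<close> that]]) simp
    then show ?thesis by (simp add: QC_def)
  qed
  have key: "cmb q \<in> ?O \<longleftrightarrow> q \<in> QC (\<lambda>_. 1)" for q
  proof
    assume O: "cmb q \<in> ?O"
    show "q \<in> QC (\<lambda>_. 1)"
      unfolding QC_def
    proof clarify
      fix s w assume s: "s \<in> Rf" and w: "w \<in> W"
      let ?r = "rr s (cmb q)"
      have r: "al s * ?r w = cmb q w - sig s (cmb q) w" if "w \<in> W" for w
        by (rule rr [OF O s _ that]) simp
      \<comment> \<open>Across \<open>s\<close> itself the odd power of \<open>al s\<close> changes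
        sign under \<open>act s\<close>, which leaves
        \<open>al s ^ (2 * k s) * (u - act s u)\<close> as the jump of \<open>?r\<close>.\<close>
      have "?r \<in> ?E"
        unfolding QC_def
      proof clarify
        fix t w assume t: "t \<in> Rf" and w: "w \<in> W"
        show "al t ^ (2 * k t) dvd ?r w - ?r (t \<otimes> w)"
        proof (cases "s = t")
          case False
          have "al t ^ (2 * k t + 1) dvd ?r w - ?r (t \<otimes> w)"
            by (rule rr_other [OF conjO O s _ t False w]) simp
          then show ?thesis by (rule dvd_trans [OF le_imp_power_dvd, rotated]) simp
        next
          case True
          obtain u where u: "cmb q w - cmb q (s \<otimes> w) = al s ^ (2 * k s + 1) * u"
            using QC_D [OF O s w] by (auto simp: dvd_def)
          have "act s (al s ^ (2 * k s + 1)) = - (al s ^ (2 * k s + 1))"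
            by (simp add: al_neg [OF s])
          then have "al s * (?r w - ?r (s \<otimes> w)) = al s * (al s ^ (2 * k s) * (u - act s u))"
            using rr_same [OF O s _ w] u by (simp add: algebra_simps)
          then have "?r w - ?r (s \<otimes> w) = al s ^ (2 * k s) * (u - act s u)"
            using al_nz [OF s] unfolding mpoly_mult_cancel by blast
          then show ?thesis using True by simp
        qed
      qed
      then obtain c where c: "\<forall>w\<in>W. ?r w = (\<Sum>g\<in>W. c g * e g w)" using espan by blast
      have "\<forall>w\<in>W. (\<Sum>g\<in>W. (al s * c g - (q g - act s (q (s \<otimes> g)))) * e g w) = 0"
      proof
        fix w assume w: "w \<in> W"
        have "(\<Sum>g\<in>W. (al s * c g - (q g - act s (q (s \<otimes> g)))) * e g w) =
          al s * (\<Sum>g\<in>W. c g * e g w) - (cmb q w - cmb (\<lambda>g. act s (q (s \<otimes> g))) w)"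
          by (simp add: cmb_def left_diff_distrib sum_subtractf sum_distrib_left mult.assoc)
        also have "\<dots> = al s * ?r w - (cmb q w - sig s (cmb q) w)" using c w sigcmb [OF s w] by simp
        finally show "(\<Sum>g\<in>W. (al s * c g - (q g - act s (q (s \<otimes> g)))) * e g w) = 0"
          using r [OF w] by simp
      qed
      then have "\<forall>g\<in>W. al s * c g - (q g - act s (q (s \<otimes> g))) = 0" by (rule eind)
      then have "al s * c w - (q w - act s (q (s \<otimes> w))) = 0" using w by blast
      then have "al s dvd q w - act s (q (s \<otimes> w))" by (metis dvd_triv_left right_minus_eq)
      then have "al s dvd (q w - act s (q (s \<otimes> w))) - (q (s \<otimes> w) - act s (q (s \<otimes> w)))"
        by (rule dvd_diff [OF _ al_dvd_act [OF s]])
      then show "al s ^ 1 dvd q w - q (s \<otimes> w)" by simp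
    qed
  next
    assume q: "q \<in> QC (\<lambda>_. 1)"
    show "cmb q \<in> ?O"
      unfolding QC_def
    proof clarify
      fix s w assume s: "s \<in> Rf" and w: "w \<in> W"
      \<comment> \<open>Divided differences of the coordinates, so that \<open>cmb c\<close> is
        again in the even module. Comparing jumps across \<open>s\<close> shows that
        \<open>al s\<close> divides \<open>2 * u\<close>, one power more than the even module
        provides.\<close>
      define c where "c = rr s q"
      have c: "al s * c g = q g - act s (q (s \<otimes> g))" if "g \<in> W" for g
        using rr [OF q s _ that] s by (simp add: c_def sig_refl)
      have r: "al s * cmb c w = cmb q w - sig s (cmb q) w" if "w \<in> W" for w
        using sigcmb [OF s that, of q] c
        by (simp add: cmb_def sum_distrib_left mult.assoc [symmetric] left_diff_distrib sum_subtractf)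
      obtain u where u: "cmb q w - cmb q (s \<otimes> w) = al s ^ (2 * k s) * u"
        using QC_D [OF cmbE s w] by (auto simp: dvd_def)
      obtain v where v: "cmb c w - cmb c (s \<otimes> w) = al s ^ (2 * k s) * v"
        using QC_D [OF cmbE s w] by (auto simp: dvd_def)
      obtain z where z: "u - act s u = al s * z" using al_dvd_act [OF s, of u] by (auto simp: dvd_def)
      have "al s * (cmb c w - cmb c (s \<otimes> w)) = (cmb q w - cmb q (s \<otimes> w)) + act s (cmb q w - cmb q (s \<otimes> w))"
        using r [OF w] r [of "s \<otimes> w"] s w by (simp add: right_diff_distrib sig_refl)
      then have "al s ^ (2 * k s) * (al s * v) = al s ^ (2 * k s) * (u + act s u)"
        unfolding u v using al_neg [OF s] by (simp add: algebra_simps)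
      then have "al s * v = u + act s u" using al_nz [OF s] unfolding mpoly_mult_cancel by simp
      then have "u + u = al s * (v + z)" using z by (simp add: distrib_left algebra_simps)
      then have "poly_const 2 * u = al s * (v + z)"
        by (simp only: one_add_one [symmetric] poly_const_add poly_const_simps distrib_right mult_1_left)
      then have "al s dvd poly_const 2 * u" by simp
      then have "al s dvd u"
        using linear_form_prime [OF al_homog [OF s] al_nz [OF s], of "poly_const 2" u]
          linear_form_not_dvd_const [OF al_homog [OF s] al_nz [OF s], of 2] by auto
      then have "al s ^ (2 * k s) * al s dvd al s ^ (2 * k s) * u" by (rule mult_dvd_mono [OF dvd_refl])
      then show "al s ^ (2 * k s + 1) dvd cmb q w - cmb q (s \<otimes> w)" by (simp add: u mult.commute)
    qed
  qed
  define E where "E j w = cmb (\<lambda>g. act g j) w" for j w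
  have "is_basis ?O J E"
    unfolding is_basis_def
  proof (intro conjI ballI allI impI)
    show "finite J" using J by (simp add: is_basis_def)
    show "E j \<in> ?O" if "j \<in> J" for j
      using J that key unfolding E_def [abs_def] is_basis_def by blast
    have cmbsum: "cmb (\<lambda>g. \<Sum>j\<in>J. c j * act g j) w = (\<Sum>j\<in>J. c j * E j w)" for c w
      unfolding cmb_def E_def sum_distrib_left sum_distrib_right by (subst sum.swap) (simp only: mult.assoc)
    have cmb_cong: "cmb q w = cmb q' w" if "\<And>g. g \<in> W \<Longrightarrow> q g = q' g" for q q' w
      unfolding cmb_def using that by (intro sum.cong) auto
    show "\<exists>c. \<forall>w\<in>W. p w = (\<Sum>j\<in>J. c j * E j w)" if p: "p \<in> ?O" for p
    proof -
      obtain q where q: "\<forall>w\<in>W. p w = cmb q w" using espan [OF OE [OF p]] unfolding cmb_def by blast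
      have "q \<in> QC (\<lambda>_. 1)" using key QC_cong [OF _ p, of "cmb q"] q by simp
      then obtain c where c: "\<forall>g\<in>W. q g = (\<Sum>j\<in>J. c j * act g j)"
        using J unfolding is_basis_def by blast
      have "p w = (\<Sum>j\<in>J. c j * E j w)" if "w \<in> W" for w
        using q that cmb_cong [of q "\<lambda>g. \<Sum>j\<in>J. c j * act g j" w] c cmbsum by simp
      then show ?thesis by blast
    qed
    show "c j = 0" if c: "\<forall>w\<in>W. (\<Sum>j\<in>J. c j * E j w) = 0" and j: "j \<in> J" for c j
    proof -
      have "\<forall>w\<in>W. cmb (\<lambda>g. \<Sum>j\<in>J. c j * act g j) w = 0" using c cmbsum by simp
      then have "\<forall>g\<in>W. (\<Sum>j\<in>J. c j * act g j) = 0" unfolding cmb_def by (rule eind)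
      then show ?thesis using J j unfolding is_basis_def by blast
    qed
  qed
  then show ?thesis by blast
qed

end

section \<open>The reflection representation\<close>

lemma dt_mult: "dt n f * dt n g = dt n (\<lambda>i j. \<Sum>l<n. f i l * g l j)"
proof -
  have "mat n n (\<lambda>(i, j). f i j) * mat n n (\<lambda>(i, j). g i j) = mat n n (\<lambda>(i, j). \<Sum>l<n. f i l * g l j)"
    by (rule eq_matI) (auto simp: scalar_prod_def atLeast0LessThan)
  then show ?thesis using det_mult [of "mat n n (\<lambda>(i, j). f i j)" n "mat n n (\<lambda>(i, j). g i j)"] by (simp add: dt_def)
qed

lemma dt_identity: "dt n (\<lambda>i j. if i = j then 1 else 0) = 1"
proof -
  have "mat n n (\<lambda>(i, j). if i = j then 1 else 0) = (1\<^sub>m n :: 'a mat)" by (rule eq_matI) auto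
  then show ?thesis by (simp add: dt_def)
qed

text \<open>Two factorisations of the bordered matrix \<open>[[1, a], [c, 1]]\<close>.\<close>

lemma dt_rank_one:
  fixes c a :: "nat \<Rightarrow> 'a::field"
  shows "dt n (\<lambda>i j. (if i = j then 1 else 0) - c i * a j) = 1 - (\<Sum>i<n. c i * a i)"
proof -
  let ?C = "mat n 1 (\<lambda>(i, j). c i)" and ?A = "mat 1 n (\<lambda>(i, j). a j)"
  let ?M = "mat n n (\<lambda>(i, j). (if i = j then 1 else 0) - c i * a j)"
  let ?s = "mat 1 1 (\<lambda>(i, j). 1 - (\<Sum>i<n. c i * a i))"
  let ?L = "four_block_mat (1\<^sub>m 1) (0\<^sub>m 1 n) ?C (1\<^sub>m n)"
  let ?U = "four_block_mat (1\<^sub>m 1) ?A (0\<^sub>m n 1) ?M"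
  let ?V = "four_block_mat ?s ?A (0\<^sub>m n 1) (1\<^sub>m n)"
  have 1: "?L * ?U = four_block_mat (1\<^sub>m 1) ?A ?C (1\<^sub>m n)"
  proof -
    have "?C * ?A + 1\<^sub>m n * ?M = 1\<^sub>m n"
      by (rule eq_matI) (auto simp: scalar_prod_def)
    moreover have "1\<^sub>m 1 * ?A + 0\<^sub>m 1 n * ?M = ?A" "?C * 1\<^sub>m 1 + 1\<^sub>m n * 0\<^sub>m n 1 = ?C"
      "1\<^sub>m 1 * 1\<^sub>m 1 + 0\<^sub>m 1 n * 0\<^sub>m n 1 = (1\<^sub>m 1 :: 'a mat)"
      by (auto intro!: eq_matI simp: scalar_prod_def)
    ultimately show ?thesis
      by (subst mult_four_block_mat [of _ 1 1 _ n _ n]) auto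
  qed
  have 2: "?V * ?L = four_block_mat (1\<^sub>m 1) ?A ?C (1\<^sub>m n)"
  proof -
    have "?s * 1\<^sub>m 1 + ?A * ?C = 1\<^sub>m 1"
      by (rule eq_matI) (auto simp: scalar_prod_def atLeast0LessThan mult.commute)
    moreover have "?s * 0\<^sub>m 1 n + ?A * 1\<^sub>m n = ?A" "0\<^sub>m n 1 * 1\<^sub>m 1 + 1\<^sub>m n * ?C = ?C"
      "0\<^sub>m n 1 * 0\<^sub>m 1 n + 1\<^sub>m n * 1\<^sub>m n = (1\<^sub>m n :: 'a mat)"
      by (auto intro!: eq_matI simp: scalar_prod_def)
    ultimately show ?thesis
      by (subst mult_four_block_mat [of _ 1 1 _ n _ n]) auto
  qed
  have dL: "det ?L = 1"
    by (subst det_four_block_mat_upper_right_zero [where n = 1 and m = n]) auto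
  have cM: "?L \<in> carrier_mat (1 + n) (1 + n)" "?U \<in> carrier_mat (1 + n) (1 + n)" "?V \<in> carrier_mat (1 + n) (1 + n)"
    by (intro four_block_carrier_mat; simp)+
  have "det ?U = det ?M" by (subst det_four_block_mat_lower_left_zero_col [where n = n]) auto
  moreover have "det ?V = 1 - (\<Sum>i<n. c i * a i)"
    by (subst det_four_block_mat_lower_left_zero_col [where n = n]) (auto simp: det_single)
  moreover have "det ?L * det ?U = det ?V * det ?L"
    using det_mult [OF cM(1,2)] det_mult [OF cM(3,1)] 1 2 by simp
  ultimately show ?thesis using dL by (simp add: dt_def)
qed

section \<open>Reflections in the finite linear group\<close>

locale refl_setup = finite_dimensional_vector_space scale B
  for scale :: "'k::field_char_0 \<Rightarrow> 'v::ab_group_add \<Rightarrow> 'v" (infixr "*s" 75) and B :: "'v set" +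
  fixes W :: "('w, 'x) monoid_scheme" (structure)
    and S :: "'w set"
    and \<rho> :: "'w \<Rightarrow> 'v \<Rightarrow> 'v"
    and \<alpha> :: "'v set \<Rightarrow> 'v \<Rightarrow> 'k"
  assumes cox: "coxeter_system W S"
    and finW: "finite (carrier W)"
    and rep: "reflection_representation scale W S \<rho>"
    and forms: "defining_forms scale W \<rho> \<alpha>"
begin

lemma W_group: "group W" using cox by (simp add: coxeter_system_def)

sublocale W: group W by (rule W_group)

definition lf :: "('v \<Rightarrow> 'k) \<Rightarrow> bool" where
  "lf a \<longleftrightarrow> (\<forall>x y. a (x + y) = a x + a y) \<and> (\<forall>c x. a (c *s x) = c * a x)"

lemma lf_add: "lf a \<Longrightarrow> a (x + y) = a x + a y" and lf_scale: "lf a \<Longrightarrow> a (c *s x) = c * a x"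
  by (simp_all add: lf_def)

lemma lf_diff: "lf a \<Longrightarrow> a (x - y) = a x - a y"
  using lf_add [of a "x - y" y] by simp

lemma lf_zero: "lf a \<Longrightarrow> a 0 = 0"
  using lf_diff [of a 0 0] by simp

lemma lf_sum: "lf a \<Longrightarrow> a (sum f I) = (\<Sum>i\<in>I. a (f i))"
  by (induction I rule: infinite_finite_induct) (auto simp: lf_add lf_zero)

lemma rho_one: "\<rho> \<one> v = v" and rho_mult: "g \<in> carrier W \<Longrightarrow> h \<in> carrier W \<Longrightarrow> \<rho> (g \<otimes> h) v = \<rho> g (\<rho> h v)"
  using rep by (auto simp: reflection_representation_def)

lemma rho_inj:
  assumes "g \<in> carrier W" "h \<in> carrier W" "\<And>v. \<rho> g v = \<rho> h v" shows "g = h"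
proof (rule inj_onD [of \<rho> "carrier W"])
  show "inj_on \<rho> (carrier W)" using rep by (simp add: reflection_representation_def)
  show "\<rho> g = \<rho> h" by (rule ext) (rule assms(3))
qed (rule assms)+

lemma rho_linear: "g \<in> carrier W \<Longrightarrow> Vector_Spaces.linear scale scale (\<rho> g)"
  using rep by (simp add: reflection_representation_def)

lemma rho_add: "g \<in> carrier W \<Longrightarrow> \<rho> g (x + y) = \<rho> g x + \<rho> g y"
  and rho_scale: "g \<in> carrier W \<Longrightarrow> \<rho> g (c *s x) = c *s \<rho> g x"
  and rho_diff: "g \<in> carrier W \<Longrightarrow> \<rho> g (x - y) = \<rho> g x - \<rho> g y"
proof -
  assume "g \<in> carrier W"
  then interpret Vector_Spaces.linear scale scale "\<rho> g" by (rule rho_linear)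
  show "\<rho> g (x + y) = \<rho> g x + \<rho> g y" by (rule add)
  show "\<rho> g (c *s x) = c *s \<rho> g x" by (rule scale)
  show "\<rho> g (x - y) = \<rho> g x - \<rho> g y" by (rule diff)
qed

lemma rho_inv: "g \<in> carrier W \<Longrightarrow> \<rho> (inv g) (\<rho> g v) = v" "g \<in> carrier W \<Longrightarrow> \<rho> g (\<rho> (inv g) v) = v"
  by (simp_all add: rho_mult [symmetric] rho_one)

lemma lf_rho: "lf a \<Longrightarrow> g \<in> carrier W \<Longrightarrow> lf (\<lambda>v. a (\<rho> g v))"
  by (simp add: lf_def rho_add rho_scale)

definition coord :: "'v \<Rightarrow> 'v \<Rightarrow> 'k" where "coord b v = representation B v b"

lemma in_span_B [simp]: "v \<in> span B" using span_Basis by simp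

lemma coord_sum: "(\<Sum>b\<in>B. coord b v *s b) = v"
  unfolding coord_def by (rule sum_representation_eq [OF independent_Basis]) (auto simp: finite_Basis)

lemma lf_coord: "lf (coord b)"
  unfolding lf_def coord_def
  using representation_add [OF independent_Basis] representation_scale [OF independent_Basis] by simp

lemma coord_basis: "c \<in> B \<Longrightarrow> coord b c = (if b = c then 1 else 0)"
  unfolding coord_def by (simp add: representation_basis [OF independent_Basis])

lemma lf_expand: "lf a \<Longrightarrow> a v = (\<Sum>b\<in>B. coord b v * a b)"
proof -
  assume a: "lf a"
  have "a v = a (\<Sum>b\<in>B. coord b v *s b)" by (simp only: coord_sum)
  also have "\<dots> = (\<Sum>b\<in>B. coord b v * a b)" using a by (simp add: lf_sum lf_scale)
  finally show ?thesis .
qed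

lemma dim_hyperplane:
  assumes a: "lf a" and nz: "a v0 \<noteq> 0"
  shows "Suc (dim {v. a v = 0}) = dim (UNIV :: 'v set)"
proof -
  let ?H = "{v. a v = 0}"
  have H: "subspace ?H" using a by (auto simp: subspace_def lf_zero lf_add lf_scale)
  then have "v0 \<notin> span ?H" using nz by (simp add: span_eq_iff [THEN iffD2])
  moreover have "span (insert v0 ?H) = UNIV"
  proof -
    have "v \<in> span (insert v0 ?H)" for v
    proof -
      let ?c = "a v / a v0"
      have "v - ?c *s v0 \<in> ?H" using a nz by (simp add: lf_diff lf_scale)
      then have "v - ?c *s v0 \<in> span (insert v0 ?H)" by (intro span_base) simp
      moreover have "?c *s v0 \<in> span (insert v0 ?H)" by (intro span_scale span_base) simp
      ultimately show ?thesis using span_add [of "v - ?c *s v0" _ "?c *s v0"] by simp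
    qed
    then show ?thesis by blast
  qed
  ultimately show ?thesis using dim_insert [of v0 ?H] dim_span [of "insert v0 ?H"] by simp
qed

definition Rf :: "'w set" where "Rf = {s \<in> carrier W. is_reflection scale (\<rho> s)}"

definition hyp :: "'w \<Rightarrow> 'v set" where "hyp s = fixed_space (\<rho> s)"

definition fm :: "'w \<Rightarrow> 'v \<Rightarrow> 'k" where "fm s = \<alpha> (hyp s)"

lemma Rf_W: "s \<in> Rf \<Longrightarrow> s \<in> carrier W" by (simp add: Rf_def)

lemma hyp_in: "s \<in> Rf \<Longrightarrow> hyp s \<in> reflection_hyperplanes scale W \<rho>"
  by (auto simp: Rf_def hyp_def reflection_hyperplanes_def)

lemma fm_lf: "s \<in> Rf \<Longrightarrow> lf (fm s)"
proof -
  assume "s \<in> Rf"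
  then have "Vector_Spaces.linear scale (*) (fm s)"
    using forms hyp_in by (simp add: defining_forms_def fm_def)
  then interpret Vector_Spaces.linear scale "(*)" "fm s" .
  show ?thesis by (simp add: lf_def add scale)
qed

lemma fm_ker: "s \<in> Rf \<Longrightarrow> fm s v = 0 \<longleftrightarrow> \<rho> s v = v"
  using forms hyp_in [of s] by (auto simp: defining_forms_def fm_def hyp_def fixed_space_def)

lemma Rf_square: "s \<in> Rf \<Longrightarrow> s \<otimes> s = \<one>"
proof (rule rho_inj)
  assume s: "s \<in> Rf"
  then have "\<rho> s \<circ> \<rho> s = id" by (simp add: Rf_def is_reflection_def)
  then show "\<rho> (s \<otimes> s) v = \<rho> \<one> v" for v
    using s by (simp add: rho_mult Rf_W rho_one fun_eq_iff)
qed (auto simp: Rf_W)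

text \<open>The vector \<open>c\<close> is the coroot for the chosen form, namely
  \<open>v0 - \<rho> s v0\<close> for a vector with \<open>fm s v0 = 1\<close>. That
  \<open>s\<close> is an involution forces the value 2.\<close>

lemma reflection_formula:
  assumes s: "s \<in> Rf" obtains c where "\<And>v. \<rho> s v = v - fm s v *s c" "fm s c = 2"
proof -
  have sW: "s \<in> carrier W" using s by (rule Rf_W)
  have "Suc (dim (hyp s)) = dim (UNIV :: 'v set)"
    using s by (simp add: Rf_def is_reflection_def hyp_def)
  then have "hyp s \<noteq> UNIV" by auto
  then obtain u where u: "fm s u \<noteq> 0" using fm_ker [OF s] by (auto simp: hyp_def fixed_space_def)
  define v0 where "v0 = (1 / fm s u) *s u"
  have v0: "fm s v0 = 1" using u by (simp add: v0_def lf_scale [OF fm_lf [OF s]])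
  define c where "c = v0 - \<rho> s v0"
  have f: "\<rho> s v = v - fm s v *s c" for v
  proof -
    have "fm s (v - fm s v *s v0) = 0" by (simp add: lf_diff [OF fm_lf [OF s]] lf_scale [OF fm_lf [OF s]] v0)
    then have "\<rho> s (v - fm s v *s v0) = v - fm s v *s v0" using fm_ker [OF s] by blast
    then have "\<rho> s v = v - fm s v *s v0 + fm s v *s \<rho> s v0"
      by (simp add: rho_diff [OF sW] rho_scale [OF sW] algebra_simps)
    then show ?thesis by (simp add: c_def scale_right_diff_distrib)
  qed
  have "\<rho> s (\<rho> s v0) = v0" using Rf_square [OF s] by (simp add: rho_mult [symmetric] sW rho_one)
  moreover have "\<rho> s (\<rho> s v0) = v0 - (2 - fm s c) *s c"
  proof -
    have "\<rho> s v0 = v0 - c" using f [of v0] v0 by simp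
    then have "\<rho> s (\<rho> s v0) = (v0 - c) - fm s (v0 - c) *s c" using f [of "v0 - c"] by simp
    also have "fm s (v0 - c) = 1 - fm s c" by (simp add: lf_diff [OF fm_lf [OF s]] v0)
    also have "(v0 - c) - (1 - fm s c) *s c = v0 - (2 - fm s c) *s c"
    proof -
      have "2 - fm s c = 1 + (1 - fm s c)" by simp
      then have "(2 - fm s c) *s c = c + (1 - fm s c) *s c" by (simp only: scale_left_distrib scale_one)
      then show ?thesis by (simp only: diff_diff_add)
    qed
    finally show ?thesis .
  qed
  ultimately have "(2 - fm s c) *s c = 0" by (metis diff_0_right diff_left_imp_eq)
  moreover have "c \<noteq> 0"
  proof
    assume "c = 0"
    then have "\<rho> s v0 = v0" unfolding c_def by simp
    then show False using v0 fm_ker [OF s, of v0] by simp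
  qed
  ultimately have "fm s c = 2" by simp
  with f show ?thesis by (rule that)
qed

text \<open>The displacement of the n-th power is n times that of \<open>x\<close>. Finite order and
  characteristic 0 make it vanish.\<close>

lemma transvection_trivial:
  assumes x: "x \<in> carrier W" and f: "\<And>v. \<rho> x v = v - a v *s c" and a: "lf a" and "a c = 0"
  shows "a v *s c = 0"
proof -
  have "\<rho> (x [^] n) v = v - (of_nat n * a v) *s c" for n :: nat and v
  proof (induction n arbitrary: v)
    case 0
    then show ?case by (simp add: rho_one)
  next
    case (Suc n)
    have "a (\<rho> x v) = a v" by (simp add: f lf_diff [OF a] lf_scale [OF a] assms(4))
    then have "\<rho> (x [^] Suc n) v = (v - a v *s c) - (of_nat n * a v) *s c"
      using x by (simp add: rho_mult Suc f)
    then show ?case by (simp add: scale_left_distrib algebra_simps)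
  qed
  from this [of "Coset.order W" v] have "(of_nat (Coset.order W) * a v) *s c = 0"
    using W.pow_order_eq_1 [OF x] by (simp add: rho_one)
  moreover have "(of_nat (Coset.order W) :: 'k) \<noteq> 0"
    using finW W.one_closed by (auto simp: Coset.order_def card_eq_0_iff)
  ultimately show ?thesis by auto
qed

text \<open>Two reflections with a common hyperplane compose to a shear along it, which is trivial
  by \<open>transvection_trivial\<close>. This makes \<open>hyperplane_reflection\<close> well
  defined.\<close>

lemma hyp_inj:
  assumes s: "s \<in> Rf" and t: "t \<in> Rf" and "hyp s = hyp t" shows "s = t"
proof -
  obtain c where c: "\<And>v. \<rho> s v = v - fm s v *s c" "fm s c = 2" using reflection_formula [OF s] by metis
  obtain d where d: "\<And>v. \<rho> t v = v - fm t v *s d" "fm t d = 2" using reflection_formula [OF t] by metis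
  have fm: "fm t = fm s" using assms(3) by (simp add: fm_def)
  note lf = fm_lf [OF s]
  have st: "\<rho> (s \<otimes> t) v = v - fm s v *s (d - c)" for v
  proof -
    have "fm s (v - fm s v *s d) = - fm s v" using d(2) by (simp add: lf_diff [OF lf] lf_scale [OF lf] fm)
    then have "\<rho> s (\<rho> t v) = v - fm s v *s d + fm s v *s c"
      using c(1) [of "v - fm s v *s d"] d(1) [of v] by (simp add: fm)
    then show ?thesis using s t by (simp add: rho_mult Rf_W scale_right_diff_distrib)
  qed
  have "fm s v *s (d - c) = 0" for v
    by (rule transvection_trivial [OF _ st lf]) (use s t c d fm in \<open>auto simp: Rf_W lf_diff [OF lf]\<close>)
  then have "\<rho> (s \<otimes> t) v = \<rho> \<one> v" for v by (simp add: st rho_one)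
  then have "s \<otimes> t = \<one>" using s t by (intro rho_inj) (auto simp: Rf_W)
  then show ?thesis using s t Rf_square [OF t] Rf_W by (metis W.inv_equality)
qed

lemma reflection_criterion:
  assumes x: "x \<in> carrier W" and f: "\<And>v. \<rho> x v = v - a v *s c" and a: "lf a" and "a c = 2"
  shows "x \<in> Rf" "hyp x = {v. a v = 0}"
proof -
  have c: "c \<noteq> 0" using assms(4) lf_zero [OF a] by auto
  have H: "fixed_space (\<rho> x) = {v. a v = 0}" using c by (auto simp: fixed_space_def f)
  then show "hyp x = {v. a v = 0}" by (simp add: hyp_def)
  have "\<rho> x (\<rho> x v) = v" for v
  proof -
    have "a (v - a v *s c) = - a v" using assms(4) by (simp add: lf_diff [OF a] lf_scale [OF a])
    then show ?thesis using f [of "v - a v *s c"] f [of v] by simp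
  qed
  then have "\<rho> x \<circ> \<rho> x = id" by (simp add: fun_eq_iff)
  moreover have "Suc (dim (fixed_space (\<rho> x))) = dim (UNIV :: 'v set)"
    unfolding H by (rule dim_hyperplane [OF a, of c]) (simp add: assms(4))
  ultimately show "x \<in> Rf" using x rho_linear [OF x] by (simp add: Rf_def is_reflection_def)
qed

lemma Rf_conj:
  assumes g: "g \<in> carrier W" and s: "s \<in> Rf"
  shows "g \<otimes> s \<otimes> inv g \<in> Rf" "hyp (g \<otimes> s \<otimes> inv g) = {v. fm s (\<rho> (inv g) v) = 0}"
    "hyp (g \<otimes> s \<otimes> inv g) = \<rho> g ` hyp s"
proof -
  obtain c where c: "\<And>v. \<rho> s v = v - fm s v *s c" "fm s c = 2" using reflection_formula [OF s] by metis
  have sW: "s \<in> carrier W" using s by (rule Rf_W)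
  have f: "\<rho> (g \<otimes> s \<otimes> inv g) v = v - fm s (\<rho> (inv g) v) *s \<rho> g c" for v
    using g sW by (simp add: rho_mult c(1) rho_diff rho_scale rho_inv)
  have l: "lf (\<lambda>v. fm s (\<rho> (inv g) v))" using lf_rho [OF fm_lf [OF s]] g by simp
  have 2: "fm s (\<rho> (inv g) (\<rho> g c)) = 2" using g c(2) by (simp add: rho_inv)
  have W: "g \<otimes> s \<otimes> inv g \<in> carrier W" using g sW by simp
  show "g \<otimes> s \<otimes> inv g \<in> Rf" and H: "hyp (g \<otimes> s \<otimes> inv g) = {v. fm s (\<rho> (inv g) v) = 0}"
    using reflection_criterion [OF W f l 2] by auto
  show "hyp (g \<otimes> s \<otimes> inv g) = \<rho> g ` hyp s"
  proof -
    have "\<rho> g ` hyp s = {v. fm s (\<rho> (inv g) v) = 0}"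
    proof (intro equalityI subsetI)
      fix v assume "v \<in> {v. fm s (\<rho> (inv g) v) = 0}"
      then have "\<rho> (inv g) v \<in> hyp s" using fm_ker [OF s] by (simp add: hyp_def fixed_space_def)
      then show "v \<in> \<rho> g ` hyp s" by (intro image_eqI [of _ _ "\<rho> (inv g) v"]) (simp_all only: rho_inv(2) [OF g])
    next
      fix v assume "v \<in> \<rho> g ` hyp s"
      then obtain x where x: "v = \<rho> g x" "x \<in> hyp s" by (rule imageE)
      then have "fm s x = 0" using fm_ker [OF s] by (simp add: hyp_def fixed_space_def)
      then show "v \<in> {v. fm s (\<rho> (inv g) v) = 0}" using g by (simp add: x(1) rho_inv)
    qed
    then show ?thesis using H by simp
  qed
qed

lemma lf_same_kernel:
  assumes a: "lf a" and b: "lf b" and ker: "\<And>v. a v = 0 \<Longrightarrow> b v = 0" and nz: "b v0 \<noteq> 0"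
  shows "\<exists>u. u \<noteq> 0 \<and> (\<forall>v. b v = u * a v)"
proof -
  have a0: "a v0 \<noteq> 0" using ker nz by blast
  have *: "b v = (b v0 / a v0) * a v" for v
  proof -
    have "a (v - (a v / a v0) *s v0) = 0" using a0 by (simp add: lf_diff [OF a] lf_scale [OF a])
    then have "b (v - (a v / a v0) *s v0) = 0" by (rule ker)
    then show ?thesis using a0 by (simp add: lf_diff [OF b] lf_scale [OF b] field_simps)
  qed
  show ?thesis by (rule exI [of _ "b v0 / a v0"], intro conjI allI) (use a0 nz in simp, rule *)
qed

lemma S_Rf: "S \<subseteq> Rf"
  using cox rep by (auto simp: Rf_def coxeter_system_def reflection_representation_def)

lemma Rf_generate: "generate W Rf = carrier W"
proof
  show "generate W Rf \<subseteq> carrier W" by (rule W.generate_incl) (auto simp: Rf_W)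
  have "generate W S \<subseteq> generate W Rf" by (rule W.mono_generate [OF S_Rf])
  then show "carrier W \<subseteq> generate W Rf" using cox by (simp add: coxeter_system_def)
qed

text \<open>The group is generated by involutions. In \<open>pseudo_reflection\<close> this excludes
  maps that fix a hyperplane pointwise and scale a complement by a root of unity other than
  -1.\<close>

lemma det_pm1:
  obtains bx where "bij_betw bx {..<card B} B"
    "\<And>g. g \<in> carrier W \<Longrightarrow> (dt (card B) (\<lambda>i j. coord (bx i) (\<rho> g (bx j)))) ^ 2 = 1"
proof -
  let ?n = "card B"
  obtain bx where bx: "bij_betw bx {..<?n} B"
    using ex_bij_betw_nat_finite [OF finite_Basis] by (auto simp: atLeast0LessThan)
  have bxB: "bx i \<in> B" if "i < ?n" for i using bx that by (auto simp: bij_betw_def)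
  have bx_inj: "bx i = bx j \<longleftrightarrow> i = j" if "i < ?n" "j < ?n" for i j
    using bx that by (auto simp: bij_betw_def inj_on_def)
  define D where "D g = dt ?n (\<lambda>i j. coord (bx i) (\<rho> g (bx j)))" for g
  have Dmult: "D (g \<otimes> h) = D g * D h" if "g \<in> carrier W" "h \<in> carrier W" for g h
  proof -
    have "coord (bx i) (\<rho> (g \<otimes> h) (bx j)) = (\<Sum>l<?n. coord (bx i) (\<rho> g (bx l)) * coord (bx l) (\<rho> h (bx j)))" for i j
    proof -
      have "coord (bx i) (\<rho> g (\<rho> h (bx j))) = (\<Sum>b\<in>B. coord b (\<rho> h (bx j)) * coord (bx i) (\<rho> g b))"
        by (rule lf_expand [OF lf_rho [OF lf_coord that(1)]])
      also have "\<dots> = (\<Sum>l<?n. coord (bx l) (\<rho> h (bx j)) * coord (bx i) (\<rho> g (bx l)))"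
        by (rule sum.reindex_bij_betw [OF bx, symmetric])
      finally show ?thesis using that by (simp add: rho_mult mult.commute)
    qed
    then show ?thesis unfolding D_def dt_mult by simp
  qed
  have D1: "D \<one> = 1"
  proof -
    have "D \<one> = dt ?n (\<lambda>i j. if i = j then 1 else 0)"
      unfolding D_def by (rule dt_cong) (simp add: rho_one coord_basis bxB bx_inj)
    then show ?thesis by (simp add: dt_identity)
  qed
  have "D g ^ 2 = 1" if "g \<in> generate W Rf" for g
    using that
  proof (induction rule: generate.induct)
    case one
    then show ?case by (simp add: D1)
  next
    case (incl s)
    then have "D s * D s = D (s \<otimes> s)" by (simp add: Dmult Rf_W)
    then show ?case using incl by (simp add: Rf_square D1 power2_eq_square)
  next
    case (inv s)
    then have "D s * D s = D (s \<otimes> s)" by (simp only: Dmult Rf_W)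
    moreover have "inv s = s" using Rf_square [OF inv] inv by (simp add: Rf_W W.inv_equality)
    ultimately show ?case using inv by (simp add: Rf_square D1 power2_eq_square)
  next
    case (eng g h)
    then show ?case using Rf_generate by (simp add: Dmult power_mult_distrib)
  qed
  then show ?thesis using that [OF bx] by (simp add: D_def Rf_generate)
qed

text \<open>The determinant of the identity minus a rank one map is \<open>1 - a c\<close>, so
  \<open>a c\<close> is 0 or 2. The first case is a shear of finite order and hence trivial, the
  second is a reflection.\<close>

lemma pseudo_reflection:
  assumes g: "g \<in> carrier W" and f: "\<And>v. \<rho> g v = v - a v *s c" and a: "lf a" and ne: "g \<noteq> \<one>"
  shows "g \<in> Rf"
proof -
  obtain bx where bx: "bij_betw bx {..<card B} B"
    and D: "\<And>g. g \<in> carrier W \<Longrightarrow> (dt (card B) (\<lambda>i j. coord (bx i) (\<rho> g (bx j)))) ^ 2 = 1"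
    by (rule det_pm1) blast
  have bxB: "bx i \<in> B" if "i < card B" for i using bx that by (auto simp: bij_betw_def)
  have bx_inj: "bx i = bx j \<longleftrightarrow> i = j" if "i < card B" "j < card B" for i j
    using bx that by (auto simp: bij_betw_def inj_on_def)
  have "dt (card B) (\<lambda>i j. coord (bx i) (\<rho> g (bx j))) =
    dt (card B) (\<lambda>i j. (if i = j then 1 else 0) - coord (bx i) c * a (bx j))"
    by (rule dt_cong) (simp add: f lf_diff [OF lf_coord] lf_scale [OF lf_coord] coord_basis bxB bx_inj)
  also have "\<dots> = 1 - (\<Sum>i<card B. coord (bx i) c * a (bx i))" by (rule dt_rank_one)
  also have "(\<Sum>i<card B. coord (bx i) c * a (bx i)) = (\<Sum>b\<in>B. coord b c * a b)"
    by (rule sum.reindex_bij_betw [OF bx])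
  also have "\<dots> = a c" by (rule lf_expand [OF a, symmetric])
  finally have "(1 - a c) ^ 2 = 1" using D [OF g] by simp
  then have "a c * (a c - 2) = 0" by (simp add: power2_eq_square algebra_simps)
  then consider "a c = 0" | "a c = 2" by auto
  then show ?thesis
  proof cases
    case 1
    then have "a v *s c = 0" for v by (rule transvection_trivial [OF g f a])
    then have "g = \<one>" using g by (intro rho_inj) (simp_all add: f rho_one)
    then show ?thesis using ne by simp
  next
    case 2
    then show ?thesis by (rule reflection_criterion(1) [OF g f a])
  qed
qed

end

section \<open>From the representation to the action on polynomials\<close>

context refl_setup
begin

abbreviation fp :: "('v \<Rightarrow> 'k) \<Rightarrow> ('v, 'k) mpoly" where "fp a \<equiv> form_poly B a"

lemma fp_sum: "fp a = (\<Sum>b\<in>B. poly_const (a b) * pvar b)"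
  unfolding form_poly_def by (simp add: poly_const_def pvar_def mult_single)

lemma fp_PV: "fp a \<in> PV B"
  unfolding fp_sum by (intro PV_sum PV_mult) auto

lemma fp_homog: "homog (Suc 0) (fp a)"
  unfolding fp_sum by (intro homog_sum homog_const_mult homog_var)

lemma peval_fp: "lf a \<Longrightarrow> peval (\<lambda>b. coord b v) (fp a) = a v"
proof -
  assume a: "lf a"
  have "peval (\<lambda>b. coord b v) (fp a) = (\<Sum>b\<in>B. coord b v * a b)"
    unfolding fp_sum insn_sum [OF ident_hom] by (simp add: mult.commute)
  then show ?thesis by (simp only: lf_expand [OF a, symmetric])
qed

lemma fp_dvd_kernel: "fp a dvd fp b \<Longrightarrow> lf a \<Longrightarrow> lf b \<Longrightarrow> a v = 0 \<Longrightarrow> b v = 0"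
  by (metis dvdE peval_fp peval_simps(6) mult_zero_left)

lemma fp_eq_0: "lf a \<Longrightarrow> fp a = 0 \<Longrightarrow> a v = 0"
  by (metis peval_fp peval_simps(3))

lemma fp_scale: "fp (\<lambda>v. k * a v) = poly_const k * fp a"
  by (simp add: fp_sum sum_distrib_left poly_const_mult mult.assoc)

lemma fp_diff: "fp (\<lambda>v. a v - b v) = fp a - fp b"
proof -
  interpret comm_ring_hom "poly_const :: 'k \<Rightarrow> ('v, 'k) mpoly" by (rule poly_const_hom)
  show ?thesis by (simp add: fp_sum hom_minus left_diff_distrib sum_subtractf)
qed

lemma fp_coord: "b \<in> B \<Longrightarrow> fp (coord b) = pvar b"
proof -
  assume b: "b \<in> B"
  have "fp (coord b) = (\<Sum>c\<in>B. if c = b then pvar c else 0)"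
    unfolding fp_sum by (rule sum.cong) (auto simp: coord_basis)
  then show ?thesis using b finite_Basis by simp
qed

text \<open>The contragredient action on coordinate functions, where the inverse makes it a left
  action, extended by the identity to variables outside \<open>B\<close>.\<close>

definition hh :: "'w \<Rightarrow> 'v \<Rightarrow> ('v, 'k) mpoly" where
  "hh g v = (if v \<in> B then fp (\<lambda>u. coord v (\<rho> (inv g) u)) else pvar v)"

definition al :: "'w \<Rightarrow> ('v, 'k) mpoly" where "al s = fp (fm s)"

lemma psubst_fp:
  assumes g: "g \<in> carrier W" and a: "lf a"
  shows "psubst (hh g) (fp a) = fp (\<lambda>u. a (\<rho> (inv g) u))"
proof -
  interpret comm_ring_hom "poly_const :: 'k \<Rightarrow> ('v, 'k) mpoly" by (rule poly_const_hom)
  have "psubst (hh g) (fp a) = (\<Sum>b\<in>B. poly_const (a b) * fp (\<lambda>u. coord b (\<rho> (inv g) u)))"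
    unfolding fp_sum [of a] psubst_sum by (rule sum.cong) (simp_all add: hh_def)
  also have "\<dots> = (\<Sum>b\<in>B. \<Sum>c\<in>B. poly_const (coord b (\<rho> (inv g) c) * a b) * pvar c)"
    by (simp add: fp_sum sum_distrib_left poly_const_mult ac_simps)
  also have "\<dots> = (\<Sum>c\<in>B. \<Sum>b\<in>B. poly_const (coord b (\<rho> (inv g) c) * a b) * pvar c)"
    by (rule sum.swap)
  also have "\<dots> = (\<Sum>c\<in>B. poly_const (a (\<rho> (inv g) c)) * pvar c)"
    by (intro sum.cong HOL.refl) (simp add: lf_expand [OF a, of "\<rho> (inv g) _"] hom_sum sum_distrib_right)
  finally show ?thesis by (simp add: fp_sum)
qed

lemma fm_ex: "s \<in> Rf \<Longrightarrow> \<exists>v. fm s v \<noteq> 0"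
proof -
  assume "s \<in> Rf"
  then obtain c where "fm s c = 2" by (rule reflection_formula)
  then show ?thesis by (intro exI [of _ c]) simp
qed

lemma var_diff: "v \<in> B \<Longrightarrow> pvar v - hh g v = fp (\<lambda>u. coord v u - coord v (\<rho> (inv g) u))"
  by (simp add: fp_diff fp_coord hh_def)

lemma Rf_inv_self: "s \<in> Rf \<Longrightarrow> inv s = s"
  using Rf_square [of s] by (simp add: Rf_W W.inv_equality)

lemma coord_eqI: "(\<And>b. b \<in> B \<Longrightarrow> coord b u = coord b v) \<Longrightarrow> u = v"
proof -
  assume "\<And>b. b \<in> B \<Longrightarrow> coord b u = coord b v"
  then have "(\<Sum>b\<in>B. coord b u *s b) = (\<Sum>b\<in>B. coord b v *s b)" by (intro sum.cong) auto
  then show ?thesis by (simp only: coord_sum)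
qed

lemma lf_minus: "lf a \<Longrightarrow> lf b \<Longrightarrow> lf (\<lambda>v. a v - b v)"
  by (simp add: lf_def right_diff_distrib)

text \<open>If one nonzero difference divided all the others, every displacement by
  \<open>inv g\<close> would be a multiple of a fixed vector, and \<open>pseudo_reflection\<close>
  would make \<open>g\<close> a reflection. This supplies the two factors used in
  \<open>inL_delta_one\<close>.\<close>

lemma hh_non_reflection:
  assumes g: "g \<in> carrier W" and ne: "g \<noteq> \<one>" and nR: "g \<notin> Rf"
  shows "\<exists>v w. hh g v \<noteq> pvar v \<and> hh g w \<noteq> pvar w \<and> \<not> (pvar v - hh g v) dvd (pvar w - hh g w)"
proof (rule ccontr)
  assume contra: "\<not> ?thesis"
  let ?b = "\<lambda>w u. coord w u - coord w (\<rho> (inv g) u)"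
  have ig: "inv g \<in> carrier W" using g by simp
  have lfb: "lf (?b w)" for w
    by (rule lf_minus [OF lf_coord lf_rho [OF lf_coord ig]])
  have "\<exists>v\<in>B. \<exists>u. ?b v u \<noteq> 0"
  proof (rule ccontr)
    assume neg: "\<not> ?thesis"
    have "\<rho> (inv g) u = \<rho> \<one> u" for u
    proof (rule coord_eqI)
      fix w assume "w \<in> B"
      then have "?b w u = 0" using neg by blast
      then show "coord w (\<rho> (inv g) u) = coord w (\<rho> \<one> u)" by (simp only: rho_one right_minus_eq)
    qed
    then have "inv g = \<one>" using ig by (intro rho_inj) auto
    then show False using ne g by (metis W.inv_inv W.inv_one)
  qed
  then obtain v u0 where v: "v \<in> B" and u0: "?b v u0 \<noteq> 0" by blast
  have v_moved: "hh g v \<noteq> pvar v"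
    using u0 fp_eq_0 [OF lfb [of v], of u0] var_diff [OF v, of g] by auto
  have "\<exists>k. \<forall>u. ?b w u = k * ?b v u" if w: "w \<in> B" for w
  proof (cases "\<exists>u1. ?b w u1 \<noteq> 0")
    case False
    then show ?thesis by (intro exI [of _ 0]) simp
  next
    case True
    then obtain u1 where u1: "?b w u1 \<noteq> 0" ..
    then have "hh g w \<noteq> pvar w"
      using fp_eq_0 [OF lfb [of w], of u1] var_diff [OF w, of g] by auto
    then have "(pvar v - hh g v) dvd (pvar w - hh g w)" using contra v_moved by blast
    then have dvd: "fp (?b v) dvd fp (?b w)" using v w by (simp add: var_diff)
    have "?b w u = 0" if "?b v u = 0" for u by (rule fp_dvd_kernel [OF dvd lfb lfb that])
    then have "\<exists>k. k \<noteq> 0 \<and> (\<forall>u. ?b w u = k * ?b v u)" 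
      using lf_same_kernel [OF lfb [of v] lfb [of w], of u1] u1 by blast
    then show ?thesis by blast
  qed
  then have "\<forall>w\<in>B. \<exists>k. \<forall>u. ?b w u = k * ?b v u" by blast
  from bchoice [OF this] obtain k where k: "\<forall>w\<in>B. \<forall>u. ?b w u = k w * ?b v u" ..
  \<comment> \<open>The direction of all displacements, assembled from the factors of
    proportionality.\<close>
  let ?c = "\<Sum>w\<in>B. k w *s w"
  have "\<rho> (inv g) u = u - ?b v u *s ?c" for u
  proof (rule coord_eqI)
    fix w assume w: "w \<in> B"
    have "coord w ?c = (\<Sum>b\<in>B. if w = b then k b else 0)"
      unfolding lf_sum [OF lf_coord] by (rule sum.cong) (auto simp: lf_scale [OF lf_coord] coord_basis)
    then have c: "coord w ?c = k w" using w finite_Basis by simp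
    have m: "?b w u = k w * ?b v u" using k w by blast
    have "coord w (u - ?b v u *s ?c) = coord w u - k w * ?b v u"
      by (simp only: lf_diff [OF lf_coord] lf_scale [OF lf_coord] c mult.commute)
    then show "coord w (\<rho> (inv g) u) = coord w (u - ?b v u *s ?c)" unfolding m [symmetric] by simp
  qed
  moreover have "inv g \<noteq> \<one>" using ne g by (metis W.inv_inv W.inv_one)
  ultimately have "inv g \<in> Rf" using pseudo_reflection [OF ig _ lfb [of v]] by blast
  then show False using nR Rf_inv_self g by fastforce
qed

lemma reflection_action: "reflection_action W B hh Rf al"
proof
  show "finite (carrier W)" by (rule finW)
  show "finite B" by (rule finite_Basis)
  show "homog (Suc 0) (hh g v)" for g v
    by (simp add: hh_def fp_homog)
  show "hh g b \<in> PV B" if "b \<in> B" for g b using that by (simp add: hh_def fp_PV)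
  show "hh g v = pvar v" if "v \<notin> B" for g v using that by (simp add: hh_def)
  show "hh \<one> v = pvar v" for v
    using fp_coord [of v] by (simp add: hh_def rho_one)
  show "hh (g \<otimes> h) v = psubst (hh g) (hh h v)" if g: "g \<in> carrier W" and h: "h \<in> carrier W" for g h v
  proof (cases "v \<in> B")
    case True
    have "lf (\<lambda>u. coord v (\<rho> (inv h) u))" using lf_rho [OF lf_coord] h by simp
    then show ?thesis using True g h by (simp add: hh_def psubst_fp W.inv_mult_group rho_mult)
  qed (simp add: hh_def)
  show "Rf \<subseteq> carrier W" using Rf_W by blast
  show "s \<otimes> s = \<one>" if "s \<in> Rf" for s using that by (rule Rf_square)
  show "homog (Suc 0) (al s)" for s by (simp add: al_def fp_homog)
  show "al s \<in> PV B" for s by (simp add: al_def fp_PV)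
  show "al s \<noteq> 0" if s: "s \<in> Rf" for s
    using fm_ex [OF s] fp_eq_0 [OF fm_lf [OF s]] by (auto simp: al_def)
  show "al s dvd pvar v - hh s v" if s: "s \<in> Rf" for s v
  proof (cases "v \<in> B")
    case True
    obtain c where c: "\<And>v. \<rho> s v = v - fm s v *s c" by (rule reflection_formula [OF s]) blast
    have "(\<lambda>u. coord v u - coord v (\<rho> (inv s) u)) = (\<lambda>u. coord v c * fm s u)"
      by (rule ext) (simp add: Rf_inv_self [OF s] c lf_diff [OF lf_coord] lf_scale [OF lf_coord])
    then show ?thesis using True by (simp add: var_diff fp_scale al_def)
  qed (simp add: hh_def)
  show "psubst (hh s) (al s) = - al s" if s: "s \<in> Rf" for s
  proof -
    obtain c where c: "\<And>v. \<rho> s v = v - fm s v *s c" "fm s c = 2" by (rule reflection_formula [OF s]) blast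
    have "psubst (hh s) (al s) = fp (\<lambda>u. fm s (\<rho> s u))"
      using psubst_fp [OF Rf_W [OF s] fm_lf [OF s]] by (simp add: al_def Rf_inv_self [OF s])
    also have "(\<lambda>u. fm s (\<rho> s u)) = (\<lambda>u. - 1 * fm s u)"
      by (rule ext) (simp add: c lf_diff [OF fm_lf [OF s]] lf_scale [OF fm_lf [OF s]])
    finally show ?thesis by (simp only: fp_scale al_def) simp
  qed
  show "\<not> al s dvd al t" if s: "s \<in> Rf" and t: "t \<in> Rf" and "s \<noteq> t" for s t
  proof
    assume "al s dvd al t"
    then have k: "fm t v = 0" if "fm s v = 0" for v
      using fp_dvd_kernel [OF _ fm_lf [OF s] fm_lf [OF t] that] by (simp add: al_def)
    obtain v0 where "fm t v0 \<noteq> 0" using fm_ex [OF t] ..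
    then obtain u where "u \<noteq> 0" "\<And>v. fm t v = u * fm s v"
      using lf_same_kernel [OF fm_lf [OF s] fm_lf [OF t], of v0] k by blast
    then have "fm s v = 0 \<longleftrightarrow> fm t v = 0" for v by simp
    then have "hyp s = hyp t" using fm_ker s t by (auto simp: hyp_def fixed_space_def)
    then show False using hyp_inj [OF s t] \<open>s \<noteq> t\<close> by blast
  qed
  show R: "g \<otimes> s \<otimes> inv g \<in> Rf" if "g \<in> carrier W" "s \<in> Rf" for g s using that by (rule Rf_conj)
  show "\<exists>u. u \<noteq> 0 \<and> psubst (hh g) (al s) = poly_const u * al (g \<otimes> s \<otimes> inv g)"
    if g: "g \<in> carrier W" and s: "s \<in> Rf" for g s
  proof -
    let ?t = "g \<otimes> s \<otimes> inv g"
    have lf: "lf (\<lambda>u. fm s (\<rho> (inv g) u))" using lf_rho [OF fm_lf [OF s]] g by simp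
    have t: "?t \<in> Rf" by (rule R [OF g s])
    have ker: "fm ?t v = 0 \<longleftrightarrow> fm s (\<rho> (inv g) v) = 0" for v
    proof -
      have "fm ?t v = 0 \<longleftrightarrow> v \<in> hyp ?t" using fm_ker [OF t] by (simp add: hyp_def fixed_space_def)
      then show ?thesis using Rf_conj(2) [OF g s] by simp
    qed
    obtain v0 where "fm ?t v0 \<noteq> 0" using fm_ex [OF t] ..
    then have "fm s (\<rho> (inv g) v0) \<noteq> 0" using ker by blast
    then obtain u where "u \<noteq> 0" "\<And>v. fm s (\<rho> (inv g) v) = u * fm ?t v"
      using lf_same_kernel [OF fm_lf [OF t] lf, of v0] ker by blast
    then show ?thesis using psubst_fp [OF g fm_lf [OF s]]
      by (intro exI [of _ u]) (simp add: al_def fp_scale)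
  qed
  show "generate W Rf = carrier W" by (rule Rf_generate)
  show "\<exists>v w. hh g v \<noteq> pvar v \<and> hh g w \<noteq> pvar w \<and> \<not> (pvar v - hh g v) dvd (pvar w - hh g w)"
    if "g \<in> carrier W" "g \<noteq> \<one>" "g \<notin> Rf" for g by (rule hh_non_reflection [OF that])
qed

lemma hyperplane_reflection: "s \<in> Rf \<Longrightarrow> hyperplane_reflection scale W \<rho> (hyp s) = s"
  unfolding hyperplane_reflection_def
proof (rule the_equality)
  fix t assume s: "s \<in> Rf" and t: "t \<in> carrier W \<and> is_reflection scale (\<rho> t) \<and> fixed_space (\<rho> t) = hyp s"
  have "t \<in> Rf" "hyp t = hyp s" using t by (simp_all add: Rf_def hyp_def)
  then show "t = s" using s by (intro hyp_inj)
qed (auto simp: Rf_def hyp_def)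

lemma hyperplanes: "reflection_hyperplanes scale W \<rho> = hyp ` Rf"
  by (auto simp: reflection_hyperplanes_def Rf_def hyp_def)

sublocale RA: reflection_action W B hh Rf al by (rule reflection_action)

lemma conj_inv_hyp: "invariant_multiplicity scale W \<rho> m \<Longrightarrow> RA.conj_inv (\<lambda>s. m (hyp s))"
  using Rf_conj(3) hyp_in by (simp add: RA.conj_inv_def invariant_multiplicity_def)

end

section \<open>Regular sequences along chains of primes\<close>

lemma prime_in_ideal: "prime_in R P \<Longrightarrow> ideal_in R P" by (simp add: prime_in_def)

definition gen :: "'a::comm_ring_1 set \<Rightarrow> 'a set \<Rightarrow> 'a set" where
  "gen R X = \<Inter> {I. ideal_in R I \<and> X \<subseteq> I}"

lemma gen_minimal: "ideal_in R I \<Longrightarrow> X \<subseteq> I \<Longrightarrow> gen R X \<subseteq> I"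
  by (auto simp: gen_def)

lemma gen_superset: "X \<subseteq> gen R X" by (auto simp: gen_def)

lemma gen_in: "x \<in> X \<Longrightarrow> x \<in> gen R X" using gen_superset by blast

lemma gen_mono: "X \<subseteq> Y \<Longrightarrow> gen R X \<subseteq> gen R Y" by (auto simp: gen_def)

lemma ideal_in_self: "sub_ring R \<Longrightarrow> ideal_in R R"
  by (simp add: sub_ring_def ideal_in_def)

lemma gen_ideal: "sub_ring R \<Longrightarrow> X \<subseteq> R \<Longrightarrow> ideal_in R (gen R X)"
  unfolding ideal_in_def [of R "gen R X"]
proof (intro conjI ballI)
  assume R: "sub_ring R" "X \<subseteq> R"
  show "gen R X \<subseteq> R" using gen_minimal [OF ideal_in_self [OF R(1)] R(2)] .
qed (auto simp: gen_def intro: ideal_in_0 ideal_in_add ideal_in_mult)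

definition noeth :: "'a::comm_ring_1 set \<Rightarrow> bool" where
  "noeth R \<longleftrightarrow> (\<forall>I. ideal_in R I \<longrightarrow>
     (\<exists>X. finite X \<and> X \<subseteq> I \<and> (\<forall>K. ideal_in R K \<and> X \<subseteq> K \<longrightarrow> I \<subseteq> K)))"

lemma noethD: "noeth R \<Longrightarrow> ideal_in R I \<Longrightarrow>
    \<exists>X. finite X \<and> X \<subseteq> I \<and> (\<forall>K. ideal_in R K \<and> X \<subseteq> K \<longrightarrow> I \<subseteq> K)"
  unfolding noeth_def by (elim allE, erule mp)

text \<open>Properness of the ideal generated by the sequence comes from the prime in which the
  sequence is found.\<close>

definition regular :: "'a::comm_ring_1 set \<Rightarrow> 'a list \<Rightarrow> bool" where
  "regular R xs \<longleftrightarrow> set xs \<subseteq> R \<and>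
     (\<forall>i<length xs. \<forall>r\<in>R. xs ! i * r \<in> gen R (set (take i xs)) \<longrightarrow> r \<in> gen R (set (take i xs)))"

definition prime_chain :: "'a::comm_ring_1 set \<Rightarrow> nat \<Rightarrow> (nat \<Rightarrow> 'a set) \<Rightarrow> bool" where
  "prime_chain R n P \<longleftrightarrow> (\<forall>i\<le>n. prime_in R (P i)) \<and> (\<forall>i<n. P i \<subset> P (Suc i))"

definition regular_chains :: "'a::comm_ring_1 set \<Rightarrow> bool" where
  "regular_chains R \<longleftrightarrow> (\<forall>n P. prime_chain R n P \<longrightarrow>
     (\<exists>xs. length xs = n \<and> set xs \<subseteq> P n \<and> regular R xs))"

lemma prime_chain_mono: "prime_chain R n P \<Longrightarrow> i \<le> j \<Longrightarrow> j \<le> n \<Longrightarrow> P i \<subseteq> P j"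
proof (induction j)
  case (Suc j)
  then show ?case
  proof (cases "i = Suc j")
    case False
    then have "P i \<subseteq> P j" using Suc by simp
    then show ?thesis using Suc.prems unfolding prime_chain_def by (meson Suc_le_lessD order.trans psubset_imp_subset)
  qed simp
qed simp

section \<open>Finitely generated submodules and finite extensions\<close>

definition submodule_of :: "'a::comm_ring_1 set \<Rightarrow> ('j \<Rightarrow> 'a) set \<Rightarrow> bool" where
  "submodule_of R M \<longleftrightarrow> (\<lambda>_. 0) \<in> M \<and> (\<forall>u\<in>M. \<forall>v\<in>M. (\<lambda>j. u j + v j) \<in> M) \<and>
     (\<forall>r\<in>R. \<forall>v\<in>M. (\<lambda>j. r * v j) \<in> M)"

lemma submodule_0: "submodule_of R M \<Longrightarrow> (\<lambda>_. 0) \<in> M"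
  and submodule_add: "submodule_of R M \<Longrightarrow> u \<in> M \<Longrightarrow> v \<in> M \<Longrightarrow> (\<lambda>j. u j + v j) \<in> M"
  and submodule_scale: "submodule_of R M \<Longrightarrow> r \<in> R \<Longrightarrow> v \<in> M \<Longrightarrow> (\<lambda>j. r * v j) \<in> M"
  by (simp_all add: submodule_of_def)

lemma submodule_Int: "submodule_of R M \<Longrightarrow> submodule_of R N \<Longrightarrow> submodule_of R (M \<inter> N)"
  by (simp add: submodule_of_def)

lemma submodule_vanishing: "submodule_of R {v. v l = 0}"
  by (simp add: submodule_of_def)

text \<open>The values at one coordinate form an ideal, and the vectors vanishing there are covered
  by induction. Coordinates outside \<open>J\<close> are not controlled, hence the conclusion up to
  agreement on \<open>J\<close>.\<close>

lemma noeth_submodule: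
  fixes M :: "('j \<Rightarrow> 'a::comm_ring_1) set"
  assumes R: "sub_ring R" "noeth R" and "finite J" "submodule_of R M"
    and "\<forall>v\<in>M. \<forall>j\<in>J. v j \<in> R"
  shows "\<exists>G. finite G \<and> G \<subseteq> M \<and> (\<forall>N. submodule_of R N \<and> G \<subseteq> N \<longrightarrow> (\<forall>v\<in>M. \<exists>u\<in>N. \<forall>j\<in>J. u j = v j))"
  using assms(3-)
proof (induction J arbitrary: M)
  case empty
  show ?case by (rule exI [of _ "{}"]) (auto dest: submodule_0)
next
  case (insert l J)
  note M = insert.prems(1)
  have eval_ideal: "ideal_in R ((\<lambda>v. v l) ` N)" if N: "submodule_of R N" "N \<subseteq> M" for N
    unfolding ideal_in_def
  proof (intro conjI ballI)
    show "(\<lambda>v. v l) ` N \<subseteq> R" using insert.prems(2) N(2) by blast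
    show "0 \<in> (\<lambda>v. v l) ` N" using submodule_0 [OF N(1)] by (rule rev_image_eqI) simp
  next
    fix x y assume "x \<in> (\<lambda>v. v l) ` N" "y \<in> (\<lambda>v. v l) ` N"
    then obtain u v where uv: "u \<in> N" "v \<in> N" "x = u l" "y = v l" by blast
    show "x + y \<in> (\<lambda>v. v l) ` N" by (rule rev_image_eqI [OF submodule_add [OF N(1) uv(1,2)]]) (simp add: uv)
  next
    fix r x assume r: "r \<in> R" and "x \<in> (\<lambda>v. v l) ` N"
    then obtain u where u: "u \<in> N" "x = u l" by blast
    show "r * x \<in> (\<lambda>v. v l) ` N" by (rule rev_image_eqI [OF submodule_scale [OF N(1) r u(1)]]) (simp add: u)
  qed
  let ?I = "(\<lambda>v. v l) ` M" and ?M0 = "M \<inter> {v. v l = 0}"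
  obtain X where X0: "finite X \<and> X \<subseteq> ?I \<and> (\<forall>K. ideal_in R K \<and> X \<subseteq> K \<longrightarrow> ?I \<subseteq> K)"
    using noethD [OF R(2) eval_ideal [OF M order_refl]] by (rule exE)
  then have X: "finite X" "X \<subseteq> ?I" and Xgen: "\<And>K. ideal_in R K \<Longrightarrow> X \<subseteq> K \<Longrightarrow> ?I \<subseteq> K"
    by simp_all
  obtain H where H: "H \<subseteq> M" "finite H" "X = (\<lambda>v. v l) ` H" using finite_subset_image [OF X] by blast
  have M0: "submodule_of R ?M0" by (rule submodule_Int [OF M submodule_vanishing])
  have M0R: "\<forall>v\<in>?M0. \<forall>j\<in>J. v j \<in> R" using insert.prems(2) by simp
  obtain G where G0: "finite G \<and> G \<subseteq> ?M0 \<and>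
      (\<forall>N. submodule_of R N \<and> G \<subseteq> N \<longrightarrow> (\<forall>v\<in>?M0. \<exists>u\<in>N. \<forall>j\<in>J. u j = v j))"
    using insert.IH [OF M0 M0R] by (rule exE)
  then have G: "finite G" "G \<subseteq> ?M0" by simp_all
  have Ggen: "\<exists>u\<in>N. \<forall>j\<in>J. u j = v j" if "submodule_of R N" "G \<subseteq> N" "v \<in> ?M0" for N v
    using bspec [OF mp [OF spec [OF conjunct2 [OF conjunct2 [OF G0]], of N] conjI [OF that(1,2)]] that(3)] .
  have "\<exists>u\<in>N. \<forall>j\<in>insert l J. u j = v j" if N: "submodule_of R N" "G \<union> H \<subseteq> N" and v: "v \<in> M" for N v
  proof -
    have "?I \<subseteq> (\<lambda>v. v l) ` (N \<inter> M)"
      by (rule Xgen [OF eval_ideal [OF submodule_Int [OF N(1) M]]]) (use H N in auto)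
    then have "v l \<in> (\<lambda>v. v l) ` (N \<inter> M)" using v by (rule subsetD [OF _ imageI])
    then obtain u where u: "u \<in> N" "u \<in> M" "u l = v l" by auto
    \<comment> \<open>Subtracting an element of \<open>N\<close> with the same value at
      \<open>l\<close> leads to the submodule treated by induction.\<close>
    have "(\<lambda>j. v j + (- 1) * u j) \<in> M"
      by (rule submodule_add [OF M v submodule_scale [OF M _ u(2)]])
        (simp add: sub_ring_uminus [OF R(1) sub_ring_1 [OF R(1)]])
    then have "(\<lambda>j. v j + (- 1) * u j) \<in> ?M0" using u(3) by simp
    moreover have "G \<subseteq> N \<inter> {v. v l = 0}" using N(2) G(2) by blast
    ultimately have "\<exists>w\<in>N \<inter> {v. v l = 0}. \<forall>j\<in>J. w j = v j + (- 1) * u j"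
      by (intro Ggen submodule_Int [OF N(1) submodule_vanishing])
    then obtain w where w: "w \<in> N" "w l = 0" "\<forall>j\<in>J. w j = v j + (- 1) * u j" by blast
    show ?thesis
      by (rule bexI [OF _ submodule_add [OF N(1) u(1) w(1)]]) (use u w in auto)
  qed
  then show ?case using G H by (intro exI [of _ "G \<union> H"] conjI allI impI ballI) (elim conjE | blast | simp)+
qed

text \<open>The case \<open>f = 0\<close> is a finite extension; for \<open>f \<noteq> 0\<close> it says that the hypersurface ring \<open>S/fS\<close> is finite
  over \<open>R\<close>.\<close>

locale finite_ext =
  fixes R S :: "'a::comm_ring_1 set" and f :: 'a and J :: "'j set" and e :: "'j \<Rightarrow> 'a"
  assumes R: "sub_ring R" and S: "sub_ring S" and RS: "R \<subseteq> S" and f: "f \<in> S"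
    and finJ: "finite J" and eS: "j \<in> J \<Longrightarrow> e j \<in> S"
    and span: "s \<in> S \<Longrightarrow> \<exists>c t. (\<forall>j\<in>J. c j \<in> R) \<and> t \<in> S \<and> s = (\<Sum>j\<in>J. c j * e j) + f * t"
begin

text \<open>Pull \<open>I\<close> back to coefficient vectors over \<open>R\<close>, where
  \<open>noeth_submodule\<close> applies; the extra generator \<open>f\<close> accounts for the
  remainder \<open>f * t\<close>.\<close>

lemma noeth_ext:
  assumes N: "noeth R" and I: "ideal_in S I" "f \<in> I"
  shows "\<exists>X. finite X \<and> X \<subseteq> I \<and> (\<forall>K. ideal_in S K \<and> X \<subseteq> K \<longrightarrow> I \<subseteq> K)"
proof -
  let ?c = "\<lambda>c. \<Sum>j\<in>J. c j * e j"
  define M where "M = {c. (\<forall>j\<in>J. c j \<in> R) \<and> ?c c \<in> I}"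
  have submod: "submodule_of R {c. ?c c \<in> K}" if K: "ideal_in S K" for K
    unfolding submodule_of_def
  proof (intro conjI ballI; clarify)
    show "(\<Sum>j\<in>J. 0 * e j) \<in> K" using ideal_in_0 [OF K] by simp
    show "(\<Sum>j\<in>J. (u j + v j) * e j) \<in> K" if "?c u \<in> K" "?c v \<in> K" for u v
      using ideal_in_add [OF K that] by (simp add: distrib_right sum.distrib)
    show "(\<Sum>j\<in>J. r * v j * e j) \<in> K" if "r \<in> R" "?c v \<in> K" for r v
      using ideal_in_mult [OF K subsetD [OF RS that(1)] that(2)] by (simp add: sum_distrib_left mult.assoc)
  qed
  have "submodule_of R {c. \<forall>j\<in>J. c j \<in> R}"
    unfolding submodule_of_def by (auto intro: sub_ring_0 sub_ring_add sub_ring_mult R)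
  from submodule_Int [OF this submod [OF I(1)]] have M: "submodule_of R M"
    by (simp add: M_def Collect_conj_eq)
  have MR: "\<forall>v\<in>M. \<forall>j\<in>J. v j \<in> R" by (simp add: M_def)
  obtain G where G0: "finite G \<and> G \<subseteq> M \<and>
      (\<forall>N. submodule_of R N \<and> G \<subseteq> N \<longrightarrow> (\<forall>v\<in>M. \<exists>u\<in>N. \<forall>j\<in>J. u j = v j))"
    using noeth_submodule [OF R N finJ M MR] by (rule exE)
  then have G: "finite G" "G \<subseteq> M" by simp_all
  have Ggen: "\<exists>u\<in>N. \<forall>j\<in>J. u j = v j" if "submodule_of R N" "G \<subseteq> N" "v \<in> M" for N v
    using bspec [OF mp [OF spec [OF conjunct2 [OF conjunct2 [OF G0]], of N] conjI [OF that(1,2)]] that(3)] .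
  have "I \<subseteq> K" if K: "ideal_in S K" "insert f (?c ` G) \<subseteq> K" for K
  proof
    fix s assume s: "s \<in> I"
    then obtain c t where c: "\<forall>j\<in>J. c j \<in> R" and t: "t \<in> S" and s_eq: "s = ?c c + f * t"
      using span ideal_in_sub [OF I(1)] by blast
    have "?c c = s - f * t" by (simp add: s_eq)
    also have "\<dots> \<in> I"
      using ideal_in_diff [OF S I(1) s ideal_in_mult [OF I(1) t I(2)]] by (simp add: mult.commute)
    finally have "c \<in> M" using c by (simp add: M_def)
    moreover have "G \<subseteq> {c. ?c c \<in> K}" using K(2) by blast
    ultimately have "\<exists>u\<in>{c. ?c c \<in> K}. \<forall>j\<in>J. u j = c j" by (intro Ggen submod [OF K(1)])
    then obtain u where u: "?c u \<in> K" "\<forall>j\<in>J. u j = c j" by blast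
    have "?c c = ?c u" using u(2) by (intro sum.cong) auto
    moreover have "f * t \<in> K" using ideal_in_mult [OF K(1) t, of f] K(2) by (simp add: mult.commute)
    ultimately show "s \<in> K" using u(1) ideal_in_add [OF K(1)] by (simp add: s_eq)
  qed
  moreover have "insert f (?c ` G) \<subseteq> I" using I(2) G(2) by (auto simp: M_def)
  ultimately show ?thesis using G(1) by (intro exI [of _ "insert f (?c ` G)"]) simp
qed

lemma contract_prime: "prime_in S P \<Longrightarrow> prime_in R (P \<inter> R)"
proof -
  assume P: "prime_in S P"
  have I: "ideal_in S P" by (rule prime_in_ideal [OF P])
  have "ideal_in R (P \<inter> R)"
    unfolding ideal_in_def using RS ideal_in_0 [OF I] ideal_in_add [OF I] ideal_in_mult [OF I]
    by (auto intro: sub_ring_0 [OF R] sub_ring_add [OF R] sub_ring_mult [OF R])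
  then show ?thesis using P RS unfolding prime_in_def by blast
qed

text \<open>Modulo a prime containing \<open>f\<close>, the powers of any element satisfy a relation over \<open>R\<close>;
  its lowest coefficient outside the prime lies in every larger prime containing the element.\<close>

lemma incomparable:
  assumes P: "prime_in S P" and P': "prime_in S P'" and PP': "P \<subset> P'" and fP: "f \<in> P"
  shows "P \<inter> R \<subset> P' \<inter> R"
proof (rule ccontr)
  assume "\<not> ?thesis"
  then have eq: "P' \<inter> R = P \<inter> R" using PP' by blast
  obtain x where x: "x \<in> P'" "x \<notin> P" using PP' by blast
  note I = prime_in_ideal [OF P] and I' = prime_in_ideal [OF P']
  have xS: "x \<in> S" by (rule ideal_in_sub [OF I' x(1)])
  let ?n = "card J"
  have "\<forall>i. \<exists>v t. (\<forall>j\<in>J. v j \<in> R) \<and> t \<in> S \<and> x ^ i = (\<Sum>j\<in>J. v j * e j) + f * t"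
    using span sub_ring_power [OF S xS] by blast
  from choice [OF this] obtain v where
    "\<forall>i. \<exists>t. (\<forall>j\<in>J. v i j \<in> R) \<and> t \<in> S \<and> x ^ i = (\<Sum>j\<in>J. v i j * e j) + f * t" ..
  from choice [OF this] obtain t where
    v: "\<And>i j. j \<in> J \<Longrightarrow> v i j \<in> R" and t: "\<And>i. t i \<in> S" and
    xi: "\<And>i. x ^ i = (\<Sum>j\<in>J. v i j * e j) + f * t i" by blast
  \<comment> \<open>There is one more power of \<open>x\<close> than there are generators, hence a
    relation over \<open>R\<close> modulo the contracted prime.\<close>
  have "\<exists>r. (\<forall>i\<in>{..?n}. r i \<in> R) \<and> (\<exists>i\<in>{..?n}. r i \<notin> P \<inter> R) \<and> (\<forall>j\<in>J. (\<Sum>i\<le>?n. r i * v i j) \<in> P \<inter> R)"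
    by (rule dependent_mod_prime [OF R contract_prime [OF P] finJ]) (use v in auto)
  then obtain r where r: "\<And>i. i \<le> ?n \<Longrightarrow> r i \<in> R" and ex: "\<exists>i. i \<le> ?n \<and> r i \<notin> P"
    and rel: "\<And>j. j \<in> J \<Longrightarrow> (\<Sum>i\<le>?n. r i * v i j) \<in> P" by auto
  define k where "k = (LEAST i. i \<le> ?n \<and> r i \<notin> P)"
  have k: "k \<le> ?n" "r k \<notin> P" using LeastI_ex [OF ex] by (simp_all add: k_def)
  have low: "r i \<in> P" if "i < k" for i using not_less_Least [of i] that k(1) unfolding k_def by fastforce
  have rS: "r i \<in> S" if "i \<le> ?n" for i using r [OF that] RS by blast
  have "(\<Sum>i\<le>?n. r i * x ^ i) = (\<Sum>j\<in>J. e j * (\<Sum>i\<le>?n. r i * v i j)) + (\<Sum>i\<le>?n. r i * t i) * f"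
  proof -
    have "(\<Sum>i\<le>?n. r i * x ^ i) = (\<Sum>i\<le>?n. (\<Sum>j\<in>J. e j * (r i * v i j)) + r i * t i * f)"
      by (rule sum.cong [OF HOL.refl]) (simp only: xi distrib_left sum_distrib_left ac_simps)
    also have "\<dots> = (\<Sum>i\<le>?n. \<Sum>j\<in>J. e j * (r i * v i j)) + (\<Sum>i\<le>?n. r i * t i) * f"
      by (simp only: sum.distrib sum_distrib_right)
    also have "(\<Sum>i\<le>?n. \<Sum>j\<in>J. e j * (r i * v i j)) = (\<Sum>j\<in>J. \<Sum>i\<le>?n. e j * (r i * v i j))"
      by (rule sum.swap)
    finally show ?thesis by (simp only: sum_distrib_left)
  qed
  also have "\<dots> \<in> P"
    by (intro ideal_in_add [OF I] ideal_in_sum [OF I] ideal_in_mult [OF I] eS rel fP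
        sub_ring_sum [OF S] sub_ring_mult [OF S] rS t) auto
  finally have all: "(\<Sum>i\<le>?n. r i * x ^ i) \<in> P" .
  \<comment> \<open>The relation without its terms below \<open>k\<close>, which lie in
    \<open>P\<close>, and divided by \<open>x ^ k\<close>; its constant term is
    \<open>r k\<close>.\<close>
  let ?y = "\<Sum>i\<in>{k..?n}. r i * x ^ (i - k)"
  have yS: "?y \<in> S" by (intro sub_ring_sum [OF S] sub_ring_mult [OF S] sub_ring_power [OF S] xS rS) auto
  have "{..?n} = {..<k} \<union> {k..?n}" using k(1) by auto
  then have "(\<Sum>i\<le>?n. r i * x ^ i) = (\<Sum>i<k. r i * x ^ i) + (\<Sum>i\<in>{k..?n}. r i * x ^ i)"
    by (simp add: sum.union_disjoint ivl_disj_int)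
  also have "(\<Sum>i\<in>{k..?n}. r i * x ^ i) = x ^ k * ?y"
    unfolding sum_distrib_left
    by (rule sum.cong [OF HOL.refl]) (simp add: mult.left_commute flip: power_add)
  finally have "x ^ k * ?y = (\<Sum>i\<le>?n. r i * x ^ i) - (\<Sum>i<k. x ^ i * r i)" by (simp add: mult.commute)
  also have "\<dots> \<in> P"
    by (intro ideal_in_diff [OF S I] all ideal_in_sum [OF I] ideal_in_mult [OF I] sub_ring_power [OF S] xS low) auto
  finally have "x ^ k * ?y \<in> P" .
  moreover have "x ^ i \<notin> P" for i
  proof (induction i)
    case 0
    then show ?case using P by (simp add: prime_in_def)
  next
    case (Suc i)
    then show ?case using P x(2) xS sub_ring_power [OF S xS, of i] by (auto simp: prime_in_def)
  qed
  ultimately have "?y \<in> P" using P yS sub_ring_power [OF S xS] unfolding prime_in_def by blast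
  then have y': "?y \<in> P'" using PP' by blast
  have "?y = r k + (\<Sum>i\<in>{k<..?n}. r i * x ^ (i - k))"
    using k(1) by (simp add: sum.head [OF k(1)])
  then have "r k = ?y - (\<Sum>i\<in>{k<..?n}. r i * x ^ (i - k))" by simp
  also have "\<dots> \<in> P'"
  proof (intro ideal_in_diff [OF S I'] y' ideal_in_sum [OF I'] ideal_in_mult [OF I'] rS)
    fix i assume "i \<in> {k<..?n}"
    then have "x ^ (i - k) = x ^ (i - k - 1) * x" by (cases "i - k") (auto simp: mult.commute)
    then show "x ^ (i - k) \<in> P'" using ideal_in_mult [OF I' sub_ring_power [OF S xS] x(1)] by simp
  qed auto
  finally show False using eq k r by blast
qed

lemma contract_chain:
  assumes "\<And>i. i \<le> n \<Longrightarrow> prime_in S (P i)" "\<And>i. i < n \<Longrightarrow> P i \<subset> P (Suc i)" "\<And>i. i \<le> n \<Longrightarrow> f \<in> P i"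
  shows "prime_chain R n (\<lambda>i. P i \<inter> R)"
  unfolding prime_chain_def using contract_prime incomparable assms by auto

end

text \<open>That is, the quotient of \<open>S\<close> by \<open>f * S\<close> is free over
  \<open>R\<close> on the images of the \<open>e j\<close>.\<close>

locale free_ext = finite_ext +
  assumes free: "(\<And>j. j \<in> J \<Longrightarrow> c j \<in> R) \<Longrightarrow> t \<in> S \<Longrightarrow> (\<Sum>j\<in>J. c j * e j) = f * t \<Longrightarrow> j \<in> J \<Longrightarrow> c j = 0"
begin

text \<open>For an ideal \<open>A\<close> of \<open>R\<close>, the preimage in \<open>S\<close> of
  the ideal that \<open>A\<close> generates in the quotient by \<open>f * S\<close>.\<close>

definition extend :: "'a set \<Rightarrow> 'a set" where
  "extend A = {(\<Sum>j\<in>J. c j * e j) + f * t | c t. (\<forall>j\<in>J. c j \<in> A) \<and> t \<in> S}"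

lemma extendI: "(\<And>j. j \<in> J \<Longrightarrow> c j \<in> A) \<Longrightarrow> t \<in> S \<Longrightarrow> (\<Sum>j\<in>J. c j * e j) + f * t \<in> extend A"
  by (auto simp: extend_def)

lemma extend_mult:
  assumes A: "ideal_in R A" and a: "a \<in> A" and s: "s \<in> S" shows "a * s \<in> extend A"
proof -
  obtain c t where c: "\<forall>j\<in>J. c j \<in> R" "t \<in> S" "s = (\<Sum>j\<in>J. c j * e j) + f * t" using span [OF s] by blast
  have "a * s = (\<Sum>j\<in>J. (c j * a) * e j) + f * (a * t)"
    by (simp add: c(3) distrib_left sum_distrib_left ac_simps)
  also have "\<dots> \<in> extend A"
    using c RS ideal_in_sub [OF A a]
    by (intro extendI ideal_in_mult [OF A] a sub_ring_mult [OF S]) auto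
  finally show ?thesis .
qed

lemma extend_ideal:
  assumes A: "ideal_in R A" shows "ideal_in S (extend A)"
proof -
  have AS: "a \<in> S" if "a \<in> A" for a using ideal_in_sub [OF A that] RS by blast
  have add: "x + y \<in> extend A" if xy: "x \<in> extend A" "y \<in> extend A" for x y
  proof -
    obtain c t d u where c: "\<forall>j\<in>J. c j \<in> A" "t \<in> S" "x = (\<Sum>j\<in>J. c j * e j) + f * t"
      and d: "\<forall>j\<in>J. d j \<in> A" "u \<in> S" "y = (\<Sum>j\<in>J. d j * e j) + f * u"
      using xy unfolding extend_def by blast
    have "x + y = (\<Sum>j\<in>J. (c j + d j) * e j) + f * (t + u)"
      by (simp add: c(3) d(3) distrib_left distrib_right sum.distrib)
    also have "\<dots> \<in> extend A" using c d by (intro extendI ideal_in_add [OF A] sub_ring_add [OF S]) auto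
    finally show ?thesis .
  qed
  have zero: "0 \<in> extend A"
    using extendI [of "\<lambda>_. 0" A 0] ideal_in_0 [OF A] sub_ring_0 [OF S] by simp
  have sum: "sum g I \<in> extend A" if "\<And>i. i \<in> I \<Longrightarrow> g i \<in> extend A" for g and I :: "'b set"
    using that by (induction I rule: infinite_finite_induct) (auto intro: add zero)
  have fm: "f * t \<in> extend A" if "t \<in> S" for t
    using extendI [of "\<lambda>_. 0" A t] ideal_in_0 [OF A] that by simp
  have "r * x \<in> extend A" if r: "r \<in> S" and x: "x \<in> extend A" for r x
  proof -
    obtain c t where c: "\<forall>j\<in>J. c j \<in> A" "t \<in> S" "x = (\<Sum>j\<in>J. c j * e j) + f * t"
      using x unfolding extend_def by blast
    have "r * x = (\<Sum>j\<in>J. c j * (r * e j)) + f * (r * t)"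
      by (simp add: c(3) distrib_left sum_distrib_left ac_simps)
    also have "\<dots> \<in> extend A"
      using c r by (intro add sum fm extend_mult [OF A] sub_ring_mult [OF S] eS) auto
    finally show ?thesis .
  qed
  moreover have "extend A \<subseteq> S"
    unfolding extend_def using AS
    by (auto intro!: sub_ring_add [OF S] sub_ring_sum [OF S] sub_ring_mult [OF S] eS f)
  ultimately show ?thesis unfolding ideal_in_def using add zero by blast
qed

lemma gen_extend:
  assumes X: "X \<subseteq> R" shows "gen S (insert f X) = extend (gen R X)"
proof
  have A: "ideal_in R (gen R X)" by (rule gen_ideal [OF R X])
  have fX: "insert f X \<subseteq> S" using X RS f by blast
  show "gen S (insert f X) \<subseteq> extend (gen R X)"
  proof (rule gen_minimal [OF extend_ideal [OF A]])
    have "f \<in> extend (gen R X)"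
      using extendI [of "\<lambda>_. 0" "gen R X" 1] ideal_in_0 [OF A] sub_ring_1 [OF S] by simp
    moreover have "x \<in> extend (gen R X)" if "x \<in> X" for x
      using extend_mult [OF A gen_in [OF that] sub_ring_1 [OF S]] by simp
    ultimately show "insert f X \<subseteq> extend (gen R X)" by blast
  qed
  note G = gen_ideal [OF S fX]
  have "ideal_in R (gen S (insert f X) \<inter> R)"
    unfolding ideal_in_def using RS ideal_in_0 [OF G] ideal_in_add [OF G] ideal_in_mult [OF G]
    by (auto intro: sub_ring_0 [OF R] sub_ring_add [OF R] sub_ring_mult [OF R])
  then have sub: "gen R X \<subseteq> gen S (insert f X) \<inter> R"
    by (rule gen_minimal) (use X gen_in [of _ "insert f X" S] in blast)
  show "extend (gen R X) \<subseteq> gen S (insert f X)"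
  proof
    fix x assume "x \<in> extend (gen R X)"
    then obtain c t where c: "\<forall>j\<in>J. c j \<in> gen R X" "t \<in> S" "x = (\<Sum>j\<in>J. c j * e j) + f * t"
      unfolding extend_def by blast
    have fG: "f \<in> gen S (insert f X)" by (rule gen_in) simp
    have "x = (\<Sum>j\<in>J. e j * c j) + t * f" by (simp add: c(3) mult.commute)
    also have "\<dots> \<in> gen S (insert f X)"
      using c sub by (intro ideal_in_add [OF G] ideal_in_sum [OF G] ideal_in_mult [OF G] eS fG) auto
    finally show "x \<in> gen S (insert f X)" .
  qed
qed

text \<open>By \<open>gen_extend\<close> and freeness, membership is decided coefficient by
  coefficient, where regularity over \<open>R\<close> applies.\<close>

lemma regular_extend:
  assumes ys: "regular R ys" and i: "i < length ys" and r: "r \<in> S"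
    and yr: "ys ! i * r \<in> gen S (insert f (set (take i ys)))"
  shows "r \<in> gen S (insert f (set (take i ys)))"
proof -
  let ?A = "gen R (set (take i ys))"
  have Y: "set (take i ys) \<subseteq> R" "ys ! i \<in> R"
    using ys i set_take_subset [of i ys] nth_mem [OF i] by (auto simp: regular_def)
  have A: "ideal_in R ?A" by (rule gen_ideal [OF R Y(1)])
  obtain c t where c: "\<forall>j\<in>J. c j \<in> R" "t \<in> S" "r = (\<Sum>j\<in>J. c j * e j) + f * t" using span [OF r] by blast
  obtain a u where a: "\<forall>j\<in>J. a j \<in> ?A" "u \<in> S" "ys ! i * r = (\<Sum>j\<in>J. a j * e j) + f * u"
    using yr unfolding gen_extend [OF Y(1)] extend_def by blast
  have "(\<Sum>j\<in>J. (ys ! i * c j - a j) * e j) = f * (u - ys ! i * t)"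
  proof -
    have "(\<Sum>j\<in>J. (ys ! i * c j - a j) * e j) = ys ! i * (\<Sum>j\<in>J. c j * e j) - (\<Sum>j\<in>J. a j * e j)"
      by (simp add: left_diff_distrib sum_subtractf sum_distrib_left mult.assoc)
    also have "(\<Sum>j\<in>J. c j * e j) = r - f * t" using c(3) by simp
    also have "(\<Sum>j\<in>J. a j * e j) = ys ! i * r - f * u" using a(3) by simp
    finally show ?thesis by (simp add: algebra_simps)
  qed
  moreover have "ys ! i * c j - a j \<in> R" if "j \<in> J" for j
    using that c(1) a(1) Y(2) ideal_in_sub [OF A] by (intro sub_ring_diff [OF R] sub_ring_mult [OF R]) auto
  moreover have "u - ys ! i * t \<in> S"
    using a(2) c(2) Y(2) RS by (intro sub_ring_diff [OF S] sub_ring_mult [OF S]) auto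
  ultimately have z: "ys ! i * c j - a j = 0" if "j \<in> J" for j
    using free [of "\<lambda>j. ys ! i * c j - a j" "u - ys ! i * t"] that by blast
  have "c j \<in> ?A" if "j \<in> J" for j
  proof -
    have "ys ! i * c j \<in> ?A" using z [OF that] a(1) that by simp
    then show ?thesis using ys i c(1) that unfolding regular_def by blast
  qed
  then show ?thesis unfolding gen_extend [OF Y(1)] c(3) by (rule extendI [OF _ c(2)])
qed

end

section \<open>Transport of ideals, chains and regular sequences along ring homomorphisms\<close>

lemma ideal_preimage:
  assumes "comm_ring_hom \<psi>" and S: "sub_ring S" "\<And>y. y \<in> S \<Longrightarrow> \<psi> y \<in> T" and I: "ideal_in T I"
  shows "ideal_in S {y \<in> S. \<psi> y \<in> I}"
proof -
  interpret comm_ring_hom \<psi> by fact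
  show ?thesis
    unfolding ideal_in_def using S ideal_in_0 [OF I]
    by (auto simp: hom_add hom_mult intro: sub_ring_0 sub_ring_add sub_ring_mult ideal_in_add [OF I] ideal_in_mult [OF I])
qed

lemma prime_preimage:
  assumes h: "comm_ring_hom \<psi>" and S: "sub_ring S" "\<And>y. y \<in> S \<Longrightarrow> \<psi> y \<in> T" and P: "prime_in T P"
  shows "prime_in S {y \<in> S. \<psi> y \<in> P}"
proof -
  interpret comm_ring_hom \<psi> by fact
  show ?thesis
    unfolding prime_in_def
  proof (intro conjI ballI impI)
    show "ideal_in S {y \<in> S. \<psi> y \<in> P}" by (rule ideal_preimage [OF h S prime_in_ideal [OF P]])
    show "1 \<notin> {y \<in> S. \<psi> y \<in> P}" using P by (simp add: prime_in_def)
    show "x \<in> {y \<in> S. \<psi> y \<in> P} \<or> y \<in> {y \<in> S. \<psi> y \<in> P}"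
      if "x \<in> S" "y \<in> S" "x * y \<in> {y \<in> S. \<psi> y \<in> P}" for x y
      using P S(2) that by (auto simp: prime_in_def hom_mult)
  qed
qed

lemma noeth_iso:
  assumes h: "comm_ring_hom \<kappa>" "comm_ring_hom \<epsilon>" and S: "sub_ring S" and T: "sub_ring T"
    and \<kappa>: "\<And>x. x \<in> S \<Longrightarrow> \<kappa> x \<in> T" and \<epsilon>: "\<And>y. y \<in> T \<Longrightarrow> \<epsilon> y \<in> S" and inv: "\<And>y. y \<in> T \<Longrightarrow> \<kappa> (\<epsilon> y) = y"
    and N: "noeth S"
  shows "noeth T"
  unfolding noeth_def
proof (intro allI impI)
  fix I assume I: "ideal_in T I"
  have pre: "ideal_in S {x \<in> S. \<kappa> x \<in> K}" if "ideal_in T K" for K by (rule ideal_preimage [OF h(1) S \<kappa> that])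
  obtain X where X: "finite X \<and> X \<subseteq> {x \<in> S. \<kappa> x \<in> I} \<and>
      (\<forall>K. ideal_in S K \<and> X \<subseteq> K \<longrightarrow> {x \<in> S. \<kappa> x \<in> I} \<subseteq> K)" using noethD [OF N pre [OF I]] by (rule exE)
  have "I \<subseteq> K" if K: "ideal_in T K" "\<kappa> ` X \<subseteq> K" for K
  proof
    fix y assume y: "y \<in> I"
    have yT: "y \<in> T" by (rule ideal_in_sub [OF I y])
    have "X \<subseteq> {x \<in> S. \<kappa> x \<in> K}" using K(2) X by blast
    then have "{x \<in> S. \<kappa> x \<in> I} \<subseteq> {x \<in> S. \<kappa> x \<in> K}" using X pre [OF K(1)] by simp
    moreover have "\<epsilon> y \<in> {x \<in> S. \<kappa> x \<in> I}" using y yT \<epsilon> inv by simp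
    ultimately have "\<epsilon> y \<in> {x \<in> S. \<kappa> x \<in> K}" by (rule subsetD)
    then show "y \<in> K" using inv [OF yT] by simp
  qed
  then show "\<exists>X. finite X \<and> X \<subseteq> I \<and> (\<forall>K. ideal_in T K \<and> X \<subseteq> K \<longrightarrow> I \<subseteq> K)"
    using X by (intro exI [of _ "\<kappa> ` X"]) auto
qed

lemma regular_chains_iso:
  assumes h: "comm_ring_hom \<kappa>" "comm_ring_hom \<epsilon>" and S: "sub_ring S" and T: "sub_ring T"
    and \<kappa>: "\<And>x. x \<in> S \<Longrightarrow> \<kappa> x \<in> T" and \<epsilon>: "\<And>y. y \<in> T \<Longrightarrow> \<epsilon> y \<in> S"
    and inv: "\<And>y. y \<in> T \<Longrightarrow> \<kappa> (\<epsilon> y) = y" "\<And>x. x \<in> S \<Longrightarrow> \<epsilon> (\<kappa> x) = x"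
    and C: "regular_chains S"
  shows "regular_chains T"
  unfolding regular_chains_def
proof (intro allI impI)
  interpret e: comm_ring_hom \<epsilon> by (rule h)
  fix n P assume P: "prime_chain T n P"
  have prime: "prime_in T (P i)" if "i \<le> n" for i using P that by (simp add: prime_chain_def)
  have "prime_chain S n (\<lambda>i. {x \<in> S. \<kappa> x \<in> P i})"
    unfolding prime_chain_def
  proof (intro conjI allI impI)
    show "prime_in S {x \<in> S. \<kappa> x \<in> P i}" if "i \<le> n" for i by (rule prime_preimage [OF h(1) S \<kappa> prime [OF that]])
    fix i assume i: "i < n"
    then have "P i \<subset> P (Suc i)" using P by (simp add: prime_chain_def)
    then obtain y where y: "y \<in> P (Suc i)" "y \<notin> P i" and sub: "P i \<subseteq> P (Suc i)" by blast
    have yT: "y \<in> T" using ideal_in_sub [OF prime_in_ideal [OF prime] y(1)] i by simp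
    then have "\<epsilon> y \<in> {x \<in> S. \<kappa> x \<in> P (Suc i)}" "\<epsilon> y \<notin> {x \<in> S. \<kappa> x \<in> P i}" using y \<epsilon> inv(1) by simp_all
    then show "{x \<in> S. \<kappa> x \<in> P i} \<subset> {x \<in> S. \<kappa> x \<in> P (Suc i)}" using sub by blast
  qed
  then obtain xs where xs: "length xs = n" "set xs \<subseteq> {x \<in> S. \<kappa> x \<in> P n}" "regular S xs"
    using C unfolding regular_chains_def by blast
  have "regular T (map \<kappa> xs)"
    unfolding regular_def
  proof (intro conjI allI impI ballI)
    show "set (map \<kappa> xs) \<subseteq> T" using xs(2) \<kappa> by auto
    fix i r assume i: "i < length (map \<kappa> xs)" and r: "r \<in> T"
      and *: "map \<kappa> xs ! i * r \<in> gen T (set (take i (map \<kappa> xs)))"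
    let ?X = "set (take i xs)"
    have X: "?X \<subseteq> S" using xs(2) set_take_subset [of i xs] by blast
    have "ideal_in T {y \<in> T. \<epsilon> y \<in> gen S ?X}" by (rule ideal_preimage [OF h(2) T \<epsilon> gen_ideal [OF S X]])
    then have "gen T (\<kappa> ` ?X) \<subseteq> {y \<in> T. \<epsilon> y \<in> gen S ?X}"
      by (rule gen_minimal) (use X \<kappa> inv(2) gen_in [of _ ?X S] in auto)
    then have "\<epsilon> (map \<kappa> xs ! i * r) \<in> gen S ?X" using * by (auto simp: take_map)
    moreover have "xs ! i \<in> S" using subsetD [OF xs(2) nth_mem [of i xs]] i by simp
    ultimately have "xs ! i * \<epsilon> r \<in> gen S ?X" using i inv(2) by (simp add: e.hom_mult)
    then have er: "\<epsilon> r \<in> gen S ?X" using xs(3) i \<epsilon> [OF r] by (simp add: regular_def)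
    have kX: "\<kappa> ` ?X \<subseteq> T" using X \<kappa> by blast
    have "ideal_in S {x \<in> S. \<kappa> x \<in> gen T (\<kappa> ` ?X)}" by (rule ideal_preimage [OF h(1) S \<kappa> gen_ideal [OF T kX]])
    then have "gen S ?X \<subseteq> {x \<in> S. \<kappa> x \<in> gen T (\<kappa> ` ?X)}"
      by (rule gen_minimal) (use X gen_in [of _ "\<kappa> ` ?X" T] in auto)
    then have "\<kappa> (\<epsilon> r) \<in> gen T (\<kappa> ` ?X)" using er by blast
    then show "r \<in> gen T (set (take i (map \<kappa> xs)))" using inv(1) [OF r] by (simp add: take_map)
  qed
  then show "\<exists>xs. length xs = n \<and> set xs \<subseteq> P n \<and> regular T xs"
    using xs(1,2) by (intro exI [of _ "map \<kappa> xs"]) auto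
qed

text \<open>Every variable contributes \<open>x v\<close> times \<open>b\<close> at most once, so
  the coefficient at the highest possible power of \<open>b\<close> is the value of the form in the
  direction \<open>x\<close>. A direction where this is nonzero makes the polynomial monic in
  \<open>b\<close> up to a constant.\<close>

lemma coeff_top:
  fixes x :: "'v \<Rightarrow> 'k::comm_ring_1"
  assumes p: "homog d p" and h: "\<And>v. uni b (h v) = [:A v, poly_const (x v):]"
  shows "(\<forall>i>d. coeff (uni b (psubst h p)) i = 0) \<and> coeff (uni b (psubst h p)) d = poly_const (peval x p)"
  using p
proof (induction rule: homog_induct)
  case (mon e a)
  have "(\<forall>i>mdeg e. coeff (uni b (psubst h (Poly_Mapping.single e 1))) i = 0) \<and>
    coeff (uni b (psubst h (Poly_Mapping.single e 1))) (mdeg e) = poly_const (peval x (Poly_Mapping.single e 1))"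
  proof (induction e rule: poly_mapping_nat_induct)
    case zero
    have "Poly_Mapping.single 0 1 = (1 :: ('v, 'k) mpoly)" by (simp add: one_poly_mapping.abs_eq single.abs_eq)
    then show ?case by (simp add: coeff_1)
  next
    case (add e v)
    let ?U = "uni b (psubst h (Poly_Mapping.single e 1))"
    have "uni b (psubst h (Poly_Mapping.single (e + Poly_Mapping.single v 1) 1)) = ?U * [:A v, poly_const (x v):]"
      unfolding single_add_var by (simp add: h)
    then have "coeff (uni b (psubst h (Poly_Mapping.single (e + Poly_Mapping.single v 1) 1))) (Suc i) =
        A v * coeff ?U (Suc i) + poly_const (x v) * coeff ?U i" for i
      by simp
    moreover have "peval x (Poly_Mapping.single (e + Poly_Mapping.single v 1) 1) = peval x (Poly_Mapping.single e 1) * x v"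
      unfolding single_add_var by simp
    ultimately have *: "\<And>i. coeff (uni b (psubst h (Poly_Mapping.single (e + Poly_Mapping.single v 1) 1))) (Suc i) =
        A v * coeff ?U (Suc i) + poly_const (x v) * coeff ?U i"
      "peval x (Poly_Mapping.single (e + Poly_Mapping.single v 1) 1) = peval x (Poly_Mapping.single e 1) * x v"
      by blast+
    show ?case
    proof (intro conjI allI impI)
      fix i assume "i > mdeg (e + Poly_Mapping.single v 1)"
      then obtain j where "i = Suc j" "j > mdeg e" by (cases i) (auto simp: mdeg_add)
      then show "coeff (uni b (psubst h (Poly_Mapping.single (e + Poly_Mapping.single v 1) 1))) i = 0"
        using add * by simp
    qed (use add * in \<open>simp add: mdeg_add poly_const_mult mult.commute\<close>)
  qed
  then show ?case using mon unfolding single_eq_const_mult [of e a]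
    by (simp add: poly_const_mult)
qed (simp_all add: poly_const_add)

lemma PV_sub_ring: "sub_ring (PV X)"
  by (simp add: sub_ring_def PV_add PV_mult PV_uminus)

text \<open>Noether normalisation of a hypersurface.\<close>

lemma coordinate_change:
  fixes f :: "('v, 'k::field_char_0) mpoly"
  assumes f: "f \<noteq> 0"
  shows "\<exists>h h' d a. (\<forall>v\<in>insert b C. h v \<in> PV (insert b C) \<and> h' v \<in> PV (insert b C)) \<and>
    (\<forall>p. psubst h' (psubst h p) = p) \<and> (\<forall>p. psubst h (psubst h' p) = p) \<and> a \<noteq> 0 \<and>
    coeff (uni b (psubst h f)) d = poly_const a \<and> (\<forall>i>d. coeff (uni b (psubst h f)) i = 0)"
proof -
  obtain n where n: "\<forall>d>n. hc d f = 0" using hc_bound by blast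
  have "\<exists>d. hc d f \<noteq> 0" using f hc_eqI [of f 0] by auto
  moreover have "d \<le> n" if "hc d f \<noteq> 0" for d using n that not_less by blast
  ultimately obtain d where d: "hc d f \<noteq> 0" "\<And>i. hc i f \<noteq> 0 \<Longrightarrow> i \<le> d"
    using GreatestI_ex_nat [of "\<lambda>d. hc d f \<noteq> 0" n] Greatest_le_nat [of "\<lambda>d. hc d f \<noteq> 0" _ n] by blast
  have dtop: "\<forall>i>d. hc i f = 0" using d(2) not_less by blast
  have "pvar b \<noteq> (0 :: ('v, 'k) mpoly)"
  proof
    assume "pvar b = (0 :: ('v, 'k) mpoly)"
    then have "peval (\<lambda>_. 1) (pvar b) = (0 :: 'k)" by (simp only: peval_simps)
    then show False by simp
  qed
  \<comment> \<open>The factor \<open>pvar b\<close> forces \<open>x b \<noteq> 0\<close>, which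
    makes the substitution \<open>h\<close> invertible.\<close>
  then have "hc d f * pvar b \<noteq> 0" using d(1) by simp
  then obtain x where "peval x (hc d f * pvar b) \<noteq> 0" using ex_nonzero_point by blast
  then have x: "peval x (hc d f) \<noteq> 0" "x b \<noteq> 0" by auto
  define h where "h v = (if v = b then poly_const (x b) * pvar b else pvar v + poly_const (x v) * pvar b)" for v
  define h' where "h' v = (if v = b then poly_const (1 / x b) * pvar b else pvar v - poly_const (x v / x b) * pvar b)" for v
  have c: "poly_const (1 / x b) * (poly_const (x b) * y) = y" "poly_const (x b) * (poly_const (1 / x b) * y) = y"
    "poly_const (x v / x b) * (poly_const (x b) * y) = poly_const (x v) * y"
    "poly_const (x v) * (poly_const (1 / x b) * y) = poly_const (x v / x b) * y" for y :: "('v, 'k) mpoly" and v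
    using x(2) by (simp_all add: mult.assoc [symmetric] poly_const_mult [symmetric])
  have PV: "\<forall>v\<in>insert b C. h v \<in> PV (insert b C) \<and> h' v \<in> PV (insert b C)"
    by (auto simp: h_def h'_def intro!: PV_add PV_diff PV_mult)
  have "psubst h' (h v) = pvar v" "psubst h (h' v) = pvar v" for v
    using x(2) by (auto simp: h_def h'_def c)
  then have inv: "\<forall>p. psubst h' (psubst h p) = p" "\<forall>p. psubst h (psubst h' p) = p"
    by (simp_all add: psubst_psubst)
  define A where "A v = (if v = b then 0 else pvar v :: ('v, 'k) mpoly)" for v
  have h: "uni b (h v) = [:A v, poly_const (x v):]" for v by (simp add: h_def A_def)
  have sum: "coeff (uni b (psubst h f)) i = (\<Sum>j\<le>d. coeff (uni b (psubst h (hc j f))) i)" for i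
    by (subst sum_hc [OF dtop]) (simp add: psubst_sum uni_sum coeff_sum)
  have top: "\<forall>i>j. coeff (uni b (psubst h (hc j f))) i = 0"
    "coeff (uni b (psubst h (hc j f))) j = poly_const (peval x (hc j f))" for j
    using coeff_top [where h = h and x = x and A = A, OF homog_hc [of j f] h] by blast+
  have "coeff (uni b (psubst h f)) d = (\<Sum>j\<le>d. if j = d then poly_const (peval x (hc d f)) else 0)"
    unfolding sum by (rule sum.cong) (use top in auto)
  moreover have "coeff (uni b (psubst h f)) i = 0" if "i > d" for i
    unfolding sum by (rule sum.neutral) (use top that in auto)
  ultimately show ?thesis using x(1) PV inv
    by (intro exI [of _ h] exI [of _ h'] exI [of _ d] exI [of _ "peval x (hc d f)"]) simp
qed

lemma low_degree_remainder:
  fixes s :: "('v, 'k::comm_ring_1) mpoly"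
  assumes s: "s \<in> PV (insert b C)" "\<forall>i\<ge>d. coeff (uni b s) i = 0"
  shows "\<exists>c t. (\<forall>i<d. c i \<in> PV C) \<and> t \<in> PV (insert b C) \<and> s = (\<Sum>i<d. c i * pvar b ^ i) + g * t"
proof -
  have "s = (\<Sum>i\<le>degree (uni b s). coeff (uni b s) i * pvar b ^ i)"
    unfolding poly_altdef [symmetric] by simp
  also have "\<dots> = (\<Sum>i<d. coeff (uni b s) i * pvar b ^ i)"
    by (rule sum.mono_neutral_cong) (use s(2) in \<open>auto simp: not_less coeff_eq_0\<close>)
  finally show ?thesis using coeff_uni_PV [OF s(1)]
    by (intro exI [of _ "coeff (uni b s)"] exI [of _ 0]) simp
qed

text \<open>Division with remainder; \<open>n\<close> bounds the degree of \<open>s\<close> in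
  \<open>b\<close>, and each step removes the top coefficient because that of \<open>g\<close> is a
  nonzero constant.\<close>

lemma monic_division:
  fixes g :: "('v, 'k::field) mpoly"
  assumes b: "b \<notin> C" and a: "a \<noteq> 0"
    and g: "g \<in> PV (insert b C)" "coeff (uni b g) d = poly_const a" "\<forall>i>d. coeff (uni b g) i = 0"
  shows "s \<in> PV (insert b C) \<Longrightarrow> \<forall>i\<ge>n. coeff (uni b s) i = 0 \<Longrightarrow>
    \<exists>c t. (\<forall>i<d. c i \<in> PV C) \<and> t \<in> PV (insert b C) \<and> s = (\<Sum>i<d. c i * pvar b ^ i) + g * t"
proof (induction n arbitrary: s)
  case 0
  then show ?case by (intro low_degree_remainder) simp_all
next
  case (Suc n)
  show ?case
  proof (cases "d \<le> n")
    case False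
    then have "\<forall>i\<ge>d. coeff (uni b s) i = 0" using Suc.prems(2) by simp
    then show ?thesis by (rule low_degree_remainder [OF Suc.prems(1)])
  next
    case True
    let ?w = "poly_const (1 / a) * coeff (uni b s) n"
    let ?q = "?w * pvar b ^ (n - d)"
    have w: "?w \<in> PV C" by (intro PV_mult PV_const coeff_uni_PV [OF Suc.prems(1)])
    have q1: "uni b ?q = uni b ?w * uni b (pvar b ^ (n - d))" by (rule uni_simps(7))
    have q2: "uni b (pvar b ^ (n - d)) = monom 1 (n - d)" by (simp add: monom_altdef)
    have q: "uni b ?q = [:?w:] * monom 1 (n - d)" by (simp only: q1 q2 uni_PV [OF w b])
    have "uni b (s - g * ?q) = uni b s - uni b g * uni b ?q"
      using uni_simps(8) [of b s "g * ?q"] uni_simps(7) [of b g ?q] by (simp only:)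
    also have "\<dots> = uni b s - monom ?w (n - d) * uni b g"
      unfolding q by (simp add: smult_monom mult.commute)
    finally have "uni b (s - g * ?q) = uni b s - monom ?w (n - d) * uni b g" .
    then have cf: "coeff (uni b (s - g * ?q)) i =
        coeff (uni b s) i - (if i < n - d then 0 else ?w * coeff (uni b g) (i - (n - d)))" for i
      by (simp only: coeff_diff coeff_monom_mult)
    have "coeff (uni b (s - g * ?q)) i = 0" if i: "i \<ge> n" for i
    proof (cases "i = n")
      case True
      have "?w * poly_const a = (poly_const (1 / a) * poly_const a) * coeff (uni b s) n" by (simp only: ac_simps)
      also have "\<dots> = coeff (uni b s) n" using a by (simp add: poly_const_mult [symmetric])
      finally show ?thesis using True \<open>d \<le> n\<close> g(2) by (simp only: cf) simp
    next
      case False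
      then have "i - (n - d) > d" using i True by simp
      then have "coeff (uni b g) (i - (n - d)) = 0" using g(3) by blast
      moreover have "coeff (uni b s) i = 0" using Suc.prems(2) i False by simp
      ultimately show ?thesis by (simp only: cf) simp
    qed
    moreover have qS: "?q \<in> PV (insert b C)"
      by (rule PV_mult [OF subsetD [OF PV_mono [of C "insert b C"] w] PV_power]) auto
    moreover have "s - g * ?q \<in> PV (insert b C)" by (intro PV_diff PV_mult Suc.prems(1) g(1) qS)
    ultimately obtain c t where c: "\<forall>i<d. c i \<in> PV C" and t: "t \<in> PV (insert b C)"
      and eq: "s - g * ?q = (\<Sum>i<d. c i * pvar b ^ i) + g * t" using Suc.IH by blast
    have "s = (s - g * ?q) + g * ?q" by simp
    also have "\<dots> = (\<Sum>i<d. c i * pvar b ^ i) + g * (t + ?q)" unfolding eq by (simp only: distrib_left add.assoc)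
    finally show ?thesis using c PV_add [OF t qS] by (intro exI [of _ c] exI [of _ "t + ?q"]) simp
  qed
qed

text \<open>Freeness is uniqueness of remainders: a nonzero multiple of \<open>g\<close> has degree
  at least \<open>d\<close> in \<open>b\<close>, while the combination on the left has smaller
  degree.\<close>

lemma monic_free_ext:
  fixes g :: "('v, 'k::field) mpoly"
  assumes b: "b \<notin> C" and a: "a \<noteq> 0"
    and g: "g \<in> PV (insert b C)" "coeff (uni b g) d = poly_const a" "\<forall>i>d. coeff (uni b g) i = 0"
  shows "free_ext (PV C) (PV (insert b C)) g {..<d} (\<lambda>i. pvar b ^ i)"
proof
  show "\<exists>c t. (\<forall>j\<in>{..<d}. c j \<in> PV C) \<and> t \<in> PV (insert b C) \<and> s = (\<Sum>j\<in>{..<d}. c j * pvar b ^ j) + g * t"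
    if "s \<in> PV (insert b C)" for s
    using monic_division [OF assms that, of "Suc (degree (uni b s))"] by (auto simp: coeff_eq_0)
  fix c :: "nat \<Rightarrow> ('v, 'k) mpoly" and t j
  assume c: "\<And>j. j \<in> {..<d} \<Longrightarrow> c j \<in> PV C" and t: "t \<in> PV (insert b C)"
    and eq: "(\<Sum>j\<in>{..<d}. c j * pvar b ^ j) = g * t" and j: "j \<in> {..<d}"
  have "uni b (\<Sum>j\<in>{..<d}. c j * pvar b ^ j) = (\<Sum>j\<in>{..<d}. monom (c j) j)"
    unfolding uni_sum by (rule sum.cong) (simp_all add: uni_PV [OF c b] monom_altdef)
  then have cf: "coeff (uni b (g * t)) i = (if i < d then c i else 0)" for i
    by (simp add: eq coeff_sum if_distrib cong: if_cong)
  have "t = 0"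
  proof (rule ccontr)
    assume "t \<noteq> 0"
    then have lt: "lead_coeff (uni b t) \<noteq> 0" by simp
    have dg: "degree (uni b g) = d"
      using g(2,3) a by (intro antisym degree_le le_degree) auto
    have "coeff (uni b (g * t)) (d + degree (uni b t)) = poly_const a * lead_coeff (uni b t)"
      using coeff_mult_degree_sum [of "uni b g" "uni b t"] g(2) dg by simp
    moreover have "poly_const a * lead_coeff (uni b t) \<noteq> 0" using a lt by (simp only: mpoly_mult_eq_0) simp
    ultimately show False using cf [of "d + degree (uni b t)"] by simp
  qed
  then show "c j = 0" using cf [of j] j by simp
qed (auto simp: PV_sub_ring g intro: PV_power subsetD [OF PV_mono, rotated])

text \<open>After \<open>coordinate_change\<close> the polynomial is monic up to a constant and
  \<open>monic_free_ext\<close> applies over \<open>PV C\<close>. Undoing the change makes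
  \<open>R\<close> the image of \<open>PV C\<close> under \<open>h'\<close>, an isomorphic copy that
  inherits both properties.\<close>

lemma hypersurface_free_ext:
  fixes f :: "('v, 'k::field_char_0) mpoly"
  assumes b: "b \<notin> C" and f: "f \<noteq> 0" "f \<in> PV (insert b C)"
    and C: "noeth (PV C :: ('v, 'k) mpoly set)" "regular_chains (PV C :: ('v, 'k) mpoly set)"
  shows "\<exists>R d e. free_ext R (PV (insert b C)) f {..<d::nat} e \<and> noeth R \<and> regular_chains R"
proof -
  let ?S = "PV (insert b C) :: ('v, 'k) mpoly set"
  obtain h h' d a where PV: "\<forall>v\<in>insert b C. h v \<in> ?S \<and> h' v \<in> ?S"
    and inv: "\<forall>p. psubst h' (psubst h p) = p" "\<forall>p. psubst h (psubst h' p) = p" and a: "a \<noteq> 0"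
    "coeff (uni b (psubst h f)) d = poly_const a" "\<forall>i>d. coeff (uni b (psubst h f)) i = 0"
    using coordinate_change [OF f(1), of b C] by (elim exE conjE)
  have psub: "psubst h p \<in> ?S" "psubst h' p \<in> ?S" if "p \<in> ?S" for p
    using psubst_PV [OF that] PV by blast+
  let ?R = "psubst h' ` PV C"
  have CS: "PV C \<subseteq> ?S" by (rule PV_mono) blast
  have sub: "sub_ring ?R"
    unfolding sub_ring_def
    by (auto simp del: psubst_simps(5,6,8) simp add: psubst_simps(5,6,8) [symmetric]
      intro: PV_add PV_mult PV_uminus intro!: image_eqI [of 0 _ 0] image_eqI [of 1 _ 1])
  interpret free_ext "PV C" ?S "psubst h f" "{..<d}" "\<lambda>i. pvar b ^ i"
    by (rule monic_free_ext [OF b a(1) psub(1) [OF f(2)] a(2,3)])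
  have "free_ext ?R ?S f {..<d} (\<lambda>i. psubst h' (pvar b ^ i))"
  proof
    show "?R \<subseteq> ?S" using psub(2) CS by blast
    show "psubst h' (pvar b ^ i) \<in> ?S" for i by (intro psub(2) PV_power) simp
    show "\<exists>c t. (\<forall>j\<in>{..<d}. c j \<in> ?R) \<and> t \<in> ?S \<and> s = (\<Sum>j\<in>{..<d}. c j * psubst h' (pvar b ^ j)) + f * t"
      if s: "s \<in> ?S" for s
    proof -
      obtain c t where c: "\<forall>j\<in>{..<d}. c j \<in> PV C" and t: "t \<in> ?S"
        and eq: "psubst h s = (\<Sum>j\<in>{..<d}. c j * pvar b ^ j) + psubst h f * t"
        using span [OF psub(1) [OF s]] by (elim exE conjE)
      have "s = psubst h' (psubst h s)" using inv(1) by simp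
      also have "\<dots> = (\<Sum>j\<in>{..<d}. psubst h' (c j) * psubst h' (pvar b ^ j)) + f * psubst h' t"
        unfolding eq by (simp add: psubst_sum inv(1))
      finally show ?thesis using c psub(2) [OF t] by (intro exI [of _ "\<lambda>j. psubst h' (c j)"] exI [of _ "psubst h' t"]) simp
    qed
    fix c t j assume c: "\<And>j. j \<in> {..<d} \<Longrightarrow> c j \<in> ?R" and t: "t \<in> ?S" and j: "j \<in> {..<d}"
      and eq: "(\<Sum>j\<in>{..<d}. c j * psubst h' (pvar b ^ j)) = f * t"
    have cC: "psubst h (c j) \<in> PV C" if "j \<in> {..<d}" for j using c [OF that] inv(2) by auto
    have "psubst h (\<Sum>j\<in>{..<d}. c j * psubst h' (pvar b ^ j)) = psubst h (f * t)" by (simp only: eq)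
    then have "(\<Sum>j\<in>{..<d}. psubst h (c j) * pvar b ^ j) = psubst h f * psubst h t"
      by (simp only: psubst_sum psubst_simps(6) inv(2))
    then have "psubst h (c j) = 0" using cC psub(1) [OF t] j by (intro free [of "\<lambda>j. psubst h (c j)"])
    then have "psubst h' (psubst h (c j)) = 0" by simp
    then show "c j = 0" using inv(1) by simp
  qed (use sub PV_sub_ring assms(3) in auto)
  moreover have "noeth ?R"
    by (rule noeth_iso [OF psubst_hom psubst_hom PV_sub_ring sub _ _ _ C(1), of h' h]) (use inv in auto)
  moreover have "regular_chains ?R"
    by (rule regular_chains_iso [OF psubst_hom psubst_hom PV_sub_ring sub _ _ _ _ C(2), of h' h]) (use inv in auto)
  ultimately show ?thesis by blast
qed

lemma PV_empty_const: "p \<in> PV {} \<Longrightarrow> \<exists>c. p = poly_const c"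
proof (induction rule: PV_induct)
  case (add p q)
  then show ?case by (metis poly_const_add)
next
  case (mult p q)
  then show ?case by (metis poly_const_mult)
qed auto

theorem PV_noeth_regular_chains:
  assumes "finite C"
  shows "noeth (PV C :: ('v, 'k::field_char_0) mpoly set) \<and> regular_chains (PV C :: ('v, 'k) mpoly set)"
  using assms
proof (induction C)
  case empty
  have unit: "1 \<in> I" if I: "ideal_in (PV {}) I" and p: "p \<in> I" "p \<noteq> 0" for I and p :: "('v, 'k) mpoly"
  proof -
    obtain c where c: "p = poly_const c" using PV_empty_const [OF ideal_in_sub [OF I p(1)]] ..
    have "poly_const (1 / c) * p \<in> I" by (rule ideal_in_mult [OF I PV_const p(1)])
    then show ?thesis using p(2) c by (simp add: poly_const_mult [symmetric])
  qed
  have "noeth (PV {} :: ('v, 'k) mpoly set)"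
    unfolding noeth_def
  proof (intro allI impI)
    fix I :: "('v, 'k) mpoly set" assume I: "ideal_in (PV {}) I"
    show "\<exists>X. finite X \<and> X \<subseteq> I \<and> (\<forall>K. ideal_in (PV {}) K \<and> X \<subseteq> K \<longrightarrow> I \<subseteq> K)"
    proof (cases "I \<subseteq> {0}")
      case True
      then show ?thesis by (intro exI [of _ "{}"]) (auto dest: ideal_in_0)
    next
      case False
      then have "1 \<in> I" using unit [OF I] by blast
      moreover have "x \<in> K" if "ideal_in (PV {}) K" "1 \<in> K" "x \<in> I" for K x
        using ideal_in_mult [OF that(1) ideal_in_sub [OF I that(3)] that(2)] by simp
      ultimately show ?thesis by (intro exI [of _ "{1}"]) auto
    qed
  qed
  moreover have "n = 0" if P: "prime_chain (PV {}) n P" for n and P :: "nat \<Rightarrow> ('v, 'k) mpoly set"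
  proof (rule ccontr)
    assume "n \<noteq> 0"
    then have lt: "P 0 \<subset> P 1" and P0: "prime_in (PV {}) (P 0)" and P1: "prime_in (PV {}) (P 1)"
      using P by (auto simp: prime_chain_def)
    obtain p where p: "p \<in> P 1" "p \<notin> P 0" using lt by blast
    have "p \<noteq> 0" using ideal_in_0 [OF prime_in_ideal [OF P0]] p(2) by blast
    then have "1 \<in> P 1" by (rule unit [OF prime_in_ideal [OF P1] p(1)])
    then show False using P1 by (simp add: prime_in_def)
  qed
  then have "regular_chains (PV {} :: ('v, 'k) mpoly set)"
    unfolding regular_chains_def by (intro allI impI exI [of _ "[]"]) (simp add: regular_def)
  ultimately show ?case ..
next
  case (insert b C)
  let ?S = "PV (insert b C) :: ('v, 'k) mpoly set"
  note ext = hypersurface_free_ext [OF insert.hyps(2) _ _ conjunct1 [OF insert.IH] conjunct2 [OF insert.IH]]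
  have "noeth ?S"
    unfolding noeth_def
  proof (intro allI impI)
    fix I :: "('v, 'k) mpoly set" assume I: "ideal_in ?S I"
    show "\<exists>X. finite X \<and> X \<subseteq> I \<and> (\<forall>K. ideal_in ?S K \<and> X \<subseteq> K \<longrightarrow> I \<subseteq> K)"
    proof (cases "I \<subseteq> {0}")
      case True
      then show ?thesis by (intro exI [of _ "{}"]) (auto dest: ideal_in_0)
    next
      case False
      then obtain g where g: "g \<in> I" "g \<noteq> 0" by blast
      from ext [OF g(2) ideal_in_sub [OF I g(1)]] obtain R d e where
        ext: "free_ext R ?S g {..<d::nat} e" "noeth R" by (elim exE conjE)
      then interpret free_ext R ?S g "{..<d}" e by simp
      show ?thesis by (rule noeth_ext [OF ext(2) I g(1)])
    qed
  qed
  moreover have "\<exists>xs. length xs = n \<and> set xs \<subseteq> P n \<and> regular ?S xs" if P: "prime_chain ?S n P" for n P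
  proof (cases n)
    case 0
    then show ?thesis by (intro exI [of _ "[]"]) (simp add: regular_def)
  next
    case (Suc m)
    have prime: "prime_in ?S (P i)" if "i \<le> n" for i using P that by (simp add: prime_chain_def)
    have "P 0 \<subset> P 1" using P Suc by (simp add: prime_chain_def)
    \<comment> \<open>The first member of the regular sequence. It is nonzero and lies in every
      prime of the chain except \<open>P 0\<close>, so the other primes form a chain over the
      hypersurface ring of \<open>g\<close>.\<close>
    then obtain g where g: "g \<in> P 1" "g \<notin> P 0" by blast
    have g0: "g \<noteq> 0" using ideal_in_0 [OF prime_in_ideal [OF prime [of 0]]] g(2) by auto
    have gS: "g \<in> ?S" using ideal_in_sub [OF prime_in_ideal [OF prime [of 1]] g(1)] Suc by simp
    have gP: "g \<in> P (Suc i)" if "i \<le> m" for i using prime_chain_mono [OF P, of 1 "Suc i"] g(1) that Suc by auto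
    from ext [OF g0 gS] obtain R d e where
      ext: "free_ext R ?S g {..<d::nat} e" "regular_chains R" by (elim exE conjE)
    then interpret free_ext R ?S g "{..<d}" e by simp
    have "prime_chain R m (\<lambda>i. P (Suc i) \<inter> R)"
    proof (rule contract_chain)
      show "P (Suc i) \<subset> P (Suc (Suc i))" if "i < m" for i using P that Suc by (simp add: prime_chain_def)
    qed (use prime gP Suc in auto)
    then obtain ys where ys: "length ys = m" "set ys \<subseteq> P (Suc m) \<inter> R" "regular R ys"
      using ext(2) unfolding regular_chains_def by blast
    have "regular ?S (g # ys)"
      unfolding regular_def
    proof (intro conjI allI impI ballI)
      show "set (g # ys) \<subseteq> ?S" using ys(2) gS RS by auto
      fix i r assume i: "i < length (g # ys)" and r: "r \<in> ?S"
        and *: "(g # ys) ! i * r \<in> gen ?S (set (take i (g # ys)))"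
      show "r \<in> gen ?S (set (take i (g # ys)))"
      proof (cases i)
        case 0
        have "ideal_in ?S {0}" by (simp add: ideal_in_def)
        then have "gen ?S {} \<subseteq> {0}" by (rule gen_minimal) simp
        then have "g * r = 0" using * 0 by auto
        then have "r = 0" using g0 by simp
        then show ?thesis using ideal_in_0 [OF gen_ideal [OF PV_sub_ring, of "{}"]] 0 by simp
      next
        case (Suc j)
        then show ?thesis using regular_extend [OF ys(3) _ r, of j] i * by simp
      qed
    qed
    then show ?thesis using ys(1,2) gP [of m] Suc by (intro exI [of _ "g # ys"]) auto
  qed
  then have "regular_chains ?S" unfolding regular_chains_def by blast
  ultimately show ?case ..
qed

section \<open>Primes, localizations and depth\<close>

lemma (in cring) ideal_criterion:
  assumes sub: "I \<subseteq> carrier R" and zero: "\<zero> \<in> I"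
    and add: "\<And>a b. a \<in> I \<Longrightarrow> b \<in> I \<Longrightarrow> a \<oplus> b \<in> I"
    and mult: "\<And>r a. r \<in> carrier R \<Longrightarrow> a \<in> I \<Longrightarrow> r \<otimes> a \<in> I"
  shows "ideal I R"
proof (rule idealI [OF ring_axioms])
  show "subgroup I (add_monoid R)"
  proof (rule group.subgroupI [OF a_group])
    show "inv\<^bsub>add_monoid R\<^esub> a \<in> I" if "a \<in> I" for a
    proof -
      have "(\<ominus> \<one>) \<otimes> a \<in> I" using that by (intro mult) auto
      moreover have "(\<ominus> \<one>) \<otimes> a = \<ominus> a" using sub that by (simp add: l_minus subsetD)
      ultimately show ?thesis by (simp add: a_inv_def)
    qed
  qed (use sub zero add in auto)
  show "x \<otimes> a \<in> I" if "a \<in> I" "x \<in> carrier R" for a x using mult that by blast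
  then show "a \<otimes> x \<in> I" if "a \<in> I" "x \<in> carrier R" for a x using that sub by (metis m_comm subsetD)
qed

lemma ideal_facts:
  assumes "ideal I R"
  shows "I \<subseteq> carrier R" "\<zero>\<^bsub>R\<^esub> \<in> I" "a \<in> I \<Longrightarrow> b \<in> I \<Longrightarrow> a \<oplus>\<^bsub>R\<^esub> b \<in> I"
    "r \<in> carrier R \<Longrightarrow> a \<in> I \<Longrightarrow> r \<otimes>\<^bsub>R\<^esub> a \<in> I" "r \<in> carrier R \<Longrightarrow> a \<in> I \<Longrightarrow> a \<otimes>\<^bsub>R\<^esub> r \<in> I"
proof -
  interpret ideal I R by fact
  show "I \<subseteq> carrier R" "\<zero>\<^bsub>R\<^esub> \<in> I" "a \<in> I \<Longrightarrow> b \<in> I \<Longrightarrow> a \<oplus>\<^bsub>R\<^esub> b \<in> I"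
    "r \<in> carrier R \<Longrightarrow> a \<in> I \<Longrightarrow> r \<otimes>\<^bsub>R\<^esub> a \<in> I" "r \<in> carrier R \<Longrightarrow> a \<in> I \<Longrightarrow> a \<otimes>\<^bsub>R\<^esub> r \<in> I"
    by (auto simp: I_l_closed I_r_closed)
qed

lemma (in cring) ideal_one: "ideal I R \<Longrightarrow> \<one> \<in> I \<Longrightarrow> I = carrier R"
  using ideal_facts(1,4) [of I R] by (metis one_closed r_one subsetI subset_antisym)

text \<open>An ideal maximal among those avoiding \<open>T\<close> is prime: adjoining either of two
  outside elements produces a member of \<open>T\<close>, and the product of these members would lie
  in the ideal if the product of the two elements did.\<close>

lemma (in cring) prime_avoiding:
  assumes I: "ideal I R" and T: "T \<subseteq> carrier R" "\<one> \<in> T" "\<And>s t. s \<in> T \<Longrightarrow> t \<in> T \<Longrightarrow> s \<otimes> t \<in> T"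
    and disj: "I \<inter> T = {}"
  shows "\<exists>Q. primeideal Q R \<and> I \<subseteq> Q \<and> Q \<inter> T = {}"
proof -
  let ?A = "{J. ideal J R \<and> I \<subseteq> J \<and> J \<inter> T = {}}"
  have "\<exists>M\<in>?A. \<forall>X\<in>?A. M \<subseteq> X \<longrightarrow> X = M"
  proof (rule subset_Zorn_nonempty)
    show "?A \<noteq> {}" using I disj by blast
    fix C assume C: "C \<noteq> {}" "subset.chain ?A C"
    have "subset.chain {J. ideal J R} C" using C(2) by (auto simp: pred_on.chain_def)
    from chain_Union_is_ideal [OF this] have "ideal (\<Union>C) R" using C(1) by simp
    then show "\<Union>C \<in> ?A" using C by (auto simp: pred_on.chain_def)
  qed
  then obtain Q where Q0: "Q \<in> ?A" "\<forall>X\<in>?A. Q \<subseteq> X \<longrightarrow> X = Q" by (rule bexE)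
  then have Q: "ideal Q R" "I \<subseteq> Q" "Q \<inter> T = {}" by simp_all
  have max: "X = Q" if "ideal X R" "I \<subseteq> X" "X \<inter> T = {}" "Q \<subseteq> X" for X
    using Q0(2) that by simp
  note Qf = ideal_facts [OF Q(1)]
  have QR: "q \<in> carrier R" if "q \<in> Q" for q using Qf(1) that by blast
  have meets: "\<exists>q\<in>Q. \<exists>r\<in>carrier R. q \<oplus> r \<otimes> a \<in> T" if a: "a \<in> carrier R" "a \<notin> Q" for a
  proof (rule ccontr)
    assume no: "\<not> ?thesis"
    let ?X = "{q \<oplus> r \<otimes> a | q r. q \<in> Q \<and> r \<in> carrier R}"
    have "ideal ?X R"
    proof (rule ideal_criterion)
      show "?X \<subseteq> carrier R" using a QR by auto
      have "\<zero> = \<zero> \<oplus> \<zero> \<otimes> a" using a by simp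
      then show "\<zero> \<in> ?X" using Qf(2) by blast
    next
      fix x y assume "x \<in> ?X" "y \<in> ?X"
      then obtain q r q' r' where x: "x = q \<oplus> r \<otimes> a" "q \<in> Q" "r \<in> carrier R"
        and y: "y = q' \<oplus> r' \<otimes> a" "q' \<in> Q" "r' \<in> carrier R" by blast
      have "x \<oplus> y = (q \<oplus> q') \<oplus> (r \<oplus> r') \<otimes> a" using x y a by (simp add: QR l_distr a_ac)
      then show "x \<oplus> y \<in> ?X" using x y Qf(3) by blast
    next
      fix z x assume z: "z \<in> carrier R" and "x \<in> ?X"
      then obtain q r where x: "x = q \<oplus> r \<otimes> a" "q \<in> Q" "r \<in> carrier R" by blast
      have "z \<otimes> x = z \<otimes> q \<oplus> (z \<otimes> r) \<otimes> a" using x z a by (simp add: QR r_distr m_assoc)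
      then show "z \<otimes> x \<in> ?X" using x z Qf(4) by blast
    qed
    moreover have QX: "Q \<subseteq> ?X"
    proof
      fix q assume q: "q \<in> Q"
      then have "q = q \<oplus> \<zero> \<otimes> a" using a by (simp add: QR)
      then show "q \<in> ?X" using q by blast
    qed
    ultimately have "?X = Q" using max [of ?X] Q(2) no by blast
    moreover have "a = \<zero> \<oplus> \<one> \<otimes> a" using a by simp
    then have "a \<in> ?X" using Qf(2) by blast
    ultimately show False using a(2) by blast
  qed
  have "primeideal Q R"
  proof (rule primeidealI [OF Q(1) is_cring])
    show "carrier R \<noteq> Q" using Q(3) T(1,2) by blast
    fix a b assume a: "a \<in> carrier R" and b: "b \<in> carrier R" and ab: "a \<otimes> b \<in> Q"
    show "a \<in> Q \<or> b \<in> Q"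
    proof (rule ccontr)
      assume "\<not> ?thesis"
      then obtain q r q' r' where q: "q \<in> Q" "r \<in> carrier R" "q \<oplus> r \<otimes> a \<in> T"
        and q': "q' \<in> Q" "r' \<in> carrier R" "q' \<oplus> r' \<otimes> b \<in> T" using meets a b by metis
      have "(q \<oplus> r \<otimes> a) \<otimes> (q' \<oplus> r' \<otimes> b) = q \<otimes> (q' \<oplus> r' \<otimes> b) \<oplus> (r \<otimes> a \<otimes> q' \<oplus> (r \<otimes> r') \<otimes> (a \<otimes> b))"
        using q(1,2) q'(1,2) a b by (simp add: QR l_distr r_distr m_ac a_ac)
      moreover have "q \<otimes> (q' \<oplus> r' \<otimes> b) \<in> Q" "r \<otimes> a \<otimes> q' \<in> Q" "(r \<otimes> r') \<otimes> (a \<otimes> b) \<in> Q"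
        using q(1,2) q'(1,2) a b ab by (simp_all add: QR Qf(4) Qf(5))
      ultimately have "(q \<oplus> r \<otimes> a) \<otimes> (q' \<oplus> r' \<otimes> b) \<in> Q" by (simp only: Qf(3))
      then show False using T(3) [OF q(3) q'(3)] Q(3) by blast
    qed
  qed
  then show ?thesis using Q by blast
qed

text \<open>Since \<open>x\<close> is regular modulo \<open>I\<close>, the ideal \<open>I\<close>
  avoids all products of an element outside \<open>P\<close> with a power of \<open>x\<close>. A
  prime over \<open>I\<close> avoiding these products lies inside \<open>P\<close> and omits
  \<open>x\<close>.\<close>

lemma (in cring) prime_below:
  assumes I: "ideal I R" and P: "primeideal P R" "I \<subseteq> P" and x: "x \<in> P"
    and reg: "\<And>r. r \<in> carrier R \<Longrightarrow> x \<otimes> r \<in> I \<Longrightarrow> r \<in> I"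
  shows "\<exists>Q. primeideal Q R \<and> I \<subseteq> Q \<and> Q \<subset> P"
proof -
  interpret P: primeideal P R by fact
  let ?T = "{s \<otimes> x [^] n | s n. s \<in> carrier R \<and> s \<notin> P \<and> n \<in> (UNIV :: nat set)}"
  have xR: "x \<in> carrier R" using x P.Icarr by blast
  have reg_pow: "s \<in> I" if "s \<in> carrier R" "s \<otimes> x [^] n \<in> I" for s and n :: nat
    using that(2)
  proof (induction n)
    case (Suc n)
    have "s \<otimes> x [^] Suc n = x \<otimes> (s \<otimes> x [^] n)" using that(1) xR by (simp add: m_ac)
    then have "s \<otimes> x [^] n \<in> I" using Suc.prems reg [of "s \<otimes> x [^] n"] that(1) xR by simp
    then show ?case by (rule Suc.IH)
  qed (use that(1) in simp)
  have one: "\<one> \<notin> P" using ideal_one [OF P.is_ideal] P.I_notcarr by blast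
  have in_T: "s \<in> ?T" if "s \<in> carrier R" "s \<notin> P" for s
  proof -
    have "s = s \<otimes> x [^] (0 :: nat)" using that by simp
    then show ?thesis using that by blast
  qed
  have "\<exists>Q. primeideal Q R \<and> I \<subseteq> Q \<and> Q \<inter> ?T = {}"
  proof (rule prime_avoiding [OF I])
    show "?T \<subseteq> carrier R" using xR by auto
    show "\<one> \<in> ?T" using in_T one by simp
    show "I \<inter> ?T = {}" using reg_pow P(2) by blast
    fix a b assume "a \<in> ?T" "b \<in> ?T"
    then obtain s n t k where a: "a = s \<otimes> x [^] (n::nat)" "s \<in> carrier R" "s \<notin> P"
      and b: "b = t \<otimes> x [^] (k::nat)" "t \<in> carrier R" "t \<notin> P" by blast
    have "a \<otimes> b = (s \<otimes> t) \<otimes> x [^] (n + k)"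
      using a b xR by (simp add: nat_pow_mult [symmetric] m_ac)
    moreover have "s \<otimes> t \<notin> P" using a b P.I_prime by blast
    ultimately show "a \<otimes> b \<in> ?T" using a b by blast
  qed
  then obtain Q where Q: "primeideal Q R" "I \<subseteq> Q" "Q \<inter> ?T = {}" by blast
  interpret Q: primeideal Q R by (rule Q(1))
  have "Q \<subseteq> P" using in_T Q(3) Q.Icarr by blast
  moreover have "x \<notin> Q"
  proof -
    have "x = \<one> \<otimes> x [^] (1 :: nat)" using xR by simp
    then have "x \<in> ?T" using one by blast
    then show ?thesis using Q(3) by blast
  qed
  ultimately show ?thesis using Q(1,2) x by blast
qed

definition ring_chain :: "('a, 'c) ring_scheme \<Rightarrow> nat \<Rightarrow> (nat \<Rightarrow> 'a set) \<Rightarrow> bool" where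
  "ring_chain R n P \<longleftrightarrow> (\<forall>i\<le>n. primeideal (P i) R) \<and> (\<forall>i<n. P i \<subset> P (Suc i))"

text \<open>Start with a prime over the whole ideal and take the elements of the sequence from the
  last to the first: each gives a strictly smaller prime by \<open>prime_below\<close>. This bounds
  the depth by the dimension.\<close>

lemma (in cring) regular_sequence_chain:
  assumes reg: "regular_sequence R xs"
  shows "\<exists>P. ring_chain R (length xs) P"
proof -
  have xs: "set xs \<subseteq> carrier R" and proper: "Idl (set xs) \<noteq> carrier R"
    using reg by (auto simp: regular_sequence_def)
  have tk: "set (take i xs) \<subseteq> carrier R" for i using xs set_take_subset [of i xs] by blast
  have "\<exists>P. ring_chain R k P \<and> Idl (set (take (length xs - k) xs)) \<subseteq> P 0" if "k \<le> length xs" for k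
    using that
  proof (induction k)
    case 0
    have "\<exists>Q. primeideal Q R \<and> Idl (set xs) \<subseteq> Q \<and> Q \<inter> {\<one>} = {}"
      using proper ideal_one [OF genideal_ideal [OF xs]]
      by (intro prime_avoiding [OF genideal_ideal [OF xs]]) auto
    then obtain Q where "primeideal Q R" "Idl (set xs) \<subseteq> Q" by blast
    then show ?case by (intro exI [of _ "\<lambda>_. Q"]) (simp add: ring_chain_def)
  next
    case (Suc k)
    then obtain P where P: "ring_chain R k P" "Idl (set (take (length xs - k) xs)) \<subseteq> P 0" by auto
    define i where "i = length xs - Suc k"
    have i: "length xs - k = Suc i" "i < length xs" using Suc.prems by (auto simp: i_def)
    have tS: "set (take (Suc i) xs) = insert (xs ! i) (set (take i xs))"
      using i(2) by (simp add: take_Suc_conv_app_nth)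
    let ?I = "Idl (set (take i xs))"
    have sub: "insert (xs ! i) (set (take i xs)) \<subseteq> P 0"
      using genideal_self [OF tk [of "Suc i"]] P(2) i(1) tS by auto
    have P0: "primeideal (P 0) R" using P(1) by (simp add: ring_chain_def)
    have "?I \<subseteq> P 0"
      using genideal_minimal [of "P 0" "set (take i xs)"] sub P0 by (auto simp: primeideal_def)
    then have "\<exists>Q. primeideal Q R \<and> ?I \<subseteq> Q \<and> Q \<subset> P 0"
      using reg i(2) sub
      by (intro prime_below [OF genideal_ideal [OF tk] P0]) (auto simp: regular_sequence_def)
    then obtain Q where Q: "primeideal Q R" "?I \<subseteq> Q" "Q \<subset> P 0" by blast
    \<comment> \<open>The new prime is put at the bottom, and the old ones move up by one
      index.\<close>
    have "ring_chain R (Suc k) (\<lambda>j. case j of 0 \<Rightarrow> Q | Suc j \<Rightarrow> P j)"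
      using Q P(1) by (auto simp: ring_chain_def split: nat.splits)
    then show ?case using Q(2) by (intro exI [of _ "\<lambda>j. case j of 0 \<Rightarrow> Q | Suc j \<Rightarrow> P j"]) (simp add: i_def)
  qed
  from this [of "length xs"] show ?thesis by auto
qed

section \<open>Rings of fractions\<close>

locale fractions = cring R for R (structure) +
  fixes D :: "'a set"
  assumes D_sub: "D \<subseteq> carrier R" and D_one: "\<one> \<in> D" and D_mult: "s \<in> D \<Longrightarrow> t \<in> D \<Longrightarrow> s \<otimes> t \<in> D"
begin

abbreviation L where "L \<equiv> ring_of_fractions R D"

abbreviation fr where "fr a s \<equiv> frac R D a s"

lemma D_carrier [simp]: "s \<in> D \<Longrightarrow> s \<in> carrier R" using D_sub by blast

lemma D_closed [simp]: "s \<in> D \<Longrightarrow> t \<in> D \<Longrightarrow> s \<otimes> t \<in> D" by (rule D_mult)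

lemma D_one' [simp]: "\<one> \<in> D" by (rule D_one)

lemma rel_equiv: "equiv (carrier R \<times> D) (fraction_rel R D)"
proof (rule equivI)
  show "fraction_rel R D \<subseteq> (carrier R \<times> D) \<times> (carrier R \<times> D)" by (auto simp: fraction_rel_def)
  show "refl_on (carrier R \<times> D) (fraction_rel R D)" by (auto simp: fraction_rel_def refl_on_def)
  show "Relation.sym (fraction_rel R D)" by (rule symI) (auto simp: fraction_rel_def, metis)
  show "Relation.trans (fraction_rel R D)"
  proof (rule transI)
    fix x y z assume "(x, y) \<in> fraction_rel R D" "(y, z) \<in> fraction_rel R D"
    then obtain a s b t c r u v where
      abc: "x = (a, s)" "y = (b, t)" "z = (c, r)" "a \<in> carrier R" "b \<in> carrier R" "c \<in> carrier R"
      "s \<in> D" "t \<in> D" "r \<in> D" "u \<in> D" "v \<in> D"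
      and eq: "u \<otimes> (a \<otimes> t) = u \<otimes> (b \<otimes> s)" "v \<otimes> (b \<otimes> r) = v \<otimes> (c \<otimes> t)"
      by (auto simp: fraction_rel_def)
    have "(u \<otimes> v \<otimes> t) \<otimes> (a \<otimes> r) = (v \<otimes> r) \<otimes> (u \<otimes> (a \<otimes> t))" using abc by (simp add: m_ac)
    also have "\<dots> = (u \<otimes> s) \<otimes> (v \<otimes> (b \<otimes> r))" unfolding eq(1) using abc by (simp add: m_ac)
    also have "\<dots> = (u \<otimes> v \<otimes> t) \<otimes> (c \<otimes> s)" unfolding eq(2) using abc by (simp add: m_ac)
    finally have "(u \<otimes> v \<otimes> t) \<otimes> (a \<otimes> r) = (u \<otimes> v \<otimes> t) \<otimes> (c \<otimes> s)" .
    moreover have "u \<otimes> v \<otimes> t \<in> D" using abc by simp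
    ultimately show "(x, z) \<in> fraction_rel R D" using abc by (auto simp: fraction_rel_def)
  qed
qed

lemma fr_eq:
  assumes "a \<in> carrier R" "s \<in> D" "b \<in> carrier R" "t \<in> D"
  shows "fr a s = fr b t \<longleftrightarrow> (\<exists>u\<in>D. u \<otimes> (a \<otimes> t) = u \<otimes> (b \<otimes> s))"
proof -
  have "fr a s = fr b t \<longleftrightarrow> ((a, s), (b, t)) \<in> fraction_rel R D"
    unfolding frac_def by (rule eq_equiv_class_iff [OF rel_equiv]) (use assms in auto)
  then show ?thesis using assms by (auto simp: fraction_rel_def)
qed

lemma fr_eqI: "a \<in> carrier R \<Longrightarrow> s \<in> D \<Longrightarrow> b \<in> carrier R \<Longrightarrow> t \<in> D \<Longrightarrow> a \<otimes> t = b \<otimes> s \<Longrightarrow> fr a s = fr b t"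
  by (subst fr_eq) (auto intro!: bexI [of _ \<one>])

lemma fr_self: "a \<in> carrier R \<Longrightarrow> s \<in> D \<Longrightarrow> (a, s) \<in> fr a s"
  unfolding frac_def by (rule equiv_class_self [OF rel_equiv]) simp

lemma in_frD: "(b, t) \<in> fr a s \<Longrightarrow> b \<in> carrier R \<and> t \<in> D \<and> (\<exists>u\<in>D. u \<otimes> (b \<otimes> s) = u \<otimes> (a \<otimes> t))"
  unfolding frac_def fraction_rel_def by auto metis

lemma carrier_L: "carrier L = {fr a s | a s. a \<in> carrier R \<and> s \<in> D}"
  by (auto simp: ring_of_fractions_def quotient_def frac_def)

lemma L_cases:
  assumes "X \<in> carrier L" obtains a s where "X = fr a s" "a \<in> carrier R" "s \<in> D"
  using assms by (auto simp: carrier_L)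

lemma fr_carrier [simp]: "a \<in> carrier R \<Longrightarrow> s \<in> D \<Longrightarrow> fr a s \<in> carrier L"
  by (auto simp: carrier_L)

lemma UN_collapse:
  assumes "a \<in> carrier R" "s \<in> D" "b \<in> carrier R" "t \<in> D"
    and "\<And>a' s' b' t'. (a', s') \<in> fr a s \<Longrightarrow> (b', t') \<in> fr b t \<Longrightarrow> F a' s' b' t' = F a s b t"
  shows "(\<Union>(a', s')\<in>fr a s. \<Union>(b', t')\<in>fr b t. F a' s' b' t') = F a s b t"
proof -
  have in_self: "(a, s) \<in> fr a s" "(b, t) \<in> fr b t" using assms(1-4) by (simp_all add: fr_self)
  show ?thesis
  proof (intro equalityI subsetI)
    fix x assume "x \<in> (\<Union>(a', s')\<in>fr a s. \<Union>(b', t')\<in>fr b t. F a' s' b' t')"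
    then obtain a' s' b' t' where "(a', s') \<in> fr a s" "(b', t') \<in> fr b t" "x \<in> F a' s' b' t'" by blast
    then show "x \<in> F a s b t" by (simp only: assms(5))
  next
    fix x assume "x \<in> F a s b t"
    then show "x \<in> (\<Union>(a', s')\<in>fr a s. \<Union>(b', t')\<in>fr b t. F a' s' b' t')" using in_self by blast
  qed
qed

lemma mult_fr:
  assumes a: "a \<in> carrier R" "s \<in> D" and b: "b \<in> carrier R" "t \<in> D"
  shows "fr a s \<otimes>\<^bsub>L\<^esub> fr b t = fr (a \<otimes> b) (s \<otimes> t)"
proof -
  have "fr a s \<otimes>\<^bsub>L\<^esub> fr b t = (\<Union>(a', s')\<in>fr a s. \<Union>(b', t')\<in>fr b t. fr (a' \<otimes> b') (s' \<otimes> t'))"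
    by (simp only: ring_of_fractions_def monoid.select_convs)
  also have "\<dots> = fr (a \<otimes> b) (s \<otimes> t)"
  proof (rule UN_collapse [OF a b])
  fix a' s' b' t' assume "(a', s') \<in> fr a s" "(b', t') \<in> fr b t"
  from in_frD [OF this(1)] in_frD [OF this(2)] have a': "a' \<in> carrier R" "s' \<in> D" and b': "b' \<in> carrier R" "t' \<in> D"
    and "\<exists>u\<in>D. u \<otimes> (a' \<otimes> s) = u \<otimes> (a \<otimes> s')" "\<exists>v\<in>D. v \<otimes> (b' \<otimes> t) = v \<otimes> (b \<otimes> t')"
    by blast+
  then obtain u v where u: "u \<in> D" "u \<otimes> (a' \<otimes> s) = u \<otimes> (a \<otimes> s')"
    and v: "v \<in> D" "v \<otimes> (b' \<otimes> t) = v \<otimes> (b \<otimes> t')" by blast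
  have "(u \<otimes> v) \<otimes> ((a' \<otimes> b') \<otimes> (s \<otimes> t)) = (u \<otimes> (a' \<otimes> s)) \<otimes> (v \<otimes> (b' \<otimes> t))"
    using a a' b b' u(1) v(1) by (simp add: m_ac)
  also have "\<dots> = (u \<otimes> v) \<otimes> ((a \<otimes> b) \<otimes> (s' \<otimes> t'))"
    unfolding u(2) v(2) using a a' b b' u(1) v(1) by (simp add: m_ac)
  finally show "fr (a' \<otimes> b') (s' \<otimes> t') = fr (a \<otimes> b) (s \<otimes> t)"
    using a a' b b' u(1) v(1) by (subst fr_eq) auto
  qed
  finally show ?thesis .
qed

lemma add_fr:
  assumes a: "a \<in> carrier R" "s \<in> D" and b: "b \<in> carrier R" "t \<in> D"
  shows "fr a s \<oplus>\<^bsub>L\<^esub> fr b t = fr (a \<otimes> t \<oplus> b \<otimes> s) (s \<otimes> t)"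
proof -
  have "fr a s \<oplus>\<^bsub>L\<^esub> fr b t = (\<Union>(a', s')\<in>fr a s. \<Union>(b', t')\<in>fr b t. fr (a' \<otimes> t' \<oplus> b' \<otimes> s') (s' \<otimes> t'))"
    by (simp only: ring_of_fractions_def ring.select_convs)
  also have "\<dots> = fr (a \<otimes> t \<oplus> b \<otimes> s) (s \<otimes> t)"
  proof (rule UN_collapse [OF a b])
  fix a' s' b' t' assume "(a', s') \<in> fr a s" "(b', t') \<in> fr b t"
  from in_frD [OF this(1)] in_frD [OF this(2)] have a': "a' \<in> carrier R" "s' \<in> D" and b': "b' \<in> carrier R" "t' \<in> D"
    and "\<exists>u\<in>D. u \<otimes> (a' \<otimes> s) = u \<otimes> (a \<otimes> s')" "\<exists>v\<in>D. v \<otimes> (b' \<otimes> t) = v \<otimes> (b \<otimes> t')"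
    by blast+
  then obtain u v where u: "u \<in> D" "u \<otimes> (a' \<otimes> s) = u \<otimes> (a \<otimes> s')"
    and v: "v \<in> D" "v \<otimes> (b' \<otimes> t) = v \<otimes> (b \<otimes> t')" by blast
  have "(u \<otimes> v) \<otimes> ((a' \<otimes> t' \<oplus> b' \<otimes> s') \<otimes> (s \<otimes> t)) =
      (v \<otimes> (t' \<otimes> t)) \<otimes> (u \<otimes> (a' \<otimes> s)) \<oplus> (u \<otimes> (s' \<otimes> s)) \<otimes> (v \<otimes> (b' \<otimes> t))"
    using a a' b b' u(1) v(1) by (simp add: r_distr l_distr m_ac)
  also have "\<dots> = (u \<otimes> v) \<otimes> ((a \<otimes> t \<oplus> b \<otimes> s) \<otimes> (s' \<otimes> t'))"
    unfolding u(2) v(2) using a a' b b' u(1) v(1) by (simp add: r_distr l_distr m_ac)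
  finally show "fr (a' \<otimes> t' \<oplus> b' \<otimes> s') (s' \<otimes> t') = fr (a \<otimes> t \<oplus> b \<otimes> s) (s \<otimes> t)"
    using a a' b b' u(1) v(1) by (subst fr_eq) auto
  qed
  finally show ?thesis .
qed

lemma one_L: "\<one>\<^bsub>L\<^esub> = fr \<one> \<one>" and zero_L: "\<zero>\<^bsub>L\<^esub> = fr \<zero> \<one>"
  by (simp_all add: ring_of_fractions_def)

lemma cring_L: "cring L"
proof (rule cringI)
  show "abelian_group L"
  proof (rule abelian_groupI)
    fix X Y Z assume "X \<in> carrier L" "Y \<in> carrier L" "Z \<in> carrier L"
    then obtain a s b t c r where X: "X = fr a s" "a \<in> carrier R" "s \<in> D"
      and Y: "Y = fr b t" "b \<in> carrier R" "t \<in> D" and Z: "Z = fr c r" "c \<in> carrier R" "r \<in> D"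
      by (metis L_cases)
    show "X \<oplus>\<^bsub>L\<^esub> Y \<oplus>\<^bsub>L\<^esub> Z = X \<oplus>\<^bsub>L\<^esub> (Y \<oplus>\<^bsub>L\<^esub> Z)"
      using X Y Z by (simp add: add_fr l_distr r_distr m_ac a_ac)
    show "X \<oplus>\<^bsub>L\<^esub> Y = Y \<oplus>\<^bsub>L\<^esub> X" using X Y by (simp add: add_fr m_ac a_ac)
    show "X \<oplus>\<^bsub>L\<^esub> Y \<in> carrier L" using X Y by (simp add: add_fr)
    show "\<zero>\<^bsub>L\<^esub> \<oplus>\<^bsub>L\<^esub> X = X" using X by (simp add: add_fr zero_L)
    have "fr (\<ominus> a) s \<oplus>\<^bsub>L\<^esub> X = fr (\<ominus> a \<otimes> s \<oplus> a \<otimes> s) (s \<otimes> s)" using X by (simp add: add_fr)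
    also have "\<dots> = \<zero>\<^bsub>L\<^esub>"
      unfolding zero_L using X by (intro fr_eqI) (simp_all add: l_minus l_neg)
    finally show "\<exists>Y\<in>carrier L. Y \<oplus>\<^bsub>L\<^esub> X = \<zero>\<^bsub>L\<^esub>" using X by (intro bexI [of _ "fr (\<ominus> a) s"]) auto
  qed (simp add: zero_L)
  show "comm_monoid L"
  proof (rule comm_monoidI)
    fix X Y Z assume "X \<in> carrier L" "Y \<in> carrier L" "Z \<in> carrier L"
    then obtain a s b t c r where X: "X = fr a s" "a \<in> carrier R" "s \<in> D"
      and Y: "Y = fr b t" "b \<in> carrier R" "t \<in> D" and Z: "Z = fr c r" "c \<in> carrier R" "r \<in> D"
      by (metis L_cases)
    show "X \<otimes>\<^bsub>L\<^esub> Y \<otimes>\<^bsub>L\<^esub> Z = X \<otimes>\<^bsub>L\<^esub> (Y \<otimes>\<^bsub>L\<^esub> Z)" using X Y Z by (simp add: mult_fr m_ac)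
    show "X \<otimes>\<^bsub>L\<^esub> Y = Y \<otimes>\<^bsub>L\<^esub> X" using X Y by (simp add: mult_fr m_ac)
    show "X \<otimes>\<^bsub>L\<^esub> Y \<in> carrier L" using X Y by (simp add: mult_fr)
    show "\<one>\<^bsub>L\<^esub> \<otimes>\<^bsub>L\<^esub> X = X" using X by (simp add: mult_fr one_L)
  qed (simp add: one_L)
  fix X Y Z assume "X \<in> carrier L" "Y \<in> carrier L" "Z \<in> carrier L"
  then obtain a s b t c r where X: "X = fr a s" "a \<in> carrier R" "s \<in> D"
    and Y: "Y = fr b t" "b \<in> carrier R" "t \<in> D" and Z: "Z = fr c r" "c \<in> carrier R" "r \<in> D"
    by (metis L_cases)
  have "fr ((a \<otimes> t \<oplus> b \<otimes> s) \<otimes> c) (s \<otimes> t \<otimes> r) = fr (a \<otimes> c \<otimes> (t \<otimes> r) \<oplus> b \<otimes> c \<otimes> (s \<otimes> r)) (s \<otimes> r \<otimes> (t \<otimes> r))"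
    using X Y Z by (intro fr_eqI) (simp_all add: l_distr r_distr m_ac)
  then show "(X \<oplus>\<^bsub>L\<^esub> Y) \<otimes>\<^bsub>L\<^esub> Z = X \<otimes>\<^bsub>L\<^esub> Z \<oplus>\<^bsub>L\<^esub> Y \<otimes>\<^bsub>L\<^esub> Z"
    using X Y Z by (simp add: mult_fr add_fr)
qed

sublocale L: cring L by (rule cring_L)

definition contract :: "('a \<times> 'a) set set \<Rightarrow> 'a set" where
  "contract J = {a \<in> carrier R. fr a \<one> \<in> J}"

definition expand :: "'a set \<Rightarrow> ('a \<times> 'a) set set" where
  "expand I = {fr a s | a s. a \<in> I \<and> s \<in> D}"

lemma expandI: "a \<in> I \<Longrightarrow> s \<in> D \<Longrightarrow> fr a s \<in> expand I"
  unfolding expand_def by blast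

lemma fr_mem:
  assumes J: "ideal J L" and a: "a \<in> carrier R" "s \<in> D"
  shows "fr a s \<in> J \<longleftrightarrow> a \<in> contract J"
proof
  assume "fr a s \<in> J"
  then have "fr s \<one> \<otimes>\<^bsub>L\<^esub> fr a s \<in> J" using a by (intro ideal_facts(4) [OF J]) auto
  moreover have "fr s \<one> \<otimes>\<^bsub>L\<^esub> fr a s = fr a \<one>"
    using a by (simp add: mult_fr) (rule fr_eqI, auto simp: m_ac)
  ultimately show "a \<in> contract J" using a by (simp add: contract_def)
next
  assume "a \<in> contract J"
  then have "fr \<one> s \<otimes>\<^bsub>L\<^esub> fr a \<one> \<in> J" using a by (intro ideal_facts(4) [OF J]) (auto simp: contract_def)
  then show "fr a s \<in> J" using a by (simp add: mult_fr)
qed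

lemma contract_subset_iff:
  assumes "ideal J L" "ideal K L" shows "contract J \<subseteq> contract K \<longleftrightarrow> J \<subseteq> K"
proof
  assume *: "contract J \<subseteq> contract K"
  show "J \<subseteq> K"
  proof
    fix X assume X: "X \<in> J"
    then obtain a s where "X = fr a s" "a \<in> carrier R" "s \<in> D" using ideal_facts(1) [OF assms(1)] L_cases by blast
    then show "X \<in> K" using X * fr_mem assms by blast
  qed
qed (auto simp: contract_def)

lemma contract_ideal:
  assumes J: "ideal J L" shows "ideal (contract J) R"
proof (rule ideal_criterion)
  show "contract J \<subseteq> carrier R" by (auto simp: contract_def)
  show "\<zero> \<in> contract J" using ideal_facts(2) [OF J] by (simp add: contract_def zero_L)
  show "a \<oplus> b \<in> contract J" if "a \<in> contract J" "b \<in> contract J" for a b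
    using ideal_facts(3) [OF J, of "fr a \<one>" "fr b \<one>"] that by (simp add: contract_def add_fr)
  show "r \<otimes> a \<in> contract J" if "r \<in> carrier R" "a \<in> contract J" for r a
    using ideal_facts(4) [OF J, of "fr r \<one>" "fr a \<one>"] that by (simp add: contract_def mult_fr)
qed

lemma contract_prime:
  assumes J: "primeideal J L" shows "primeideal (contract J) R"
proof -
  interpret J: primeideal J L by fact
  show ?thesis
  proof (rule primeidealI [OF contract_ideal [OF J.is_ideal] is_cring])
    show "carrier R \<noteq> contract J"
    proof
      assume "carrier R = contract J"
      then have "\<one>\<^bsub>L\<^esub> \<in> J" using one_closed by (auto simp: contract_def one_L)
      then show False using L.ideal_one [OF J.is_ideal] J.I_notcarr by simp
    qed
    show "a \<in> contract J \<or> b \<in> contract J" if "a \<in> carrier R" "b \<in> carrier R" "a \<otimes> b \<in> contract J" for a b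
      using J.I_prime [of "fr a \<one>" "fr b \<one>"] that by (auto simp: contract_def mult_fr)
  qed
qed

lemma expand_mem:
  assumes I: "ideal I R" and a: "a \<in> carrier R" "s \<in> D"
  shows "fr a s \<in> expand I \<longleftrightarrow> (\<exists>u\<in>D. u \<otimes> a \<in> I)"
proof
  note If = ideal_facts [OF I]
  assume "fr a s \<in> expand I"
  then obtain b t where b: "b \<in> I" "t \<in> D" "fr a s = fr b t" by (auto simp: expand_def)
  have bR: "b \<in> carrier R" using b(1) If(1) by blast
  then obtain u where u: "u \<in> D" "u \<otimes> (a \<otimes> t) = u \<otimes> (b \<otimes> s)" using b a by (auto simp: fr_eq)
  have "(u \<otimes> t) \<otimes> a = (u \<otimes> s) \<otimes> b" using u a b bR by (simp add: m_ac)
  also have "\<dots> \<in> I" using u a b by (intro If(4)) auto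
  finally show "\<exists>u\<in>D. u \<otimes> a \<in> I" using u b by (intro bexI [of _ "u \<otimes> t"]) auto
next
  assume "\<exists>u\<in>D. u \<otimes> a \<in> I"
  then obtain u where u: "u \<in> D" "u \<otimes> a \<in> I" by blast
  have "fr a s = fr (u \<otimes> a) (u \<otimes> s)" using u a by (intro fr_eqI) (auto simp: m_ac)
  then show "fr a s \<in> expand I" using expandI [OF u(2), of "u \<otimes> s"] u(1) a by simp
qed

lemma expand_ideal:
  assumes I: "ideal I R" shows "ideal (expand I) L"
proof (rule L.ideal_criterion)
  note If = ideal_facts [OF I]
  have IR: "a \<in> carrier R" if "a \<in> I" for a using that If(1) by blast
  show "expand I \<subseteq> carrier L" using IR by (auto simp: expand_def)
  show "\<zero>\<^bsub>L\<^esub> \<in> expand I" unfolding zero_L expand_def using If(2) D_one by blast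
  fix X Y assume "Y \<in> expand I"
  then obtain b t where Y: "Y = fr b t" "b \<in> I" "t \<in> D" by (auto simp: expand_def)
  show "X \<oplus>\<^bsub>L\<^esub> Y \<in> expand I" if XI: "X \<in> expand I"
  proof -
    obtain a s where X: "X = fr a s" "a \<in> I" "s \<in> D" using XI by (auto simp: expand_def)
    have "a \<otimes> t \<oplus> b \<otimes> s \<in> I" using X Y by (intro If(3) If(5)) auto
    then show ?thesis using X Y IR expandI by (simp add: add_fr)
  qed
  show "X \<otimes>\<^bsub>L\<^esub> Y \<in> expand I" if XL: "X \<in> carrier L"
  proof -
    obtain a s where X: "X = fr a s" "a \<in> carrier R" "s \<in> D" using XL by (rule L_cases)
    have "a \<otimes> b \<in> I" using X Y by (intro If(4)) auto
    then show ?thesis using X Y IR expandI by (simp add: mult_fr)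
  qed
qed

lemma noetherian_L:
  assumes N: "noetherian_ring R" shows "noetherian_ring L"
proof (rule L.noetherian_ringI)
  fix J assume J: "ideal J L"
  obtain A where A: "A \<subseteq> carrier R" "finite A" "contract J = Idl A"
    using noetherian_ring.finetely_gen [OF N contract_ideal [OF J]] by blast
  let ?A = "(\<lambda>a. fr a \<one>) ` A"
  have AL: "?A \<subseteq> carrier L" using A by auto
  note G = L.genideal_ideal [OF AL]
  have "A \<subseteq> contract (Idl\<^bsub>L\<^esub> ?A)" using L.genideal_self [OF AL] A by (auto simp: contract_def)
  then have "contract J \<subseteq> contract (Idl\<^bsub>L\<^esub> ?A)"
    unfolding A(3) by (rule genideal_minimal [OF contract_ideal [OF G]])
  then have "J \<subseteq> Idl\<^bsub>L\<^esub> ?A" using contract_subset_iff [OF J G] by simp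
  moreover have "Idl\<^bsub>L\<^esub> ?A \<subseteq> J"
    using genideal_self [OF A(1)] A(3) by (intro L.genideal_minimal [OF J]) (auto simp: contract_def)
  ultimately show "\<exists>A\<subseteq>carrier L. finite A \<and> J = Idl\<^bsub>L\<^esub> A" using AL A(2) by blast
qed

text \<open>Clearing denominators: membership in the ideal of the localization means membership in
  \<open>Idl T\<close> after multiplication by some \<open>u\<close> in \<open>D\<close>, and
  \<open>u\<close> can be moved past \<open>x\<close>.\<close>

lemma regular_L:
  assumes x: "x \<in> carrier R" and T: "T \<subseteq> carrier R"
    and reg: "\<And>r. r \<in> carrier R \<Longrightarrow> x \<otimes> r \<in> Idl T \<Longrightarrow> r \<in> Idl T"
    and X: "X \<in> carrier L" "fr x \<one> \<otimes>\<^bsub>L\<^esub> X \<in> Idl\<^bsub>L\<^esub> ((\<lambda>a. fr a \<one>) ` T)"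
  shows "X \<in> Idl\<^bsub>L\<^esub> ((\<lambda>a. fr a \<one>) ` T)"
proof -
  let ?T = "(\<lambda>a. fr a \<one>) ` T"
  obtain a s where a: "X = fr a s" "a \<in> carrier R" "s \<in> D" using X(1) by (rule L_cases)
  have TL: "?T \<subseteq> carrier L" using T by auto
  note G = L.genideal_ideal [OF TL] and I = genideal_ideal [OF T]
  have "?T \<subseteq> expand (Idl T)" using genideal_self [OF T] by (auto intro!: expandI)
  then have "Idl\<^bsub>L\<^esub> ?T \<subseteq> expand (Idl T)" by (rule L.genideal_minimal [OF expand_ideal [OF I]])
  then have "fr (x \<otimes> a) s \<in> expand (Idl T)" using X(2) a x by (auto simp: mult_fr)
  then obtain u where u: "u \<in> D" "u \<otimes> (x \<otimes> a) \<in> Idl T" using expand_mem [OF I] a x by auto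
  have "x \<otimes> (u \<otimes> a) \<in> Idl T" using u a x by (simp add: m_lcomm)
  then have ua: "u \<otimes> a \<in> Idl T" using reg u a by simp
  have "T \<subseteq> contract (Idl\<^bsub>L\<^esub> ?T)" using L.genideal_self [OF TL] T by (auto simp: contract_def)
  then have "Idl T \<subseteq> contract (Idl\<^bsub>L\<^esub> ?T)" by (rule genideal_minimal [OF contract_ideal [OF G]])
  then have "fr (u \<otimes> a) (u \<otimes> s) \<in> Idl\<^bsub>L\<^esub> ?T" using fr_mem [OF G] ua u a by auto
  moreover have "fr (u \<otimes> a) (u \<otimes> s) = fr a s" using u a by (intro fr_eqI) (auto simp: m_ac)
  ultimately show ?thesis using a by simp
qed

end

text \<open>Chains in the localization contract to chains in \<open>R\<close>, and the sequences
  found there stay regular by \<open>regular_L\<close>. Lying in the maximal ideal, they generate a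
  proper ideal, as \<open>regular_sequence\<close> demands.\<close>

theorem localization_cohen_macaulay:
  assumes R: "cring R" and N: "noetherian_ring R" and P: "primeideal P R"
    and chains: "\<And>n Q. ring_chain R n Q \<Longrightarrow> \<exists>xs. length xs = n \<and> set xs \<subseteq> Q n \<and>
      (\<forall>i<n. \<forall>r\<in>carrier R. xs ! i \<otimes>\<^bsub>R\<^esub> r \<in> Idl\<^bsub>R\<^esub> (set (take i xs)) \<longrightarrow> r \<in> Idl\<^bsub>R\<^esub> (set (take i xs)))"
  shows "cohen_macaulay_local_ring (localization_at R P)"
proof -
  interpret R: cring R by fact
  interpret P: primeideal P R by fact
  let ?D = "carrier R - P"
  interpret fractions R ?D
  proof
    show "\<one>\<^bsub>R\<^esub> \<in> ?D" using R.ideal_one [OF P.is_ideal] P.I_notcarr by auto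
    show "s \<otimes>\<^bsub>R\<^esub> t \<in> ?D" if "s \<in> ?D" "t \<in> ?D" for s t using that P.I_prime by auto
  qed auto
  let ?M = "expand P"
  have M: "ideal ?M L" by (rule expand_ideal [OF P.is_ideal])
  have M_mem: "fr a s \<in> ?M \<longleftrightarrow> a \<in> P" if "a \<in> carrier R" "s \<in> ?D" for a s
  proof -
    have "a \<in> P" if "u \<in> ?D" "u \<otimes>\<^bsub>R\<^esub> a \<in> P" for u using that \<open>a \<in> carrier R\<close> P.I_prime by blast
    moreover have "\<one>\<^bsub>R\<^esub> \<otimes>\<^bsub>R\<^esub> a = a" using that by simp
    ultimately show ?thesis using expand_mem [OF P.is_ideal that] D_one by metis
  qed
  have M_ne: "carrier L \<noteq> ?M"
    using M_mem [of "\<one>\<^bsub>R\<^esub>" "\<one>\<^bsub>R\<^esub>"] D_one fr_carrier [of "\<one>\<^bsub>R\<^esub>" "\<one>\<^bsub>R\<^esub>"] by auto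
  have proper: "J \<subseteq> ?M" if J: "ideal J L" "J \<noteq> carrier L" for J
  proof
    fix X assume X: "X \<in> J"
    then obtain a s where a: "X = fr a s" "a \<in> carrier R" "s \<in> ?D"
      using ideal_facts(1) [OF J(1)] L_cases by blast
    show "X \<in> ?M"
    proof (rule ccontr)
      assume "X \<notin> ?M"
      then have aD: "a \<in> ?D" using M_mem a by simp
      have "fr s a \<otimes>\<^bsub>L\<^esub> X \<in> J" using X a aD by (intro ideal_facts(4) [OF J(1)]) auto
      moreover have "fr s a \<otimes>\<^bsub>L\<^esub> X = \<one>\<^bsub>L\<^esub>"
      proof -
        have "fr s a \<otimes>\<^bsub>L\<^esub> X = fr (s \<otimes>\<^bsub>R\<^esub> a) (a \<otimes>\<^bsub>R\<^esub> s)"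
          unfolding a(1) using a aD by (intro mult_fr) auto
        also have "\<dots> = fr \<one>\<^bsub>R\<^esub> \<one>\<^bsub>R\<^esub>"
          by (rule fr_eqI) (use a(2,3) aD D_one D_mult in \<open>auto simp: R.m_ac\<close>)
        finally show ?thesis unfolding one_L .
      qed
      ultimately show False using L.ideal_one [OF J(1)] J(2) by simp
    qed
  qed
  have max_M: "maximalideal ?M L"
    by (rule maximalidealI [OF M M_ne]) (use proper in blast)
  have unique: "K = ?M" if "maximalideal K L" for K
  proof -
    interpret K: maximalideal K L by fact
    show ?thesis using K.I_maximal [OF M] proper [OF K.is_ideal] K.I_notcarr M_ne ideal_facts(1) [OF M] by blast
  qed
  have "\<exists>P. ring_chain L (length xs) P" if "regular_sequence L xs" for xs
    using L.regular_sequence_chain that by blast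
  then have le: "ideal_depth L ?M \<le> krull_dim L"
    unfolding ideal_depth_def krull_dim_def ring_chain_def by (intro Sup_subset_mono) blast
  have ex: "\<exists>xs. length xs = n \<and> set xs \<subseteq> ?M \<and> regular_sequence L xs" if J: "ring_chain L n J" for n J
  proof -
    have prime: "primeideal (J i) L" if "i \<le> n" for i using J that by (simp add: ring_chain_def)
    have id: "ideal (J i) L" if "i \<le> n" for i using prime [OF that] by (simp add: primeideal_def)
    have "ring_chain R n (\<lambda>i. contract (J i))"
      unfolding ring_chain_def
    proof (intro conjI allI impI)
      show "contract (J i) \<subset> contract (J (Suc i))" if "i < n" for i
      proof -
        have "J i \<subset> J (Suc i)" using J that by (simp add: ring_chain_def)
        then show ?thesis
          using contract_subset_iff [OF id [of i] id [of "Suc i"]] contract_subset_iff [OF id [of "Suc i"] id [of i]] that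
          by auto
      qed
    qed (use contract_prime prime in blast)
    from chains [OF this] obtain xs where xs: "length xs = n" "set xs \<subseteq> contract (J n)"
      and reg: "\<forall>i<n. \<forall>r\<in>carrier R. xs ! i \<otimes>\<^bsub>R\<^esub> r \<in> Idl\<^bsub>R\<^esub> (set (take i xs)) \<longrightarrow> r \<in> Idl\<^bsub>R\<^esub> (set (take i xs))"
      by blast
    have xsR: "set xs \<subseteq> carrier R" using xs(2) by (auto simp: contract_def)
    let ?ys = "map (\<lambda>a. fr a \<one>\<^bsub>R\<^esub>) xs"
    have "J n \<noteq> carrier L"
    proof -
      interpret Jn: primeideal "J n" L by (rule prime) simp
      show ?thesis using Jn.I_notcarr by blast
    qed
    then have JM: "J n \<subseteq> ?M" using proper [OF id [OF order_refl]] by blast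
    have ysJ: "set ?ys \<subseteq> J n" using xs(2) by (auto simp: contract_def)
    have "regular_sequence L ?ys"
      unfolding regular_sequence_def
    proof (intro conjI allI impI ballI)
      show "set ?ys \<subseteq> carrier L" using ysJ ideal_facts(1) [OF id [OF order_refl]] by blast
      have "Idl\<^bsub>L\<^esub> (set ?ys) \<subseteq> ?M" by (rule L.genideal_minimal [OF M]) (use ysJ JM in blast)
      then show "Idl\<^bsub>L\<^esub> (set ?ys) \<noteq> carrier L" using M_ne ideal_facts(1) [OF M] by blast
      fix i X assume i: "i < length ?ys" and X: "X \<in> carrier L"
        and *: "?ys ! i \<otimes>\<^bsub>L\<^esub> X \<in> Idl\<^bsub>L\<^esub> (set (take i ?ys))"
      have tk: "set (take i ?ys) = (\<lambda>a. fr a \<one>\<^bsub>R\<^esub>) ` set (take i xs)" by (simp add: take_map)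
      show "X \<in> Idl\<^bsub>L\<^esub> (set (take i ?ys))"
        unfolding tk
      proof (rule regular_L [where x = "xs ! i"])
        show "xs ! i \<in> carrier R" using i xsR by (simp add: subsetD)
        show "set (take i xs) \<subseteq> carrier R" using xsR set_take_subset [of i xs] by blast
        show "r \<in> Idl\<^bsub>R\<^esub> (set (take i xs))"
          if "r \<in> carrier R" "xs ! i \<otimes>\<^bsub>R\<^esub> r \<in> Idl\<^bsub>R\<^esub> (set (take i xs))" for r
          using reg i xs(1) that by simp
        show "fr (xs ! i) \<one>\<^bsub>R\<^esub> \<otimes>\<^bsub>L\<^esub> X \<in> Idl\<^bsub>L\<^esub> ((\<lambda>a. fr a \<one>\<^bsub>R\<^esub>) ` set (take i xs))"
          using * i unfolding tk by simp
      qed (rule X)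
    qed
    then show ?thesis using xs(1) ysJ JM by (intro exI [of _ ?ys]) auto
  qed
  have "krull_dim L \<le> ideal_depth L ?M"
    unfolding ideal_depth_def krull_dim_def
  proof (intro Sup_subset_mono subsetI)
    fix x assume "x \<in> {enat n | n. \<exists>P. (\<forall>i\<le>n. primeideal (P i) L) \<and> (\<forall>i<n. P i \<subset> P (Suc i))}"
    then obtain n J where n: "x = enat n" and J: "ring_chain L n J" by (auto simp: ring_chain_def)
    then show "x \<in> {enat (length xs) | xs. set xs \<subseteq> ?M \<and> regular_sequence L xs}" using ex [OF J] by blast
  qed
  then have "ideal_depth L ?M = krull_dim L" using le by (rule antisym [rotated])
  then show ?thesis
    unfolding cohen_macaulay_local_ring_def localization_at_def
    using cring_L noetherian_L [OF N] max_M unique by blast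
qed

section \<open>Transfer to rings given as records\<close>

lemma (in finite_ext) noeth_integral: "f = 0 \<Longrightarrow> noeth R \<Longrightarrow> noeth S"
  unfolding noeth_def [of S] using noeth_ext ideal_in_0 by metis

lemma (in free_ext) regular_chains_integral:
  assumes "f = 0" "regular_chains R" shows "regular_chains S"
  unfolding regular_chains_def
proof (intro allI impI)
  fix n P assume P: "prime_chain S n P"
  have prime: "prime_in S (P i)" if "i \<le> n" for i using P that by (simp add: prime_chain_def)
  have "prime_chain R n (\<lambda>i. P i \<inter> R)"
  proof (rule contract_chain [OF prime])
    show "P i \<subset> P (Suc i)" if "i < n" for i using P that by (simp add: prime_chain_def)
    show "f \<in> P i" if "i \<le> n" for i using ideal_in_0 [OF prime_in_ideal [OF prime [OF that]]] assms(1) by simp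
  qed
  then obtain ys where ys: "length ys = n" "set ys \<subseteq> P n \<inter> R" "regular R ys"
    using assms(2) unfolding regular_chains_def by blast
  have "gen S (insert f X) = gen S X" if "X \<subseteq> S" for X
  proof
    have "insert f X \<subseteq> gen S X" using gen_superset ideal_in_0 [OF gen_ideal [OF S that]] assms(1) by blast
    then show "gen S (insert f X) \<subseteq> gen S X" by (rule gen_minimal [OF gen_ideal [OF S that]])
  qed (rule gen_mono, blast)
  moreover have "set (take i ys) \<subseteq> S" for i using ys(2) RS set_take_subset [of i ys] by blast
  ultimately have "regular S ys"
    unfolding regular_def using regular_extend [OF ys(3)] ys(2) RS by auto
  then show "\<exists>xs. length xs = n \<and> set xs \<subseteq> P n \<and> regular S xs" using ys by blast
qed

text \<open>A record ring identified by \<open>\<phi>\<close> with a subset of a ring type, the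
  bridge over which results about \<open>sub_ring\<close> sets reach records.\<close>

locale ring_model =
  fixes Q :: "('a, 'c) ring_scheme" (structure) and T :: "'b::comm_ring_1 set" and \<phi> :: "'a \<Rightarrow> 'b"
  assumes T: "sub_ring T" and bij: "bij_betw \<phi> (carrier Q) T"
    and mult: "x \<in> carrier Q \<Longrightarrow> y \<in> carrier Q \<Longrightarrow> x \<otimes> y \<in> carrier Q \<and> \<phi> (x \<otimes> y) = \<phi> x * \<phi> y"
    and add: "x \<in> carrier Q \<Longrightarrow> y \<in> carrier Q \<Longrightarrow> x \<oplus> y \<in> carrier Q \<and> \<phi> (x \<oplus> y) = \<phi> x + \<phi> y"
    and zero: "\<zero> \<in> carrier Q \<and> \<phi> \<zero> = 0" and one: "\<one> \<in> carrier Q \<and> \<phi> \<one> = 1"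
begin

lemma in_T: "x \<in> carrier Q \<Longrightarrow> \<phi> x \<in> T" using bij by (auto simp: bij_betw_def)

lemma eqI: "x \<in> carrier Q \<Longrightarrow> y \<in> carrier Q \<Longrightarrow> \<phi> x = \<phi> y \<Longrightarrow> x = y"
  using bij by (auto simp: bij_betw_def inj_on_def)

lemma lift: "t \<in> T \<Longrightarrow> \<exists>x\<in>carrier Q. \<phi> x = t" using bij by (auto simp: bij_betw_def)

lemma cring_Q: "cring Q"
proof (rule cringI)
  show "abelian_group Q"
  proof (rule abelian_groupI)
    fix x assume x: "x \<in> carrier Q"
    obtain y where "y \<in> carrier Q" "\<phi> y = - \<phi> x" using lift sub_ring_uminus [OF T in_T [OF x]] by blast
    then show "\<exists>y\<in>carrier Q. y \<oplus> x = \<zero>" using x add zero by (intro bexI [of _ y] eqI) auto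
  qed (use add zero in \<open>auto intro!: eqI simp: ac_simps\<close>)
  show "comm_monoid Q"
    by (rule comm_monoidI) (use mult one in \<open>auto intro!: eqI simp: ac_simps\<close>)
qed (use add mult in \<open>auto intro!: eqI simp: distrib_right\<close>)

sublocale Q: cring Q by (rule cring_Q)

lemma uminus: "x \<in> carrier Q \<Longrightarrow> \<phi> (\<ominus> x) = - \<phi> x"
proof -
  assume x: "x \<in> carrier Q"
  then have "\<phi> (\<ominus> x) + \<phi> x = 0" using add [of "\<ominus> x" x] zero by (simp add: Q.l_neg)
  then show ?thesis by (simp add: eq_neg_iff_add_eq_0)
qed

lemma nat_pow: "x \<in> carrier Q \<Longrightarrow> \<phi> (x [^] (n :: nat)) = \<phi> x ^ n"
  by (induction n) (auto simp: one mult mult.commute)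

lemma finsum: "finite I \<Longrightarrow> (\<And>i. i \<in> I \<Longrightarrow> g i \<in> carrier Q) \<Longrightarrow> \<phi> (finsum Q g I) = (\<Sum>i\<in>I. \<phi> (g i))"
proof (induction I rule: finite_induct)
  case (insert i I)
  then have "finsum Q g (insert i I) = g i \<oplus> finsum Q g I" by (intro Q.finsum_insert) auto
  moreover have "finsum Q g I \<in> carrier Q" using insert.prems by (intro Q.finsum_closed) auto
  ultimately show ?case using insert by (simp add: add)
qed (simp add: zero)

lemma ideal_image: "ideal I Q \<Longrightarrow> ideal_in T (\<phi> ` I)"
  unfolding ideal_in_def
proof (intro conjI ballI)
  assume I: "ideal I Q"
  note If = ideal_facts [OF I]
  have IQ: "x \<in> carrier Q" if "x \<in> I" for x using If(1) that by blast
  show "\<phi> ` I \<subseteq> T" using IQ in_T by blast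
  show "0 \<in> \<phi> ` I" using If(2) zero by (metis imageI)
  show "x + y \<in> \<phi> ` I" if xy: "x \<in> \<phi> ` I" "y \<in> \<phi> ` I" for x y
  proof -
    obtain a b where a: "a \<in> I" "x = \<phi> a" "b \<in> I" "y = \<phi> b" using xy by blast
    then have "x + y = \<phi> (a \<oplus> b)" using add IQ by simp
    then show ?thesis using If(3) a by blast
  qed
  show "r * x \<in> \<phi> ` I" if rx: "r \<in> T" "x \<in> \<phi> ` I" for r x
  proof -
    obtain a where a: "a \<in> I" "x = \<phi> a" using rx by blast
    obtain b where b: "b \<in> carrier Q" "\<phi> b = r" using lift rx by blast
    have "r * x = \<phi> (b \<otimes> a)" using mult IQ a b by simp
    then show ?thesis using If(4) a b by blast
  qed
qed

lemma mem_image: "I \<subseteq> carrier Q \<Longrightarrow> x \<in> carrier Q \<Longrightarrow> \<phi> x \<in> \<phi> ` I \<longleftrightarrow> x \<in> I"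
  using eqI by blast

lemma ideal_vimage:
  assumes K: "ideal_in T K" shows "ideal {x \<in> carrier Q. \<phi> x \<in> K} Q"
  by (rule Q.ideal_criterion)
    (use zero add mult in_T ideal_in_0 [OF K] ideal_in_add [OF K] ideal_in_mult [OF K] in auto)

lemma prime_image: "primeideal P Q \<Longrightarrow> prime_in T (\<phi> ` P)"
proof -
  assume "primeideal P Q"
  then interpret P: primeideal P Q .
  have PQ: "P \<subseteq> carrier Q" using ideal_facts(1) [OF P.is_ideal] .
  have "1 \<notin> \<phi> ` P"
    using Q.ideal_one [OF P.is_ideal] P.I_notcarr mem_image [OF PQ, of \<one>] one by auto
  moreover have "x \<in> \<phi> ` P \<or> y \<in> \<phi> ` P" if xy: "x \<in> T" "y \<in> T" "x * y \<in> \<phi> ` P" for x y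
  proof -
    obtain a b where a: "a \<in> carrier Q" "\<phi> a = x" and b: "b \<in> carrier Q" "\<phi> b = y" using lift xy by metis
    have "\<phi> (a \<otimes> b) \<in> \<phi> ` P" using mult a b xy(3) by simp
    then have "a \<otimes> b \<in> P" using mem_image [OF PQ] a b by simp
    then show ?thesis using P.I_prime a b by blast
  qed
  ultimately show ?thesis using ideal_image [OF P.is_ideal] by (simp add: prime_in_def)
qed

lemma noetherian_Q:
  assumes N: "noeth T" shows "noetherian_ring Q"
proof (rule Q.noetherian_ringI)
  fix I assume I: "ideal I Q"
  have IQ: "I \<subseteq> carrier Q" by (rule ideal_facts(1) [OF I])
  obtain X where X: "finite X \<and> X \<subseteq> \<phi> ` I \<and> (\<forall>K. ideal_in T K \<and> X \<subseteq> K \<longrightarrow> \<phi> ` I \<subseteq> K)"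
    using noethD [OF N ideal_image [OF I]] by (rule exE)
  obtain A where A: "A \<subseteq> I" "finite A" "X = \<phi> ` A" using finite_subset_image X by metis
  have AQ: "A \<subseteq> carrier Q" using A(1) IQ by blast
  note G = Q.genideal_ideal [OF AQ]
  have "X \<subseteq> \<phi> ` (Idl A)" using Q.genideal_self [OF AQ] A(3) by blast
  then have "\<phi> ` I \<subseteq> \<phi> ` (Idl A)" using X ideal_image [OF G] by simp
  then have "I \<subseteq> Idl A" using mem_image [OF ideal_facts(1) [OF G]] IQ by blast
  moreover have "Idl A \<subseteq> I" by (rule Q.genideal_minimal [OF I A(1)])
  ultimately show "\<exists>A\<subseteq>carrier Q. finite A \<and> I = Idl A" using AQ A(2) by blast
qed

lemma chains_Q:
  assumes C: "regular_chains T" and P: "ring_chain Q n P"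
  shows "\<exists>xs. length xs = n \<and> set xs \<subseteq> P n \<and>
    (\<forall>i<n. \<forall>r\<in>carrier Q. xs ! i \<otimes> r \<in> Idl (set (take i xs)) \<longrightarrow> r \<in> Idl (set (take i xs)))"
proof -
  have prime: "primeideal (P i) Q" if "i \<le> n" for i using P that by (simp add: ring_chain_def)
  have PQ: "P i \<subseteq> carrier Q" if "i \<le> n" for i
    using prime [OF that] by (auto simp: primeideal_def dest: ideal_facts(1))
  have "prime_chain T n (\<lambda>i. \<phi> ` P i)"
    unfolding prime_chain_def
  proof (intro conjI allI impI)
    show "\<phi> ` P i \<subset> \<phi> ` P (Suc i)" if i: "i < n" for i
    proof -
      have "P i \<subset> P (Suc i)" using P i by (simp add: ring_chain_def)
      then obtain x where x: "x \<in> P (Suc i)" "x \<notin> P i" and sub: "P i \<subseteq> P (Suc i)" by blast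
      have "\<phi> x \<notin> \<phi> ` P i" using mem_image [OF PQ [of i]] x PQ [of "Suc i"] i by auto
      then show ?thesis using x(1) sub by blast
    qed
  qed (use prime_image prime in blast)
  then obtain xs where xs: "length xs = n" "set xs \<subseteq> \<phi> ` P n" "regular T xs"
    using C unfolding regular_chains_def by blast
  have "\<exists>ys. xs = map \<phi> ys \<and> set ys \<subseteq> P n" using xs(2)
  proof (induction xs)
    case (Cons x xs)
    then obtain ys y where "xs = map \<phi> ys" "set ys \<subseteq> P n" "x = \<phi> y" "y \<in> P n" by auto
    then show ?case by (intro exI [of _ "y # ys"]) simp
  qed simp
  then obtain ys where ys: "xs = map \<phi> ys" "set ys \<subseteq> P n" by blast
  have "r \<in> Idl (set (take i ys))" if i: "i < n" and r: "r \<in> carrier Q"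
    and yr: "ys ! i \<otimes> r \<in> Idl (set (take i ys))" for i r
  proof -
    let ?Y = "set (take i ys)"
    have Y: "?Y \<subseteq> carrier Q" using ys(2) PQ [of n] set_take_subset [of i ys] by blast
    have yi: "ys ! i \<in> carrier Q" 
      using subsetD [OF PQ [of n] subsetD [OF ys(2) nth_mem [of i ys]]] ys(1) xs(1) i by simp
    have YT: "\<phi> ` ?Y \<subseteq> T" using Y in_T by blast
    have "Idl ?Y \<subseteq> {x \<in> carrier Q. \<phi> x \<in> gen T (\<phi> ` ?Y)}"
      by (rule Q.genideal_minimal [OF ideal_vimage [OF gen_ideal [OF T YT]]])
        (use Y gen_in [of _ "\<phi> ` ?Y" T] in auto)
    then have "\<phi> (ys ! i \<otimes> r) \<in> gen T (\<phi> ` ?Y)" using yr by blast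
    then have "xs ! i * \<phi> r \<in> gen T (set (take i xs))" using ys xs(1) i mult yi r by (simp add: take_map)
    then have "\<phi> r \<in> gen T (set (take i xs))" using xs(1,3) i in_T [OF r] by (simp add: regular_def)
    then have "\<phi> r \<in> gen T (\<phi> ` ?Y)" using ys by (simp add: take_map)
    moreover have "gen T (\<phi> ` ?Y) \<subseteq> \<phi> ` (Idl ?Y)"
      by (rule gen_minimal [OF ideal_image [OF Q.genideal_ideal [OF Y]]]) (use Q.genideal_self [OF Y] in blast)
    ultimately show ?thesis using mem_image [OF ideal_facts(1) [OF Q.genideal_ideal [OF Y]] r] by blast
  qed
  then show ?thesis using ys xs(1) by (intro exI [of _ ys]) auto
qed

end

section \<open>The ring of quasi-covariants\<close>

lemma sym_dual_simps [simp]: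
  "carrier (sym_dual B) = PV B" "x \<otimes>\<^bsub>sym_dual B\<^esub> y = x * y" "x \<oplus>\<^bsub>sym_dual B\<^esub> y = x + y"
  "\<one>\<^bsub>sym_dual B\<^esub> = 1" "\<zero>\<^bsub>sym_dual B\<^esub> = 0"
  by (simp_all add: sym_dual_def PV_def)

lemma sym_dual_model: "ring_model (sym_dual B) (PV B) (\<lambda>p. p)"
  by unfold_locales (auto simp: PV_sub_ring PV_mult PV_add bij_betw_def)

lemma sym_dual_cring: "cring (sym_dual B)"
  by (rule ring_model.cring_Q [OF sym_dual_model])

lemma sym_dual_minus: "x \<in> PV B \<Longrightarrow> y \<in> PV B \<Longrightarrow> x \<ominus>\<^bsub>sym_dual B\<^esub> y = x - y"
  using ring_model.uminus [OF sym_dual_model, of y B] by (simp add: a_minus_def)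

lemma sym_dual_pow: "x \<in> PV B \<Longrightarrow> x [^]\<^bsub>sym_dual B\<^esub> (n :: nat) = x ^ n"
  using ring_model.nat_pow [OF sym_dual_model, of x B] by simp

text \<open>Setting the outer variables to zero fixes \<open>PV B\<close>, and with it the forms
  \<open>al s\<close>. Applied to a basis and to coefficients it moves both into
  \<open>PV B\<close>.\<close>

definition retract :: "'v set \<Rightarrow> ('v, 'k::comm_ring_1) mpoly \<Rightarrow> ('v, 'k) mpoly" where
  "retract B = psubst (\<lambda>v. if v \<in> B then pvar v else 0)"

lemma retract_PV [simp]: "retract B p \<in> PV B"
  unfolding retract_def by (rule psubst_PV [of _ UNIV]) auto

lemma retract_id: "p \<in> PV B \<Longrightarrow> retract B p = p"
  unfolding retract_def by (rule psubst_id_PV) auto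

lemma retract_simps [simp]:
  "retract B (p + q) = retract B p + retract B q" "retract B (p - q) = retract B p - retract B q"
  "retract B (p * q) = retract B p * retract B q" "retract B (p ^ n) = retract B p ^ n"
  by (simp_all add: retract_def)

lemma retract_sum: "retract B (sum f I) = (\<Sum>i\<in>I. retract B (f i))"
  by (simp add: retract_def psubst_sum)

lemma retract_dvd: "a dvd b \<Longrightarrow> retract B a dvd retract B b"
  by (metis dvdE dvdI retract_simps(3))

lemma PIdl_sym_dual:
  assumes "a \<in> PV B" "p \<in> PV B" shows "p \<in> PIdl\<^bsub>sym_dual B\<^esub> a \<longleftrightarrow> a dvd p"
proof
  assume "a dvd p"
  then obtain z where z: "p = a * z" by (auto simp: dvd_def)
  have "p = retract B z * a" using retract_id [OF assms(2)] retract_id [OF assms(1)] by (simp add: z mult.commute)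
  then show "p \<in> PIdl\<^bsub>sym_dual B\<^esub> a" by (auto simp: cgenideal_def)
qed (auto simp: cgenideal_def)

section \<open>The quasi-covariants as a record and as a ring of functions\<close>

context refl_setup
begin

abbreviation "quasi m \<equiv> quasi_covariants scale B W \<rho> \<alpha> m"

lemma quasi_carrier: "carrier (quasi m) = {p \<in> carrier W \<rightarrow>\<^sub>E PV B. p \<in> RA.QC (\<lambda>s. m (hyp s))}"
proof -
  have "p w \<ominus>\<^bsub>sym_dual B\<^esub> p (hyperplane_reflection scale W \<rho> (hyp s) \<otimes> w)
      \<in> PIdl\<^bsub>sym_dual B\<^esub> (fp (\<alpha> (hyp s)) [^]\<^bsub>sym_dual B\<^esub> m (hyp s)) \<longleftrightarrow>
      al s ^ m (hyp s) dvd p w - p (s \<otimes> w)"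
    if p: "p \<in> carrier W \<rightarrow>\<^sub>E PV B" and s: "s \<in> Rf" and w: "w \<in> carrier W" for p s w
  proof -
    have pw: "p w \<in> PV B" "p (s \<otimes> w) \<in> PV B" using PiE_mem [OF p] w Rf_W [OF s] by simp_all
    have "al s \<in> PV B" by (simp add: al_def fp_PV)
    then show ?thesis
      using pw by (simp add: hyperplane_reflection [OF s] sym_dual_minus sym_dual_pow fm_def [symmetric]
        al_def [symmetric] PIdl_sym_dual PV_power PV_diff)
  qed
  then show ?thesis
    unfolding quasi_covariants_def Let_def hyperplanes RA.QC_def
    by (auto simp del: One_nat_def)
qed

lemma quasi_ops:
  "p \<otimes>\<^bsub>quasi m\<^esub> q = (\<lambda>w\<in>carrier W. p w * q w)" "p \<oplus>\<^bsub>quasi m\<^esub> q = (\<lambda>w\<in>carrier W. p w + q w)"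
  "\<one>\<^bsub>quasi m\<^esub> = (\<lambda>w\<in>carrier W. 1)" "\<zero>\<^bsub>quasi m\<^esub> = (\<lambda>w\<in>carrier W. 0)"
  "f \<odot>\<^bsub>quasi m\<^esub> p = (\<lambda>w\<in>carrier W. f * p w)"
  by (auto simp: quasi_covariants_def Let_def diagonal_def intro!: restrict_ext)

lemma QC_cong: "(\<And>w. w \<in> carrier W \<Longrightarrow> p w = q w) \<Longrightarrow> p \<in> RA.QC m \<longleftrightarrow> q \<in> RA.QC m"
  by (simp add: RA.QC_def)

lemma QC_mult: "p \<in> RA.QC m \<Longrightarrow> q \<in> RA.QC m \<Longrightarrow> (\<lambda>w. p w * q w) \<in> RA.QC m"
  unfolding RA.QC_def
proof clarify
  fix s w assume *: "\<forall>s\<in>Rf. \<forall>w\<in>carrier W. al s ^ m s dvd p w - p (s \<otimes> w)"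
    "\<forall>s\<in>Rf. \<forall>w\<in>carrier W. al s ^ m s dvd q w - q (s \<otimes> w)" and s: "s \<in> Rf" "w \<in> carrier W"
  have "p w * q w - p (s \<otimes> w) * q (s \<otimes> w) =
      (p w - p (s \<otimes> w)) * q w + p (s \<otimes> w) * (q w - q (s \<otimes> w))" by (simp add: algebra_simps)
  moreover have "al s ^ m s dvd (p w - p (s \<otimes> w)) * q w" "al s ^ m s dvd p (s \<otimes> w) * (q w - q (s \<otimes> w))"
    using * s by (blast intro: dvd_mult dvd_mult2)+
  ultimately show "al s ^ m s dvd p w * q w - p (s \<otimes> w) * q (s \<otimes> w)" by (simp only: dvd_add)
qed

lemma QC_const: "(\<lambda>w. c) \<in> RA.QC m" by (simp add: RA.QC_def)

text \<open>Functions are normalised outside \<open>W\<close> by their value at the identity, so that the constant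
  functions, hence the unit of the pointwise ring structure, are included.\<close>

definition spread :: "('w \<Rightarrow> ('v, 'k) mpoly) \<Rightarrow> 'w \<Rightarrow> ('v, 'k) mpoly" where
  "spread p w = (if w \<in> carrier W then p w else p \<one>)"

definition model :: "('v set \<Rightarrow> nat) \<Rightarrow> ('w \<Rightarrow> ('v, 'k) mpoly) set" where
  "model m = {p \<in> RA.QC (\<lambda>s. m (hyp s)). (\<forall>w. p w \<in> PV B) \<and> spread p = p}"

lemma spread_iff: "spread p = p \<longleftrightarrow> (\<forall>w. w \<notin> carrier W \<longrightarrow> p w = p \<one>)"
  unfolding fun_eq_iff spread_def by auto

lemma spread_eqI: "spread p = p \<Longrightarrow> spread q = q \<Longrightarrow> (\<And>w. w \<in> carrier W \<Longrightarrow> p w = q w) \<Longrightarrow> p = q"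
  using W.one_closed by (metis spread_def ext)

lemma spread_in [simp]: "w \<in> carrier W \<Longrightarrow> spread p w = p w" by (simp add: spread_def)

lemma spread_spread: "spread (spread p) = spread p" by (rule ext) (simp add: spread_def)

lemma model_iff: "p \<in> model m \<longleftrightarrow>
    p \<in> RA.QC (\<lambda>s. m (hyp s)) \<and> (\<forall>w. p w \<in> PV B) \<and> (\<forall>w. w \<notin> carrier W \<longrightarrow> p w = p \<one>)"
  by (simp add: model_def spread_iff)

lemma model_sub_ring: "sub_ring (model m)"
  unfolding sub_ring_def
proof (intro conjI ballI)
  show "0 \<in> model m" using QC_const [of 0] by (simp add: model_iff zero_fun_def)
  show "1 \<in> model m" using QC_const [of 1] by (simp add: model_iff one_fun_def)
  fix p q assume p: "p \<in> model m" and q: "q \<in> model m"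
  show "p + q \<in> model m"
    using p q RA.QC_add [of p _ q] by (simp add: model_iff PV_add plus_fun_def)
  show "p * q \<in> model m"
    using p q QC_mult [of p _ q] by (simp add: model_iff PV_mult times_fun_def)
next
  fix p assume p: "p \<in> model m"
  show "- p \<in> model m"
    using p RA.QC_cmult [of p _ "- 1"] by (simp add: model_iff PV_uminus fun_Compl_def)
qed

lemma model_ring: "ring_model (quasi m) (model m) spread"
proof
  show "sub_ring (model m)" by (rule model_sub_ring)
  have PiE: "p \<in> carrier (quasi m) \<Longrightarrow> w \<in> carrier W \<Longrightarrow> p w \<in> PV B" for p w
    by (auto simp: quasi_carrier)
  have QC_spread: "spread p \<in> RA.QC k \<longleftrightarrow> p \<in> RA.QC k" for p k by (rule QC_cong) simp
  show "bij_betw spread (carrier (quasi m)) (model m)"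
  proof (rule bij_betwI')
    show "spread p = spread q \<longleftrightarrow> p = q" if "p \<in> carrier (quasi m)" "q \<in> carrier (quasi m)" for p q
    proof
      assume eq: "spread p = spread q"
      have "p w = q w" if "w \<in> carrier W" for w using fun_cong [OF eq, of w] that by simp
      then show "p = q" using that by (intro PiE_ext [of p "carrier W" "\<lambda>_. PV B"]) (auto simp: quasi_carrier)
    qed simp
    show "spread p \<in> model m" if "p \<in> carrier (quasi m)" for p
      using that PiE [OF that] spread_spread [of p] QC_spread by (simp add: model_def quasi_carrier spread_def)
    show "\<exists>x\<in>carrier (quasi m). p = spread x" if p: "p \<in> model m" for p
    proof
      have np: "spread p = p" using p by (simp add: model_def)
      show "p = spread (restrict p (carrier W))"
        by (rule spread_eqI [OF np spread_spread]) simp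
      have "restrict p (carrier W) \<in> RA.QC (\<lambda>s. m (hyp s)) \<longleftrightarrow> p \<in> RA.QC (\<lambda>s. m (hyp s))"
        by (rule QC_cong) simp
      then show "restrict p (carrier W) \<in> carrier (quasi m)" using p by (auto simp: quasi_carrier model_def)
    qed
  qed
  fix p q assume pq: "p \<in> carrier (quasi m)" "q \<in> carrier (quasi m)"
  then have QC: "p \<in> RA.QC (\<lambda>s. m (hyp s))" "q \<in> RA.QC (\<lambda>s. m (hyp s))" by (simp_all add: quasi_carrier)
  have "(\<lambda>w\<in>carrier W. p w * q w) \<in> RA.QC (\<lambda>s. m (hyp s))"
    using QC_mult [OF QC] QC_cong [of "\<lambda>w\<in>carrier W. p w * q w" "\<lambda>w. p w * q w"] by simp
  then show "p \<otimes>\<^bsub>quasi m\<^esub> q \<in> carrier (quasi m) \<and> spread (p \<otimes>\<^bsub>quasi m\<^esub> q) = spread p * spread q"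
    using PiE [OF pq(1)] PiE [OF pq(2)] by (auto simp: quasi_ops quasi_carrier PV_mult spread_def fun_eq_iff)
  have "(\<lambda>w\<in>carrier W. p w + q w) \<in> RA.QC (\<lambda>s. m (hyp s))"
    using RA.QC_add [OF QC] QC_cong [of "\<lambda>w\<in>carrier W. p w + q w" "\<lambda>w. p w + q w"] by simp
  then show "p \<oplus>\<^bsub>quasi m\<^esub> q \<in> carrier (quasi m) \<and> spread (p \<oplus>\<^bsub>quasi m\<^esub> q) = spread p + spread q"
    using PiE [OF pq(1)] PiE [OF pq(2)] by (auto simp: quasi_ops quasi_carrier PV_add spread_def fun_eq_iff)
next
  have c: "(\<lambda>w\<in>carrier W. c) \<in> RA.QC k" for c k
    using QC_const QC_cong [of "\<lambda>w\<in>carrier W. c" "\<lambda>w. c"] by simp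
  show "\<zero>\<^bsub>quasi m\<^esub> \<in> carrier (quasi m) \<and> spread \<zero>\<^bsub>quasi m\<^esub> = 0"
    "\<one>\<^bsub>quasi m\<^esub> \<in> carrier (quasi m) \<and> spread \<one>\<^bsub>quasi m\<^esub> = 1"
    using c by (auto simp: quasi_ops quasi_carrier spread_def fun_eq_iff)
qed

definition diag :: "('v, 'k) mpoly \<Rightarrow> 'w \<Rightarrow> ('v, 'k) mpoly" where "diag r = (\<lambda>_. r)"

lemma diag_hom: "comm_ring_hom diag"
  by unfold_locales (simp_all add: diag_def fun_eq_iff)

lemma diag_model: "r \<in> PV B \<Longrightarrow> diag r \<in> model m"
  using QC_const by (simp add: model_def diag_def spread_def [abs_def])

lemma sum_apply: "(\<Sum>i\<in>I. g i) w = (\<Sum>i\<in>I. g i w)" for g :: "'i \<Rightarrow> 'w \<Rightarrow> ('v, 'k) mpoly"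
  by (induction I rule: infinite_finite_induct) auto

text \<open>A basis expressed in the pointwise function ring with scalars embedded by
  \<open>diag\<close>, the form required for \<open>free_ext\<close>.\<close>

definition quasi_basis :: "('v set \<Rightarrow> nat) \<Rightarrow> ('w \<Rightarrow> ('v, 'k) mpoly) set \<Rightarrow> bool" where
  "quasi_basis m X \<longleftrightarrow> finite X \<and> card X = card (carrier W) \<and> X \<subseteq> carrier (quasi m) \<and>
    (\<forall>x\<in>carrier (quasi m). \<exists>c. (\<forall>y. c y \<in> PV B) \<and> spread x = (\<Sum>y\<in>X. diag (c y) * spread y)) \<and>
    (\<forall>c. (\<Sum>y\<in>X. diag (c y) * spread y) = 0 \<longrightarrow> (\<forall>y\<in>X. c y = 0))"

text \<open>Retracting the expansions preserves spanning, and independence is recovered from the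
  number of vectors by \<open>spanning_independent\<close>.\<close>

lemma quasi_basis_retract:
  assumes "RA.is_basis (RA.QC (\<lambda>s. m (hyp s))) J e"
  shows "\<exists>X. quasi_basis m X"
proof -
  let ?Q = "RA.QC (\<lambda>s. m (hyp s))"
  have J: "finite J" and eQ: "\<forall>j\<in>J. e j \<in> ?Q"
    and sp: "\<forall>p\<in>?Q. \<exists>q. \<forall>w\<in>carrier W. p w = (\<Sum>j\<in>J. q j * e j w)"
    using assms unfolding RA.is_basis_def by - (elim conjE, assumption)+
  have cJ: "card J = card (carrier W)" by (rule RA.basis_card [OF assms])
  define b where "b j = (\<lambda>w\<in>carrier W. retract B (e j w))" for j
  have bQ: "b j \<in> ?Q" if j: "j \<in> J" for j
  proof -
    have "(\<lambda>w. retract B (e j w)) \<in> ?Q"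
      unfolding RA.QC_def
    proof clarify
      fix s w assume s: "s \<in> Rf" and w: "w \<in> carrier W"
      have "al s ^ m (hyp s) dvd e j w - e j (s \<otimes> w)" using eQ j s w by (simp add: RA.QC_def)
      then have "retract B (al s ^ m (hyp s)) dvd retract B (e j w - e j (s \<otimes> w))"
        by (rule retract_dvd)
      then show "al s ^ m (hyp s) dvd retract B (e j w) - retract B (e j (s \<otimes> w))"
        by (simp add: retract_id al_def fp_PV)
    qed
    then show ?thesis using QC_cong [of "b j" "\<lambda>w. retract B (e j w)"] by (simp add: b_def)
  qed
  have bC: "b j \<in> carrier (quasi m)" if "j \<in> J" for j using bQ [OF that] by (auto simp: quasi_carrier b_def)
  have span: "\<exists>c. (\<forall>j. c j \<in> PV B) \<and> (\<forall>w\<in>carrier W. p w = (\<Sum>j\<in>J. c j * b j w))"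
    if p: "p \<in> ?Q" "\<forall>w\<in>carrier W. p w \<in> PV B" for p
  proof -
    obtain q where q: "\<forall>w\<in>carrier W. p w = (\<Sum>j\<in>J. q j * e j w)" using bspec [OF sp p(1)] by (rule exE)
    have "p w = (\<Sum>j\<in>J. retract B (q j) * b j w)" if w: "w \<in> carrier W" for w
    proof -
      have "p w = retract B (p w)" using p(2) w retract_id by metis
      also have "\<dots> = (\<Sum>j\<in>J. retract B (q j) * b j w)" using q w by (simp add: retract_sum b_def)
      finally show ?thesis .
    qed
    then show ?thesis by (intro exI [of _ "\<lambda>j. retract B (q j)"]) simp
  qed
  have ind: "c j = 0" if z: "\<And>w. w \<in> carrier W \<Longrightarrow> (\<Sum>j\<in>J. c j * b j w) = 0" and j: "j \<in> J" for c j
  proof (rule spanning_independent [OF finW J cJ, where d = "\<lambda>_. RA.QCgen (\<lambda>s. m (hyp s))" and e = b and q = c and g = j])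
    fix x assume x: "x \<in> carrier W"
    let ?d = "RA.QCgen (\<lambda>s. m (hyp s))"
    have "?d \<in> PV B" unfolding RA.QCgen_def by (intro PV_prod PV_power) (simp add: al_def fp_PV)
    moreover have "(\<lambda>w. ?d * (if w = x then 1 else 0)) \<in> ?Q" by (rule RA.QCgen_QC)
    ultimately obtain c where "\<forall>w\<in>carrier W. ?d * (if w = x then 1 else 0) = (\<Sum>j\<in>J. c j * b j w)"
      using span [of "\<lambda>w. ?d * (if w = x then 1 else 0)"] by (auto simp: PV_mult)
    then show "?d \<noteq> 0 \<and> (\<exists>c. \<forall>w\<in>carrier W. (\<Sum>j\<in>J. c j * b j w) = (if w = x then ?d else 0))"
      using RA.QCgen_nz by (intro conjI exI [of _ c]) (auto simp: if_distrib)
  qed (rule z, assumption, rule j)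
  \<comment> \<open>The basis becomes a set of vectors, so distinct indices must give distinct
    vectors; two equal ones would satisfy a relation with coefficients 1 and -1.\<close>
  have inj: "inj_on b J"
  proof (rule inj_onI, rule ccontr)
    fix i j assume ij: "i \<in> J" "j \<in> J" "b i = b j" "i \<noteq> j"
    let ?q = "\<lambda>l. (if l = i then 1 else 0 :: ('v, 'k) mpoly) - (if l = j then 1 else 0)"
    have "(\<Sum>l\<in>J. ?q l * b l w) = (\<Sum>l\<in>J. if l = i then b l w else 0) - (\<Sum>l\<in>J. if l = j then b l w else 0)" for w
      unfolding sum_subtractf [symmetric] by (rule sum.cong) auto
    then have "(\<Sum>l\<in>J. ?q l * b l w) = 0" for w using ij J by simp
    then have "?q i = 0" by (rule ind) (rule ij)
    then show False using ij(4) by simp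
  qed
  have sumX: "(\<Sum>y\<in>b ` J. diag (c y) * spread y) w = (\<Sum>j\<in>J. c (b j) * spread (b j) w)" for c w
    by (simp add: sum.reindex [OF inj] sum_apply diag_def)
  have "\<exists>c. (\<forall>y. c y \<in> PV B) \<and> spread x = (\<Sum>y\<in>b ` J. diag (c y) * spread y)" if x: "x \<in> carrier (quasi m)" for x
  proof -
    have "x \<in> ?Q" "\<forall>w\<in>carrier W. x w \<in> PV B" using x by (auto simp: quasi_carrier)
    from span [OF this] obtain c where c: "\<forall>j. c j \<in> PV B"
      and eq: "\<forall>w\<in>carrier W. x w = (\<Sum>j\<in>J. c j * b j w)" by (elim exE conjE)
    let ?c = "\<lambda>y. c (inv_into J b y)"
    have "spread x w = (\<Sum>y\<in>b ` J. diag (?c y) * spread y) w" for w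
      unfolding sumX using eq by (simp add: spread_def inv_into_f_f [OF inj] cong: sum.cong)
    then show ?thesis using c by (intro exI [of _ ?c]) (simp add: fun_eq_iff)
  qed
  moreover have "\<forall>y\<in>b ` J. c y = 0" if z: "(\<Sum>y\<in>b ` J. diag (c y) * spread y) = 0" for c
  proof
    fix y assume "y \<in> b ` J"
    then obtain j where j: "j \<in> J" "y = b j" by blast
    have "(\<Sum>j\<in>J. c (b j) * b j w) = 0" if "w \<in> carrier W" for w
      using sumX [of c w] that by (simp add: z)
    then show "c y = 0" unfolding j(2) by (rule ind [OF _ j(1)])
  qed
  ultimately show ?thesis
    unfolding quasi_basis_def using J bC cJ card_image [OF inj] by (intro exI [of _ "b ` J"]) auto
qed

end

section \<open>Freeness, localizations and variety structure of the quasi-covariants\<close>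

context refl_setup
begin

lemma diag_range_sub_ring: "sub_ring (diag ` PV B)"
proof -
  interpret comm_ring_hom diag by (rule diag_hom)
  have uminus: "- diag p = diag (- p)" for p by (rule ext) (simp add: diag_def)
  show ?thesis
    unfolding sub_ring_def
    by (auto simp: uminus hom_add [symmetric] hom_mult [symmetric] intro: PV_add PV_mult PV_uminus
      intro!: image_eqI [of 0 diag 0] image_eqI [of 1 diag 1])
qed

text \<open>The inverse of \<open>diag\<close> on its range.\<close>

lemma eval_hom: "comm_ring_hom (\<lambda>p :: 'w \<Rightarrow> ('v, 'k) mpoly. p \<one>)"
  by unfold_locales simp_all

lemma quasi_basisD:
  assumes "quasi_basis m X"
  shows "finite X" "card X = card (carrier W)" "X \<subseteq> carrier (quasi m)"
    "\<And>x. x \<in> carrier (quasi m) \<Longrightarrow> \<exists>c. (\<forall>y. c y \<in> PV B) \<and> spread x = (\<Sum>y\<in>X. diag (c y) * spread y)"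
    "\<And>c. (\<Sum>y\<in>X. diag (c y) * spread y) = 0 \<Longrightarrow> \<forall>y\<in>X. c y = 0"
  using assms unfolding quasi_basis_def by - (elim conjE; simp)+

lemma model_free_ext:
  assumes X: "quasi_basis m X"
  shows "free_ext (diag ` PV B) (model m) 0 X spread"
proof
  interpret M: ring_model "quasi m" "model m" spread by (rule model_ring)
  show "sub_ring (diag ` PV B)" by (rule diag_range_sub_ring)
  show "sub_ring (model m)" by (rule model_sub_ring)
  then show "0 \<in> model m" by (rule sub_ring_0)
  show "diag ` PV B \<subseteq> model m" using diag_model by blast
  show "finite X" by (rule quasi_basisD [OF X])
  show "spread y \<in> model m" if "y \<in> X" for y using quasi_basisD(3) [OF X] M.in_T that by blast
  show "\<exists>c t. (\<forall>y\<in>X. c y \<in> diag ` PV B) \<and> t \<in> model m \<and> p = (\<Sum>y\<in>X. c y * spread y) + 0 * t"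
    if "p \<in> model m" for p
  proof -
    from M.lift [OF that] obtain x where x: "x \<in> carrier (quasi m)" and p: "spread x = p" by (rule bexE)
    obtain c where "(\<forall>y. c y \<in> PV B) \<and> p = (\<Sum>y\<in>X. diag (c y) * spread y)"
      unfolding p [symmetric] using quasi_basisD(4) [OF X x] by (rule exE)
    then show ?thesis using sub_ring_0 [OF model_sub_ring]
      by (intro exI [of _ "\<lambda>y. diag (c y)"] exI [of _ 0]) simp
  qed
  fix c t y assume c: "\<And>y. y \<in> X \<Longrightarrow> c y \<in> diag ` PV B" and eq: "(\<Sum>y\<in>X. c y * spread y) = 0 * t" and y: "y \<in> X"
  have c': "diag (c y \<one>) = c y" if "y \<in> X" for y using c [OF that] by (auto simp: diag_def)
  then have "(\<Sum>y\<in>X. diag (c y \<one>) * spread y) = 0" using eq by simp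
  then have "\<forall>y\<in>X. c y \<one> = 0" by (rule quasi_basisD(5) [OF X])
  then have "c y \<one> = 0" using y by blast
  then show "c y = 0" using c' [OF y] by (simp add: diag_def fun_eq_iff)
qed

lemma diag_noeth: "noeth (diag ` PV B :: ('w \<Rightarrow> ('v, 'k) mpoly) set)"
  by (rule noeth_iso [OF diag_hom eval_hom PV_sub_ring diag_range_sub_ring _ _ _ PV_noeth_regular_chains [OF finite_Basis, THEN conjunct1]])
    (auto simp: diag_def)

lemma diag_regular_chains: "regular_chains (diag ` PV B :: ('w \<Rightarrow> ('v, 'k) mpoly) set)"
  by (rule regular_chains_iso [OF diag_hom eval_hom PV_sub_ring diag_range_sub_ring _ _ _ _
        PV_noeth_regular_chains [OF finite_Basis, THEN conjunct2]]) (auto simp: diag_def)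

lemma smult_closed:
  assumes f: "f \<in> PV B" and p: "p \<in> carrier (quasi m)"
  shows "f \<odot>\<^bsub>quasi m\<^esub> p \<in> carrier (quasi m) \<and> spread (f \<odot>\<^bsub>quasi m\<^esub> p) = diag f * spread p"
proof -
  have "p \<in> RA.QC (\<lambda>s. m (hyp s))" using p by (simp add: quasi_carrier)
  then have "(\<lambda>w\<in>carrier W. f * p w) \<in> RA.QC (\<lambda>s. m (hyp s))"
    using RA.QC_cmult [of p _ f] QC_cong [of "\<lambda>w\<in>carrier W. f * p w" "\<lambda>w. f * p w"] by simp
  moreover have "p w \<in> PV B" if "w \<in> carrier W" for w using p that by (auto simp: quasi_carrier)
  ultimately show ?thesis using f by (auto simp: quasi_ops quasi_carrier PV_mult spread_def fun_eq_iff diag_def)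
qed

lemma quasi_module: "module (sym_dual B) (quasi m)"
proof -
  interpret M: ring_model "quasi m" "model m" spread by (rule model_ring)
  have d: "diag (f + g) = diag f + diag g" "diag (f * g) = diag f * diag g" "diag 1 = 1" for f g
    by (simp_all add: diag_def fun_eq_iff)
  show ?thesis
  proof (rule moduleI [OF sym_dual_cring])
    show "abelian_group (quasi m)" by (rule M.Q.abelian_group_axioms)
    fix f g :: "('v, 'k) mpoly" and p q
    assume "f \<in> carrier (sym_dual B)" "g \<in> carrier (sym_dual B)" "p \<in> carrier (quasi m)" "q \<in> carrier (quasi m)"
    then have f: "f \<in> PV B" "g \<in> PV B" and p: "p \<in> carrier (quasi m)" "q \<in> carrier (quasi m)" by simp_all
    note s = smult_closed [THEN conjunct1] smult_closed [THEN conjunct2]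
    show "f \<odot>\<^bsub>quasi m\<^esub> p \<in> carrier (quasi m)" by (rule s [OF f(1) p(1)])
    show "(f \<oplus>\<^bsub>sym_dual B\<^esub> g) \<odot>\<^bsub>quasi m\<^esub> p = f \<odot>\<^bsub>quasi m\<^esub> p \<oplus>\<^bsub>quasi m\<^esub> g \<odot>\<^bsub>quasi m\<^esub> p"
      by (rule M.eqI) (use f p in \<open>simp_all add: s M.add PV_add d distrib_right\<close>)
    show "f \<odot>\<^bsub>quasi m\<^esub> (p \<oplus>\<^bsub>quasi m\<^esub> q) = f \<odot>\<^bsub>quasi m\<^esub> p \<oplus>\<^bsub>quasi m\<^esub> f \<odot>\<^bsub>quasi m\<^esub> q"
      by (rule M.eqI) (use f p in \<open>simp_all add: s M.add distrib_left\<close>)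
    show "(f \<otimes>\<^bsub>sym_dual B\<^esub> g) \<odot>\<^bsub>quasi m\<^esub> p = f \<odot>\<^bsub>quasi m\<^esub> (g \<odot>\<^bsub>quasi m\<^esub> p)"
      by (rule M.eqI) (use f p in \<open>simp_all add: s PV_mult d mult.assoc\<close>)
  next
    fix p assume p: "p \<in> carrier (quasi m)"
    show "\<one>\<^bsub>sym_dual B\<^esub> \<odot>\<^bsub>quasi m\<^esub> p = p"
      by (rule M.eqI) (use p smult_closed [OF PV_one p] in \<open>simp_all add: d\<close>)
  qed
qed

context
  fixes m :: "'v set \<Rightarrow> nat" and X :: "('w \<Rightarrow> ('v, 'k) mpoly) set"
  assumes qb: "quasi_basis m X"
begin

lemmas X = quasi_basisD [OF qb]

interpretation M: ring_model "quasi m" "model m" spread by (rule model_ring)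

lemma localizations_cohen_macaulay:
  assumes P: "primeideal P (quasi m)" shows "cohen_macaulay_local_ring (localization_at (quasi m) P)"
proof (rule localization_cohen_macaulay [OF M.cring_Q _ P])
  interpret free_ext "diag ` PV B" "model m" 0 X spread by (rule model_free_ext [OF qb])
  show "noetherian_ring (quasi m)"
    by (rule M.noetherian_Q [OF noeth_integral [OF HOL.refl diag_noeth]])
  show "\<exists>xs. length xs = n \<and> set xs \<subseteq> Q n \<and>
      (\<forall>i<n. \<forall>r\<in>carrier (quasi m). xs ! i \<otimes>\<^bsub>quasi m\<^esub> r \<in> Idl\<^bsub>quasi m\<^esub> (set (take i xs)) \<longrightarrow>
        r \<in> Idl\<^bsub>quasi m\<^esub> (set (take i xs)))" if "ring_chain (quasi m) n Q" for n Q
    by (rule M.chains_Q [OF regular_chains_integral [OF HOL.refl diag_regular_chains] that])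
qed

lemma combination:
  assumes c: "\<And>y. y \<in> X \<Longrightarrow> c y \<in> PV B"
  shows "(\<Oplus>\<^bsub>quasi m\<^esub>y\<in>X. c y \<odot>\<^bsub>quasi m\<^esub> y) \<in> carrier (quasi m)"
    "spread (\<Oplus>\<^bsub>quasi m\<^esub>y\<in>X. c y \<odot>\<^bsub>quasi m\<^esub> y) = (\<Sum>y\<in>X. diag (c y) * spread y)"
proof -
  have cl: "c y \<odot>\<^bsub>quasi m\<^esub> y \<in> carrier (quasi m) \<and> spread (c y \<odot>\<^bsub>quasi m\<^esub> y) = diag (c y) * spread y"
    if "y \<in> X" for y using smult_closed [OF c [OF that] subsetD [OF X(3) that]] .
  then show "(\<Oplus>\<^bsub>quasi m\<^esub>y\<in>X. c y \<odot>\<^bsub>quasi m\<^esub> y) \<in> carrier (quasi m)"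
    by (intro M.Q.finsum_closed) auto
  show "spread (\<Oplus>\<^bsub>quasi m\<^esub>y\<in>X. c y \<odot>\<^bsub>quasi m\<^esub> y) = (\<Sum>y\<in>X. diag (c y) * spread y)"
    by (subst M.finsum [OF X(1)]) (simp_all add: cl)
qed

lemma expansion:
  assumes x: "x \<in> carrier (quasi m)"
  shows "\<exists>c. (\<forall>y. c y \<in> PV B) \<and> x = (\<Oplus>\<^bsub>quasi m\<^esub>y\<in>X. c y \<odot>\<^bsub>quasi m\<^esub> y)"
proof -
  obtain c where c: "\<forall>y. c y \<in> PV B" "spread x = (\<Sum>y\<in>X. diag (c y) * spread y)"
    using X(4) [OF x] by (elim exE conjE)
  then have cP: "\<And>y. c y \<in> PV B" by blast
  have "x = (\<Oplus>\<^bsub>quasi m\<^esub>y\<in>X. c y \<odot>\<^bsub>quasi m\<^esub> y)"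
    by (rule M.eqI [OF x combination(1) [of c, OF cP]]) (simp only: combination(2) [of c, OF cP] c)
  then show ?thesis using cP by blast
qed

lemma quasi_module_basis: "finite_module_basis (sym_dual B) (quasi m) X"
  unfolding finite_module_basis_def
proof (intro conjI ballI X(1,3))
  fix x assume x: "x \<in> carrier (quasi m)"
  obtain c where c: "\<forall>y. c y \<in> PV B"
    and xc: "x = (\<Oplus>\<^bsub>quasi m\<^esub>y\<in>X. c y \<odot>\<^bsub>quasi m\<^esub> y)" using expansion [OF x] by (elim exE conjE)
  show "\<exists>!c. c \<in> X \<rightarrow>\<^sub>E carrier (sym_dual B) \<and> x = (\<Oplus>\<^bsub>quasi m\<^esub>y\<in>X. c y \<odot>\<^bsub>quasi m\<^esub> y)"
  proof (rule ex1I [of _ "restrict c X"])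
    have "(\<Oplus>\<^bsub>quasi m\<^esub>y\<in>X. restrict c X y \<odot>\<^bsub>quasi m\<^esub> y) = (\<Oplus>\<^bsub>quasi m\<^esub>y\<in>X. c y \<odot>\<^bsub>quasi m\<^esub> y)"
      using c X(3) by (intro M.Q.finsum_cong') (auto simp: smult_closed)
    then show "restrict c X \<in> X \<rightarrow>\<^sub>E carrier (sym_dual B) \<and> x = (\<Oplus>\<^bsub>quasi m\<^esub>y\<in>X. restrict c X y \<odot>\<^bsub>quasi m\<^esub> y)"
      using c xc by auto
    fix d assume d: "d \<in> X \<rightarrow>\<^sub>E carrier (sym_dual B) \<and> x = (\<Oplus>\<^bsub>quasi m\<^esub>y\<in>X. d y \<odot>\<^bsub>quasi m\<^esub> y)"
    then have dP: "d y \<in> PV B" if "y \<in> X" for y using that by auto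
    have "spread x = (\<Sum>y\<in>X. diag (d y) * spread y)" using combination(2) [of d, OF dP] d by simp
    moreover have "spread x = (\<Sum>y\<in>X. diag (c y) * spread y)" using combination(2) [of c] c xc by simp
    ultimately have "(\<Sum>y\<in>X. diag (d y - c y) * spread y) = 0"
      by (simp add: diag_def fun_eq_iff sum_apply left_diff_distrib sum_subtractf)
    then have eq: "\<forall>y\<in>X. d y - c y = 0" by (rule X(5))
    show "d = restrict c X"
      by (rule PiE_ext [of d X "\<lambda>_. PV B"]) (use d c eq in auto)
  qed
qed

lemma quasi_free: "free_module_of_rank (sym_dual B) (quasi m) (Coset.order W)"
  unfolding free_module_of_rank_def
  using quasi_module quasi_module_basis X(2) by (auto simp: Coset.order_def)

lemma diagonal_facts:
  assumes "p \<in> PV B"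
  shows "diagonal W p \<in> carrier (quasi m)" "spread (diagonal W p) = diag p"
proof -
  have "diagonal W p = p \<odot>\<^bsub>quasi m\<^esub> \<one>\<^bsub>quasi m\<^esub>"
    by (auto simp: diagonal_def quasi_ops intro!: restrict_ext)
  then show "diagonal W p \<in> carrier (quasi m)" "spread (diagonal W p) = diag p"
    using smult_closed [OF assms M.Q.one_closed] M.one by simp_all
qed

text \<open>Over the constants the ring is generated by the diagonal variables and the module basis.
  It is reduced because powers are taken pointwise in a polynomial ring without zero
  divisors.\<close>

lemma quasi_variety: "spec_is_variety (range (\<lambda>c. diagonal W (poly_const c))) (quasi m)"
proof -
  let ?K = "range (\<lambda>c. diagonal W (poly_const c :: ('v, 'k) mpoly))"
  let ?F = "(\<lambda>v. diagonal W (pvar v)) ` B \<union> X"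
  note D = diagonal_facts
  have Keq: "diagonal W (poly_const c) \<otimes>\<^bsub>quasi m\<^esub> diagonal W (poly_const d) = diagonal W (poly_const (c * d))"
    "diagonal W (poly_const c) \<oplus>\<^bsub>quasi m\<^esub> diagonal W (poly_const d) = diagonal W (poly_const (c + d))"
    "\<ominus>\<^bsub>quasi m\<^esub> diagonal W (poly_const c) = diagonal W (poly_const (- c))"
    "\<one>\<^bsub>quasi m\<^esub> = diagonal W (poly_const 1)" "\<zero>\<^bsub>quasi m\<^esub> = diagonal W (poly_const 0)" for c d
    by (rule M.eqI; simp add: D M.mult M.add M.uminus M.one M.zero PV_uminus; simp add: diag_def fun_eq_iff poly_const_mult poly_const_add)+
  have K0: "diagonal W (poly_const c) = \<zero>\<^bsub>quasi m\<^esub> \<longleftrightarrow> c = 0" for c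
  proof
    assume "diagonal W (poly_const c) = \<zero>\<^bsub>quasi m\<^esub>"
    then have "diag (poly_const c) = 0" using D(2) [of "poly_const c"] M.zero by simp
    then show "c = 0" by (simp add: diag_def fun_eq_iff)
  qed (simp add: Keq)
  have KQ: "?K \<subseteq> carrier (quasi m)" using D(1) by auto
  have K: "subfield ?K (quasi m)"
  proof (rule M.Q.subfieldI)
    have "subring ?K (quasi m)"
      by (rule M.Q.subringI [OF KQ]) (auto simp: Keq simp del: poly_const_simps)
    then show "subcring ?K (quasi m)" by (rule M.Q.subcringI')
    show "Units (quasi m \<lparr>carrier := ?K\<rparr>) = ?K - {\<zero>\<^bsub>quasi m\<^esub>}"
    proof (intro equalityI subsetI)
      fix x assume "x \<in> Units (quasi m \<lparr>carrier := ?K\<rparr>)"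
      then obtain c d where cd: "x = diagonal W (poly_const c)"
        "diagonal W (poly_const (c * d)) = \<one>\<^bsub>quasi m\<^esub>" by (auto simp: Units_def Keq)
      have "c \<noteq> 0"
      proof
        assume "c = 0"
        then have "\<one>\<^bsub>quasi m\<^esub> = \<zero>\<^bsub>quasi m\<^esub>" using cd(2) K0 [of "c * d"] by simp
        then show False using K0 [of 1] by (simp add: Keq(4))
      qed
      then show "x \<in> ?K - {\<zero>\<^bsub>quasi m\<^esub>}" using cd(1) K0 by simp
    next
      fix x assume "x \<in> ?K - {\<zero>\<^bsub>quasi m\<^esub>}"
      then obtain c where c: "x = diagonal W (poly_const c)" "c \<noteq> 0" using K0 by auto
      then have "x \<otimes>\<^bsub>quasi m\<^esub> diagonal W (poly_const (1 / c)) = \<one>\<^bsub>quasi m\<^esub>"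
        "diagonal W (poly_const (1 / c)) \<otimes>\<^bsub>quasi m\<^esub> x = \<one>\<^bsub>quasi m\<^esub>" by (simp_all add: Keq)
      then show "x \<in> Units (quasi m \<lparr>carrier := ?K\<rparr>)" using c(1) by (auto simp: Units_def)
    qed
  qed
  have FQ: "?F \<subseteq> carrier (quasi m)" using D(1) X(3) by auto
  let ?G = "generate_ring (quasi m) (?K \<union> ?F)"
  have GQ: "?G \<subseteq> carrier (quasi m)" by (rule M.Q.generate_ring_incl) (use KQ FQ in blast)
  have diagG: "diagonal W p \<in> ?G" if "p \<in> PV B" for p
    using that
  proof (induction rule: PV_induct)
    case (const c)
    show ?case by (rule generate_ring.incl) blast
  next
    case (var v)
    then show ?case by (intro generate_ring.incl) blast
  next
    case (add p q)
    have "diagonal W (p + q) = diagonal W p \<oplus>\<^bsub>quasi m\<^esub> diagonal W q"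
      by (auto simp: diagonal_def quasi_ops intro!: restrict_ext)
    then show ?case using generate_ring.eng_add [OF add] by simp
  next
    case (mult p q)
    have "diagonal W (p * q) = diagonal W p \<otimes>\<^bsub>quasi m\<^esub> diagonal W q"
      by (auto simp: diagonal_def quasi_ops intro!: restrict_ext)
    then show ?case using generate_ring.eng_mult [OF mult] by simp
  qed
  have smultG: "f \<odot>\<^bsub>quasi m\<^esub> y \<in> ?G" if "f \<in> PV B" "y \<in> X" for f y
  proof -
    have "f \<odot>\<^bsub>quasi m\<^esub> y = diagonal W f \<otimes>\<^bsub>quasi m\<^esub> y"
      by (auto simp: diagonal_def quasi_ops intro!: restrict_ext)
    moreover have "y \<in> ?G" by (rule generate_ring.incl) (use that in blast)
    ultimately show ?thesis using generate_ring.eng_mult [OF diagG [OF that(1)]] by simp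
  qed
  have sumG: "(\<Oplus>\<^bsub>quasi m\<^esub>y\<in>Y. g y) \<in> ?G" if "finite Y" "\<And>y. y \<in> Y \<Longrightarrow> g y \<in> ?G" for Y and g :: "('w \<Rightarrow> ('v, 'k) mpoly) \<Rightarrow> 'w \<Rightarrow> ('v, 'k) mpoly"
    using that
  proof (induction Y)
    case empty
    have "\<zero>\<^bsub>quasi m\<^esub> \<in> ?G" using diagG [of 0] Keq(5) by simp
    then show ?case by simp
  next
    case (insert y Y)
    have "(\<Oplus>\<^bsub>quasi m\<^esub>z\<in>insert y Y. g z) = g y \<oplus>\<^bsub>quasi m\<^esub> (\<Oplus>\<^bsub>quasi m\<^esub>z\<in>Y. g z)"
      using insert.hyps insert.prems GQ by (intro M.Q.finsum_insert) auto
    moreover have "g y \<in> ?G" "(\<Oplus>\<^bsub>quasi m\<^esub>z\<in>Y. g z) \<in> ?G" using insert by simp_all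
    ultimately show ?case by (simp only: generate_ring.eng_add)
  qed
  have "carrier (quasi m) \<subseteq> ?G"
  proof
    fix x assume "x \<in> carrier (quasi m)"
    from expansion [OF this] obtain c where c: "\<forall>y. c y \<in> PV B"
      and x: "x = (\<Oplus>\<^bsub>quasi m\<^esub>y\<in>X. c y \<odot>\<^bsub>quasi m\<^esub> y)"
      by (elim exE conjE)
    show "x \<in> ?G" unfolding x by (rule sumG) (use X(1) c smultG in auto)
  qed
  then have "?G = carrier (quasi m)" using GQ by blast
  moreover have "finite ?F" using X(1) finite_Basis by simp
  moreover have "x = \<zero>\<^bsub>quasi m\<^esub>" if x: "x \<in> carrier (quasi m)" and n: "x [^]\<^bsub>quasi m\<^esub> n = \<zero>\<^bsub>quasi m\<^esub>" for x and n :: nat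
  proof (rule M.eqI [OF x M.Q.zero_closed])
    have z: "spread x ^ n = 0" using M.nat_pow [OF x, of n] n M.zero by simp
    have pow: "(g ^ n) w = g w ^ n" for g :: "'w \<Rightarrow> ('v, 'k) mpoly" and w by (induction n) auto
    have "spread x w = 0" for w using fun_cong [OF z, of w] pow [of "spread x" w] by simp
    then show "spread x = spread \<zero>\<^bsub>quasi m\<^esub>" using M.zero by (simp add: fun_eq_iff)
  qed
  ultimately show ?thesis
    unfolding spec_is_variety_def using M.cring_Q K FQ by blast
qed

end

lemma quasi_covariants_free_cohen_macaulay:
  assumes k: "invariant_multiplicity scale W \<rho> k"
    and m: "(\<forall>H\<in>reflection_hyperplanes scale W \<rho>. m H = 2 * k H) \<or>
      (\<forall>H\<in>reflection_hyperplanes scale W \<rho>. m H = 2 * k H + 1)"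
  shows "free_module_of_rank (sym_dual B) (quasi m) (Coset.order W) \<and>
    spec_is_cohen_macaulay_variety (range (\<lambda>c. diagonal W (poly_const c))) (quasi m)"
proof -
  have "\<exists>X. quasi_basis m X"
    using m
  proof
    assume "\<forall>H\<in>reflection_hyperplanes scale W \<rho>. m H = 2 * k H"
    then have "RA.QC (\<lambda>s. m (hyp s)) = RA.QC (\<lambda>s. 2 * k (hyp s))" by (auto simp: RA.QC_def hyp_in)
    then show ?thesis using RA.even_basis [OF conj_inv_hyp [OF k]] quasi_basis_retract [of m] by (elim exE conjE) simp
  next
    assume "\<forall>H\<in>reflection_hyperplanes scale W \<rho>. m H = 2 * k H + 1"
    then have "RA.QC (\<lambda>s. m (hyp s)) = RA.QC (\<lambda>s. 2 * k (hyp s) + 1)" by (auto simp: RA.QC_def hyp_in)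
    then show ?thesis using RA.odd_basis [OF conj_inv_hyp [OF k]] quasi_basis_retract [of m] by (elim exE) simp
  qed
  then obtain X where X: "quasi_basis m X" ..
  show ?thesis
    unfolding spec_is_cohen_macaulay_variety_def
    using quasi_free [OF X] quasi_variety [OF X] localizations_cohen_macaulay [OF X] by blast
qed

end

hide_const (open) Polynomial.order

theorem theorem2p9:
  fixes scale :: "'k::field_char_0 \<Rightarrow> 'v::ab_group_add \<Rightarrow> 'v"
    and B :: "'v set"
    and W :: "('w, 'x) monoid_scheme"
    and S :: "'w set"
    and \<rho> :: "'w \<Rightarrow> 'v \<Rightarrow> 'v"
    and \<alpha> :: "'v set \<Rightarrow> 'v \<Rightarrow> 'k"
    and m :: "'v set \<Rightarrow> nat"
  assumes "finite_dimensional_vector_space scale B"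
    and "coxeter_system W S"
    and "finite (carrier W)"
    and "reflection_representation scale W S \<rho>"
    and "defining_forms scale W \<rho> \<alpha>"
    and "invariant_multiplicity scale W \<rho> m"
    and "\<exists>k. invariant_multiplicity scale W \<rho> k \<and>
           ((\<forall>H\<in>reflection_hyperplanes scale W \<rho>. m H = 2 * k H) \<or>
            (\<forall>H\<in>reflection_hyperplanes scale W \<rho>. m H = 2 * k H + 1))"
  shows "free_module_of_rank (sym_dual B) (quasi_covariants scale B W \<rho> \<alpha> m) (order W) \<and>
         spec_is_cohen_macaulay_variety (range (\<lambda>c. diagonal W (poly_const c)))
           (quasi_covariants scale B W \<rho> \<alpha> m)"
proof -
  have "refl_setup scale B W S \<rho> \<alpha>"
    using assms by (simp add: refl_setup_def refl_setup_axioms_def)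
  then interpret refl_setup scale B W S \<rho> \<alpha> .
  obtain k where k: "invariant_multiplicity scale W \<rho> k"
    "(\<forall>H\<in>reflection_hyperplanes scale W \<rho>. m H = 2 * k H) \<or>
      (\<forall>H\<in>reflection_hyperplanes scale W \<rho>. m H = 2 * k H + 1)" using assms(7) by blast
  show ?thesis by (rule quasi_covariants_free_cohen_macaulay [OF k])
qed

end
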